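(* For the two-user IM/DD interference channel, the capacity region satisfies $\mathcal{G}'_{\rm HK}\subseteq\mathcal{G}$, where $$\mathcal{G}'_{\rm HK}={\rm Conv}\Big(\bigcup\mathcal{R}'_{\rm HK}(\boldsymbol{\kappa},\boldsymbol{\eta},\boldsymbol{\theta},\boldsymbol{\phi})\Big),$$ the union being over $\boldsymbol{\kappa}=(\kappa_1,\kappa_2)$, $\boldsymbol{\eta}=(\eta_1,\eta_2)$, $\boldsymbol{\theta}=(\theta_1,\theta_2)$, $\boldsymbol{\phi}=(\phi_1,\phi_2)$ with $\theta_i,\phi_i\in(0,1]$ and, for $i=1,2$, $\kappa_i,\eta_i\in[0,\mathsf{A}]$, $\kappa_i+\eta_i\le\mathsf{A}$, $\theta_i\kappa_i+\phi_i\eta_i\le\alpha_i\mathsf{A}$; and $\mathcal{R}'_{\rm HK}(\boldsymbol{\kappa},\boldsymbol{\eta},\boldsymbol{\theta},\boldsymbol{\phi})$ is the set of $(\mathsf{R}_1,\mathsf{R}_2)\in\mathbb{R}_+^2$ such that, for $i,j\in\{1,2\}$, $i\neq j$, $$\mathsf{R}_i\le\mathsf{F}(0,h_{ii}\kappa_i,h_{ji}\kappa_j,1,\theta_i,\theta_j)+\min_{k\in\{1,2\}}\mathsf{F}(0,h_{ik}\eta_i,h_{ik}\kappa_i+h_{jk}\kappa_j,1,\phi_i,\theta'_k),$$ $$\mathsf{R}_1+\mathsf{R}_2\le\sum_{\substack{i,j\in\{1,2\}\\ i\neq j}}\mathsf{F}(0,h_{ii}\kappa_i,h_{ji}\kappa_j,1,\theta_i,\theta_j)+\min_{\substack{i,j\in\{1,2\}\\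 i\neq j}}\mathsf{F}(h_{ii}\eta_i,h_{ji}\eta_j,h_{ii}\kappa_i+h_{ji}\kappa_j,\phi_i,\phi_j,\theta'_i),$$ where, for $i\neq j$, $\theta'_i=\frac{h_{ii}\theta_i\kappa_i+h_{ji}\theta_j\kappa_j}{h_{ii}\kappa_i+h_{ji}\kappa_j}$ if $h_{ii}\kappa_i+h_{ji}\kappa_j>0$ and $\theta'_i=0$ otherwise.
   Context: Two-user IM/DD interference channel: for $i,j\in\{1,2\}$, $i\neq j$, $Y_i=h_{ii}X_i+h_{ji}X_j+Z_i$, with channel gains $h_{kl}\ge0$, noises $Z_1,Z_2\sim\mathcal{N}(0,\sigma^2)$ ($\sigma>0$) i.i.d. over time and independent of inputs; inputs satisfy $X_i\in[0,\mathsf{A}]$ ($\mathsf{A}>0$) and $\mathbb{E}[X_i]\le\alpha_i\mathsf{A}$, $\alpha_i\in(0,1]$. Transmitter $i$ encodes $m_i\in\{1,\dots,\lceil2^{n\mathsf{R}_i}\rceil\}$ into a length-$n$ codeword satisfying these constraints; receiver $i$ decodes $m_i$ from $Y_i^n$; $(\mathsf{R}_1,\mathsf{R}_2)$ is achievable if both average error probabilities tend to $0$; $\mathcal{G}$ is the closure of achievable pairs. ${\rm Conv}$ is the convex hull. Logs base 2, $\mathcal{Q}(x)=\int_x^\infty\frac{1}{\sqrt{2\pi}}e^{-t^2/2}dt$. $\rho(\alpha)$: for $\alpha\in(0,\frac12)$, $\rho(\alpha)=\frac{e^{2\alpha\mu^*-1}}{2\pi}\big(\frac{1-e^{-\mu^*}}{\mu^*}\big)^2$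 with $\mu^*$ the unique positive solution of $\alpha=\frac{1}{\mu^*}-\frac{e^{-\mu^*}}{1-e^{-\mu^*}}$; for $\alpha\in[\frac12,1]$, $\rho(\alpha)=\frac{1}{2\pi e}$. $\overline{\mathsf{C}}(\mathsf{A},\alpha)=c_1$ if $\alpha\in(0,\frac12)$, $=c_2$ if $\alpha\in[\frac12,1]$, where $$c_1=\min_{\mu,\xi>0}\Big[1-\mathcal{Q}\big(\tfrac{\xi+\alpha\mathsf{A}}{\sigma}\big)-\mathcal{Q}\big(\tfrac{\xi+(1-\alpha)\mathsf{A}}{\sigma}\big)\Big]\log\Big(\frac{\mathsf{A}}{\sigma}\frac{e^{\mu\xi/\mathsf{A}}-e^{-\mu(1+\xi/\mathsf{A})}}{\sqrt{2\pi}\mu(1-2\mathcal{Q}(\xi/\sigma))}\Big)+\log(e)\Big[-\tfrac12+\mathcal{Q}\big(\tfrac{\xi}{\sigma}\big)+\tfrac{\xi}{\sqrt{2\pi}\sigma}e^{-\frac{\xi^2}{2\sigma^2}}+\tfrac{\sigma}{\mathsf{A}}\tfrac{\mu}{\sqrt{2\pi}}\big(e^{-\frac{\xi^2}{2\sigma^2}}-e^{-\frac{(\mathsf{A}+\xi)^2}{2\sigma^2}}\big)+\mu\alpha\big(1-2\mathcal{Q}\big(\tfrac{\xi+\mathsf{A}/2}{\sigma}\big)\big)\Big],$$ $$c_2=\min_{\xi>0}\Big[1-2\mathcal{Q}\big(\tfrac{\xi+\mathsf{A}/2}{\sigma}\big)\Big]\log\Big(\frac{\mathsf{A}+2\xi}{\sigma\sqrt{2\pi}(1-2\mathcal{Q}(\xi/\sigma))}\Big)+\log(e)\Big[-\tfrac12+\mathcal{Q}\big(\tfrac{\xi}{\sigma}\big)+\tfrac{\xi}{\sqrt{2\pi}\sigma}e^{-\frac{\xi^2}{2\sigma^2}}\Big].$$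 $\mathsf{F}(a_1,a_2,a_3,\theta_1,\theta_2,\theta_3)=\frac12\log\Big(1+\frac{\rho(\theta_1)a_1^2+\rho(\theta_2)a_2^2}{\sigma^2\,2^{2\overline{\mathsf{C}}(a_3,\theta_3)}}\Big)$. *)

theory Defs
  imports "HOL-Probability.Probability"
begin

definition Qf :: "real \<Rightarrow> real" where
  "Qf x = (LINT t:{x..}|lborel. exp (- (t\<^sup>2) / 2) / sqrt (2 * pi))"

definition mu_star :: "real \<Rightarrow> real" where
  "mu_star a = (THE \<mu>. \<mu> > 0 \<and> a = 1 / \<mu> - exp (- \<mu>) / (1 - exp (- \<mu>)))"

definition rho :: "real \<Rightarrow> real" where
  "rho a = (if a < 1/2 then
      (let m = mu_star a in exp (2 * a * m - 1) / (2 * pi) * ((1 - exp (- m)) / m)\<^sup>2)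
    else 1 / (2 * pi * exp 1))"

definition c1_fun :: "real \<Rightarrow> real \<Rightarrow> real \<Rightarrow> real \<Rightarrow> real \<Rightarrow> real" where
  "c1_fun \<sigma> A a \<mu> \<xi> =
     (1 - Qf ((\<xi> + a * A) / \<sigma>) - Qf ((\<xi> + (1 - a) * A) / \<sigma>))
       * log 2 (A / \<sigma> * (exp (\<mu> * \<xi> / A) - exp (- \<mu> * (1 + \<xi> / A)))
                 / (sqrt (2 * pi) * \<mu> * (1 - 2 * Qf (\<xi> / \<sigma>))))
     + log 2 (exp 1) *
       (- 1/2 + Qf (\<xi> / \<sigma>) + \<xi> / (sqrt (2 * pi) * \<sigma>) * exp (- (\<xi>\<^sup>2) / (2 * \<sigma>\<^sup>2))
        + \<sigma> / A * \<mu> / sqrt (2 * pi) * (exp (- (\<xi>\<^sup>2) / (2 * \<sigma>\<^sup>2)) - exp (- ((A + \<xi>)\<^sup>2) / (2 * \<sigma>\<^sup>2)))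
        + \<mu> * a * (1 - 2 * Qf ((\<xi> + A / 2) / \<sigma>)))"

definition c2_fun :: "real \<Rightarrow> real \<Rightarrow> real \<Rightarrow> real" where
  "c2_fun \<sigma> A \<xi> =
     (1 - 2 * Qf ((\<xi> + A / 2) / \<sigma>))
       * log 2 ((A + 2 * \<xi>) / (\<sigma> * sqrt (2 * pi) * (1 - 2 * Qf (\<xi> / \<sigma>))))
     + log 2 (exp 1) * (- 1/2 + Qf (\<xi> / \<sigma>) + \<xi> / (sqrt (2 * pi) * \<sigma>) * exp (- (\<xi>\<^sup>2) / (2 * \<sigma>\<^sup>2)))"

text \<open>Cbar(A, alpha); the "min" is rendered as an infimum. Convention: Cbar(A,alpha) = 0
  for A <= 0 (no interference), the degenerate case arising when a received interference
  amplitude vanishes.\<close>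
definition Cbar :: "real \<Rightarrow> real \<Rightarrow> real \<Rightarrow> real" where
  "Cbar \<sigma> A a = (if A \<le> 0 then 0
     else if a < 1/2 then Inf {c1_fun \<sigma> A a \<mu> \<xi> | \<mu> \<xi>. \<mu> > 0 \<and> \<xi> > 0}
     else Inf {c2_fun \<sigma> A \<xi> | \<xi>. \<xi> > 0})"

definition F :: "real \<Rightarrow> real \<Rightarrow> real \<Rightarrow> real \<Rightarrow> real \<Rightarrow> real \<Rightarrow> real \<Rightarrow> real" where
  "F \<sigma> a1 a2 a3 t1 t2 t3 =
     1/2 * log 2 (1 + (rho t1 * a1\<^sup>2 + rho t2 * a2\<^sup>2) / (\<sigma>\<^sup>2 * 2 powr (2 * Cbar \<sigma> a3 t3)))"

text \<open>Users/receivers are indexed by 1 and 2; h k l is the gain h_{kl} from transmitter k to receiver l.\<close>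

definition theta' :: "(nat \<Rightarrow> nat \<Rightarrow> real) \<Rightarrow> (nat \<Rightarrow> real) \<Rightarrow> (nat \<Rightarrow> real) \<Rightarrow> nat \<Rightarrow> real" where
  "theta' h \<kappa> \<theta> k = (let s = h 1 k * \<kappa> 1 + h 2 k * \<kappa> 2 in
      if s > 0 then (h 1 k * \<theta> 1 * \<kappa> 1 + h 2 k * \<theta> 2 * \<kappa> 2) / s else 0)"

definition RHK' :: "real \<Rightarrow> (nat \<Rightarrow> nat \<Rightarrow> real) \<Rightarrow> (nat \<Rightarrow> real) \<Rightarrow> (nat \<Rightarrow> real)
                    \<Rightarrow> (nat \<Rightarrow> real) \<Rightarrow> (nat \<Rightarrow> real) \<Rightarrow> (real \<times> real) set" where
  "RHK' \<sigma> h \<kappa> \<eta> \<theta> \<phi> = {(R1, R2). R1 \<ge> 0 \<and> R2 \<ge> 0 \<and>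
     (\<forall>i\<in>{1,2}. let j = 3 - i; R = (if i = 1 then R1 else R2) in
        R \<le> F \<sigma> 0 (h i i * \<kappa> i) (h j i * \<kappa> j) 1 (\<theta> i) (\<theta> j)
             + min (F \<sigma> 0 (h i 1 * \<eta> i) (h i 1 * \<kappa> i + h j 1 * \<kappa> j) 1 (\<phi> i) (theta' h \<kappa> \<theta> 1))
                   (F \<sigma> 0 (h i 2 * \<eta> i) (h i 2 * \<kappa> i + h j 2 * \<kappa> j) 1 (\<phi> i) (theta' h \<kappa> \<theta> 2))) \<and>
     R1 + R2 \<le> F \<sigma> 0 (h 1 1 * \<kappa> 1) (h 2 1 * \<kappa> 2) 1 (\<theta> 1) (\<theta> 2)
               + F \<sigma> 0 (h 2 2 * \<kappa> 2) (h 1 2 * \<kappa> 1) 1 (\<theta> 2) (\<theta> 1)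
               + min (F \<sigma> (h 1 1 * \<eta> 1) (h 2 1 * \<eta> 2) (h 1 1 * \<kappa> 1 + h 2 1 * \<kappa> 2)
                        (\<phi> 1) (\<phi> 2) (theta' h \<kappa> \<theta> 1))
                     (F \<sigma> (h 2 2 * \<eta> 2) (h 1 2 * \<eta> 1) (h 2 2 * \<kappa> 2 + h 1 2 * \<kappa> 1)
                        (\<phi> 2) (\<phi> 1) (theta' h \<kappa> \<theta> 2))}"

definition GHK' :: "real \<Rightarrow> real \<Rightarrow> (nat \<Rightarrow> real) \<Rightarrow> (nat \<Rightarrow> nat \<Rightarrow> real) \<Rightarrow> (real \<times> real) set" where
  "GHK' \<sigma> A \<alpha> h = convex hull (\<Union> {RHK' \<sigma> h \<kappa> \<eta> \<theta> \<phi> | \<kappa> \<eta> \<theta> \<phi>.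
      \<forall>i\<in>{1::nat,2}. 0 < \<theta> i \<and> \<theta> i \<le> 1 \<and> 0 < \<phi> i \<and> \<phi> i \<le> 1 \<and>
        0 \<le> \<kappa> i \<and> \<kappa> i \<le> A \<and> 0 \<le> \<eta> i \<and> \<eta> i \<le> A \<and> \<kappa> i + \<eta> i \<le> A \<and>
        \<theta> i * \<kappa> i + \<phi> i * \<eta> i \<le> \<alpha> i * A})"

definition noise_meas :: "real \<Rightarrow> nat \<Rightarrow> (nat \<Rightarrow> real) measure" where
  "noise_meas \<sigma> n = PiM {..<n} (\<lambda>_. density lborel (normal_density 0 \<sigma>))"

definition valid_encoder :: "real \<Rightarrow> real \<Rightarrow> nat \<Rightarrow> nat \<Rightarrow> (nat \<Rightarrow> nat \<Rightarrow> real) \<Rightarrow> bool" where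
  "valid_encoder A a n M x \<longleftrightarrow>
     (\<forall>m\<in>{1..M}. (\<forall>t<n. 0 \<le> x m t \<and> x m t \<le> A) \<and> (\<Sum>t<n. x m t) \<le> real n * a * A)"

definition valid_decoder :: "nat \<Rightarrow> ((nat \<Rightarrow> real) \<Rightarrow> nat) \<Rightarrow> bool" where
  "valid_decoder n g \<longleftrightarrow> g \<in> measurable (PiM {..<n} (\<lambda>_. borel)) (count_space UNIV)"

definition err_prob :: "real \<Rightarrow> nat \<Rightarrow> real \<Rightarrow> real \<Rightarrow> nat \<Rightarrow> nat \<Rightarrow> (nat \<Rightarrow> nat \<Rightarrow> real)
                        \<Rightarrow> (nat \<Rightarrow> nat \<Rightarrow> real) \<Rightarrow> ((nat \<Rightarrow> real) \<Rightarrow> nat) \<Rightarrow> real" where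
  "err_prob \<sigma> n hdir hc M M' x x' g =
     (\<Sum>m\<in>{1..M}. \<Sum>m'\<in>{1..M'}.
        measure (noise_meas \<sigma> n)
          {z \<in> space (noise_meas \<sigma> n). g (\<lambda>t\<in>{..<n}. hdir * x m t + hc * x' m' t + z t) \<noteq> m})
     / (real M * real M')"

definition num_msgs :: "nat \<Rightarrow> real \<Rightarrow> nat" where
  "num_msgs n R = nat \<lceil>2 powr (real n * R)\<rceil>"

definition achievable :: "real \<Rightarrow> real \<Rightarrow> (nat \<Rightarrow> real) \<Rightarrow> (nat \<Rightarrow> nat \<Rightarrow> real) \<Rightarrow> real \<Rightarrow> real \<Rightarrow> bool" where
  "achievable \<sigma> A \<alpha> h R1 R2 \<longleftrightarrow>
     (\<exists>(x1 :: nat \<Rightarrow> nat \<Rightarrow> nat \<Rightarrow> real) (x2 :: nat \<Rightarrow> nat \<Rightarrow> nat \<Rightarrow> real)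
        (g1 :: nat \<Rightarrow> (nat \<Rightarrow> real) \<Rightarrow> nat) (g2 :: nat \<Rightarrow> (nat \<Rightarrow> real) \<Rightarrow> nat).
       (\<forall>n\<ge>1. valid_encoder A (\<alpha> 1) n (num_msgs n R1) (x1 n)
             \<and> valid_encoder A (\<alpha> 2) n (num_msgs n R2) (x2 n)
             \<and> valid_decoder n (g1 n) \<and> valid_decoder n (g2 n)) \<and>
       ((\<lambda>n. err_prob \<sigma> n (h 1 1) (h 2 1) (num_msgs n R1) (num_msgs n R2) (x1 n) (x2 n) (g1 n))
           \<longlonglongrightarrow> 0) \<and>
       ((\<lambda>n. err_prob \<sigma> n (h 2 2) (h 1 2) (num_msgs n R2) (num_msgs n R1) (x2 n) (x1 n) (g2 n))
           \<longlonglongrightarrow> 0))"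

definition capacity_region :: "real \<Rightarrow> real \<Rightarrow> (nat \<Rightarrow> real) \<Rightarrow> (nat \<Rightarrow> nat \<Rightarrow> real) \<Rightarrow> (real \<times> real) set" where
  "capacity_region \<sigma> A \<alpha> h = closure {(R1, R2). achievable \<sigma> A \<alpha> h R1 R2}"

end

(* The codewords are sums of a common and a private part from independent random codebooks with
   truncated exponential (or uniform) letters. A receiver first resolves both common messages
   jointly, treating the private parts as noise, and then its own private message. A time-sharing
   sequence known to everyone handles the convex hull, and scaling the inputs by c < 1 makes the
   mean constraint strict, so that almost all codewords obey it.

   Every mutual information is a difference h(V + W) - h(W), with W the remaining noise. The first
   entropy is bounded below by the entropy power inequality, the second one above by relative
   entropy duality against the output law that defines Cbar. *)

theory Submission
  imports Defs
begin

section \<open>Densities with Gaussian bounds\<close>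

text \<open>Every random letter is a fixed increasing function of a standard normal seed. One
  measure \<open>gauss\<close> then serves all codebooks, time sharing is a change of function from
  one instant to the next, and the entropy of a letter is, up to a constant, the mean of
  \<open>ln (T' x)\<close>. A transport proof of the entropy power inequality consumes it in exactly
  this form, so the bounded inputs never need densities of their own. Densities are attached only to
  sums that contain the Gaussian noise; these have Gaussian upper and lower bounds, which settles
  all integrability questions.

  Since \<rho>(\<theta>) a^2 is the entropy power N(V) of the best letter V of peak a and relative
  mean \<theta>, h(V + W) - h(W) is at least half the logarithm of 1 + N(V) / N(W), and N(W) is at
  most \<sigma>^2 2^(2 Cbar); this is \<open>F\<close>. The obstacle is that no continuity of
  \<open>Cbar\<close> is established. The scaling by c is therefore applied to the inputs, while
  peak and mean of the interference are still bounded by their unscaled values, so that only the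
  signal power in \<open>F\<close> moves with c.\<close>

abbreviation dm :: "(real \<Rightarrow> real) \<Rightarrow> real measure" where
  "dm f \<equiv> density lborel (\<lambda>x. ennreal (f x))"

abbreviation gauss :: "real measure" where
  "gauss \<equiv> dm std_normal_density"

text \<open>The two-sided Gaussian bound makes \<open>ln (f x)\<close> grow at most quadratically,
  so entropies, cross entropies and second moments of log-likelihoods are finite. The class contains
  the noise density and is closed under adding an independent bounded variable, hence contains every
  density of interference plus noise that occurs.\<close>

definition gdens :: "(real \<Rightarrow> real) \<Rightarrow> bool" where
  "gdens f \<longleftrightarrow> continuous_on UNIV f \<and> integral\<^sup>L lborel f = 1 \<and>
     (\<exists>c p C q. 0 < c \<and> 0 < p \<and> 0 < C \<and> 0 < q \<and> (\<forall>x. c * exp (- p * x\<^sup>2) \<le> f x \<and> f x \<le> C * exp (- q * x\<^sup>2)))"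

text \<open>For standard normal \<open>X\<close> and independent \<open>W\<close> with density \<open>f\<close>,
  \<open>smooth s f\<close> is the density of \<open>s X + W\<close>.\<close>

definition smooth :: "(real \<Rightarrow> real) \<Rightarrow> (real \<Rightarrow> real) \<Rightarrow> real \<Rightarrow> real" where
  "smooth s f y = (\<integral>x. f (y - s x) \<partial>gauss)"

text \<open>Differential entropy in nats; conversion factors \<open>ln 2\<close> appear only where
  \<open>Cbar\<close>, \<open>F\<close> or rates are involved.\<close>

definition dent :: "(real \<Rightarrow> real) \<Rightarrow> real" where
  "dent f = - (\<integral>x. ln (f x) \<partial>dm f)"

lemma gdens_cont: "gdens f \<Longrightarrow> continuous_on A f"
  unfolding gdens_def using continuous_on_subset by blast

lemma gdens_measurable: "gdens f \<Longrightarrow> f \<in> borel_measurable borel"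
  unfolding gdens_def using borel_measurable_continuous_onI by blast

lemma gdens_pos: "gdens f \<Longrightarrow> f x > 0"
  unfolding gdens_def by (metis exp_gt_zero less_le_trans mult_pos_pos)

lemma gdens_nonneg: "gdens f \<Longrightarrow> f x \<ge> 0"
  using gdens_pos less_imp_le by blast

lemma gdens_integrable: "gdens f \<Longrightarrow> integrable lborel f"
  unfolding gdens_def using not_integrable_integral_eq by fastforce

lemma gdens_nn_integral: "gdens f \<Longrightarrow> (\<integral>\<^sup>+x. ennreal (f x) \<partial>lborel) = 1"
  using nn_integral_eq_integral[OF gdens_integrable, of f] gdens_nonneg[of f]
  by (simp add: gdens_def)

lemma gdens_prob: "gdens f \<Longrightarrow> prob_space (dm f)"
  by (intro prob_spaceI, subst emeasure_density)
     (auto simp: gdens_nn_integral intro: measurable_compose[OF gdens_measurable])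

lemma gdens_bounded: "gdens f \<Longrightarrow> \<exists>C>0. \<forall>x. f x \<le> C"
proof -
  assume "gdens f"
  then obtain C q where C: "C > 0" "q > 0" "\<forall>x. f x \<le> C * exp (- q * x\<^sup>2)"
    unfolding gdens_def by blast
  have "f x \<le> C" for x
  proof -
    have "exp (- q * x\<^sup>2) \<le> 1" using C by simp
    then have "C * exp (- q * x\<^sup>2) \<le> C * 1" using C by (intro mult_left_mono) auto
    then show ?thesis using C(3)[rule_format, of x] by simp
  qed
  with C show ?thesis by blast
qed

lemma gdens_ln_bound: "gdens f \<Longrightarrow> \<exists>a>0. \<forall>x. \<bar>ln (f x)\<bar> \<le> a * (1 + x\<^sup>2)"
proof -
  assume f: "gdens f"
  then obtain c p C q where C: "c > 0" "p > 0" "C > 0" "q > 0" 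
    "\<forall>x. c * exp (- p * x\<^sup>2) \<le> f x \<and> f x \<le> C * exp (- q * x\<^sup>2)"
    unfolding gdens_def by blast
  let ?a = "\<bar>ln c\<bar> + \<bar>ln C\<bar> + p + q + 1"
  have "\<bar>ln (f x)\<bar> \<le> ?a * (1 + x\<^sup>2)" for x
  proof -
    have "ln (c * exp (- p * x\<^sup>2)) \<le> ln (f x)" "ln (f x) \<le> ln (C * exp (- q * x\<^sup>2))"
      using C gdens_pos[OF f, of x] by (auto simp: ln_le_cancel_iff)
    then have 1: "ln c - p * x\<^sup>2 \<le> ln (f x)" "ln (f x) \<le> ln C - q * x\<^sup>2"
      using C by (auto simp: ln_mult)
    have "0 \<le> q * x\<^sup>2" "0 \<le> p * x\<^sup>2" "0 \<le> \<bar>ln c\<bar> * x\<^sup>2" "0 \<le> \<bar>ln C\<bar> * x\<^sup>2" using C by auto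
    then have "\<bar>ln (f x)\<bar> \<le> \<bar>ln c\<bar> + \<bar>ln C\<bar> + p * x\<^sup>2 + q * x\<^sup>2" using 1 C by linarith
    also have "... \<le> ?a * (1 + x\<^sup>2)"
      using \<open>0 \<le> q * x\<^sup>2\<close> \<open>0 \<le> p * x\<^sup>2\<close> \<open>0 \<le> \<bar>ln c\<bar> * x\<^sup>2\<close> \<open>0 \<le> \<bar>ln C\<bar> * x\<^sup>2\<close> C zero_le_power2[of x]
      unfolding distrib_left distrib_right by linarith
    finally show ?thesis .
  qed
  moreover have "?a > 0" using C by linarith
  ultimately show ?thesis by blast
qed

lemma integrable_exp_moment:
  fixes q :: real assumes q: "q > 0"
  shows "integrable lborel (\<lambda>x::real. exp (- q * x\<^sup>2) * x ^ (2*k))"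
proof -
  define \<sigma> where "\<sigma> = 1 / sqrt (2 * q)"
  have s: "\<sigma> > 0" "\<sigma>\<^sup>2 = 1 / (2*q)" using q by (auto simp: \<sigma>_def power_divide)
  have "integrable lborel (\<lambda>x. sqrt (2 * pi * \<sigma>\<^sup>2) * (normal_density 0 \<sigma> x * (x - 0)^(2*k)))"
    by (intro integrable_mult_right integrable_normal_moment s)
  also have "(\<lambda>x. sqrt (2 * pi * \<sigma>\<^sup>2) * (normal_density 0 \<sigma> x * (x - 0)^(2*k))) = (\<lambda>x. exp (- q * x\<^sup>2) * x ^ (2*k))"
    unfolding normal_density_def s(2) using q by (auto simp: fun_eq_iff)
  finally show ?thesis .
qed

lemma gdens_integrable_bound:
  assumes f: "gdens f" and [measurable]: "k \<in> borel_measurable borel"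
    and b: "\<And>x. \<bar>k x\<bar> \<le> a * (1 + x ^ 4)"
  shows "integrable (dm f) k"
proof -
  obtain C q where C: "C > 0" "q > 0" "\<forall>x. f x \<le> C * exp (- q * x\<^sup>2)"
    using f unfolding gdens_def by blast
  note gdens_measurable[OF f, measurable]
  have "integrable lborel (\<lambda>x. f x * k x)"
  proof (rule Bochner_Integration.integrable_bound)
    show "integrable lborel (\<lambda>x. C * \<bar>a\<bar> * (exp (- q * x\<^sup>2) * x ^ (2*0) + exp (- q * x\<^sup>2) * x ^ (2*2)))"
      by (intro integrable_mult_right Bochner_Integration.integrable_add integrable_exp_moment C)
    show "AE x in lborel. norm (f x * k x) \<le> norm (C * \<bar>a\<bar> * (exp (- q * x\<^sup>2) * x ^ (2*0) + exp (- q * x\<^sup>2) * x ^ (2*2)))"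
    proof (intro AE_I2)
      fix x
      have "\<bar>k x\<bar> \<le> \<bar>a\<bar> * (1 + x^4)"
        using b[of x] by (smt (verit) mult_right_mono zero_le_even_power even_numeral)
      then have "\<bar>f x\<bar> * \<bar>k x\<bar> \<le> (C * exp (- q * x\<^sup>2)) * (\<bar>a\<bar> * (1 + x^4))"
        using C(3) gdens_nonneg[OF f, of x] by (intro mult_mono) (auto intro!: mult_nonneg_nonneg less_imp_le[OF C(1)])
      also have "... = C * \<bar>a\<bar> * (exp (- q * x\<^sup>2) * x ^ (2*0) + exp (- q * x\<^sup>2) * x ^ (2*2))"
        by (simp add: algebra_simps)
      finally show "norm (f x * k x) \<le> norm (C * \<bar>a\<bar> * (exp (- q * x\<^sup>2) * x ^ (2*0) + exp (- q * x\<^sup>2) * x ^ (2*2)))"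
        using C(1) by (simp add: abs_mult)
    qed
  qed simp
  then show ?thesis
    by (subst integrable_density) (auto simp: gdens_nonneg[OF f])
qed

lemma gdens_integrable_sq:
  assumes f: "gdens f" and [measurable]: "k \<in> borel_measurable borel"
    and b: "\<And>x. \<bar>k x\<bar> \<le> a * (1 + x\<^sup>2)"
  shows "integrable (dm f) k" "integrable (dm f) (\<lambda>x. (k x)\<^sup>2)"
proof -
  have *: "1 + x\<^sup>2 \<le> 2 * (1 + x^4)" "(1 + x\<^sup>2)\<^sup>2 \<le> 2 * (1 + x^4)" for x :: real
  proof -
    have "0 \<le> (x\<^sup>2 - 1)\<^sup>2" by simp
    then show "(1 + x\<^sup>2)\<^sup>2 \<le> 2 * (1 + x^4)" by (simp add: power2_eq_square algebra_simps power4_eq_xxxx)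
    have "0 \<le> x^4" "0 \<le> x\<^sup>2" by auto
    with \<open>0 \<le> (x\<^sup>2 - 1)\<^sup>2\<close> show "1 + x\<^sup>2 \<le> 2 * (1 + x^4)" 
      by (simp add: power2_eq_square algebra_simps power4_eq_xxxx)
  qed
  have a: "a \<ge> 0" using b[of 0] by simp
  show "integrable (dm f) k"
  proof (rule gdens_integrable_bound[OF f, where a="2*a"])
    show "\<bar>k x\<bar> \<le> 2 * a * (1 + x ^ 4)" for x
      using b[of x] mult_left_mono[OF *(1)[of x] a] by (simp add: algebra_simps)
  qed simp
  show "integrable (dm f) (\<lambda>x. (k x)\<^sup>2)"
  proof (rule gdens_integrable_bound[OF f, where a="2*a\<^sup>2"])
    show "\<bar>(k x)\<^sup>2\<bar> \<le> 2 * a\<^sup>2 * (1 + x ^ 4)" for x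
    proof -
      have "(k x)\<^sup>2 \<le> (a * (1 + x\<^sup>2))\<^sup>2" using b[of x] by (metis abs_ge_zero power2_abs power_mono)
      also have "... = a\<^sup>2 * (1 + x\<^sup>2)\<^sup>2" by (simp add: power_mult_distrib)
      also have "... \<le> a\<^sup>2 * (2 * (1 + x^4))" by (intro mult_left_mono *) auto
      finally show ?thesis by (simp add: algebra_simps)
    qed
  qed simp
qed

lemma gdens_normal: "\<sigma> > 0 \<Longrightarrow> gdens (normal_density 0 \<sigma>)"
  unfolding gdens_def
proof (intro conjI)
  assume s: "\<sigma> > 0"
  show "continuous_on UNIV (normal_density 0 \<sigma>)" unfolding normal_density_def
    using s by (intro continuous_intros) auto
  show "integral\<^sup>L lborel (normal_density 0 \<sigma>) = 1" using s by simp
  let ?c = "1 / sqrt (2 * pi * \<sigma>\<^sup>2)" and ?p = "1 / (2 * \<sigma>\<^sup>2)"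
  have "0 < ?c" "0 < ?p" using s by auto
  moreover have "\<forall>x. normal_density 0 \<sigma> x = ?c * exp (- ?p * x\<^sup>2)"
    by (simp add: normal_density_def)
  ultimately show "\<exists>c p C q. 0 < c \<and> 0 < p \<and> 0 < C \<and> 0 < q \<and> (\<forall>x. c * exp (- p * x\<^sup>2) \<le> normal_density 0 \<sigma> x \<and> normal_density 0 \<sigma> x \<le> C * exp (- q * x\<^sup>2))"
    by (intro exI[of _ ?c] exI[of _ ?p]) simp
qed

lemma gdens_gauss: "gdens std_normal_density" by (rule gdens_normal) simp

lemma prob_gauss: "prob_space gauss" by (rule gdens_prob[OF gdens_gauss])

lemma distr_smooth:
  assumes f: "gdens f" and [measurable]: "s \<in> borel_measurable borel"
  shows "distr (gauss \<Otimes>\<^sub>M dm f) borel (\<lambda>(x, y). s x + y) = density lborel (\<lambda>y. \<integral>\<^sup>+x. ennreal (f (y - s x)) \<partial>gauss)"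
proof (rule measure_eqI)
  note [measurable] = gdens_measurable[OF f]
  interpret G: prob_space gauss by (rule prob_gauss)
  interpret F: prob_space "dm f" by (rule gdens_prob[OF f])
  interpret GL: pair_sigma_finite gauss lborel
    by (intro pair_sigma_finite.intro G.sigma_finite_measure_axioms sigma_finite_lborel)
  fix A assume "A \<in> sets (distr (gauss \<Otimes>\<^sub>M dm f) borel (\<lambda>(x, y). s x + y))"
  then have [measurable]: "A \<in> sets borel" by simp
  have "emeasure (distr (gauss \<Otimes>\<^sub>M dm f) borel (\<lambda>(x, y). s x + y)) A
      = (\<integral>\<^sup>+z. indicator A z \<partial>distr (gauss \<Otimes>\<^sub>M dm f) borel (\<lambda>(x, y). s x + y))"
    by simp
  also have "... = (\<integral>\<^sup>+z. indicator A (case z of (x,y) \<Rightarrow> s x + y) \<partial>(gauss \<Otimes>\<^sub>M dm f))"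
    by (subst nn_integral_distr) (auto simp: measurable_cong_sets[OF sets_pair_measure_cong[OF sets_density sets_density] refl])
  also have "... = (\<integral>\<^sup>+x. \<integral>\<^sup>+y. indicator A (s x + y) \<partial>dm f \<partial>gauss)"
    by (subst F.nn_integral_fst[symmetric]) auto
  also have "... = (\<integral>\<^sup>+x. \<integral>\<^sup>+y. ennreal (f y) * indicator A (s x + y) \<partial>lborel \<partial>gauss)"
    by (intro nn_integral_cong) (auto simp: nn_integral_density)
  also have "... = (\<integral>\<^sup>+x. \<integral>\<^sup>+y. ennreal (f (y - s x)) * indicator A y \<partial>lborel \<partial>gauss)"
  proof (rule nn_integral_cong)
    fix x
    show "(\<integral>\<^sup>+y. ennreal (f y) * indicator A (s x + y) \<partial>lborel) = (\<integral>\<^sup>+y. ennreal (f (y - s x)) * indicator A y \<partial>lborel)"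
      by (subst nn_integral_real_affine[where c=1 and t="- s x"]) auto
  qed
  also have "... = (\<integral>\<^sup>+y. \<integral>\<^sup>+x. ennreal (f (y - s x)) * indicator A y \<partial>gauss \<partial>lborel)"
    by (rule GL.Fubini'[symmetric]) simp
  also have "... = (\<integral>\<^sup>+y. (\<integral>\<^sup>+x. ennreal (f (y - s x)) \<partial>gauss) * indicator A y \<partial>lborel)"
    by (intro nn_integral_cong nn_integral_multc) simp
  also have "... = emeasure (density lborel (\<lambda>y. \<integral>\<^sup>+x. ennreal (f (y - s x)) \<partial>gauss)) A"
    by (simp add: emeasure_density)
  finally show "emeasure (distr (gauss \<Otimes>\<^sub>M dm f) borel (\<lambda>(x, y). s x + y)) A =
    emeasure (density lborel (\<lambda>y. \<integral>\<^sup>+x. ennreal (f (y - s x)) \<partial>gauss)) A" .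
qed simp

lemma smooth_integrable:
  assumes f: "gdens f" and [measurable]: "s \<in> borel_measurable borel"
  shows "integrable gauss (\<lambda>x. f (y - s x))"
proof -
  note [measurable] = gdens_measurable[OF f]
  obtain C where "C > 0" "\<forall>x. f x \<le> C" using gdens_bounded[OF f] by blast
  interpret G: prob_space gauss by (rule prob_gauss)
  show ?thesis by (rule G.integrable_const_bound[where B=C]) (use \<open>\<forall>x. f x \<le> C\<close> gdens_nonneg[OF f] in auto)
qed

lemma smooth_nn:
  assumes f: "gdens f" and [measurable]: "s \<in> borel_measurable borel"
  shows "(\<integral>\<^sup>+x. ennreal (f (y - s x)) \<partial>gauss) = ennreal (smooth s f y)"
  unfolding smooth_def
  by (rule nn_integral_eq_integral[OF smooth_integrable[OF assms]]) (simp add: gdens_nonneg[OF f])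

lemma dm_smooth:
  assumes f: "gdens f" and s: "s \<in> borel_measurable borel"
  shows "distr (gauss \<Otimes>\<^sub>M dm f) borel (\<lambda>(x, y). s x + y) = dm (smooth s f)"
  unfolding distr_smooth[OF assms] smooth_nn[OF assms] ..

lemma smooth_measurable:
  assumes f: "gdens f" and [measurable]: "s \<in> borel_measurable borel"
  shows "smooth s f \<in> borel_measurable borel"
proof -
  note [measurable] = gdens_measurable[OF f]
  interpret G: prob_space gauss by (rule prob_gauss)
  show ?thesis unfolding smooth_def by measurable
qed

text \<open>A shift by at most B keeps y^2 between y^2 / 2 - B^2 and 2 y^2 + 2 B^2. Averaging over
  the shift therefore preserves Gaussian bounds, with rates \<open>2 * p\<close> and
  \<open>q / 2\<close> and constants that depend on B.\<close>

lemma gdens_smooth: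
  assumes f: "gdens f" and [measurable]: "s \<in> borel_measurable borel" and B: "\<And>x. \<bar>s x\<bar> \<le> B"
  shows "gdens (smooth s f)"
  unfolding gdens_def
proof (intro conjI)
  note [measurable] = gdens_measurable[OF f] smooth_measurable[OF f assms(2)]
  interpret G: prob_space gauss by (rule prob_gauss)
  obtain C0 where C0: "C0 > 0" "\<forall>x. f x \<le> C0" using gdens_bounded[OF f] by blast
  show "continuous_on UNIV (smooth s f)"
    unfolding continuous_on_sequentially comp_def
  proof (intro ballI allI impI, elim conjE)
    fix y :: real and u :: "nat \<Rightarrow> real" assume u: "u \<longlonglongrightarrow> y"
    show "(\<lambda>n. smooth s f (u n)) \<longlonglongrightarrow> smooth s f y"
      unfolding smooth_def
    proof (rule integral_dominated_convergence[where w="\<lambda>_. C0"])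
      show "AE x in gauss. (\<lambda>i. f (u i - s x)) \<longlonglongrightarrow> f (y - s x)"
      proof (intro AE_I2)
        fix x
        have "isCont f (y - s x)" using gdens_cont[OF f, of UNIV] continuous_on_eq_continuous_at by blast
        then show "(\<lambda>i. f (u i - s x)) \<longlonglongrightarrow> f (y - s x)"
          by (rule isCont_tendsto_compose) (intro tendsto_intros u)
      qed
    qed (use C0 gdens_nonneg[OF f] in auto)
  qed
  have "prob_space (distr (gauss \<Otimes>\<^sub>M dm f) borel (\<lambda>(x, y). s x + y))"
  proof -
    interpret F: prob_space "dm f" by (rule gdens_prob[OF f])
    interpret P: pair_prob_space gauss "dm f" ..
    show ?thesis by (intro P.prob_space_distr) (simp add: measurable_cong_sets[OF sets_pair_measure_cong[OF sets_density sets_density] refl])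
  qed
  then interpret D: prob_space "dm (smooth s f)" unfolding dm_smooth[OF f assms(2)] .
  have nn: "0 \<le> smooth s f y" for y unfolding smooth_def
    by (intro integral_nonneg_AE AE_I2 gdens_nonneg[OF f])
  have "(\<integral>\<^sup>+y. ennreal (smooth s f y) \<partial>lborel) = 1"
    using D.emeasure_space_1 by (simp add: emeasure_density)
  then show "integral\<^sup>L lborel (smooth s f) = 1"
    by (subst integral_eq_nn_integral) (auto simp: nn)
  obtain c p C q where C: "c > 0" "p > 0" "C > 0" "q > 0" 
    "\<forall>x. c * exp (- p * x\<^sup>2) \<le> f x \<and> f x \<le> C * exp (- q * x\<^sup>2)"
    using f unfolding gdens_def by blast
  let ?c = "c * exp (- p * (2 * B\<^sup>2))" and ?C = "C * exp (q * B\<^sup>2)"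
  have "?c * exp (- (2*p) * y\<^sup>2) \<le> smooth s f y \<and> smooth s f y \<le> ?C * exp (- (q/2) * y\<^sup>2)" for y
  proof
    have *: "?c * exp (- (2*p) * y\<^sup>2) \<le> f (y - s x)" "f (y - s x) \<le> ?C * exp (- (q/2) * y\<^sup>2)" for x
    proof -
      have sB: "(s x)\<^sup>2 \<le> B\<^sup>2" using B[of x] by (metis abs_ge_zero power2_abs power_mono)
      have "(y - s x)\<^sup>2 \<le> 2 * y\<^sup>2 + 2 * (s x)\<^sup>2" using sum_squares_ge_zero[of "y + s x" 0]
        by (simp add: power2_eq_square algebra_simps)
      then have "p * (y - s x)\<^sup>2 \<le> p * (2 * y\<^sup>2 + 2 * B\<^sup>2)" using sB C by (intro mult_left_mono) auto
      then have "c * exp (- p * (2 * y\<^sup>2 + 2 * B\<^sup>2)) \<le> c * exp (- p * (y - s x)\<^sup>2)" using C by simp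
      also have "... \<le> f (y - s x)" using C by blast
      finally show "?c * exp (- (2*p) * y\<^sup>2) \<le> f (y - s x)"
        by (simp add: mult.assoc exp_add[symmetric]) (simp add: algebra_simps)
      have "(y - s x)\<^sup>2 \<ge> y\<^sup>2 / 2 - (s x)\<^sup>2" using sum_squares_ge_zero[of "y - 2 * s x" 0]
        by (simp add: power2_eq_square algebra_simps)
      then have "q * (y - s x)\<^sup>2 \<ge> q * (y\<^sup>2 / 2 - B\<^sup>2)" using sB C by (intro mult_left_mono) auto
      then have "C * exp (- q * (y - s x)\<^sup>2) \<le> C * exp (- q * (y\<^sup>2 / 2 - B\<^sup>2))" using C by simp
      moreover have "f (y - s x) \<le> C * exp (- q * (y - s x)\<^sup>2)" using C by blast
      ultimately have "f (y - s x) \<le> C * exp (- q * (y\<^sup>2 / 2 - B\<^sup>2))" by linarith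
      then show "f (y - s x) \<le> ?C * exp (- (q/2) * y\<^sup>2)"
        by (simp add: mult.assoc exp_add[symmetric]) (simp add: algebra_simps)
    qed
    have "(\<integral>x. ?c * exp (- (2*p) * y\<^sup>2) \<partial>gauss) \<le> smooth s f y"
      unfolding smooth_def by (rule integral_mono[OF _ smooth_integrable[OF f assms(2)] *(1)]) simp
    then show "?c * exp (- (2*p) * y\<^sup>2) \<le> smooth s f y" using G.prob_space by simp
    have "smooth s f y \<le> (\<integral>x. ?C * exp (- (q/2) * y\<^sup>2) \<partial>gauss)"
      unfolding smooth_def by (rule integral_mono[OF smooth_integrable[OF f assms(2)] _ *(2)]) simp
    then show "smooth s f y \<le> ?C * exp (- (q/2) * y\<^sup>2)" using G.prob_space by simp
  qed
  moreover have "?c > 0" "?C > 0" "2 * p > 0" "q / 2 > 0" using C by auto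
  ultimately show "\<exists>c p C q. 0 < c \<and> 0 < p \<and> 0 < C \<and> 0 < q \<and>
     (\<forall>x. c * exp (- p * x\<^sup>2) \<le> smooth s f x \<and> smooth s f x \<le> C * exp (- q * x\<^sup>2))"
    by blast
qed

lemma integrable_ln_gdens:
  assumes "gdens f" "gdens g"
  shows "integrable (dm f) (\<lambda>x. ln (g x))" "integrable (dm f) (\<lambda>x. (ln (g x))\<^sup>2)"
proof -
  obtain a where a: "\<forall>x. \<bar>ln (g x)\<bar> \<le> a * (1 + x\<^sup>2)" using gdens_ln_bound[OF assms(2)] by blast
  note [measurable] = gdens_measurable[OF assms(2)]
  show "integrable (dm f) (\<lambda>x. ln (g x))" "integrable (dm f) (\<lambda>x. (ln (g x))\<^sup>2)"
    using gdens_integrable_sq[OF assms(1), of "\<lambda>x. ln (g x)" a] a by auto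
qed

section \<open>Change of variables and monotone transport from the Gaussian law\<close>

lemma DERIV_all_continuous_on: "(\<And>x. (g has_real_derivative g' x) (at x)) \<Longrightarrow> continuous_on A g"
  by (meson DERIV_continuous_on has_field_derivative_at_within)

lemma SUP_indicator: "(SUP n. indicator (A n) x :: ennreal) = indicator (\<Union>n. A n) x"
proof (rule antisym)
  show "(SUP n. indicator (A n) x :: ennreal) \<le> indicator (\<Union>n. A n) x"
    by (rule SUP_least) (auto simp: indicator_def)
  show "indicator (\<Union>n. A n) x \<le> (SUP n. indicator (A n) x :: ennreal)"
  proof (cases "x \<in> (\<Union>n. A n)")
    case True
    then obtain m where "x \<in> A m" by blast
    then show ?thesis using True by (intro SUP_upper2[of m]) auto
  qed auto
qed

text \<open>Substitution on [-n, n] followed by monotone convergence. The range is kept explicit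
  because the lemma serves both maps onto the line and the normal cdf, whose range is (0,
  1).\<close>

lemma nn_substitution_UNIV:
  fixes g g' :: "real \<Rightarrow> real" and k :: "real \<Rightarrow> ennreal"
  assumes [measurable]: "k \<in> borel_measurable borel"
    and g: "\<And>x. (g has_real_derivative g' x) (at x)"
    and g': "continuous_on UNIV g'" "\<And>x. g' x > 0"
  shows "(\<integral>\<^sup>+x. k (g x) * ennreal (g' x) \<partial>lborel) = (\<integral>\<^sup>+y. k y * indicator (range g) y \<partial>lborel)"
proof -
  have cg: "continuous_on UNIV g" using g by (meson DERIV_continuous_on UNIV_I has_field_derivative_at_within)
  have [measurable]: "g \<in> borel_measurable borel" "g' \<in> borel_measurable borel"
    using cg g' by (auto intro: borel_measurable_continuous_onI)
  have mono: "strict_mono g"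
    by (rule strict_monoI) (meson DERIV_pos_imp_increasing g g'(2))
  let ?I = "\<lambda>n::nat. {- real n..real n}"
  have img: "g ` ?I n = {g (- real n)..g (real n)}" for n
  proof
    show "g ` ?I n \<subseteq> {g (- real n)..g (real n)}" using strict_mono_less_eq[OF mono] by auto
    show "{g (- real n)..g (real n)} \<subseteq> g ` ?I n"
      using IVT'[of g "- real n" _ "real n"] continuous_on_subset[OF cg] by fastforce
  qed
  have un: "(\<Union>n. ?I n) = UNIV"
  proof -
    have "\<exists>n. x \<in> ?I n" for x :: real
      using real_arch_simple[of "\<bar>x\<bar>"] by (auto simp: abs_le_iff) (metis minus_le_iff)
    then show ?thesis by blast
  qed
  have SUP1: "(SUP n. k (g x) * ennreal (g' x) * indicator (?I n) x) = k (g x) * ennreal (g' x)" for x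
  proof -
    have "(SUP n. k (g x) * ennreal (g' x) * indicator (?I n) x) = k (g x) * ennreal (g' x) * (SUP n. indicator (?I n) x)"
      by (rule SUP_mult_left_ennreal[symmetric])
    also have "(SUP n. indicator (?I n) x :: ennreal) = indicator (\<Union>n. ?I n) x"
      by (rule SUP_indicator)
    finally show ?thesis unfolding un by simp
  qed
  have SUP2: "(SUP n. k y * indicator (g ` ?I n) y) = k y * indicator (range g) y" for y
  proof -
    have "(SUP n. k y * indicator (g ` ?I n) y) = k y * (SUP n. indicator (g ` ?I n) y)"
      by (rule SUP_mult_left_ennreal[symmetric])
    also have "(SUP n. indicator (g ` ?I n) y :: ennreal) = indicator (\<Union>n. g ` ?I n) y"
      by (rule SUP_indicator)
    also have "(\<Union>n. g ` ?I n) = range g" using un by (metis image_UN)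
    finally show ?thesis .
  qed
  have eq: "(\<integral>\<^sup>+x. k (g x) * ennreal (g' x) * indicator (?I n) x \<partial>lborel) = (\<integral>\<^sup>+y. k y * indicator (g ` ?I n) y \<partial>lborel)" for n
  \<comment> \<open>For n = 0 the interval is a single point and both integrals vanish; the rule for
    intervals applies for n > 0.\<close>
  proof (cases "n = 0")
    case True
    have "(\<integral>\<^sup>+x. k (g x) * ennreal (g' x) * indicator (?I 0) x \<partial>lborel) = 0"
      by (subst nn_integral_0_iff_AE) (auto intro!: AE_I[where N="{0}"] simp: indicator_def)
    moreover have "(\<integral>\<^sup>+y. k y * indicator (g ` ?I 0) y \<partial>lborel) = 0"
      by (subst nn_integral_0_iff_AE) (auto intro!: AE_I[where N="{g 0}"] simp: indicator_def)
    ultimately show ?thesis using True by simp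
  next
    case False
    have "(\<integral>\<^sup>+x. k x * indicator {g (- real n)..g (real n)} x \<partial>lborel) =
        (\<integral>\<^sup>+x. k (g x) * g' x * indicator {- real n..real n} x \<partial>lborel)"
      by (rule nn_integral_substitution_aux[OF assms(1) _ g continuous_on_subset[OF g'(1)] less_imp_le[OF g'(2)]])
         (use False in auto)
    then show ?thesis unfolding img by (rule sym)
  qed
  have [measurable]: "g ` ?I n \<in> sets borel" for n by (simp add: img)
  have incI: "indicator (?I n) x \<le> (indicator (?I (Suc n)) x :: ennreal)" for n x
    by (auto simp: indicator_def)
  have incJ: "indicator (g ` ?I n) x \<le> (indicator (g ` ?I (Suc n)) x :: ennreal)" for n x
  proof -
    have "g ` ?I n \<subseteq> g ` ?I (Suc n)" by (intro image_mono) auto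
    then show ?thesis by (auto simp: indicator_def)
  qed
  have "(\<integral>\<^sup>+x. k (g x) * ennreal (g' x) \<partial>lborel) = (\<integral>\<^sup>+x. (SUP n. k (g x) * ennreal (g' x) * indicator (?I n) x) \<partial>lborel)"
    by (simp only: SUP1)
  also have "... = (SUP n. \<integral>\<^sup>+x. k (g x) * ennreal (g' x) * indicator (?I n) x \<partial>lborel)"
    by (rule nn_integral_monotone_convergence_SUP)
       (auto intro!: incseq_SucI le_funI mult_left_mono incI)
  also have "... = (SUP n. \<integral>\<^sup>+y. k y * indicator (g ` ?I n) y \<partial>lborel)" unfolding eq ..
  also have "... = (\<integral>\<^sup>+y. (SUP n. k y * indicator (g ` ?I n) y) \<partial>lborel)"
    by (rule nn_integral_monotone_convergence_SUP[symmetric])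
       (auto intro!: incseq_SucI le_funI mult_left_mono incJ)
  also have "... = (\<integral>\<^sup>+y. k y * indicator (range g) y \<partial>lborel)" by (simp only: SUP2)
  finally show ?thesis .
qed

lemma nn_integral_dm: "gdens f \<Longrightarrow> k \<in> borel_measurable borel \<Longrightarrow> (\<integral>\<^sup>+x. k x \<partial>dm f) = (\<integral>\<^sup>+x. ennreal (f x) * k x \<partial>lborel)"
  using gdens_measurable[of f] by (intro nn_integral_density) auto

lemma gdens_measure:
  assumes f: "gdens f" and [measurable]: "A \<in> sets borel"
  shows "measure (dm f) A = (\<integral>x. indicator A x * f x \<partial>lborel)"
proof -
  note [measurable] = gdens_measurable[OF f]
  have "emeasure (dm f) A = (\<integral>\<^sup>+x. ennreal (indicator A x * f x) \<partial>lborel)"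
    by (subst emeasure_density) (auto intro!: nn_integral_cong simp: indicator_def)
  also have "... = ennreal (\<integral>x. indicator A x * f x \<partial>lborel)"
    using integrable_real_mult_indicator[OF _ gdens_integrable[OF f], of A] gdens_nonneg[OF f]
    by (intro nn_integral_eq_integral) (auto simp: mult.commute)
  finally show ?thesis
    by (simp add: measure_def integral_nonneg_AE gdens_nonneg[OF f])
qed

lemma gdens_cdf_deriv:
  assumes f: "gdens f"
  shows "(cdf (dm f) has_real_derivative f x) (at x)"
proof -
  note [measurable] = gdens_measurable[OF f]
  interpret prob_space "dm f" by (rule gdens_prob[OF f])
  interpret finite_borel_measure "dm f" by standard simp
  let ?a = "x - 1" and ?b = "x + 1"
  have eq: "cdf (dm f) y = cdf (dm f) ?a + integral {?a..y} f" if "y \<in> {?a<..<?b}" for y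
  proof -
    have "cdf (dm f) y - cdf (dm f) ?a = measure (dm f) {?a<..y}"
      using that by (intro cdf_diff_eq) auto
    also have "... = (\<integral>t. indicator {?a<..y} t * f t \<partial>lborel)"
      by (rule gdens_measure[OF f]) simp
    also have "... = (\<integral>t. indicator {?a..y} t * f t \<partial>lborel)"
    proof (rule integral_cong_AE)
      show "AE t in lborel. indicator {?a<..y} t * f t = indicator {?a..y} t * f t"
        using AE_lborel_singleton[of ?a] by eventually_elim (auto simp: indicator_def)
    qed simp_all
    also have "... = (LINT t:{?a..y}|lborel. f t)" by (simp add: set_lebesgue_integral_def)
    also have "... = integral {?a..y} f"
      by (rule set_borel_integral_eq_integral)
         (simp add: borel_integrable_atLeastAtMost' gdens_cont[OF f])
    finally show ?thesis by simp
  qed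
  have "((\<lambda>y. integral {?a..y} f) has_real_derivative f x) (at x within {?a..?b})"
    by (rule integral_has_real_derivative[OF gdens_cont[OF f]]) simp
  moreover have "at x within {?a..?b} = at x" by (rule at_within_interior) simp
  ultimately have "((\<lambda>y. integral {?a..y} f) has_real_derivative f x) (at x)"
    by (simp only:)
  then have "((\<lambda>y. cdf (dm f) ?a + integral {?a..y} f) has_real_derivative f x) (at x)"
    by (auto intro!: derivative_eq_intros)
  then show ?thesis
    by (rule has_field_derivative_transform_within_open[where S="{?a<..<?b}"]) (simp_all add: eq)
qed

lemma gdens_cdf:
  assumes f: "gdens f"
  shows "strict_mono (cdf (dm f))" "0 < cdf (dm f) x" "cdf (dm f) x < 1"
    "0 < p \<Longrightarrow> p < 1 \<Longrightarrow> \<exists>x. cdf (dm f) x = p"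
    "isCont (cdf (dm f)) x"
    "(cdf (dm f) \<longlongrightarrow> 0) at_bot" "(cdf (dm f) \<longlongrightarrow> 1) at_top"
proof -
  interpret prob_space "dm f" by (rule gdens_prob[OF f])
  interpret real_distribution "dm f" by standard auto
  show sm: "strict_mono (cdf (dm f))"
  proof (rule strict_monoI)
    fix x y :: real assume "x < y"
    then show "cdf (dm f) x < cdf (dm f) y"
    proof (rule DERIV_pos_imp_increasing)
      fix z show "\<exists>d. (cdf (dm f) has_real_derivative d) (at z) \<and> 0 < d"
        by (intro exI[of _ "f z"] conjI gdens_cdf_deriv[OF f] gdens_pos[OF f])
    qed
  qed
  show "0 < cdf (dm f) x"
    using strict_monoD[OF sm, of "x - 1" x] cdf_nonneg[of "x - 1"] by linarith
  show "cdf (dm f) x < 1"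
    using strict_monoD[OF sm, of x "x + 1"] cdf_bounded_prob[of "x + 1"] by linarith
  show c: "isCont (cdf (dm f)) x" for x by (rule DERIV_isCont[OF gdens_cdf_deriv[OF f]])
  show l0: "(cdf (dm f) \<longlongrightarrow> 0) at_bot" by (rule cdf_lim_at_bot)
  show l1: "(cdf (dm f) \<longlongrightarrow> 1) at_top" by (rule cdf_lim_at_top_prob)
  show "\<exists>x. cdf (dm f) x = p" if "0 < p" "p < 1"
  proof -
    have "eventually (\<lambda>x. cdf (dm f) x < p) at_bot" by (rule order_tendstoD(2)[OF l0 \<open>0 < p\<close>])
    then obtain a where a: "cdf (dm f) a < p" by (auto simp: eventually_at_bot_linorder)
    have "eventually (\<lambda>x. cdf (dm f) x > p) at_top" by (rule order_tendstoD(1)[OF l1 \<open>p < 1\<close>])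
    then obtain b where b: "cdf (dm f) b > p" by (auto simp: eventually_at_top_linorder)
    have "a \<le> b" using a b strict_mono_less_eq[OF sm, of b a] by linarith
    then show ?thesis using IVT[of "cdf (dm f)" a p b] a b c by auto
  qed
qed

text \<open>Monotone rearrangement: U is the inverse cdf of f applied to the normal cdf. A
  continuous positive density makes the cdf continuously differentiable with positive derivative and
  range (0, 1), so its inverse is differentiable there. The equation for
  \<open>f (U x) * U' x\<close> is the change of variables by which U carries the normal law to the
  law of density f.\<close>

lemma gdens_transport:
  assumes f: "gdens f"
  obtains U U' where "\<And>x. (U has_real_derivative U' x) (at x)" "continuous_on UNIV U'" "\<And>x. U' x > 0"
    "\<And>x. f (U x) * U' x = std_normal_density x" "surj U"
proof
  let ?F = "cdf (dm f)" and ?P = "cdf gauss"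
  define G where "G = inv ?F"
  have inj: "inj ?F" by (rule strict_mono_imp_inj_on[OF gdens_cdf(1)[OF f]])
  have GF: "G (?F x) = x" for x unfolding G_def by (rule inv_f_f[OF inj])
  have FG: "?F (G p) = p" if "0 < p" "p < 1" for p
    unfolding G_def using gdens_cdf(4)[OF f that] by (metis f_inv_into_f rangeI)
  have Gd: "(G has_real_derivative inverse (f (G p))) (at p)" if p: "0 < p" "p < 1" for p
  proof (rule DERIV_inverse_function[where f="?F" and a=0 and b=1])
    show "(?F has_real_derivative f (G p)) (at (G p))" by (rule gdens_cdf_deriv[OF f])
    show "f (G p) \<noteq> 0" using gdens_pos[OF f, of "G p"] by simp
    have "isCont G (?F (G p))"
      by (rule isCont_inverse_function2[where a="G p - 1" and b="G p + 1"]) (auto simp: GF gdens_cdf(5)[OF f])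
    then show "isCont G p" using FG p by simp
  qed (use p FG in auto)
  let ?U = "\<lambda>x. G (?P x)" and ?U' = "\<lambda>x. std_normal_density x / f (G (?P x))"
  show U: "(?U has_real_derivative ?U' x) (at x)" for x
  proof -
    have "((G \<circ> ?P) has_real_derivative inverse (f (G (?P x))) * std_normal_density x) (at x)"
      by (rule DERIV_chain[OF Gd gdens_cdf_deriv[OF gdens_gauss]]) (use gdens_cdf(2,3)[OF gdens_gauss] in auto)
    then show ?thesis by (simp add: o_def divide_inverse mult.commute)
  qed
  have cU: "continuous_on UNIV ?U" by (rule DERIV_all_continuous_on[OF U])
  show "continuous_on UNIV ?U'"
  proof (rule continuous_on_divide[OF gdens_cont[OF gdens_gauss]])
    show "continuous_on UNIV (\<lambda>x. f (?U x))"
      by (rule continuous_on_compose2[OF gdens_cont[OF f, of UNIV] cU]) simp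
    show "\<forall>x\<in>UNIV. f (?U x) \<noteq> 0" using gdens_pos[OF f] by (metis less_irrefl)
  qed
  show "?U' x > 0" for x using gdens_pos[OF f] gdens_pos[OF gdens_gauss] by simp
  show "f (?U x) * ?U' x = std_normal_density x" for x using gdens_pos[OF f, of "?U x"] by simp
  show "surj ?U"
    unfolding surj_def
  proof
    fix y
    obtain x where "?P x = ?F y" using gdens_cdf(2,3)[OF f] gdens_cdf(4)[OF gdens_gauss] by blast
    then show "\<exists>x. y = ?U x" by (intro exI[of _ x]) (simp add: GF)
  qed
qed

lemma transport_distr:
  assumes f: "gdens f" and U: "\<And>x. (U has_real_derivative U' x) (at x)" "continuous_on UNIV U'" "\<And>x. U' x > 0"
    "\<And>x. f (U x) * U' x = std_normal_density x" "surj U"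
  shows "distr gauss borel U = dm f"
proof (rule measure_eqI)
  note [measurable] = gdens_measurable[OF f]
  have [measurable]: "U \<in> borel_measurable borel" "U' \<in> borel_measurable borel"
    using DERIV_all_continuous_on[OF U(1)] U(2) by (auto intro: borel_measurable_continuous_onI)
  fix A assume "A \<in> sets (distr gauss borel U)"
  then have [measurable]: "A \<in> sets borel" by simp
  have "emeasure (distr gauss borel U) A = (\<integral>\<^sup>+y. indicator A y \<partial>distr gauss borel U)" by simp
  also have "... = (\<integral>\<^sup>+x. indicator A (U x) \<partial>gauss)"
    by (rule nn_integral_distr) auto
  also have "... = (\<integral>\<^sup>+x. ennreal (std_normal_density x) * indicator A (U x) \<partial>lborel)"
    by (rule nn_integral_dm[OF gdens_gauss]) simp
  also have "... = (\<integral>\<^sup>+x. (ennreal (f (U x)) * indicator A (U x)) * ennreal (U' x) \<partial>lborel)"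
    by (intro nn_integral_cong) (simp add: U(4)[symmetric] ennreal_mult gdens_nonneg[OF f] less_imp_le[OF U(3)] mult_ac)
  also have "... = (\<integral>\<^sup>+y. (ennreal (f y) * indicator A y) * indicator (range U) y \<partial>lborel)"
    by (rule nn_substitution_UNIV[OF _ U(1,2,3)]) simp
  also have "... = emeasure (dm f) A" using U(5) by (simp add: emeasure_density)
  finally show "emeasure (distr gauss borel U) A = emeasure (dm f) A" .
qed simp

section \<open>The entropy power inequality\<close>

lemma sets_dm_pair: "sets (dm f \<Otimes>\<^sub>M dm g) = sets (borel \<Otimes>\<^sub>M borel)"
  by (rule sets_pair_measure_cong) simp_all

lemma measurable_dm_pair: "measurable (dm f \<Otimes>\<^sub>M dm g) N = measurable (borel \<Otimes>\<^sub>M borel) N"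
  by (rule measurable_cong_sets[OF sets_dm_pair refl])

lemma nn_integral_gauss_pair:
  assumes [measurable]: "H \<in> borel_measurable (borel \<Otimes>\<^sub>M borel)"
  shows "(\<integral>\<^sup>+z. H z \<partial>(gauss \<Otimes>\<^sub>M gauss)) =
    (\<integral>\<^sup>+y. \<integral>\<^sup>+x. ennreal (std_normal_density x * std_normal_density y) * H (x, y) \<partial>lborel \<partial>lborel)"
proof -
  interpret G: prob_space gauss by (rule prob_gauss)
  interpret P: pair_sigma_finite gauss gauss ..
  have "(\<integral>\<^sup>+z. H z \<partial>(gauss \<Otimes>\<^sub>M gauss)) = (\<integral>\<^sup>+y. \<integral>\<^sup>+x. H (x, y) \<partial>gauss \<partial>gauss)"
    by (rule P.nn_integral_snd[symmetric]) (simp add: measurable_dm_pair)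
  also have "... = (\<integral>\<^sup>+y. ennreal (std_normal_density y) * (\<integral>\<^sup>+x. ennreal (std_normal_density x) * H (x, y) \<partial>lborel) \<partial>lborel)"
    by (subst nn_integral_density) (auto simp: nn_integral_density)
  also have "... = (\<integral>\<^sup>+y. \<integral>\<^sup>+x. ennreal (std_normal_density x * std_normal_density y) * H (x, y) \<partial>lborel \<partial>lborel)"
    by (intro nn_integral_cong, subst nn_integral_cmult[symmetric]) (auto simp: ennreal_mult mult_ac)
  finally show ?thesis .
qed

text \<open>The density is invariant because u^2 + v^2 is. The two-dimensional substitution is made
  as two affine ones in a single variable: u = c x - s y for fixed y, then v = (s u + y) / c for
  fixed u. Their factors 1 / c and c cancel; this is where c > 0 enters.\<close>

lemma gauss_rotation:
  fixes c s :: real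
  assumes cs: "c\<^sup>2 + s\<^sup>2 = 1" "c > 0"
  shows "distr (gauss \<Otimes>\<^sub>M gauss) (gauss \<Otimes>\<^sub>M gauss) (\<lambda>(x, y). (c * x - s * y, s * x + c * y)) = gauss \<Otimes>\<^sub>M gauss"
proof (rule measure_eqI)
  interpret G: prob_space gauss by (rule prob_gauss)
  let ?R = "\<lambda>(x, y). (c * x - s * y, s * x + c * y)"
  let ?n = std_normal_density
  fix A assume "A \<in> sets (distr (gauss \<Otimes>\<^sub>M gauss) (gauss \<Otimes>\<^sub>M gauss) ?R)"
  then have A0: "A \<in> sets (gauss \<Otimes>\<^sub>M gauss)" by simp
  then have [measurable]: "A \<in> sets (borel \<Otimes>\<^sub>M borel)" by (simp add: sets_dm_pair)
  have [measurable]: "?R \<in> measurable (gauss \<Otimes>\<^sub>M gauss) (gauss \<Otimes>\<^sub>M gauss)"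
    unfolding measurable_cong_sets[OF sets_dm_pair sets_dm_pair] by measurable
  have rot: "?n (c * u + s * v) * ?n (c * v - s * u) = ?n u * ?n v" for u v
  proof -
    have "(c * u + s * v)\<^sup>2 + (c * v - s * u)\<^sup>2 = (c\<^sup>2 + s\<^sup>2) * (u\<^sup>2 + v\<^sup>2)"
      by (simp add: power2_eq_square algebra_simps)
    then have *: "(c * u + s * v)\<^sup>2 / 2 + (c * v - s * u)\<^sup>2 / 2 = u\<^sup>2 / 2 + v\<^sup>2 / 2" using cs by simp
    have "exp (- (c * u + s * v)\<^sup>2 / 2) * exp (- (c * v - s * u)\<^sup>2 / 2) = exp (- u\<^sup>2 / 2) * exp (- v\<^sup>2 / 2)"
      unfolding exp_add[symmetric] using * by simp
    then show ?thesis unfolding std_normal_density_def by (simp add: mult_ac)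
  qed
  have "emeasure (distr (gauss \<Otimes>\<^sub>M gauss) (gauss \<Otimes>\<^sub>M gauss) ?R) A
      = (\<integral>\<^sup>+z. indicator A z \<partial>distr (gauss \<Otimes>\<^sub>M gauss) (gauss \<Otimes>\<^sub>M gauss) ?R)" using A0 by simp
  also have "... = (\<integral>\<^sup>+z. indicator A (?R z) \<partial>(gauss \<Otimes>\<^sub>M gauss))"
    by (rule nn_integral_distr) (use A0 in auto)
  also have "... = (\<integral>\<^sup>+y. \<integral>\<^sup>+x. ennreal (?n x * ?n y) * indicator A (?R (x, y)) \<partial>lborel \<partial>lborel)"
    by (rule nn_integral_gauss_pair) simp
  also have "... = (\<integral>\<^sup>+y. \<integral>\<^sup>+x. ennreal (?n x * ?n y) * indicator A (c * x - s * y, s * x + c * y) \<partial>lborel \<partial>lborel)"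
    by simp
  also have "... = (\<integral>\<^sup>+y. \<integral>\<^sup>+u. ennreal (1/c) * (ennreal (?n ((u + s * y) / c) * ?n y) * indicator A (u, (s * u + y) / c)) \<partial>lborel \<partial>lborel)"
  proof (rule nn_integral_cong)
    fix y :: real
    have 1: "c * (s * y / c + 1 / c * u) - s * y = u" for u using cs by (simp add: field_simps)
    have 2: "s * (s * y / c + 1 / c * u) + c * y = (s * u + y) / c" for u
    proof -
      have "s * (s * y / c + 1 / c * u) + c * y = (s * u + (c\<^sup>2 + s\<^sup>2) * y) / c"
        using cs(2) by (simp add: field_simps power2_eq_square)
      then show ?thesis unfolding cs(1) by simp
    qed
    have 3: "s * y / c + 1 / c * u = (u + s * y) / c" for u using cs by (simp add: field_simps)
    have "(\<integral>\<^sup>+x. ennreal (?n x * ?n y) * indicator A (c * x - s * y, s * x + c * y) \<partial>lborel)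
      = ennreal \<bar>1/c\<bar> * (\<integral>\<^sup>+u. ennreal (?n (s * y / c + 1 / c * u) * ?n y) * indicator A (c * (s * y / c + 1 / c * u) - s * y, s * (s * y / c + 1 / c * u) + c * y) \<partial>lborel)"
      by (rule nn_integral_real_affine) (use cs in auto)
    also have "... = (\<integral>\<^sup>+u. ennreal (1/c) * (ennreal (?n ((u + s * y) / c) * ?n y) * indicator A (u, (s * u + y) / c)) \<partial>lborel)"
      unfolding 1 2 unfolding 3 using cs by (subst nn_integral_cmult) auto
    finally show "(\<integral>\<^sup>+x. ennreal (?n x * ?n y) * indicator A (c * x - s * y, s * x + c * y) \<partial>lborel)
      = (\<integral>\<^sup>+u. ennreal (1/c) * (ennreal (?n ((u + s * y) / c) * ?n y) * indicator A (u, (s * u + y) / c)) \<partial>lborel)" .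
  qed
  also have "... = (\<integral>\<^sup>+u. \<integral>\<^sup>+y. ennreal (1/c) * (ennreal (?n ((u + s * y) / c) * ?n y) * indicator A (u, (s * u + y) / c)) \<partial>lborel \<partial>lborel)"
    by (rule lborel_pair.Fubini') measurable
  also have "... = (\<integral>\<^sup>+u. \<integral>\<^sup>+v. ennreal (?n u * ?n v) * indicator A (u, v) \<partial>lborel \<partial>lborel)"
  proof (rule nn_integral_cong)
    fix u :: real
    have 1: "(u + s * (- s * u + c * v)) / c = c * u + s * v" for v
    proof -
      have "u + s * (- s * u + c * v) = (c\<^sup>2 + s\<^sup>2) * u + s * (- s * u + c * v)" using cs by simp
      also have "... = c * (c * u + s * v)" by (simp add: algebra_simps power2_eq_square)
      finally show ?thesis using cs by simp
    qed
    have 2: "(s * u + (- s * u + c * v)) / c = v" for v using cs by simp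
    have 3: "- s * u + c * v = c * v - s * u" for v by simp
    have "(\<integral>\<^sup>+y. ennreal (1/c) * (ennreal (?n ((u + s * y) / c) * ?n y) * indicator A (u, (s * u + y) / c)) \<partial>lborel)
      = ennreal \<bar>c\<bar> * (\<integral>\<^sup>+v. ennreal (1/c) * (ennreal (?n ((u + s * (- s * u + c * v)) / c) * ?n (- s * u + c * v)) * indicator A (u, (s * u + (- s * u + c * v)) / c)) \<partial>lborel)"
      by (rule nn_integral_real_affine) (use cs in auto)
    also have "... = ennreal \<bar>c\<bar> * (\<integral>\<^sup>+v. ennreal (1/c) * (ennreal (?n u * ?n v) * indicator A (u, v)) \<partial>lborel)"
      unfolding 1 2 unfolding 3 rot ..
    also have "... = ennreal \<bar>c\<bar> * ennreal (1/c) * (\<integral>\<^sup>+v. ennreal (?n u * ?n v) * indicator A (u, v) \<partial>lborel)"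
      by (subst nn_integral_cmult) (auto simp: mult_ac)
    also have "ennreal \<bar>c\<bar> * ennreal (1/c) = 1" using cs by (simp add: ennreal_mult[symmetric])
    finally show "(\<integral>\<^sup>+y. ennreal (1/c) * (ennreal (?n ((u + s * y) / c) * ?n y) * indicator A (u, (s * u + y) / c)) \<partial>lborel)
      = (\<integral>\<^sup>+v. ennreal (?n u * ?n v) * indicator A (u, v) \<partial>lborel)" by simp
  qed
  also have "... = (\<integral>\<^sup>+v. \<integral>\<^sup>+u. ennreal (?n u * ?n v) * indicator A (u, v) \<partial>lborel \<partial>lborel)"
    by (rule lborel_pair.Fubini'[symmetric]) measurable
  also have "... = (\<integral>\<^sup>+z. indicator A z \<partial>(gauss \<Otimes>\<^sub>M gauss))"
    by (rule nn_integral_gauss_pair[symmetric]) simp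
  also have "... = emeasure (gauss \<Otimes>\<^sub>M gauss) A" using A0 by simp
  finally show "emeasure (distr (gauss \<Otimes>\<^sub>M gauss) (gauss \<Otimes>\<^sub>M gauss) ?R) A = emeasure (gauss \<Otimes>\<^sub>M gauss) A" .
qed simp

lemma integral_ln_gauss: "integrable gauss (\<lambda>x. ln (std_normal_density x))"
  "(\<integral>x. ln (std_normal_density x) \<partial>gauss) = - (1/2) * ln (2 * pi * exp 1)"
proof -
  show "integrable gauss (\<lambda>x. ln (std_normal_density x))"
    by (rule integrable_ln_gdens[OF gdens_gauss gdens_gauss])
  interpret G: prob_space gauss by (rule prob_gauss)
  have 1: "ln (std_normal_density x) = - ln (sqrt (2 * pi)) - x\<^sup>2 / 2" for x
    unfolding std_normal_density_def by (simp add: ln_mult ln_div)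
  have i: "integrable lborel (\<lambda>x. std_normal_density x * x\<^sup>2)"
    using integrable_std_normal_moment[of 2] by simp
  have "(\<integral>x. x\<^sup>2 \<partial>gauss) = (\<integral>x. std_normal_density x * x\<^sup>2 \<partial>lborel)"
    by (subst integral_density) auto
  also have "... = 1" using integral_std_normal_moment_even[of 1] by simp
  finally have 2: "(\<integral>x. x\<^sup>2 \<partial>gauss) = 1" .
  have "integrable gauss (\<lambda>x. x\<^sup>2)" using i by (subst integrable_density) auto
  then have "(\<integral>x. ln (std_normal_density x) \<partial>gauss) = - ln (sqrt (2 * pi)) - 1/2"
    unfolding 1 using 2 G.prob_space by simp
  also have "ln (sqrt (2 * pi)) = 1/2 * ln (2 * pi)" by (simp add: ln_sqrt)
  finally show "(\<integral>x. ln (std_normal_density x) \<partial>gauss) = - (1/2) * ln (2 * pi * exp 1)"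
    by (simp add: ln_mult field_simps)
qed

lemma weighted_ln_mean:
  fixes u v l :: real
  assumes "u > 0" "v > 0" "0 < l" "l < 1"
  shows "l * ln u + (1 - l) * ln v \<le> ln (l * u + (1 - l) * v)"
proof -
  have "concave_on {0<..} (ln :: real \<Rightarrow> real)" by (rule ln_concave)
  from concave_onD[OF this, of "1 - l" u v] assms show ?thesis by simp
qed

text \<open>Rioul's transport argument: with \<open>X = T X*\<close>, \<open>W = U Y*\<close> for independent standard
  normal \<open>X*\<close>, \<open>Y*\<close>, rotate \<open>(X*, Y*)\<close> and, for a fixed value of the second rotated coordinate,
  regard \<open>a X + W\<close> as an increasing function \<open>\<Theta>\<close> of the first one.\<close>

lemma entropy_power_linear:
  assumes f: "gdens f"
    and T: "\<And>x. (T has_real_derivative T' x) (at x)" "continuous_on UNIV T'" "\<And>x. T' x > 0"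
      "\<And>x. \<bar>T x\<bar> \<le> B"
    and intT: "integrable gauss (\<lambda>x. ln (T' x))" and a: "a > 0" and l: "0 < l" "l < 1"
  shows "l * (ln a - ln l / 2 + (\<integral>x. ln (T' x) \<partial>gauss)) + (1 - l) * (dent f - ln (1 - l) / 2)
         + l * (ln (2 * pi * exp 1) / 2) \<le> dent (smooth (\<lambda>x. a * T x) f)"
proof -
  let ?n = std_normal_density and ?P = "gauss \<Otimes>\<^sub>M gauss"
  define g where "g = smooth (\<lambda>x. a * T x) f"
  interpret G: prob_space gauss by (rule prob_gauss)
  interpret P: pair_prob_space gauss gauss ..
  obtain U U' where U: "\<And>x. (U has_real_derivative U' x) (at x)" "continuous_on UNIV U'" "\<And>x. U' x > 0"
    "\<And>x. f (U x) * U' x = ?n x" "surj U"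
    by (rule gdens_transport[OF f]) blast
  have cT: "continuous_on UNIV T" and cU: "continuous_on UNIV U"
    by (rule DERIV_all_continuous_on[OF T(1)], rule DERIV_all_continuous_on[OF U(1)])
  have [measurable]: "T \<in> borel_measurable borel" "T' \<in> borel_measurable borel"
    "U \<in> borel_measurable borel" "U' \<in> borel_measurable borel" "f \<in> borel_measurable borel"
    using cT cU T(2) U(2) gdens_measurable[OF f] by (auto intro: borel_measurable_continuous_onI)
  have g: "gdens g" unfolding g_def
  proof (rule gdens_smooth[OF f])
    show "\<bar>a * T x\<bar> \<le> a * B" for x using T(4)[of x] a by (simp add: abs_mult)
  qed simp
  have [measurable]: "g \<in> borel_measurable borel" by (rule gdens_measurable[OF g])
  \<comment> \<open>Rotation with c^2 = l and s^2 = 1 - l. Writing the output as c V + s V' with V =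
    a T X / c and V' = W / s, the claim is Lieb's form of the inequality: h(c V + s V') is at least
    l h(V) + (1 - l) h(V').\<close>
  define c s where "c = sqrt l" and "s = sqrt (1 - l)"
  have cs: "c\<^sup>2 = l" "s\<^sup>2 = 1 - l" "c > 0" "s > 0" using l by (auto simp: c_def s_def)
  define R where "R = (\<lambda>(x, y). (c * x - s * y, s * x + c * y))"
  have R: "distr ?P ?P R = ?P" unfolding R_def by (rule gauss_rotation) (use cs in auto)
  have [measurable]: "R \<in> measurable (borel \<Otimes>\<^sub>M borel) (borel \<Otimes>\<^sub>M borel)" unfolding R_def by measurable
  have Rm: "R \<in> measurable ?P ?P" unfolding measurable_cong_sets[OF sets_dm_pair sets_dm_pair] by simp
  have Rint: "integrable ?P (\<lambda>z. \<psi> (R z))" "(\<integral>z. \<psi> (R z) \<partial>?P) = (\<integral>z. \<psi> z \<partial>?P)" if "integrable ?P \<psi>" for \<psi> :: "real \<times> real \<Rightarrow> real"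
  proof -
    have m: "\<psi> \<in> borel_measurable ?P" using that by simp
    show "integrable ?P (\<lambda>z. \<psi> (R z))" using integrable_distr_eq[OF Rm m] that unfolding R by simp
    show "(\<integral>z. \<psi> (R z) \<partial>?P) = (\<integral>z. \<psi> z \<partial>?P)" using integral_distr[OF Rm m] unfolding R by simp
  qed
  have fstd: "distr ?P gauss fst = gauss" by (rule G.distr_pair_fst)
  have sndd: "distr ?P gauss snd = gauss"
  proof (rule measure_eqI)
    fix A assume "A \<in> sets (distr ?P gauss snd)"
    then have A: "A \<in> sets gauss" by simp
    then have "snd -` A \<inter> space ?P = space gauss \<times> A" by (auto simp: space_pair_measure)
    then show "emeasure (distr ?P gauss snd) A = emeasure gauss A"
      using A G.emeasure_space_1 by (simp add: emeasure_distr G.emeasure_pair_measure_Times)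
  qed simp
  have fsti: "integrable ?P (\<lambda>z. k (fst z))" "(\<integral>z. k (fst z) \<partial>?P) = (\<integral>x. k x \<partial>gauss)"
    if "integrable gauss k" for k :: "real \<Rightarrow> real"
  proof -
    have m: "k \<in> borel_measurable gauss" using that by simp
    show "integrable ?P (\<lambda>z. k (fst z))" using integrable_distr_eq[OF measurable_fst[of gauss gauss] m] that unfolding fstd by simp
    show "(\<integral>z. k (fst z) \<partial>?P) = (\<integral>x. k x \<partial>gauss)" using integral_distr[OF measurable_fst[of gauss gauss] m] unfolding fstd by simp
  qed
  have sndi: "integrable ?P (\<lambda>z. k (snd z))" "(\<integral>z. k (snd z) \<partial>?P) = (\<integral>x. k x \<partial>gauss)"
    if "integrable gauss k" for k :: "real \<Rightarrow> real"
  proof -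
    have m: "k \<in> borel_measurable gauss" using that by simp
    show "integrable ?P (\<lambda>z. k (snd z))" using integrable_distr_eq[OF measurable_snd[of gauss gauss] m] that unfolding sndd by simp
    show "(\<integral>z. k (snd z) \<partial>?P) = (\<integral>x. k x \<partial>gauss)" using integral_distr[OF measurable_snd[of gauss gauss] m] unfolding sndd by simp
  qed
  have Ud: "distr gauss borel U = dm f" by (rule transport_distr[OF f U])
  have TUd: "distr ?P borel (\<lambda>z. a * T (fst z) + U (snd z)) = dm g"
  proof -
    have "dm g = distr (gauss \<Otimes>\<^sub>M dm f) borel (\<lambda>(x, y). a * T x + y)"
      unfolding g_def by (rule dm_smooth[OF f, symmetric]) simp
    also have "gauss \<Otimes>\<^sub>M dm f = distr gauss borel (\<lambda>x. x) \<Otimes>\<^sub>M distr gauss borel U"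
      unfolding Ud by (simp add: distr_id2)
    also have "... = distr ?P (borel \<Otimes>\<^sub>M borel) (\<lambda>(x, y). (x, U y))"
      by (rule pair_measure_distr) (auto intro!: prob_space_imp_sigma_finite G.prob_space_distr)
    also have "distr ... borel (\<lambda>(x, y). a * T x + y) = distr ?P borel (\<lambda>z. a * T (fst z) + U (snd z))"
      by (subst distr_distr) (auto simp: measurable_dm_pair o_def case_prod_unfold)
    finally show ?thesis by simp
  qed
  have m1: "(\<lambda>z. a * T (fst z) + U (snd z)) \<in> measurable ?P borel" by (simp add: measurable_dm_pair)
  have i1: "integrable ?P (\<lambda>z. ln (g (a * T (fst z) + U (snd z))))"
    "(\<integral>z. ln (g (a * T (fst z) + U (snd z))) \<partial>?P) = - dent g"
    using integrable_distr_eq[OF m1, of "\<lambda>x. ln (g x)"] integral_distr[OF m1, of "\<lambda>x. ln (g x)"]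
      integrable_ln_gdens(1)[OF g g] unfolding TUd dent_def by auto
  have Uint: "integrable gauss (\<lambda>x. ln (f (U x)))" "(\<integral>x. ln (f (U x)) \<partial>gauss) = - dent f"
  proof -
    have m: "U \<in> measurable gauss borel" by simp
    show "integrable gauss (\<lambda>x. ln (f (U x)))" "(\<integral>x. ln (f (U x)) \<partial>gauss) = - dent f"
      using integrable_distr_eq[OF m, of "\<lambda>x. ln (f x)"] integral_distr[OF m, of "\<lambda>x. ln (f x)"]
      integrable_ln_gdens(1)[OF f f] unfolding Ud dent_def by auto
  qed
  have lnU': "ln (U' x) = ln (?n x) - ln (f (U x))" for x
  proof -
    have "ln (?n x) = ln (f (U x)) + ln (U' x)"
      unfolding U(4)[symmetric] by (rule ln_mult_pos) (use gdens_pos[OF f] U(3) in auto)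
    then show ?thesis by simp
  qed
  have i2: "integrable gauss (\<lambda>x. ln (U' x))" "(\<integral>x. ln (U' x) \<partial>gauss) = dent f - ln (2 * pi * exp 1) / 2"
    unfolding lnU' using Uint integral_ln_gauss by auto
  \<comment> \<open>Weighted logarithmic derivatives of a T / c and U / s; up to Gaussian constants
    their means are the two weighted entropies of the claim.\<close>
  define k1 where "k1 x = l * (ln (a * T' x) - ln c)" for x
  define k2 where "k2 x = (1 - l) * (ln (U' x) - ln s)" for x
  have k1: "k1 x = l * (ln a - ln c) + l * ln (T' x)" for x
    unfolding k1_def using a T(3)[of x] by (simp add: ln_mult algebra_simps)
  have j1: "integrable gauss k1" "(\<integral>x. k1 x \<partial>gauss) = l * (ln a - ln c) + l * (\<integral>x. ln (T' x) \<partial>gauss)"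
    unfolding k1 using intT G.prob_space by (auto simp: k1)
  have j2: "integrable gauss k2" "(\<integral>x. k2 x \<partial>gauss) = (1 - l) * (dent f - ln (2 * pi * exp 1) / 2 - ln s)"
    unfolding k2_def using i2 G.prob_space by (auto simp: k2_def[abs_def])
  \<comment> \<open>By rotation invariance the mean of \<psi> equals that of \<psi> at
    \<open>R z\<close>. There the output is \<Theta> of the two coordinates, and \<psi> can be
    compared pointwise with the logarithm of a likelihood ratio.\<close>
  define \<psi> where "\<psi> z = ln (g (a * T (fst z) + U (snd z))) + k1 (fst z) + k2 (snd z)" for z
  have psi: "integrable ?P \<psi>" "(\<integral>z. \<psi> z \<partial>?P) = - dent g + (\<integral>x. k1 x \<partial>gauss) + (\<integral>x. k2 x \<partial>gauss)"
    unfolding \<psi>_def using i1 fsti[OF j1(1)] sndi[OF j2(1)] by (auto simp: \<psi>_def[abs_def])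
  define \<Theta> where "\<Theta> y x = a * T (c * x - s * y) + U (s * x + c * y)" for x y
  define \<theta> where "\<theta> y x = a * c * T' (c * x - s * y) + s * U' (s * x + c * y)" for x y
  have \<theta>pos: "\<theta> y x > 0" for x y unfolding \<theta>_def using a cs T(3) U(3) by (simp add: add_pos_pos)
  have d\<Theta>: "(\<Theta> y has_real_derivative \<theta> y x) (at x)" for x y
  proof -
    have 1: "((\<lambda>x. T (c * x - s * y)) has_real_derivative T' (c * x - s * y) * c) (at x)"
      by (rule DERIV_chain2[OF T(1)]) (auto intro!: derivative_eq_intros)
    have 2: "((\<lambda>x. U (s * x + c * y)) has_real_derivative U' (s * x + c * y) * s) (at x)"
      by (rule DERIV_chain2[OF U(1)]) (auto intro!: derivative_eq_intros)
    show ?thesis unfolding \<Theta>_def \<theta>_def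
      using DERIV_add[OF DERIV_cmult[OF 1, of a] 2] by (simp add: mult_ac)
  qed
  have c\<theta>: "continuous_on UNIV (\<theta> y)" for y
  proof -
    have 1: "continuous_on UNIV (\<lambda>x. T' (c * x - s * y))"
      by (rule continuous_on_compose2[OF T(2)]) (auto intro!: continuous_intros)
    have 2: "continuous_on UNIV (\<lambda>x. U' (s * x + c * y))"
      by (rule continuous_on_compose2[OF U(2)]) (auto intro!: continuous_intros)
    show ?thesis unfolding \<theta>_def by (intro continuous_on_add continuous_on_mult continuous_on_const 1 2)
  qed
  \<comment> \<open>For fixed y the map \<open>\<Theta> y\<close> is strictly increasing, so g
    pulled back along it has at most the mass of g.\<close>
  have q1: "(\<integral>\<^sup>+x. ennreal (g (\<Theta> y x)) * ennreal (\<theta> y x) \<partial>lborel) \<le> 1" for y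
  proof -
    have "(\<integral>\<^sup>+x. ennreal (g (\<Theta> y x)) * ennreal (\<theta> y x) \<partial>lborel) = (\<integral>\<^sup>+w. ennreal (g w) * indicator (range (\<Theta> y)) w \<partial>lborel)"
      by (rule nn_substitution_UNIV[where k="\<lambda>w. ennreal (g w)", OF _ d\<Theta> c\<theta> \<theta>pos]) simp
    also have "... \<le> (\<integral>\<^sup>+w. ennreal (g w) \<partial>lborel)" by (intro nn_integral_mono) (auto simp: indicator_def)
    also have "... = 1" by (rule gdens_nn_integral[OF g])
    finally show ?thesis .
  qed
  \<comment> \<open>Ratio of the pulled-back output density to the normal density of the first
    coordinate. Its mean is at most 1, and ln q <= q - 1 takes the place of the nonnegativity of a
    conditional relative entropy.\<close>
  define q where "q z = g (\<Theta> (snd z) (fst z)) * \<theta> (snd z) (fst z) / ?n (fst z)" for z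
  have npos: "?n x > 0" for x by (rule gdens_pos[OF gdens_gauss])
  have qpos: "q z > 0" for z unfolding q_def using gdens_pos[OF g] \<theta>pos npos by simp
  have [measurable]: "q \<in> borel_measurable (borel \<Otimes>\<^sub>M borel)"
    unfolding q_def \<Theta>_def \<theta>_def by measurable
  have qm: "q \<in> borel_measurable ?P" by (simp add: measurable_dm_pair)
  have "(\<integral>\<^sup>+z. ennreal (q z) \<partial>?P) = (\<integral>\<^sup>+y. \<integral>\<^sup>+x. ennreal (q (x, y)) \<partial>gauss \<partial>gauss)"
    by (rule P.nn_integral_snd[symmetric]) (simp add: measurable_dm_pair)
  also have "... = (\<integral>\<^sup>+y. (\<integral>\<^sup>+x. ennreal (g (\<Theta> y x)) * ennreal (\<theta> y x) \<partial>lborel) \<partial>gauss)"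
  proof (rule nn_integral_cong)
    fix y
    have e: "ennreal (?n x) * ennreal (q (x, y)) = ennreal (g (\<Theta> y x)) * ennreal (\<theta> y x)" for x
      using npos[of x] gdens_nonneg[OF g, of "\<Theta> y x"] \<theta>pos[of y x] unfolding q_def
      by (simp add: ennreal_mult[symmetric] less_imp_le)
    have "(\<integral>\<^sup>+x. ennreal (q (x, y)) \<partial>gauss) = (\<integral>\<^sup>+x. ennreal (?n x) * ennreal (q (x, y)) \<partial>lborel)"
      by (rule nn_integral_dm[OF gdens_gauss]) simp
    then show "(\<integral>\<^sup>+x. ennreal (q (x, y)) \<partial>gauss) = (\<integral>\<^sup>+x. ennreal (g (\<Theta> y x)) * ennreal (\<theta> y x) \<partial>lborel)"
      unfolding e .
  qed
  also have "... \<le> (\<integral>\<^sup>+y. 1 \<partial>gauss)" by (rule nn_integral_mono) (rule q1)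
  also have "... = 1" using G.emeasure_space_1 by simp
  finally have qle: "(\<integral>\<^sup>+z. ennreal (q z) \<partial>?P) \<le> 1" .
  have qi: "integrable ?P q"
    by (rule integrableI_nonneg[OF qm AE_I2[OF less_imp_le[OF qpos]]]) (rule le_less_trans[OF qle], simp)
  have "ennreal (\<integral>z. q z \<partial>?P) \<le> 1"
    using nn_integral_eq_integral[OF qi] qle less_imp_le[OF qpos] by simp
  then have q2: "(\<integral>z. q z \<partial>?P) \<le> 1" by (simp add: ennreal_le_1)
  \<comment> \<open>Because l = c^2 and 1 - l = s^2, the average of a T' / c and U' / s with weights
    l and 1 - l is exactly \<theta>; concavity of ln then bounds k1 + k2 by ln \<theta>.\<close>
  have ptw: "\<psi> (R z) - ln (?n (fst z)) \<le> q z - 1" for z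
  proof -
    obtain x y where z: "z = (x, y)" by force
    let ?X = "c * x - s * y" and ?Y = "s * x + c * y"
    have "k1 ?X + k2 ?Y = l * ln (a * T' ?X / c) + (1 - l) * ln (U' ?Y / s)"
      unfolding k1_def k2_def using a cs T(3)[of ?X] U(3)[of ?Y] by (simp add: ln_div)
    also have "... \<le> ln (l * (a * T' ?X / c) + (1 - l) * (U' ?Y / s))"
      by (rule weighted_ln_mean) (use a cs T(3)[of ?X] U(3)[of ?Y] l in auto)
    also have "l * (a * T' ?X / c) + (1 - l) * (U' ?Y / s) = \<theta> y x"
      unfolding \<theta>_def cs(2)[symmetric] unfolding cs(1)[symmetric] using cs(3,4) by (simp add: power2_eq_square)
    finally have 1: "k1 ?X + k2 ?Y \<le> ln (\<theta> y x)" .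
    have "\<psi> (R z) - ln (?n (fst z)) \<le> ln (g (\<Theta> y x)) + ln (\<theta> y x) - ln (?n x)"
      unfolding \<psi>_def R_def z using 1 by (simp add: \<Theta>_def)
    also have "... = ln (q z)"
      unfolding q_def z using gdens_pos[OF g, of "\<Theta> y x"] \<theta>pos[of y x] npos[of x]
      by (simp add: ln_div ln_mult)
    also have "... \<le> q z - 1" by (rule ln_le_minus_one[OF qpos])
    finally show ?thesis .
  qed
  have iR: "integrable ?P (\<lambda>z. \<psi> (R z))" by (rule Rint(1)[OF psi(1)])
  have iN: "integrable ?P (\<lambda>z. ln (?n (fst z)))" by (rule fsti(1)[OF integral_ln_gauss(1)])
  have "(\<integral>z. \<psi> (R z) - ln (?n (fst z)) \<partial>?P) \<le> (\<integral>z. q z - 1 \<partial>?P)"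
    by (rule integral_mono[OF Bochner_Integration.integrable_diff[OF iR iN] _ ptw]) (use qi in simp)
  also have "... \<le> 0" using q2 qi P.prob_space by simp
  finally have "(\<integral>z. \<psi> z \<partial>?P) + (1/2) * ln (2 * pi * exp 1) \<le> 0"
    using iR iN Rint(2)[OF psi(1)] fsti(2)[OF integral_ln_gauss(1)] integral_ln_gauss(2) by simp
  then have "(\<integral>x. k1 x \<partial>gauss) + (\<integral>x. k2 x \<partial>gauss) + (1/2) * ln (2 * pi * exp 1) \<le> dent g"
    unfolding psi(2) by simp
  moreover have "ln c = ln l / 2" "ln s = ln (1 - l) / 2" using l by (auto simp: c_def s_def ln_sqrt)
  ultimately show ?thesis unfolding j1(2) j2(2) g_def by (simp add: field_simps)
qed

text \<open>Optimizes the weight in \<open>entropy_power_linear\<close>. With A = exp (2 h(a T X))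
  and E = exp (2 h(W)), the choice l = A / (A + E) makes both \<open>ln A - ln l\<close> and
  \<open>ln E - ln (1 - l)\<close> equal to ln (A + E), so the weighted mean collapses. For a = 0
  this l would be 0; there smoothing leaves f unchanged.\<close>

lemma entropy_power_inequality:
  assumes f: "gdens f"
    and T: "\<And>x. (T has_real_derivative T' x) (at x)" "continuous_on UNIV T'" "\<And>x. T' x > 0"
      "\<And>x. \<bar>T x\<bar> \<le> B"
    and intT: "integrable gauss (\<lambda>x. ln (T' x))" and a: "a \<ge> 0"
  shows "2 * pi * exp 1 * (exp (2 * (\<integral>x. ln (T' x) \<partial>gauss)) * a\<^sup>2) + exp (2 * dent f)
    \<le> exp (2 * dent (smooth (\<lambda>x. a * T x) f))"
proof (cases "a = 0")
  case True
  interpret G: prob_space gauss by (rule prob_gauss)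
  have "smooth (\<lambda>x. a * T x) f = f" unfolding smooth_def[abs_def] True using G.prob_space by simp
  then show ?thesis using True by simp
next
  case False
  then have a: "a > 0" using a by simp
  define L where "L = (\<integral>x. ln (T' x) \<partial>gauss)"
  define A where "A = 2 * pi * exp 1 * (exp (2 * L) * a\<^sup>2)"
  define E where "E = exp (2 * dent f)"
  define l where "l = A / (A + E)"
  have AE: "A > 0" "E > 0" using a by (auto simp: A_def E_def)
  have l: "0 < l" "l < 1" using AE by (auto simp: l_def)
  have l1: "1 - l = E / (A + E)" unfolding l_def using AE by (simp add: field_simps)
  have lnA: "ln A = ln (2 * pi * exp 1) + 2 * L + 2 * ln a"
    unfolding A_def using a by (simp add: ln_mult ln_realpow)
  have lnE: "ln E = 2 * dent f" by (simp add: E_def)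
  have "l * (ln a - ln l / 2 + L) + (1 - l) * (dent f - ln (1 - l) / 2)
         + l * (ln (2 * pi * exp 1) / 2) \<le> dent (smooth (\<lambda>x. a * T x) f)"
    unfolding L_def by (rule entropy_power_linear[OF f T intT a l])
  moreover have "l * (ln a - ln l / 2 + L) + (1 - l) * (dent f - ln (1 - l) / 2) + l * (ln (2 * pi * exp 1) / 2)
      = l * ((ln A - ln l) / 2) + (1 - l) * ((ln E - ln (1 - l)) / 2)"
    unfolding lnA lnE by (simp add: field_simps)
  moreover have "ln A - ln l = ln (A + E)" "ln E - ln (1 - l) = ln (A + E)"
    unfolding l1 unfolding l_def using AE by (auto simp: ln_div)
  ultimately have "ln (A + E) / 2 \<le> dent (smooth (\<lambda>x. a * T x) f)"
    by (simp add: algebra_simps) (simp add: field_simps)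
  then have "exp (ln (A + E)) \<le> exp (2 * dent (smooth (\<lambda>x. a * T x) f))" by simp
  then show ?thesis using AE unfolding A_def E_def L_def by simp
qed

section \<open>Maximum entropy inputs\<close>

text \<open>This is m / 2 < sinh (m / 2), multiplied by 2 exp (- m / 2) and squared. It expresses
  that the mean of the exponential law truncated to [0, 1] strictly decreases in its rate m.\<close>

lemma mean_map_pos: 
  fixes m :: real assumes "m > 0"
  shows "m\<^sup>2 * exp (- m) < (1 - exp (- m))\<^sup>2"
proof -
  let ?k = "\<lambda>t::real. exp t - exp (- t) - 2 * t"
  have "?k 0 < ?k (m / 2)"
  proof (rule DERIV_pos_imp_increasing_open[where f="?k"])
    fix t :: real assume t: "0 < t" "t < m / 2"
    have "0 < (exp (t/2) - exp (- (t/2)))\<^sup>2" using t by simp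
    also have "(exp (t/2) - exp (- (t/2)))\<^sup>2 = exp t + exp (- t) - 2"
      by (simp add: power2_eq_square algebra_simps exp_add[symmetric])
    finally have "0 < exp t + exp (- t) - 2" .
    moreover have "(?k has_real_derivative exp t + exp (- t) - 2) (at t)"
      by (auto intro!: derivative_eq_intros)
    ultimately show "\<exists>y. (?k has_real_derivative y) (at t) \<and> 0 < y" by blast
  qed (use assms in \<open>auto intro!: continuous_intros\<close>)
  then have "m < exp (m / 2) - exp (- (m / 2))" by simp
  then have "m * exp (- (m / 2)) < (exp (m / 2) - exp (- (m / 2))) * exp (- (m / 2))" by simp
  also have "... = 1 - exp (- m)" by (simp add: algebra_simps exp_add[symmetric])
  finally have "(m * exp (- (m / 2)))\<^sup>2 < (1 - exp (- m))\<^sup>2"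
    using assms by (intro power_strict_mono) auto
  moreover have "(m * exp (- (m / 2)))\<^sup>2 = m\<^sup>2 * exp (- m)"
    by (simp add: power_mult_distrib exp_double[symmetric])
  ultimately show ?thesis by simp
qed

text \<open>Gives meaning to the definite description in \<open>mu_star\<close>. The right-hand side
  is the mean of a truncated exponential law of rate \<mu>: its strict decrease yields uniqueness,
  its continuity existence.\<close>

lemma mu_star_ex1:
  fixes a :: real assumes a: "0 < a" "a < 1/2"
  shows "\<exists>!\<mu>. \<mu> > 0 \<and> a = 1 / \<mu> - exp (- \<mu>) / (1 - exp (- \<mu>))"
proof -
  let ?G = "\<lambda>\<mu>::real. 1 / \<mu> - exp (- \<mu>) / (1 - exp (- \<mu>))"
  have d: "(?G has_real_derivative - 1 / m\<^sup>2 + exp (- m) / (1 - exp (- m))\<^sup>2) (at m)" if "m > 0" for m :: real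
  proof -
    have "1 - exp (- m) > 0" using that by simp
    have "(?G has_real_derivative (0 * m - 1 * 1) / (m * m) -
        ((- exp (- m)) * (1 - exp (- m)) - exp (- m) * exp (- m)) / ((1 - exp (- m)) * (1 - exp (- m)))) (at m)"
      using that by (auto intro!: derivative_eq_intros)
    also have "(0 * m - 1 * 1) / (m * m) -
        ((- exp (- m)) * (1 - exp (- m)) - exp (- m) * exp (- m)) / ((1 - exp (- m)) * (1 - exp (- m)))
      = - 1 / m\<^sup>2 + exp (- m) / (1 - exp (- m))\<^sup>2"
      using that \<open>1 - exp (- m) > 0\<close> by (simp add: power2_eq_square algebra_simps)
    finally show ?thesis .
  qed
  have neg: "- 1 / m\<^sup>2 + exp (- m) / (1 - exp (- m))\<^sup>2 < 0" if "m > 0" for m :: real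
  proof -
    have "1 - exp (- m) > 0" using that by simp
    then show ?thesis using mean_map_pos[OF that] that by (simp add: divide_simps mult.commute)
  qed
  have dec: "?G y < ?G x" if "0 < x" "x < y" for x y
  proof (rule DERIV_neg_imp_decreasing[OF that(2)])
    fix m assume "x \<le> m" "m \<le> y"
    then have "m > 0" using that by simp
    then show "\<exists>d. (?G has_real_derivative d) (at m) \<and> d < 0" using d neg by blast
  qed
  \<comment> \<open>Bracket for the intermediate value theorem. At 1 / a the subtracted term is
    nonnegative, so the value is at most a. At m = 1 / a - 2 the bound exp m >= 1 + m + m^2 / 2
    gives a value of at least 1 / (m + 2) = a.\<close>
  let ?m1 = "1 / a - 2" and ?m2 = "1 / a"
  have m1: "?m1 > 0" using a by (simp add: field_simps)
  have alt: "exp (- m) / (1 - exp (- m)) = 1 / (exp m - 1)" if "m > 0" for m :: real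
    using that by (simp add: exp_minus field_simps)
  have "?G ?m1 \<ge> a"
  proof -
    let ?m = ?m1
    have "1 + ?m + ?m\<^sup>2 / 2 \<le> exp ?m" by (rule exp_lower_Taylor_quadratic) (use m1 in simp)
    then have "1 / (exp ?m - 1) \<le> 1 / (?m + ?m\<^sup>2 / 2)" using m1 
      by (intro divide_left_mono mult_pos_pos) (auto intro: add_pos_nonneg)
    moreover have "1 / ?m - 1 / (?m + ?m\<^sup>2 / 2) = a"
    proof -
      have "1 / x - 1 / (x + x\<^sup>2 / 2) = 1 / (x + 2)" if "x > 0" for x :: real
      proof -
        have e: "x + x\<^sup>2 / 2 = x * (x + 2) / 2" by (simp add: power2_eq_square field_simps)
        have "1 / x - 2 / (x * (x + 2)) = 1 / (x + 2)" using that
          by (simp add: divide_simps)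
        then show ?thesis unfolding e by simp
      qed
      from this[OF m1] show ?thesis using a by simp
    qed
    ultimately show ?thesis using alt[OF m1] by linarith
  qed
  moreover have "?G ?m2 \<le> a"
  proof -
    have "exp (- ?m2) / (1 - exp (- ?m2)) \<ge> 0" using a by simp
    then show ?thesis by simp
  qed
  moreover have "\<forall>x. ?m1 \<le> x \<and> x \<le> ?m2 \<longrightarrow> isCont ?G x"
    using m1 d by (meson DERIV_isCont less_le_trans)
  ultimately obtain m where "?m1 \<le> m" "?G m = a"
    using IVT2[of ?G ?m2 a ?m1] by auto
  then have ex: "m > 0 \<and> a = ?G m" using m1 by simp
  show ?thesis
  proof (rule ex1I[of _ m])
    fix m' assume "m' > 0 \<and> a = ?G m'"
    then show "m' = m" using dec[of m m'] dec[of m' m] ex by (metis less_irrefl linorder_neqE_linordered_idom)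
  qed (rule ex)
qed

lemma cdf_gauss_distr: "distr gauss borel (cdf gauss) = density lborel (indicator {0<..<1})"
proof (rule measure_eqI)
  let ?P = "cdf gauss"
  have c: "continuous_on UNIV ?P" by (rule DERIV_all_continuous_on[OF gdens_cdf_deriv[OF gdens_gauss]])
  then have [measurable]: "?P \<in> borel_measurable borel" by (rule borel_measurable_continuous_onI)
  have rg: "range ?P = {0<..<1}"
    using gdens_cdf(2,3,4)[OF gdens_gauss] by (auto simp: image_iff) metis
  have mI: "(indicator {0<..<1::real} :: real \<Rightarrow> ennreal) \<in> borel_measurable lborel"
    by (rule borel_measurable_indicator) simp
  fix A assume "A \<in> sets (distr gauss borel ?P)"
  then have [measurable]: "A \<in> sets borel" by simp
  have "emeasure (distr gauss borel ?P) A = (\<integral>\<^sup>+y. indicator A y \<partial>distr gauss borel ?P)" by simp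
  also have "... = (\<integral>\<^sup>+x. indicator A (?P x) \<partial>gauss)"
    by (rule nn_integral_distr) auto
  also have "... = (\<integral>\<^sup>+x. ennreal (std_normal_density x) * indicator A (?P x) \<partial>lborel)"
    by (rule nn_integral_dm[OF gdens_gauss]) simp
  also have "... = (\<integral>\<^sup>+x. indicator A (?P x) * ennreal (std_normal_density x) \<partial>lborel)"
    by (simp add: mult.commute)
  also have "... = (\<integral>\<^sup>+y. indicator A y * indicator (range ?P) y \<partial>lborel)"
    by (rule nn_substitution_UNIV[OF _ gdens_cdf_deriv[OF gdens_gauss] gdens_cont[OF gdens_gauss] gdens_pos[OF gdens_gauss]]) simp
  also have "... = emeasure (density lborel (indicator {0<..<1})) A"
    unfolding rg by (subst emeasure_density[OF mI]) (simp_all add: mult.commute)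
  finally show "emeasure (distr gauss borel ?P) A = emeasure (density lborel (indicator {0<..<1})) A" .
qed simp

lemma integral_cdf_gauss:
  assumes H: "\<And>p. 0 \<le> p \<Longrightarrow> p \<le> 1 \<Longrightarrow> (H has_real_derivative h p) (at p)"
    and h: "continuous_on {0..1} h" and [measurable]: "h \<in> borel_measurable borel"
  shows "integrable gauss (\<lambda>x. h (cdf gauss x))" "(\<integral>x. h (cdf gauss x) \<partial>gauss) = H 1 - H 0"
proof -
  let ?P = "cdf gauss"
  have c: "continuous_on UNIV ?P" by (rule DERIV_all_continuous_on[OF gdens_cdf_deriv[OF gdens_gauss]])
  then have m[measurable]: "?P \<in> measurable gauss borel" by (simp add: borel_measurable_continuous_onI)
  have si: "set_integrable lborel {0..1} h" by (rule borel_integrable_atLeastAtMost'[OF h])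
  have d: "density lborel (indicator {0<..<1}) = density lborel (\<lambda>x. ennreal (indicator {0<..<1} x :: real))"
    by (simp only: ennreal_indicator)
  have ae: "AE x in lborel. indicator {0<..<1} x *\<^sub>R h x = indicator {0..1} x *\<^sub>R h x"
    using AE_lborel_singleton[of 0] AE_lborel_singleton[of 1] by eventually_elim (auto simp: indicator_def)
  have i: "integrable lborel (\<lambda>x. indicator {0<..<1} x *\<^sub>R h x)"
    using si unfolding set_integrable_def by (subst integrable_cong_AE[OF _ _ ae]) auto
  have i2: "integrable (density lborel (indicator {0<..<1})) h"
    unfolding d using i by (subst integrable_density) auto
  show "integrable gauss (\<lambda>x. h (?P x))"
    using integrable_distr_eq[OF m, of h] i2 unfolding cdf_gauss_distr by simp
  have "(\<integral>x. h (?P x) \<partial>gauss) = (\<integral>x. h x \<partial>density lborel (indicator {0<..<1}))"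
    using integral_distr[OF m, of h] unfolding cdf_gauss_distr by simp
  also have "... = (\<integral>x. indicator {0<..<1} x *\<^sub>R h x \<partial>lborel)"
    unfolding d by (subst integral_density) auto
  also have "... = (\<integral>x. indicator {0..1} x *\<^sub>R h x \<partial>lborel)"
    by (rule integral_cong_AE[OF _ _ ae]) auto
  also have "... = integral {0..1} h"
    using set_borel_integral_eq_integral(2)[OF si] by (simp add: set_lebesgue_integral_def)
  also have "... = H 1 - H 0"
  proof (rule integral_unique, rule fundamental_theorem_of_calculus)
    fix p :: real assume "p \<in> {0..1}"
    then show "(H has_vector_derivative h p) (at p within {0..1})"
      using H[of p] by (auto simp: has_real_derivative_iff_has_vector_derivative intro: has_vector_derivative_at_within)
  qed simp
  finally show "(\<integral>x. h (?P x) \<partial>gauss) = H 1 - H 0" .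
qed

text \<open>T is the quantile function of the maximum entropy law on [0, 1] with mean at most t,
  applied to the normal cdf: uniform for t >= 1 / 2, and below that truncated exponential of rate
  \<open>mu_star t\<close>, with mean exactly t. The last clause identifies \<open>rho t\<close> as
  the entropy power of that law.\<close>

lemma rho_quantile:
  assumes t: "0 < t"
  obtains T T' where "\<And>x. (T has_real_derivative T' x) (at x)" "continuous_on UNIV T'" "\<And>x. T' x > 0"
    "\<And>x. 0 \<le> T x" "\<And>x. T x \<le> 1" "integrable gauss (\<lambda>x. ln (T' x))" "(\<integral>x. T x \<partial>gauss) \<le> t"
    "exp (2 * (\<integral>x. ln (T' x) \<partial>gauss)) = rho t"
proof (cases "t < 1/2")
  case False
  let ?P = "cdf gauss"
  have "(\<integral>x. ?P x \<partial>gauss) = 1\<^sup>2 / 2 - 0\<^sup>2 / 2"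
    by (rule integral_cdf_gauss(2)[where h="\<lambda>p. p" and H="\<lambda>p. p\<^sup>2/2"]) (auto intro!: derivative_eq_intros)
  then have m: "(\<integral>x. ?P x \<partial>gauss) \<le> t" using False by simp
  have e: "exp (2 * (\<integral>x. ln (std_normal_density x) \<partial>gauss)) = rho t"
    unfolding integral_ln_gauss rho_def using False by (simp add: exp_minus inverse_eq_divide)
  show ?thesis
    by (rule that[OF gdens_cdf_deriv[OF gdens_gauss] gdens_cont[OF gdens_gauss] gdens_pos[OF gdens_gauss]
        less_imp_le[OF gdens_cdf(2)[OF gdens_gauss]] less_imp_le[OF gdens_cdf(3)[OF gdens_gauss]] integral_ln_gauss(1) m e])
next
  case True
  let ?P = "cdf gauss" and ?n = std_normal_density
  interpret G: prob_space gauss by (rule prob_gauss)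
  define m where "m = mu_star t"
  have m: "m > 0" "t = 1 / m - exp (- m) / (1 - exp (- m))"
    using theI'[OF mu_star_ex1[OF t True]] unfolding m_def mu_star_def by auto
  define d where "d = 1 - exp (- m)"
  have d: "0 < d" "d < 1" using m by (auto simp: d_def)
  have lnd: "ln (1 - d) = - m" by (simp add: d_def)
  have pd: "1 - d \<le> 1 - p * d" "1 - p * d \<le> 1" "0 < 1 - p * d" if "0 \<le> p" "p \<le> 1" for p
  proof -
    have "p * d \<le> 1 * d" using that d by (intro mult_right_mono) auto
    then show "1 - d \<le> 1 - p * d" "0 < 1 - p * d" using d by linarith+
    show "1 - p * d \<le> 1" using that d by simp
  qed
  have P: "0 \<le> ?P x" "?P x \<le> 1" for x using gdens_cdf(2,3)[OF gdens_gauss] by (auto intro: less_imp_le)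
  \<comment> \<open>Inverse of the cdf (1 - exp (- m x)) / d of the exponential law of rate m
    truncated to [0, 1].\<close>
  define Q where "Q p = - (1 / m) * ln (1 - p * d)" for p
  define Q' where "Q' p = d / (m * (1 - p * d))" for p
  have dQ: "(Q has_real_derivative Q' p) (at p)" if "0 \<le> p" "p \<le> 1" for p
    unfolding Q_def Q'_def using pd(3)[OF that] m d
    by (auto intro!: derivative_eq_intros simp: field_simps)
  have Q'pos: "Q' p > 0" if "0 \<le> p" "p \<le> 1" for p unfolding Q'_def using pd(3)[OF that] m d by simp
  have cQ: "continuous_on {0..1} Q"
    by (meson dQ DERIV_continuous_on atLeastAtMost_iff has_field_derivative_at_within)
  have [measurable]: "Q \<in> borel_measurable borel" unfolding Q_def by measurable
  have Q01: "0 \<le> Q p" "Q p \<le> 1" if "0 \<le> p" "p \<le> 1" for p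
  proof -
    show "0 \<le> Q p" unfolding Q_def using pd[OF that] m by (simp add: mult_nonneg_nonpos divide_nonpos_pos)
    have "- m \<le> ln (1 - p * d)" unfolding lnd[symmetric] using pd[OF that] d by simp
    then show "Q p \<le> 1" unfolding Q_def using m by (simp add: field_simps)
  qed
  \<comment> \<open>Antiderivative of Q. Its increment over [0, 1] is the mean of the letter, which
    the equation defining m turns into t.\<close>
  define H where "H p = 1 / (m * d) * ((1 - p * d) * ln (1 - p * d) - (1 - p * d))" for p
  have dH: "(H has_real_derivative Q p) (at p)" if "0 \<le> p" "p \<le> 1" for p
  proof -
    have 1: "((\<lambda>p. 1 - p * d) has_real_derivative - d) (at p)" by (auto intro!: derivative_eq_intros)
    note 2 = DERIV_chain2[OF DERIV_ln_divide[OF pd(3)[OF that]] 1]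
    have "1 / (m * d) * ((- d) * ln w + (1 / w * - d) * w - (- d)) = - (1 / m) * ln w" if "w > 0" for w
      using m(1) d that by (simp add: field_simps)
    from this[OF pd(3)[OF that]] show ?thesis
      unfolding Q_def H_def using DERIV_cmult[OF DERIV_diff[OF DERIV_mult[OF 1 2] 1], of "1 / (m * d)"] by simp
  qed
  have H10: "H 1 - H 0 = t"
    unfolding H_def m(2) using lnd m(1) d unfolding d_def by (simp add: field_simps)
  note iQ = integral_cdf_gauss[OF dH cQ]
  define T where "T x = Q (?P x)" for x
  define T' where "T' x = Q' (?P x) * ?n x" for x
  have dT: "(T has_real_derivative T' x) (at x)" for x
    unfolding T_def T'_def
    by (rule DERIV_chain2[OF dQ[OF P] gdens_cdf_deriv[OF gdens_gauss]])
  have cP: "continuous_on UNIV ?P" by (rule DERIV_all_continuous_on[OF gdens_cdf_deriv[OF gdens_gauss]])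
  have cT': "continuous_on UNIV T'" unfolding T'_def Q'_def
    by (intro continuous_on_mult continuous_on_divide continuous_on_diff continuous_on_const cP gdens_cont[OF gdens_gauss])
       (use pd(3)[OF P] m in \<open>auto simp: less_imp_neq[symmetric] dest: less_imp_neq\<close>)
  have T'pos: "T' x > 0" for x unfolding T'_def using Q'pos[OF P] gdens_pos[OF gdens_gauss] by simp
  \<comment> \<open>Since Q' = (d / m) exp (m Q), the logarithm of T' is affine in the letter apart
    from the normal term, and its mean is determined by the mean t of the letter.\<close>
  have lnT': "ln (T' x) = ln (d / m) + m * Q (?P x) + ln (?n x)" for x
  proof -
    have "ln (T' x) = ln (Q' (?P x)) + ln (?n x)" unfolding T'_def
      by (rule ln_mult_pos[OF Q'pos[OF P] gdens_pos[OF gdens_gauss]])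
    also have "ln (Q' (?P x)) = ln (d / m / (1 - ?P x * d))" unfolding Q'_def by simp
    also have "... = ln (d / m) - ln (1 - ?P x * d)"
      by (rule ln_divide_pos) (use pd(3)[OF P[of x]] m d in auto)
    finally show ?thesis unfolding Q_def using m by simp
  qed
  have iT': "integrable gauss (\<lambda>x. ln (T' x))"
    unfolding lnT' using iQ(1) integral_ln_gauss(1) by auto
  have "(\<integral>x. ln (T' x) \<partial>gauss) = ln (d / m) + m * t - (1/2) * ln (2 * pi * exp 1)"
    unfolding lnT' using iQ integral_ln_gauss G.prob_space H10 by simp
  then have "exp (2 * (\<integral>x. ln (T' x) \<partial>gauss)) = exp (ln (d / m) + ln (d / m) + 2 * m * t - ln (2 * pi * exp 1))"
    by (simp add: algebra_simps)
  also have "... = (d / m)\<^sup>2 * exp (2 * m * t) / (2 * pi * exp 1)"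
    using m d by (simp only: exp_add exp_diff exp_ln[OF divide_pos_pos[OF d(1) m(1)]]) (simp add: power2_eq_square)
  also have "... = rho t"
    unfolding rho_def Let_def m_def[symmetric] d_def[symmetric] using True by (simp add: exp_diff mult_ac)
  finally have e: "exp (2 * (\<integral>x. ln (T' x) \<partial>gauss)) = rho t" .
  have mT: "(\<integral>x. T x \<partial>gauss) \<le> t" unfolding T_def using iQ H10 by simp
  show ?thesis
    by (rule that[OF dT cT' T'pos _ _ iT' mT e]) (auto simp: T_def Q01[OF P])
qed

section \<open>The duality bound\<close>

lemma gibbs_inequality:
  assumes f: "gdens f" and R: "\<And>x. R x > 0" and [measurable]: "R \<in> borel_measurable borel"
    and R1: "(\<integral>\<^sup>+x. ennreal (R x) \<partial>lborel) \<le> 1" and i: "integrable (dm f) (\<lambda>x. ln (R x))"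
  shows "dent f \<le> - (\<integral>x. ln (R x) \<partial>dm f)"
proof -
  note [measurable] = gdens_measurable[OF f]
  have Ri: "integrable lborel R"
    by (rule integrableI_nonneg[OF _ AE_I2[OF less_imp_le[OF R]]]) (simp, rule le_less_trans[OF R1], simp)
  have "ennreal (\<integral>x. R x \<partial>lborel) \<le> 1"
    using nn_integral_eq_integral[OF Ri] R1 less_imp_le[OF R] by simp
  then have R2: "(\<integral>x. R x \<partial>lborel) \<le> 1" by (simp add: ennreal_le_1)
  have il: "integrable (dm f) (\<lambda>x. ln (R x) - ln (f x))"
    by (rule Bochner_Integration.integrable_diff[OF i integrable_ln_gdens(1)[OF f f]])
  then have il2: "integrable lborel (\<lambda>x. f x * (ln (R x) - ln (f x)))"
    by (subst (asm) integrable_density) (auto simp: gdens_nonneg[OF f])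
  have "(\<integral>x. ln (R x) - ln (f x) \<partial>dm f) = (\<integral>x. f x * (ln (R x) - ln (f x)) \<partial>lborel)"
    by (subst integral_density) (auto simp: gdens_nonneg[OF f])
  also have "... \<le> (\<integral>x. R x - f x \<partial>lborel)"
  proof (rule integral_mono[OF il2 Bochner_Integration.integrable_diff[OF Ri gdens_integrable[OF f]]])
    fix x
    have "ln (R x) - ln (f x) = ln (R x / f x)" using R[of x] gdens_pos[OF f, of x] by (simp add: ln_div)
    also have "... \<le> R x / f x - 1" by (rule ln_le_minus_one) (use R gdens_pos[OF f] in simp)
    finally have "f x * (ln (R x) - ln (f x)) \<le> f x * (R x / f x - 1)"
      by (rule mult_left_mono[OF _ gdens_nonneg[OF f]])
    then show "f x * (ln (R x) - ln (f x)) \<le> R x - f x" using gdens_pos[OF f, of x] by (simp add: algebra_simps)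
  qed
  also have "... \<le> 0" using R2 Ri gdens_integrable[OF f] f by (simp add: gdens_def)
  finally show ?thesis using i integrable_ln_gdens(1)[OF f f] by (simp add: dent_def)
qed

lemma gdens_measure_tail:
  assumes f: "gdens f"
  shows "measure (dm f) {x..} = 1 - cdf (dm f) x" "measure (dm f) {..<x} = cdf (dm f) x"
    "a \<le> b \<Longrightarrow> measure (dm f) {a..b} = cdf (dm f) b - cdf (dm f) a"
    "measure (dm f) {x<..} = 1 - cdf (dm f) x"
proof -
  interpret prob_space "dm f" by (rule gdens_prob[OF f])
  note [measurable] = gdens_measurable[OF f]
  have s: "measure (dm f) {y} = 0" for y
    unfolding measure_def by (subst emeasure_density) (auto simp: nn_integral_0_iff_AE intro!: AE_I[where N="{y}"])
  have [simp]: "A \<in> events" if "A \<in> sets borel" for A using that by simp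
  have 1: "measure (dm f) {..<x} = cdf (dm f) x" for x
  proof -
    have "{..x} = {..<x} \<union> {x}" by auto
    then have "cdf (dm f) x = measure (dm f) ({..<x} \<union> {x})" unfolding cdf_def by simp
    also have "... = measure (dm f) {..<x} + measure (dm f) {x}" by (rule finite_measure_Union) auto
    finally show ?thesis using s by simp
  qed
  show "measure (dm f) {..<x} = cdf (dm f) x" by (rule 1)
  have "{x..} = space (dm f) - {..<x}" by auto
  then show "measure (dm f) {x..} = 1 - cdf (dm f) x" using prob_compl[of "{..<x}"] 1 by simp
  have "{x<..} = space (dm f) - {..x}" by auto
  then show "measure (dm f) {x<..} = 1 - cdf (dm f) x" using prob_compl[of "{..x}"] by (simp add: cdf_def)
  show "measure (dm f) {a..b} = cdf (dm f) b - cdf (dm f) a" if "a \<le> b"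
  proof -
    have "{..b} = {..<a} \<union> {a..b}" using that by auto
    then have "cdf (dm f) b = measure (dm f) ({..<a} \<union> {a..b})" unfolding cdf_def by simp
    also have "... = measure (dm f) {..<a} + measure (dm f) {a..b}" by (rule finite_measure_Union) auto
    finally show ?thesis using 1[of a] by simp
  qed
qed

lemma Qf_cdf:
  assumes s: "\<sigma> > 0"
  shows "Qf (x / \<sigma>) = 1 - cdf (dm (normal_density 0 \<sigma>)) x"
proof -
  have "Qf (x / \<sigma>) = (\<integral>t. indicator {x/\<sigma>..} t * std_normal_density t \<partial>lborel)"
    unfolding Qf_def set_lebesgue_integral_def by (intro Bochner_Integration.integral_cong) (auto simp: std_normal_density_def)
  also have "... = \<bar>1/\<sigma>\<bar> *\<^sub>R (\<integral>y. indicator {x/\<sigma>..} (0 + 1/\<sigma> * y) * std_normal_density (0 + 1/\<sigma> * y) \<partial>lborel)"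
    by (rule lborel_integral_real_affine) (use s in simp)
  also have "... = (\<integral>y. (1/\<sigma>) * (indicator {x/\<sigma>..} (0 + 1/\<sigma> * y) * std_normal_density (0 + 1/\<sigma> * y)) \<partial>lborel)"
    using s by simp
  also have "... = (\<integral>y. indicator {x..} y * normal_density 0 \<sigma> y \<partial>lborel)"
  proof (rule Bochner_Integration.integral_cong[OF refl])
    fix y
    have 1: "(indicator {x/\<sigma>..} (0 + 1/\<sigma> * y) :: real) = indicator {x..} y"
      using s by (auto simp: indicator_def divide_le_cancel)
    have 2: "normal_density 0 \<sigma> y = (1/\<sigma>) * std_normal_density (0 + 1/\<sigma> * y)"
      unfolding normal_density_def using s by (simp add: real_sqrt_mult power_divide mult_ac)
    show "(1/\<sigma>) * (indicator {x/\<sigma>..} (0 + 1/\<sigma> * y) * std_normal_density (0 + 1/\<sigma> * y)) = indicator {x..} y * normal_density 0 \<sigma> y"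
      unfolding 1 2 by simp
  qed
  also have "... = measure (dm (normal_density 0 \<sigma>)) {x..}"
    by (rule gdens_measure[symmetric, OF gdens_normal[OF s]]) simp
  also have "... = 1 - cdf (dm (normal_density 0 \<sigma>)) x" by (rule gdens_measure_tail[OF gdens_normal[OF s]])
  finally show ?thesis .
qed

lemma cdf_normal_minus:
  assumes s: "\<sigma> > 0"
  shows "cdf (dm (normal_density 0 \<sigma>)) (- x) = 1 - cdf (dm (normal_density 0 \<sigma>)) x"
proof -
  let ?n = "normal_density 0 \<sigma>"
  have g: "gdens ?n" by (rule gdens_normal[OF s])
  have "cdf (dm ?n) (- x) = (\<integral>y. indicator {..-x} y * ?n y \<partial>lborel)"
    unfolding cdf_def by (rule gdens_measure[OF g]) simp
  also have "... = \<bar>-1\<bar> *\<^sub>R (\<integral>y. indicator {..-x} (0 + -1 * y) * ?n (0 + -1 * y) \<partial>lborel)"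
    by (rule lborel_integral_real_affine) simp
  also have "... = (\<integral>y. indicator {x..} y * ?n y \<partial>lborel)"
    by (simp, intro Bochner_Integration.integral_cong refl) (auto simp: indicator_def normal_density_def)
  also have "... = measure (dm ?n) {x..}" by (rule gdens_measure[OF g, symmetric]) simp
  finally show ?thesis using gdens_measure_tail(1)[OF g] by simp
qed

lemma normal_density_mono:
  "0 < \<sigma> \<Longrightarrow> \<bar>x\<bar> \<le> \<bar>y\<bar> \<Longrightarrow> normal_density 0 \<sigma> y \<le> normal_density 0 \<sigma> x"
  unfolding normal_density_def
  by (intro mult_left_mono) (auto simp: divide_le_cancel abs_le_square_iff)

lemma normal_density_deriv:
  "\<sigma> > 0 \<Longrightarrow> (normal_density 0 \<sigma> has_real_derivative - (x / \<sigma>\<^sup>2) * normal_density 0 \<sigma> x) (at x)"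
proof -
  assume s: "\<sigma> > 0"
  have "((\<lambda>x. c * exp (- (x - 0)\<^sup>2 / (2 * \<sigma>\<^sup>2))) has_real_derivative - (x / \<sigma>\<^sup>2) * (c * exp (- (x - 0)\<^sup>2 / (2 * \<sigma>\<^sup>2)))) (at x)" for c
    using s by (auto intro!: derivative_eq_intros simp: power2_eq_square)
  then show ?thesis unfolding normal_density_def[abs_def] .
qed

lemma integral_dm_interval:
  assumes f: "gdens f" and k: "\<And>x. (K has_real_derivative k x * f x) (at x)" and ck: "continuous_on UNIV k" and ab: "a \<le> b"
  shows "(\<integral>x. indicator {a..b} x * k x \<partial>dm f) = K b - K a" "integrable (dm f) (\<lambda>x. indicator {a..b} x * k x)"
proof -
  note [measurable] = gdens_measurable[OF f] borel_measurable_continuous_onI[OF ck]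
  have c: "continuous_on {a..b} (\<lambda>x. k x * f x)"
    by (intro continuous_on_mult gdens_cont[OF f] continuous_on_subset[OF ck]) simp
  have si: "set_integrable lborel {a..b} (\<lambda>x. k x * f x)" by (rule borel_integrable_atLeastAtMost'[OF c])
  show "integrable (dm f) (\<lambda>x. indicator {a..b} x * k x)"
    using si unfolding set_integrable_def
    by (subst integrable_density) (auto simp: gdens_nonneg[OF f] mult_ac)
  have "(\<integral>x. indicator {a..b} x * k x \<partial>dm f) = (LINT x:{a..b}|lborel. k x * f x)"
    unfolding set_lebesgue_integral_def
    by (subst integral_density) (auto simp: gdens_nonneg[OF f] mult_ac)
  also have "... = integral {a..b} (\<lambda>x. k x * f x)" by (rule set_borel_integral_eq_integral(2)[OF si])
  also have "... = K b - K a"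
    by (rule integral_unique, rule fundamental_theorem_of_calculus[OF ab])
       (use k in \<open>auto simp: has_real_derivative_iff_has_vector_derivative intro: has_vector_derivative_at_within\<close>)
  finally show "(\<integral>x. indicator {a..b} x * k x \<partial>dm f) = K b - K a" .
qed

text \<open>\<open>R\<close> is the output density of Lapidoth, Moser and Wigger: Gaussian tails outside \<open>[-\<xi>, B + \<xi>]\<close>,
  exponential of rate \<open>\<mu> / B\<close> inside. Letting \<open>\<mu> = 0\<close> covers the uniform shape needed when the mean constraint is inactive.\<close>

lemma duality_bound:
  fixes \<sigma> B \<xi> \<mu> D \<tau> :: real
  defines "n \<equiv> normal_density 0 \<sigma>"
  defines "q \<equiv> \<lambda>x. Qf (x / \<sigma>)"
  defines "p \<equiv> \<lambda>s. 1 - q (\<xi> + s) - q (\<xi> + (B - s))"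
  defines "\<Lambda> \<equiv> ln (D / (\<sigma> * sqrt (2 * pi) * (1 - 2 * q \<xi>)))"
  assumes pos: "\<sigma> > 0" "B > 0" "\<xi> > 0" "\<mu> \<ge> 0" and \<tau>: "0 \<le> \<tau>" "\<tau> \<le> B / 2"
    and D: "(\<integral>\<^sup>+y. ennreal (exp (- \<mu> * y / B)) * indicator {- \<xi>..B + \<xi>} y \<partial>lborel) = ennreal D" "D \<ge> 2 * \<xi>"
  obtains R a c where "\<And>y. R y > 0" "R \<in> borel_measurable borel" "(\<integral>\<^sup>+y. ennreal (R y) \<partial>lborel) \<le> 1"
    "\<And>y. \<bar>ln (R y)\<bar> \<le> a * (1 + y\<^sup>2)" "c \<ge> 0" "\<tau> = B / 2 \<Longrightarrow> \<mu> = 0 \<Longrightarrow> c = 0"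
    "\<And>s. 0 \<le> s \<Longrightarrow> s \<le> B \<Longrightarrow> - (\<integral>w. ln (R (s + w)) \<partial>dm n)
       \<le> ln (2 * pi * \<sigma>\<^sup>2) / 2 + \<Lambda> * p \<tau> + q \<xi> + \<xi> * n \<xi> + \<mu> / B * (\<sigma>\<^sup>2 * (n \<xi> - n (B + \<xi>))) 
          + \<mu> / B * (p (B/2) * \<tau>) + c * (s - \<tau>)"
proof -
  have g: "gdens n" unfolding n_def by (rule gdens_normal[OF pos(1)])
  interpret N: prob_space "dm n" by (rule gdens_prob[OF g])
  note [measurable] = gdens_measurable[OF g]
  have npos: "n x > 0" for x by (rule gdens_pos[OF g])
  have nmono: "\<bar>x\<bar> \<le> \<bar>y\<bar> \<Longrightarrow> n y \<le> n x" for x y unfolding n_def by (rule normal_density_mono[OF pos(1)])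
  have qc: "q x = 1 - cdf (dm n) x" for x unfolding q_def n_def by (rule Qf_cdf[OF pos(1)])
  have cm: "cdf (dm n) (- x) = q x" for x unfolding qc n_def by (rule cdf_normal_minus[OF pos(1)])
  define K where "K = ln (2 * pi * \<sigma>\<^sup>2) / 2"
  have p_meas: "p s = measure (dm n) {- \<xi> - s..B + \<xi> - s}" for s
  proof -
    have "p s = cdf (dm n) (B + \<xi> - s) - cdf (dm n) (- (\<xi> + s))"
      unfolding p_def cm qc[of "\<xi> + (B - s)"] by (simp add: algebra_simps)
    then show ?thesis using gdens_measure_tail(3)[OF g, of "- \<xi> - s" "B + \<xi> - s"] pos by simp
  qed
  have p_nn: "p s \<ge> 0" "p s \<le> 1" for s unfolding p_meas by auto
  have q2: "1 - 2 * q \<xi> = cdf (dm n) \<xi> - cdf (dm n) (- \<xi>)" unfolding cm using qc[of \<xi>] by simp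
  have q2pos: "1 - 2 * q \<xi> > 0" unfolding q2 using strict_monoD[OF gdens_cdf(1)[OF g], of "- \<xi>" \<xi>] pos by simp
  \<comment> \<open>Mean value theorem together with the peak 1 / (\<sigma> sqrt (2 \<pi>)) of n.
    Combined with D >= 2 \<xi> it makes \<Lambda> nonnegative, so that \<Lambda> may multiply an
    upper bound on p.\<close>
  have q2le: "1 - 2 * q \<xi> \<le> 2 * \<xi> / (\<sigma> * sqrt (2 * pi))"
  proof -
    obtain z where "cdf (dm n) \<xi> - cdf (dm n) (- \<xi>) = (\<xi> - (- \<xi>)) * n z"
      using MVT2[of "- \<xi>" \<xi> "cdf (dm n)" n] gdens_cdf_deriv[OF g] pos by auto
    moreover have "n z \<le> n 0" by (rule nmono) simp
    moreover have "n 0 = 1 / (\<sigma> * sqrt (2 * pi))" unfolding n_def normal_density_def using pos by (simp add: real_sqrt_mult)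
    ultimately show ?thesis unfolding q2 using pos mult_left_mono[of "n z" "n 0" "2 * \<xi>"] by simp
  qed
  have Dpos: "D > 0" using D(2) pos by simp
  have den: "\<sigma> * sqrt (2 * pi) * (1 - 2 * q \<xi>) > 0" using q2pos pos by simp
  have \<Lambda>nn: "\<Lambda> \<ge> 0"
  proof -
    have "\<sigma> * sqrt (2 * pi) * (1 - 2 * q \<xi>) \<le> 2 * \<xi>" using q2le pos by (simp add: field_simps)
    then have "1 \<le> D / (\<sigma> * sqrt (2 * pi) * (1 - 2 * q \<xi>))" using D(2) den by (simp add: field_simps)
    then show ?thesis unfolding \<Lambda>_def by simp
  qed
  \<comment> \<open>Normalization that gives the middle part of R the mass 1 - 2 q \<xi> left over
    by the two Gaussian tails of mass q \<xi> each.\<close>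
  define D' where "D' = D / (1 - 2 * q \<xi>)"
  have D'pos: "D' > 0" unfolding D'_def using Dpos q2pos by simp
  have \<Lambda>D': "ln D' = \<Lambda> + K"
  proof -
    have "K = ln (\<sigma> * sqrt (2 * pi))" unfolding K_def using pos by (simp add: ln_mult ln_sqrt ln_realpow)
    moreover have "D' = D / (\<sigma> * sqrt (2 * pi) * (1 - 2 * q \<xi>)) * (\<sigma> * sqrt (2 * pi))"
      unfolding D'_def using pos by simp
    ultimately show ?thesis unfolding \<Lambda>_def using den Dpos pos
      by (simp only:) (subst ln_mult_pos, auto)
  qed
  define G where "G y = (if y < - \<xi> then K + y\<^sup>2 / (2 * \<sigma>\<^sup>2) else if y \<le> B + \<xi> then ln D' + \<mu> * y / B
    else K + (y - B)\<^sup>2 / (2 * \<sigma>\<^sup>2))" for y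
  define R where "R y = exp (- G y)" for y
  have [measurable]: "G \<in> borel_measurable borel" unfolding G_def by measurable
  have lnR: "ln (R y) = - G y" for y unfolding R_def by simp
  have expK: "exp (- (K + y\<^sup>2 / (2 * \<sigma>\<^sup>2))) = n y" for y
  proof -
    have "exp (- K) = 1 / sqrt (2 * pi * \<sigma>\<^sup>2)"
      unfolding K_def using pos by (simp add: exp_minus ln_sqrt[symmetric] inverse_eq_divide)
    then show ?thesis unfolding n_def normal_density_def by (simp add: exp_diff exp_minus field_simps)
  qed
  have Rm: "R \<in> borel_measurable borel" unfolding R_def by measurable
  have R1: "(\<integral>\<^sup>+y. ennreal (R y) \<partial>lborel) \<le> 1"
  proof -
    have e: "ennreal (R y) = ennreal (n y) * indicator {..<-\<xi>} y + ennreal (1 / D') * (ennreal (exp (- \<mu> * y / B)) * indicator {- \<xi>..B + \<xi>} y)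
        + ennreal (n (y - B)) * indicator {B + \<xi><..} y" for y
    proof -
      have "exp (- (ln D' + \<mu> * y / B)) = 1 / D' * exp (- \<mu> * y / B)"
        using D'pos by (simp add: exp_diff exp_minus exp_add field_simps)
      then show ?thesis unfolding R_def G_def using pos expK[of y] expK[of "y - B"] D'pos
        by (auto simp: indicator_def ennreal_mult[symmetric])
    qed
    have 1: "(\<integral>\<^sup>+y. ennreal (n y) * indicator {..<-\<xi>} y \<partial>lborel) = ennreal (q \<xi>)"
    proof -
      have "(\<integral>\<^sup>+y. ennreal (n y) * indicator {..<-\<xi>} y \<partial>lborel) = emeasure (dm n) {..<-\<xi>}"
        by (subst emeasure_density) auto
      then show ?thesis by (simp add: N.emeasure_eq_measure gdens_measure_tail(2)[OF g] cm)
    qed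
    have 3: "(\<integral>\<^sup>+y. ennreal (n (y - B)) * indicator {B + \<xi><..} y \<partial>lborel) = ennreal (q \<xi>)"
    proof -
      have "(\<integral>\<^sup>+y. ennreal (n (y - B)) * indicator {B + \<xi><..} y \<partial>lborel) = ennreal \<bar>1\<bar> * (\<integral>\<^sup>+y. ennreal (n ((B + 1 * y) - B)) * indicator {B + \<xi><..} (B + 1 * y) \<partial>lborel)"
        by (rule nn_integral_real_affine) auto
      also have "... = emeasure (dm n) {\<xi><..}"
        by (subst emeasure_density) (auto intro!: nn_integral_cong simp: indicator_def)
      finally show ?thesis by (simp add: N.emeasure_eq_measure gdens_measure_tail(4)[OF g] qc)
    qed
    have 2: "(\<integral>\<^sup>+y. ennreal (1 / D') * (ennreal (exp (- \<mu> * y / B)) * indicator {- \<xi>..B + \<xi>} y) \<partial>lborel) = ennreal (1 - 2 * q \<xi>)"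
      using D'pos q2pos Dpos by (subst nn_integral_cmult) (simp_all add: D(1)[simplified] ennreal_mult[symmetric] D'_def)
    have q0: "q \<xi> \<ge> 0" unfolding cm[symmetric] by (simp add: cdf_def)
    have "(\<integral>\<^sup>+y. ennreal (R y) \<partial>lborel) = ennreal (q \<xi>) + ennreal (1 - 2 * q \<xi>) + ennreal (q \<xi>)"
      unfolding e 1[symmetric] 2[symmetric]
      by (subst nn_integral_add, simp, simp, subst nn_integral_add, simp, simp, simp only: 1 3)
    also have "... = 1" using q0 q2pos by (simp flip: ennreal_plus)
    finally show ?thesis by simp
  qed
  define a where "a = \<bar>K\<bar> + \<bar>ln D'\<bar> + \<mu> / B + 1 / \<sigma>\<^sup>2 * (1 + B\<^sup>2)"
  have Gb: "\<bar>G y\<bar> \<le> a * (1 + y\<^sup>2)" for y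
  proof -
    have y1: "\<bar>y\<bar> \<le> 1 + y\<^sup>2"
    proof (cases "\<bar>y\<bar> \<le> 1")
      case False
      then have "\<bar>y\<bar> * 1 \<le> \<bar>y\<bar> * \<bar>y\<bar>" by (intro mult_left_mono) auto
      then show ?thesis by (simp add: power2_eq_square)
    qed (simp add: add_increasing2)
    have t1: "\<bar>\<mu> * y / B\<bar> \<le> \<mu> / B * (1 + y\<^sup>2)"
      using mult_left_mono[OF y1, of "\<mu> / B"] pos by (simp add: abs_mult)
    have t2: "y\<^sup>2 / (2 * \<sigma>\<^sup>2) \<le> 1 / \<sigma>\<^sup>2 * (1 + B\<^sup>2) * (1 + y\<^sup>2)" "(y - B)\<^sup>2 / (2 * \<sigma>\<^sup>2) \<le> 1 / \<sigma>\<^sup>2 * (1 + B\<^sup>2) * (1 + y\<^sup>2)"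
    proof -
      have "(y - B)\<^sup>2 \<le> 2 * y\<^sup>2 + 2 * B\<^sup>2" using zero_le_power2[of "y + B"] by (simp add: power2_eq_square algebra_simps)
      moreover have "0 \<le> y\<^sup>2 * B\<^sup>2" by simp
      moreover have e: "(1 + B\<^sup>2) * (1 + y\<^sup>2) = 1 + y\<^sup>2 + B\<^sup>2 + y\<^sup>2 * B\<^sup>2" by (simp add: algebra_simps)
      ultimately have h: "(y - B)\<^sup>2 / 2 \<le> (1 + B\<^sup>2) * (1 + y\<^sup>2)" "y\<^sup>2 / 2 \<le> (1 + B\<^sup>2) * (1 + y\<^sup>2)"
        unfolding e using zero_le_power2[of y] zero_le_power2[of B] by linarith+
      have "(y - B)\<^sup>2 / 2 / \<sigma>\<^sup>2 \<le> (1 + B\<^sup>2) * (1 + y\<^sup>2) / \<sigma>\<^sup>2" by (rule divide_right_mono[OF h(1)]) simp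
      moreover have "y\<^sup>2 / 2 / \<sigma>\<^sup>2 \<le> (1 + B\<^sup>2) * (1 + y\<^sup>2) / \<sigma>\<^sup>2" by (rule divide_right_mono[OF h(2)]) simp
      ultimately show "y\<^sup>2 / (2 * \<sigma>\<^sup>2) \<le> 1 / \<sigma>\<^sup>2 * (1 + B\<^sup>2) * (1 + y\<^sup>2)" "(y - B)\<^sup>2 / (2 * \<sigma>\<^sup>2) \<le> 1 / \<sigma>\<^sup>2 * (1 + B\<^sup>2) * (1 + y\<^sup>2)" by auto
    qed
    have nn: "0 \<le> \<bar>K\<bar> * y\<^sup>2" "0 \<le> \<bar>ln D'\<bar> * y\<^sup>2" "0 \<le> \<mu> / B * (1 + y\<^sup>2)" "0 \<le> 1 / \<sigma>\<^sup>2 * (1 + B\<^sup>2) * (1 + y\<^sup>2)"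
      "0 \<le> y\<^sup>2 / (2 * \<sigma>\<^sup>2)" "0 \<le> (y - B)\<^sup>2 / (2 * \<sigma>\<^sup>2)"
      using pos by auto
    have "a * (1 + y\<^sup>2) = \<bar>K\<bar> + \<bar>K\<bar> * y\<^sup>2 + \<bar>ln D'\<bar> + \<bar>ln D'\<bar> * y\<^sup>2 + \<mu> / B * (1 + y\<^sup>2) + 1 / \<sigma>\<^sup>2 * (1 + B\<^sup>2) * (1 + y\<^sup>2)"
      unfolding a_def by (simp add: algebra_simps)
    then have "\<bar>K + y\<^sup>2 / (2 * \<sigma>\<^sup>2)\<bar> \<le> a * (1 + y\<^sup>2)" "\<bar>ln D' + \<mu> * y / B\<bar> \<le> a * (1 + y\<^sup>2)"
      "\<bar>K + (y - B)\<^sup>2 / (2 * \<sigma>\<^sup>2)\<bar> \<le> a * (1 + y\<^sup>2)"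
      using t1 t2 nn by linarith+
    then show ?thesis unfolding G_def by presburger
  qed
  \<comment> \<open>\<open>p s\<close> is the probability that s + Z falls into
    [- \<xi>, B + \<xi>]. Its derivative decreases on [0, B] and vanishes at B / 2, so p lies below
    its tangent at \<tau> and below \<open>p (B/2)\<close>.\<close>
  define p' where "p' s = n (\<xi> + s) - n (\<xi> + (B - s))" for s
  have dp: "(p has_real_derivative p' s) (at s)" for s
  proof -
    have 1: "((\<lambda>s. cdf (dm n) (\<xi> + s)) has_real_derivative n (\<xi> + s) * 1) (at s)"
      by (rule DERIV_chain2[OF gdens_cdf_deriv[OF g]]) (auto intro!: derivative_eq_intros)
    have 2: "((\<lambda>s. cdf (dm n) (\<xi> + (B - s))) has_real_derivative n (\<xi> + (B - s)) * (-1)) (at s)"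
      by (rule DERIV_chain2[OF gdens_cdf_deriv[OF g]]) (auto intro!: derivative_eq_intros)
    have "p = (\<lambda>s. cdf (dm n) (\<xi> + s) + cdf (dm n) (\<xi> + (B - s)) - 1)" unfolding p_def qc by auto
    then show ?thesis unfolding p'_def using DERIV_diff[OF DERIV_add[OF 1 2] DERIV_const[of 1]] by simp
  qed
  have p'anti: "p' y \<le> p' x" if "0 \<le> x" "x \<le> y" "y \<le> B" for x y
  proof -
    have "n (\<xi> + y) \<le> n (\<xi> + x)" "n (\<xi> + (B - x)) \<le> n (\<xi> + (B - y))" using that pos by (auto intro!: nmono)
    then show ?thesis unfolding p'_def by linarith
  qed
  have tangent: "p s \<le> p x + p' x * (s - x)" if "0 \<le> s" "s \<le> B" "0 \<le> x" "x \<le> B" for s x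
  proof -
    consider "s = x" | "s < x" | "x < s" by linarith
    then show ?thesis
    proof cases
      case 2
      then obtain z where z: "s < z" "z < x" "p x - p s = (x - s) * p' z" using MVT2[OF 2, of p p'] dp by auto
      have "(x - s) * p' x \<le> (x - s) * p' z" using z that by (intro mult_left_mono p'anti) auto
      then show ?thesis using z by (simp add: algebra_simps)
    next
      case 3
      then obtain z where z: "x < z" "z < s" "p s - p x = (s - x) * p' z" using MVT2[OF 3, of p p'] dp by auto
      have "(s - x) * p' z \<le> (s - x) * p' x" using z that by (intro mult_left_mono p'anti) auto
      then show ?thesis using z by (simp add: algebra_simps)
    qed simp
  qed
  have p'0: "p' (B/2) = 0" unfolding p'_def by (simp add: field_simps)
  have p'nn: "p' \<tau> \<ge> 0" using p'anti[of \<tau> "B/2"] \<tau> pos p'0 by simp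
  have pmax: "p s \<le> p (B/2)" if "0 \<le> s" "s \<le> B" for s using tangent[OF that, of "B/2"] p'0 pos by simp
  \<comment> \<open>Slope of the bound in s: the tangent of p contributes \<Lambda> p' \<tau>, the
    exponential shape contributes \<mu> / B times \<open>p (B/2)\<close>. Both vanish for \<tau> = B
    / 2 and \<mu> = 0, which later frees the bound from the mean of the amplitude.\<close>
  define c where "c = \<Lambda> * p' \<tau> + \<mu> / B * p (B/2)"
  have cnn: "c \<ge> 0" unfolding c_def using \<Lambda>nn p'nn pos p_nn[of "B/2"] by simp
  define V where "V y = indicator {..<-\<xi>} y * (y\<^sup>2 / (2 * \<sigma>\<^sup>2))" for y
  define W where "W y = indicator {\<xi><..} y * (y\<^sup>2 / (2 * \<sigma>\<^sup>2))" for y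
  have [measurable]: "V \<in> borel_measurable borel" "W \<in> borel_measurable borel" unfolding V_def W_def by measurable
  have Vnn: "V y \<ge> 0" "W y \<ge> 0" for y unfolding V_def W_def by auto
  have VWb: "\<bar>V (x + y)\<bar> \<le> (1 + x\<^sup>2) / \<sigma>\<^sup>2 * (1 + y\<^sup>2)" "\<bar>W (x + y)\<bar> \<le> (1 + x\<^sup>2) / \<sigma>\<^sup>2 * (1 + y\<^sup>2)" for x y
  proof -
    have "(x + y)\<^sup>2 / 2 \<le> (1 + x\<^sup>2) * (1 + y\<^sup>2)"
    proof -
      have "(x + y)\<^sup>2 \<le> 2 * x\<^sup>2 + 2 * y\<^sup>2" using zero_le_power2[of "x - y"] by (simp add: power2_eq_square algebra_simps)
      moreover have "0 \<le> x\<^sup>2 * y\<^sup>2" by simp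
      moreover have "(1 + x\<^sup>2) * (1 + y\<^sup>2) = 1 + x\<^sup>2 + y\<^sup>2 + x\<^sup>2 * y\<^sup>2" by (simp add: algebra_simps)
      ultimately show ?thesis using zero_le_power2[of x] zero_le_power2[of y] by linarith
    qed
    then have "(x + y)\<^sup>2 / 2 / \<sigma>\<^sup>2 \<le> (1 + x\<^sup>2) * (1 + y\<^sup>2) / \<sigma>\<^sup>2" by (rule divide_right_mono) simp
    then show "\<bar>V (x + y)\<bar> \<le> (1 + x\<^sup>2) / \<sigma>\<^sup>2 * (1 + y\<^sup>2)" "\<bar>W (x + y)\<bar> \<le> (1 + x\<^sup>2) / \<sigma>\<^sup>2 * (1 + y\<^sup>2)"
      unfolding V_def W_def by (auto simp: indicator_def)
  qed
  have Vint: "integrable (dm n) (\<lambda>w. V (x + w))" "integrable (dm n) (\<lambda>w. W (x + w))" for x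
    by (rule gdens_integrable_sq(1)[OF g _ VWb(1)], simp, rule gdens_integrable_sq(1)[OF g _ VWb(2)], simp)
  \<comment> \<open>The left tail as seen from s = 0 and the right tail as seen from s = B add up to
    the normalized second moment outside [- \<xi>, \<xi>]; integration by parts gives its
    value.\<close>
  have tails0: "(\<integral>w. V w \<partial>dm n) + (\<integral>w. W w \<partial>dm n) = q \<xi> + \<xi> * n \<xi>"
  proof -
    let ?S = "\<lambda>w. w\<^sup>2 / (2 * \<sigma>\<^sup>2)"
    have dK: "((\<lambda>x. (cdf (dm n) x - x * n x) / 2) has_real_derivative ?S x * n x) (at x)" for x
    proof -
      have "((\<lambda>x. (cdf (dm n) x - x * n x) / 2) has_real_derivative (n x - (1 * n x + (- (x / \<sigma>\<^sup>2) * n x) * x)) / 2) (at x)"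
        using gdens_cdf_deriv[OF g] normal_density_deriv[OF pos(1)] unfolding n_def
        by (intro DERIV_cdivide DERIV_diff DERIV_mult DERIV_ident) auto
      then show ?thesis by (simp add: power2_eq_square field_simps)
    qed
    have c: "continuous_on UNIV ?S" using pos by (auto intro!: continuous_intros)
    have ab: "- \<xi> \<le> \<xi>" using pos by simp
    note m = integral_dm_interval[OF g dK c ab]
    have nm: "n (-\<xi>) = n \<xi>" unfolding n_def normal_density_def by simp
    have t: "(\<integral>w. ?S w \<partial>dm n) = 1/2"
    proof -
      have "(\<integral>w. w\<^sup>2 \<partial>dm n) = (\<integral>w. n w * w\<^sup>2 \<partial>lborel)"
        by (subst integral_density) (auto simp: less_imp_le[OF npos])
      also have "... = \<sigma>\<^sup>2" using integral_normal_moment_even[OF pos(1), of 0 1] unfolding n_def by (simp add: power2_eq_square)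
      finally show ?thesis using pos by simp
    qed
    have "(\<lambda>w. ?S w) = (\<lambda>w. V w + W w + indicator {-\<xi>..\<xi>} w * ?S w)"
      unfolding V_def W_def using pos by (auto simp: indicator_def fun_eq_iff)
    then have "(\<integral>w. ?S w \<partial>dm n) = (\<integral>w. V w + W w + indicator {-\<xi>..\<xi>} w * ?S w \<partial>dm n)" by simp
    also have "... = (\<integral>w. V w \<partial>dm n) + (\<integral>w. W w \<partial>dm n) + (\<integral>w. indicator {-\<xi>..\<xi>} w * ?S w \<partial>dm n)"
      using Vint[of 0] m(2) by simp
    finally have "(\<integral>w. V w \<partial>dm n) + (\<integral>w. W w \<partial>dm n) = 1/2 - ((cdf (dm n) \<xi> - cdf (dm n) (-\<xi>)) / 2 - \<xi> * n \<xi>)"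
      unfolding t m(1) nm by (simp add: field_simps)
    then show ?thesis unfolding q2[symmetric] by (simp add: field_simps)
  qed
  have shift: "(\<integral>w. k (x + w) \<partial>dm n) = (\<integral>y. k y * n (y - x) \<partial>lborel)"
    "integrable (dm n) (\<lambda>w. k (x + w)) \<longleftrightarrow> integrable lborel (\<lambda>y. k y * n (y - x))"
    if [measurable]: "k \<in> borel_measurable borel" for k :: "real \<Rightarrow> real" and x
  proof -
    have "(\<integral>y. k y * n (y - x) \<partial>lborel) = \<bar>1\<bar> *\<^sub>R (\<integral>w. k (x + 1 * w) * n (x + 1 * w - x) \<partial>lborel)"
      by (rule lborel_integral_real_affine) simp
    also have "... = (\<integral>w. k (x + w) \<partial>dm n)"
      by (subst integral_density) (auto simp: less_imp_le[OF npos] mult_ac)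
    finally show "(\<integral>w. k (x + w) \<partial>dm n) = (\<integral>y. k y * n (y - x) \<partial>lborel)" ..
    have "integrable lborel (\<lambda>y. k y * n (y - x)) \<longleftrightarrow> integrable lborel (\<lambda>w. k (x + 1 * w) * n (x + 1 * w - x))"
      by (rule lborel_integrable_real_affine_iff[symmetric]) simp
    also have "... \<longleftrightarrow> integrable (dm n) (\<lambda>w. k (x + w))"
      by (subst integrable_density) (auto simp: less_imp_le[OF npos] mult_ac)
    finally show "integrable (dm n) (\<lambda>w. k (x + w)) \<longleftrightarrow> integrable lborel (\<lambda>y. k y * n (y - x))" ..
  qed
  have main: "- (\<integral>w. ln (R (s + w)) \<partial>dm n) \<le> K + \<Lambda> * p \<tau> + q \<xi> + \<xi> * n \<xi> + \<mu> / B * (\<sigma>\<^sup>2 * (n \<xi> - n (B + \<xi>))) 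
          + \<mu> / B * (p (B/2) * \<tau>) + c * (s - \<tau>)" if s: "0 \<le> s" "s \<le> B" for s
  proof -
    let ?I = "{- \<xi> - s..B + \<xi> - s}"
    \<comment> \<open>A positive amplitude moves the law away from the left tail: for y < - \<xi>
      the density at y - s is at most that at y. The right tail is treated alike from the other end
      B, so each tail is replaced by its own extreme case.\<close>
    have Vs: "(\<integral>w. V (s + w) \<partial>dm n) \<le> (\<integral>w. V w \<partial>dm n)"
    proof -
      have "(\<integral>y. V y * n (y - s) \<partial>lborel) \<le> (\<integral>y. V y * n (y - 0) \<partial>lborel)"
      proof (rule integral_mono)
        show "V y * n (y - s) \<le> V y * n (y - 0)" for y
        proof (cases "y < - \<xi>")
          case True
          then have "n (y - s) \<le> n (y - 0)" using s pos by (intro nmono) auto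
          then show ?thesis by (rule mult_left_mono[OF _ Vnn(1)])
        qed (simp add: V_def)
      qed (use shift(2)[of V s] shift(2)[of V 0] Vint(1)[of s] Vint(1)[of 0] in auto)
      then show ?thesis using shift(1)[of V s] shift(1)[of V 0] by simp
    qed
    have Ws: "(\<integral>w. W ((s - B) + w) \<partial>dm n) \<le> (\<integral>w. W w \<partial>dm n)"
    proof -
      have "(\<integral>y. W y * n (y - (s - B)) \<partial>lborel) \<le> (\<integral>y. W y * n (y - 0) \<partial>lborel)"
      proof (rule integral_mono)
        show "W y * n (y - (s - B)) \<le> W y * n (y - 0)" for y
        proof (cases "y > \<xi>")
          case True
          then have "n (y - (s - B)) \<le> n (y - 0)" using s pos by (intro nmono) auto
          then show ?thesis by (rule mult_left_mono[OF _ Vnn(2)])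
        qed (simp add: W_def)
      qed (use shift(2)[of W "s - B"] shift(2)[of W 0] Vint(2)[of "s - B"] Vint(2)[of 0] in auto)
      then show ?thesis using shift(1)[of W "s - B"] shift(1)[of W 0] by simp
    qed
    have dL: "((\<lambda>x. - \<sigma>\<^sup>2 * n x) has_real_derivative x * n x) (at x)" for x
      unfolding n_def using DERIV_cmult[OF normal_density_deriv[OF pos(1)], of "- \<sigma>\<^sup>2" x] pos by (simp add: field_simps)
    have "- \<xi> - s \<le> B + \<xi> - s" using pos by simp
    note M1 = integral_dm_interval[OF g dL continuous_on_id this]
    have M0: "(\<integral>w. indicator ?I w \<partial>dm n) = p s" "integrable (dm n) (indicator ?I :: real \<Rightarrow> real)"
      unfolding p_meas by (auto simp: N.emeasure_eq_measure)
    have eq: "- ln (R (s + w)) = K + indicator ?I w * (ln D' - K + \<mu> / B * s) + \<mu> / B * (indicator ?I w * w) + V (s + w) + W ((s - B) + w)" for w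
    proof -
      consider "s + w < - \<xi>" | "- \<xi> \<le> s + w" "s + w \<le> B + \<xi>" | "B + \<xi> < s + w" by linarith
      then show ?thesis unfolding lnR G_def V_def W_def
        using pos by cases (auto simp: indicator_def field_simps)
    qed
    have lin: "(\<integral>w. K + indicator ?I w * x + y * (indicator ?I w * w) + V (s + w) + W ((s - B) + w) \<partial>dm n)
      = K + p s * x + y * (\<sigma>\<^sup>2 * (n (- \<xi> - s) - n (B + \<xi> - s))) + (\<integral>w. V (s + w) \<partial>dm n) + (\<integral>w. W ((s - B) + w) \<partial>dm n)" for x y
    proof -
      have "(\<integral>w. indicator ?I w * w \<partial>dm n) = \<sigma>\<^sup>2 * (n (- \<xi> - s) - n (B + \<xi> - s))"
        unfolding M1(1) by (simp add: algebra_simps)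
      then show ?thesis
        by (subst Bochner_Integration.integral_add Bochner_Integration.integral_mult_right Bochner_Integration.integral_mult_left;
            (intro Bochner_Integration.integrable_add integrable_mult_right integrable_mult_left Vint M0(2) M1(2) N.integrable_const)?)+
           (simp add: p_meas[of s] N.prob_space[simplified])
    qed
    have "- (\<integral>w. ln (R (s + w)) \<partial>dm n) = (\<integral>w. - ln (R (s + w)) \<partial>dm n)" by simp
    also have "... = K + p s * (ln D' - K + \<mu> / B * s) + \<mu> / B * (\<sigma>\<^sup>2 * (n (- \<xi> - s) - n (B + \<xi> - s)))
        + (\<integral>w. V (s + w) \<partial>dm n) + (\<integral>w. W ((s - B) + w) \<partial>dm n)"
      unfolding eq lin ..
    also have "... \<le> K + p s * (\<Lambda> + \<mu> / B * s) + \<mu> / B * (\<sigma>\<^sup>2 * (n \<xi> - n (B + \<xi>))) + (q \<xi> + \<xi> * n \<xi>)"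
    proof -
      have "n (- \<xi> - s) \<le> n \<xi>" "n (B + \<xi>) \<le> n (B + \<xi> - s)" using s pos by (auto intro!: nmono)
      then have "\<mu> / B * (\<sigma>\<^sup>2 * (n (- \<xi> - s) - n (B + \<xi> - s))) \<le> \<mu> / B * (\<sigma>\<^sup>2 * (n \<xi> - n (B + \<xi>)))"
        using pos by (intro mult_left_mono) auto
      then show ?thesis using Vs Ws tails0 unfolding \<Lambda>D' by simp
    qed
    \<comment> \<open>The \<Lambda> part uses the tangent at \<tau>. In the product p s * s only p
      is replaced, by its maximum; this is the origin of the argument \<xi> + A / 2 in the last term
      of \<open>c1_fun\<close>.\<close>
    also have "... \<le> K + (\<Lambda> * (p \<tau> + p' \<tau> * (s - \<tau>)) + \<mu> / B * (p (B/2) * s)) + \<mu> / B * (\<sigma>\<^sup>2 * (n \<xi> - n (B + \<xi>))) + (q \<xi> + \<xi> * n \<xi>)"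
    proof -
      have "\<Lambda> * p s \<le> \<Lambda> * (p \<tau> + p' \<tau> * (s - \<tau>))" using \<Lambda>nn tangent[OF s, of \<tau>] \<tau> pos by (intro mult_left_mono) auto
      moreover have "\<mu> / B * (p s * s) \<le> \<mu> / B * (p (B/2) * s)" using pmax[OF s] s pos by (intro mult_left_mono mult_right_mono) auto
      moreover have "p s * (\<Lambda> + \<mu> / B * s) = \<Lambda> * p s + \<mu> / B * (p s * s)" by (simp add: algebra_simps)
      ultimately show ?thesis by linarith
    qed
    also have "... = K + \<Lambda> * p \<tau> + q \<xi> + \<xi> * n \<xi> + \<mu> / B * (\<sigma>\<^sup>2 * (n \<xi> - n (B + \<xi>))) 
          + \<mu> / B * (p (B/2) * \<tau>) + c * (s - \<tau>)" unfolding c_def by (simp add: algebra_simps diff_divide_distrib)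
    finally show ?thesis .
  qed
  show ?thesis
  proof (rule that[of R a c])
    show "c = 0" if "\<tau> = B / 2" "\<mu> = 0"
    proof -
      have "p' \<tau> = 0" unfolding that(1) by (rule p'0)
      then show ?thesis unfolding c_def that(2) by simp
    qed
  qed (use Rm R1 Gb cnn main in \<open>auto simp: lnR K_def R_def[abs_def]\<close>)
qed


section \<open>Bounded interference plus Gaussian noise\<close>

text \<open>Intended meaning: \<open>f\<close> is the density of \<open>S + Z\<close>, where \<open>Z\<close> is the Gaussian noise and the independent
  amplitude \<open>S\<close> lies in \<open>[0, b]\<close> and has mean \<open>m\<close>. The dual formulation, through affine bounds on cross
  entropies, is what the duality bound consumes and is stable under smoothing.\<close>

definition amp_noise :: "real \<Rightarrow> real \<Rightarrow> real \<Rightarrow> (real \<Rightarrow> real) \<Rightarrow> bool" where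
  "amp_noise \<sigma> b m f \<longleftrightarrow> gdens f \<and> (\<forall>L a c0 c B. L \<in> borel_measurable borel \<and> (\<forall>y. \<bar>L y\<bar> \<le> a * (1 + y\<^sup>2)) \<and> 0 \<le> c \<and>
     (\<forall>s. 0 \<le> s \<and> s \<le> B \<longrightarrow> - (\<integral>w. L (s + w) \<partial>dm (normal_density 0 \<sigma>)) \<le> c0 + c * s) \<longrightarrow>
     (\<forall>s. 0 \<le> s \<and> s + b \<le> B \<longrightarrow> - (\<integral>w. L (s + w) \<partial>dm f) \<le> c0 + c * (s + m)))"

lemma amp_noise_gdens: "amp_noise \<sigma> b m f \<Longrightarrow> gdens f"
  unfolding amp_noise_def by blast

lemma amp_noiseD:
  assumes "amp_noise \<sigma> b m f" "L \<in> borel_measurable borel" "\<And>y. \<bar>L y\<bar> \<le> a * (1 + y\<^sup>2)" "0 \<le> c"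
    "\<And>s. 0 \<le> s \<Longrightarrow> s \<le> B \<Longrightarrow> - (\<integral>w. L (s + w) \<partial>dm (normal_density 0 \<sigma>)) \<le> c0 + c * s" "0 \<le> s" "s + b \<le> B"
  shows "- (\<integral>w. L (s + w) \<partial>dm f) \<le> c0 + c * (s + m)"
proof -
  have "L \<in> borel_measurable borel \<and> (\<forall>y. \<bar>L y\<bar> \<le> a * (1 + y\<^sup>2)) \<and> 0 \<le> c \<and>
     (\<forall>s. 0 \<le> s \<and> s \<le> B \<longrightarrow> - (\<integral>w. L (s + w) \<partial>dm (normal_density 0 \<sigma>)) \<le> c0 + c * s)"
    using assms by simp
  from assms(1)[unfolded amp_noise_def, THEN conjunct2, rule_format, OF this] assms(6,7)
  show ?thesis by simp
qed

lemma amp_noise_normal: "\<sigma> > 0 \<Longrightarrow> amp_noise \<sigma> 0 0 (normal_density 0 \<sigma>)"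
  unfolding amp_noise_def using gdens_normal by simp

lemma shift_growth:
  fixes a y s :: real
  assumes "\<And>y. \<bar>L y\<bar> \<le> a * (1 + y\<^sup>2)"
  shows "\<bar>L (s + y)\<bar> \<le> a * (2 + 2 * s\<^sup>2) * (1 + y\<^sup>2)"
proof -
  have a: "a \<ge> 0" using assms[of 0] by simp
  have "(s + y)\<^sup>2 \<le> 2 * s\<^sup>2 + 2 * y\<^sup>2" using zero_le_power2[of "s - y"] by (simp add: power2_eq_square algebra_simps)
  moreover have "0 \<le> s\<^sup>2 * y\<^sup>2" by simp
  moreover have "(2 + 2 * s\<^sup>2) * (1 + y\<^sup>2) = 2 + 2 * s\<^sup>2 + 2 * y\<^sup>2 + 2 * (s\<^sup>2 * y\<^sup>2)" by (simp add: algebra_simps)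
  ultimately have "1 + (s + y)\<^sup>2 \<le> (2 + 2 * s\<^sup>2) * (1 + y\<^sup>2)" by linarith
  then have "a * (1 + (s + y)\<^sup>2) \<le> a * ((2 + 2 * s\<^sup>2) * (1 + y\<^sup>2))" by (rule mult_left_mono[OF _ a])
  then show ?thesis using assms[of "s + y"] by (simp add: mult.assoc)
qed

text \<open>Condition on the seed: for fixed x the hypothesis applies at the amplitude s + r x, and
  averaging an affine bound only sees the mean of r. This is the reason for the quantification over
  all shifts s in \<open>amp_noise\<close>.\<close>

lemma amp_noise_smooth:
  assumes f: "amp_noise \<sigma> b m f" and [measurable]: "r \<in> borel_measurable borel" and r: "\<And>x. 0 \<le> r x" "\<And>x. r x \<le> b'"
  shows "amp_noise \<sigma> (b + b') (m + (\<integral>x. r x \<partial>gauss)) (smooth r f)"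
proof -
  have g: "gdens f" using f by (rule amp_noise_gdens)
  have gs: "gdens (smooth r f)" by (rule gdens_smooth[OF g assms(2)]) (use r in \<open>auto simp: abs_le_iff intro: order_trans[of _ 0] order_trans\<close>)
  interpret G: prob_space gauss by (rule prob_gauss)
  interpret P: pair_prob_space gauss "dm f"
    unfolding pair_prob_space_def pair_sigma_finite_def using prob_gauss gdens_prob[OF g]
    by (auto intro: prob_space_imp_sigma_finite)
  have "- (\<integral>w. L (s + w) \<partial>dm (smooth r f)) \<le> c0 + c * (s + (m + (\<integral>x. r x \<partial>gauss)))"
    if L: "L \<in> borel_measurable borel" "\<forall>y. \<bar>L y\<bar> \<le> a * (1 + y\<^sup>2)" "0 \<le> c"
      and H: "\<forall>s. 0 \<le> s \<and> s \<le> B \<longrightarrow> - (\<integral>w. L (s + w) \<partial>dm (normal_density 0 \<sigma>)) \<le> c0 + c * s"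
      and s: "0 \<le> s" "s + (b + b') \<le> B" for L a c0 c B s
  proof -
    note [measurable] = L(1)
    have m1: "(\<lambda>(x, y). r x + y) \<in> measurable (gauss \<Otimes>\<^sub>M dm f) borel"
      by (simp add: measurable_cong_sets[OF sets_pair_measure_cong[OF sets_density sets_density] refl])
    have m2: "(\<lambda>w. L (s + w)) \<in> borel_measurable borel" by simp
    have "integrable (dm (smooth r f)) (\<lambda>w. L (s + w))"
    proof (rule gdens_integrable_sq(1)[OF gs m2])
      show "\<bar>L (s + y)\<bar> \<le> a * (2 + 2 * s\<^sup>2) * (1 + y\<^sup>2)" for y
        by (rule shift_growth) (use L in blast)
    qed
    then have i: "integrable (gauss \<Otimes>\<^sub>M dm f) (\<lambda>z. L (s + (case z of (x, y) \<Rightarrow> r x + y)))"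
      unfolding dm_smooth[OF g assms(2), symmetric] using integrable_distr_eq[OF m1 m2] by simp
    have "(\<integral>w. L (s + w) \<partial>dm (smooth r f)) = (\<integral>z. L (s + (case z of (x, y) \<Rightarrow> r x + y)) \<partial>(gauss \<Otimes>\<^sub>M dm f))"
      unfolding dm_smooth[OF g assms(2), symmetric] by (rule integral_distr[OF m1 m2])
    also have "... = (\<integral>x. \<integral>y. L (s + (r x + y)) \<partial>dm f \<partial>gauss)"
      using P.integral_fst'[OF i] by simp
    finally have eq: "- (\<integral>w. L (s + w) \<partial>dm (smooth r f)) = (\<integral>x. - (\<integral>y. L (s + (r x + y)) \<partial>dm f) \<partial>gauss)" by simp
    have ir: "integrable gauss r" by (rule G.integrable_const_bound[where B=b']) (use r in auto)
    have "(\<integral>x. - (\<integral>y. L (s + (r x + y)) \<partial>dm f) \<partial>gauss) \<le> (\<integral>x. c0 + c * ((s + m) + r x) \<partial>gauss)"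
    proof (rule integral_mono)
      show "integrable gauss (\<lambda>x. - (\<integral>y. L (s + (r x + y)) \<partial>dm f))"
        using P.integrable_fst'[OF i] by simp
      show "integrable gauss (\<lambda>x. c0 + c * ((s + m) + r x))" using ir by simp
      fix x
      have "- (\<integral>y. L ((s + r x) + y) \<partial>dm f) \<le> c0 + c * ((s + r x) + m)"
        by (rule amp_noiseD[OF f L(1) L(2)[rule_format] L(3) H[rule_format]]) (use s r(1)[of x] r(2)[of x] in auto)
      then show "- (\<integral>y. L (s + (r x + y)) \<partial>dm f) \<le> c0 + c * ((s + m) + r x)" by (simp add: algebra_simps)
    qed
    also have "... = c0 + c * (s + (m + (\<integral>x. r x \<partial>gauss)))" using ir G.prob_space by (simp add: algebra_simps)
    finally show ?thesis unfolding eq .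
  qed
  then show ?thesis unfolding amp_noise_def using gs by blast
qed

lemma exp_minus_ge: "0 \<le> x \<Longrightarrow> 2 * x \<le> exp x - exp (- x)" for x :: real
proof -
  assume x: "0 \<le> x"
  let ?k = "\<lambda>t::real. exp t - exp (- t) - 2 * t"
  have "?k 0 \<le> ?k x"
  proof (rule DERIV_nonneg_imp_nondecreasing[where f="?k", OF x])
    fix t :: real
    have "0 \<le> (exp (t/2) - exp (- (t/2)))\<^sup>2" by simp
    also have "(exp (t/2) - exp (- (t/2)))\<^sup>2 = exp t + exp (- t) - 2"
      by (simp add: power2_eq_square algebra_simps exp_add[symmetric])
    finally have "0 \<le> exp t + exp (- t) - 2" .
    moreover have "(?k has_real_derivative exp t + exp (- t) - 2) (at t)"
      by (auto intro!: derivative_eq_intros)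
    ultimately show "\<exists>y. (?k has_real_derivative y) (at t) \<and> 0 \<le> y" by blast
  qed
  then show ?thesis by simp
qed

text \<open>The affine bound is evaluated at s = 0, with the peak B of the whole interference. The
  remainder c (m - \<tau>) is at most 0, either because m <= \<tau> or because c = 0 in the uniform
  case. Writing out the normal densities gives the expressions of \<open>c1_fun\<close> and
  \<open>c2_fun\<close>, in nats and without the Gaussian entropy.\<close>

lemma amp_noise_duality:
  fixes \<sigma> B \<xi> \<mu> D \<tau> m :: real
  assumes f: "amp_noise \<sigma> B m f" and pos: "\<sigma> > 0" "B > 0" "\<xi> > 0" "\<mu> \<ge> 0" and \<tau>: "0 \<le> \<tau>" "\<tau> \<le> B / 2"
    and D: "(\<integral>\<^sup>+y. ennreal (exp (- \<mu> * y / B)) * indicator {- \<xi>..B + \<xi>} y \<partial>lborel) = ennreal D" "D \<ge> 2 * \<xi>"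
    and m: "m \<le> \<tau> \<or> (\<tau> = B / 2 \<and> \<mu> = 0)"
  shows "dent f \<le> ln (2 * pi * exp 1 * \<sigma>\<^sup>2) / 2 + ((1 - Qf ((\<xi> + \<tau>) / \<sigma>) - Qf ((\<xi> + (B - \<tau>)) / \<sigma>))
       * ln (D / (\<sigma> * sqrt (2 * pi) * (1 - 2 * Qf (\<xi> / \<sigma>))))
     + (- 1/2 + Qf (\<xi> / \<sigma>) + \<xi> / (sqrt (2 * pi) * \<sigma>) * exp (- (\<xi>\<^sup>2) / (2 * \<sigma>\<^sup>2))
        + \<sigma> / B * \<mu> / sqrt (2 * pi) * (exp (- (\<xi>\<^sup>2) / (2 * \<sigma>\<^sup>2)) - exp (- ((B + \<xi>)\<^sup>2) / (2 * \<sigma>\<^sup>2)))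
        + \<mu> * (\<tau> / B) * (1 - 2 * Qf ((\<xi> + B / 2) / \<sigma>))))"
proof -
  let ?n = "normal_density 0 \<sigma>"
  have g: "gdens f" using f by (rule amp_noise_gdens)
  define X where "X = ln (2 * pi * \<sigma>\<^sup>2) / 2 + ln (D / (\<sigma> * sqrt (2 * pi) * (1 - 2 * Qf (\<xi> / \<sigma>)))) * (1 - Qf ((\<xi> + \<tau>) / \<sigma>) - Qf ((\<xi> + (B - \<tau>)) / \<sigma>))
     + Qf (\<xi> / \<sigma>) + \<xi> * ?n \<xi> + \<mu> / B * (\<sigma>\<^sup>2 * (?n \<xi> - ?n (B + \<xi>))) 
          + \<mu> / B * ((1 - Qf ((\<xi> + B/2) / \<sigma>) - Qf ((\<xi> + (B - B/2)) / \<sigma>)) * \<tau>)"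
  obtain R a c where R: "\<And>y. R y > 0" "R \<in> borel_measurable borel" "(\<integral>\<^sup>+y. ennreal (R y) \<partial>lborel) \<le> 1"
    "\<And>y. \<bar>ln (R y)\<bar> \<le> a * (1 + y\<^sup>2)" "c \<ge> 0" "\<tau> = B / 2 \<Longrightarrow> \<mu> = 0 \<Longrightarrow> c = 0"
    and b: "\<And>s. 0 \<le> s \<Longrightarrow> s \<le> B \<Longrightarrow> - (\<integral>w. ln (R (s + w)) \<partial>dm ?n) \<le> X + c * (s - \<tau>)"
    unfolding X_def by (rule duality_bound[OF pos \<tau> D]) blast
  note [measurable] = R(2)
  have b': "- (\<integral>w. ln (R (s + w)) \<partial>dm ?n) \<le> (X - c * \<tau>) + c * s" if "0 \<le> s" "s \<le> B" for s
    using b[OF that] by (simp add: algebra_simps)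
  have "- (\<integral>w. ln (R (0 + w)) \<partial>dm f) \<le> (X - c * \<tau>) + c * (0 + m)"
    by (rule amp_noiseD[where L="\<lambda>y. ln (R y)", OF f _ R(4) R(5) b']) auto
  then have "- (\<integral>w. ln (R w) \<partial>dm f) \<le> (X - c * \<tau>) + c * m" by simp
  also have "... \<le> X"
    using m R(5,6) mult_left_mono[of m \<tau> c] by auto
  finally have "- (\<integral>w. ln (R w) \<partial>dm f) \<le> X" .
  moreover have "dent f \<le> - (\<integral>w. ln (R w) \<partial>dm f)"
    by (rule gibbs_inequality[OF g R(1,2,3)])
       (rule gdens_integrable_sq(1)[OF g _ R(4)], simp)
  ultimately have "dent f \<le> X" by linarith
  moreover have n: "?n x = exp (- x\<^sup>2 / (2 * \<sigma>\<^sup>2)) / (sqrt (2 * pi) * \<sigma>)" for x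
    unfolding normal_density_def using pos by (simp add: real_sqrt_mult)
  moreover have "ln (2 * pi * exp 1 * \<sigma>\<^sup>2) / 2 = ln (2 * pi * \<sigma>\<^sup>2) / 2 + 1/2"
    using pos by (simp add: ln_mult add_divide_distrib)
  moreover have "\<mu> / B * (\<sigma>\<^sup>2 * (?n \<xi> - ?n (B + \<xi>))) = \<sigma> / B * \<mu> / sqrt (2 * pi) * (exp (- (\<xi>\<^sup>2) / (2 * \<sigma>\<^sup>2)) - exp (- ((B + \<xi>)\<^sup>2) / (2 * \<sigma>\<^sup>2)))"
    unfolding n using pos by (simp add: power2_eq_square diff_divide_distrib[symmetric])
  moreover have "\<mu> / B * ((1 - Qf ((\<xi> + B/2) / \<sigma>) - Qf ((\<xi> + (B - B/2)) / \<sigma>)) * \<tau>) = \<mu> * (\<tau> / B) * (1 - 2 * Qf ((\<xi> + B / 2) / \<sigma>))"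
    by simp
  ultimately show ?thesis unfolding X_def by (simp add: mult_ac add_divide_distrib)
qed

text \<open>Each choice of \<mu> and \<xi> gives an upper bound, hence so does the infimum. For t <
  1 / 2 the tangent point is \<tau> = t B; otherwise it is B / 2, where p is stationary, with \<mu>
  = 0. With B = 0 the comparison law is the noise itself, in accordance with the value 0 of
  \<open>Cbar\<close>.\<close>

lemma dent_le_Cbar:
  assumes f: "amp_noise \<sigma> B m f" and \<sigma>: "\<sigma> > 0" and B: "B \<ge> 0" and t: "B > 0 \<Longrightarrow> t > 0" and m: "m \<le> t * B"
  shows "dent f \<le> ln (2 * pi * exp 1 * \<sigma>\<^sup>2) / 2 + ln 2 * Cbar \<sigma> B t"
proof -
  have g: "gdens f" using f by (rule amp_noise_gdens)
  let ?C = "(dent f - ln (2 * pi * exp 1 * \<sigma>\<^sup>2) / 2) / ln 2"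
  have "?C \<le> Cbar \<sigma> B t"
  proof (cases "B = 0")
    case True
    let ?n = "normal_density 0 \<sigma>"
    have gn: "gdens ?n" by (rule gdens_normal[OF \<sigma>])
    interpret N: prob_space "dm ?n" by (rule gdens_prob[OF gn])
    note [measurable] = gdens_measurable[OF gn]
    obtain a where a: "\<forall>x. \<bar>ln (?n x)\<bar> \<le> a * (1 + x\<^sup>2)" using gdens_ln_bound[OF gn] by blast
    have ln: "ln (?n x) = - ln (2 * pi * \<sigma>\<^sup>2) / 2 - x\<^sup>2 / (2 * \<sigma>\<^sup>2)" for x
      unfolding normal_density_def using \<sigma> by (simp add: ln_mult ln_div ln_sqrt field_simps)
    have i: "integrable (dm ?n) (\<lambda>w. w\<^sup>2)"
      by (rule gdens_integrable_sq(1)[OF gn, where a=1]) auto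
    have "(\<integral>w. w\<^sup>2 \<partial>dm ?n) = (\<integral>w. ?n w * w\<^sup>2 \<partial>lborel)"
      by (subst integral_density) auto
    also have "... = \<sigma>\<^sup>2" using integral_normal_moment_even[OF \<sigma>, of 0 1] by (simp add: power2_eq_square)
    finally have v: "(\<integral>w. w\<^sup>2 \<partial>dm ?n) = \<sigma>\<^sup>2" .
    have e: "- (\<integral>w. ln (?n w) \<partial>dm ?n) = ln (2 * pi * exp 1 * \<sigma>\<^sup>2) / 2"
      unfolding ln using i v N.prob_space \<sigma> by (simp add: ln_mult field_simps)
    have e': "- (\<integral>w. ln (?n (s + w)) \<partial>dm ?n) \<le> ln (2 * pi * exp 1 * \<sigma>\<^sup>2) / 2 + 0 * s" if "0 \<le> s" "s \<le> B" for s
      using e True that by simp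
    have "- (\<integral>w. ln (?n (0 + w)) \<partial>dm f) \<le> ln (2 * pi * exp 1 * \<sigma>\<^sup>2) / 2 + 0 * (0 + m)"
      by (rule amp_noiseD[where L="\<lambda>y. ln (?n y)", OF f _ a[rule_format] order_refl e']) auto
    then have "- (\<integral>w. ln (?n w) \<partial>dm f) \<le> ln (2 * pi * exp 1 * \<sigma>\<^sup>2) / 2" by simp
    moreover have "dent f \<le> - (\<integral>w. ln (?n w) \<partial>dm f)"
      by (rule gibbs_inequality[OF g gdens_pos[OF gn] gdens_measurable[OF gn] _ integrable_ln_gdens(1)[OF g gn]])
         (simp add: gdens_nn_integral[OF gn])
    ultimately show ?thesis using True unfolding Cbar_def by (simp add: divide_le_0_iff)
  next
    case False
    then have B: "B > 0" using assms by simp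
    show ?thesis
    proof (cases "t < 1/2")
      case True
      have "?C \<le> c1_fun \<sigma> B t \<mu> \<xi>" if \<mu>\<xi>: "\<mu> > 0" "\<xi> > 0" for \<mu> \<xi>
      proof -
        define D where "D = B / \<mu> * (exp (\<mu> * \<xi> / B) - exp (- \<mu> * (1 + \<xi> / B)))"
        have D1: "(\<integral>\<^sup>+y. ennreal (exp (- \<mu> * y / B)) * indicator {- \<xi>..B + \<xi>} y \<partial>lborel) = ennreal D"
        proof -
          have "(\<integral>\<^sup>+y. ennreal (exp (- \<mu> * y / B)) * indicator {- \<xi>..B + \<xi>} y \<partial>lborel)
             = ennreal (- (B / \<mu>) * exp (- \<mu> * (B + \<xi>) / B) - (- (B / \<mu>) * exp (- \<mu> * (- \<xi>) / B)))"
            by (rule nn_integral_FTC_Icc) (use \<mu>\<xi> B in \<open>auto intro!: derivative_eq_intros\<close>)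
          also have "- (B / \<mu>) * exp (- \<mu> * (B + \<xi>) / B) - (- (B / \<mu>) * exp (- \<mu> * (- \<xi>) / B)) = D"
          proof -
            have "- \<mu> * (B + \<xi>) / B = - \<mu> * (1 + \<xi> / B)" using B by (simp add: field_simps)
            then show ?thesis unfolding D_def by (simp add: algebra_simps)
          qed
          finally show ?thesis .
        qed
        \<comment> \<open>x <= sinh x at x = \<mu> \<xi> / B, after which the subtracted exponential
          is replaced by a smaller one.\<close>
        have D2: "D \<ge> 2 * \<xi>"
        proof -
          let ?x = "\<mu> * \<xi> / B"
          have "2 * ?x \<le> exp ?x - exp (- ?x)" by (rule exp_minus_ge) (use \<mu>\<xi> B in simp)
          also have "... \<le> exp ?x - exp (- \<mu> * (1 + \<xi> / B))" using \<mu>\<xi> by (simp add: algebra_simps)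
          finally have "B / \<mu> * (2 * ?x) \<le> D" unfolding D_def using \<mu>\<xi> B by (intro mult_left_mono) auto
          then show ?thesis using \<mu>\<xi> B by simp
        qed
        have tB: "0 \<le> t * B" "t * B \<le> B / 2" using t B True by auto
        have e1: "D / (\<sigma> * sqrt (2 * pi) * (1 - 2 * Qf (\<xi> / \<sigma>))) = B / \<sigma> * (exp (\<mu> * \<xi> / B) - exp (- \<mu> * (1 + \<xi> / B)))
                 / (sqrt (2 * pi) * \<mu> * (1 - 2 * Qf (\<xi> / \<sigma>)))" unfolding D_def by (simp add: mult_ac)
        have e2: "t * B / B = t" "\<xi> + (B - t * B) = \<xi> + (1 - t) * B" using B by (auto simp: algebra_simps)
        have e3: "ln 2 * (p * (x / ln 2) + 1 / ln 2 * y) = p * x + y" for p x y :: real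
          by (simp add: field_simps)
        have "dent f \<le> ln (2 * pi * exp 1 * \<sigma>\<^sup>2) / 2 + ln 2 * c1_fun \<sigma> B t \<mu> \<xi>"
          using amp_noise_duality[OF f \<sigma> B \<mu>\<xi>(2) less_imp_le[OF \<mu>\<xi>(1)] tB D1 D2 disjI1[OF m]]
          unfolding e1 e2 c1_fun_def log_def ln_exp e3 .
        then show ?thesis by (simp add: divide_le_eq mult.commute)
      qed
      then have "?C \<le> Inf {c1_fun \<sigma> B t \<mu> \<xi> | \<mu> \<xi>. \<mu> > 0 \<and> \<xi> > 0}"
        by (intro cInf_greatest) (blast intro: zero_less_one, blast)
      then show ?thesis unfolding Cbar_def using B True by simp
    next
      case False
      have "?C \<le> c2_fun \<sigma> B \<xi>" if \<xi>: "\<xi> > 0" for \<xi>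
      proof -
        have D1: "(\<integral>\<^sup>+y. ennreal (exp (- 0 * y / B)) * indicator {- \<xi>..B + \<xi>} y \<partial>lborel) = ennreal (B + 2 * \<xi>)"
          using \<xi> B by (simp add: emeasure_lborel_Icc_eq)
        have e3: "ln 2 * (p * (x / ln 2) + 1 / ln 2 * y) = p * x + y" for p x y :: real
          by (simp add: field_simps)
        have "dent f \<le> ln (2 * pi * exp 1 * \<sigma>\<^sup>2) / 2 + ln 2 * c2_fun \<sigma> B \<xi>"
          using amp_noise_duality[OF f \<sigma> B \<xi> order_refl _ _ D1, of "B / 2"] B
          unfolding c2_fun_def log_def ln_exp e3 by simp
        then show ?thesis by (simp add: divide_le_eq mult.commute)
      qed
      then have "?C \<le> Inf {c2_fun \<sigma> B \<xi> | \<xi>. \<xi> > 0}"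
        by (intro cInf_greatest) (blast intro: zero_less_one, blast)
      then show ?thesis unfolding Cbar_def using B False by simp
    qed
  qed
  then show ?thesis by (simp add: divide_le_eq mult.commute)
qed

section \<open>Concentration for random codebooks\<close>

text \<open>Markov's inequality for the exponential of the sum; independence turns its mean into a
  product of factors at most 1. The functions vary with t because time sharing uses different
  letters at different instants.\<close>

lemma markov_sum:
  fixes l :: "nat \<Rightarrow> 'a \<Rightarrow> real"
  assumes L: "prob_space L" and [measurable]: "\<And>t. l t \<in> borel_measurable L"
    and e: "\<And>t. (\<integral>\<^sup>+x. ennreal (exp (l t x)) \<partial>L) \<le> 1"
  shows "measure (PiM {..<n} (\<lambda>_. L)) {w \<in> space (PiM {..<n} (\<lambda>_. L)). c \<le> (\<Sum>t<n. l t (w t))} \<le> exp (- c)"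
proof -
  interpret L: prob_space L by (rule L)
  interpret P: product_prob_space "\<lambda>_::nat. L" "{..<n}" ..
  let ?P = "PiM {..<n} (\<lambda>_. L)"
  let ?E = "{w \<in> space ?P. c \<le> (\<Sum>t<n. l t (w t))}"
  have E[measurable]: "?E \<in> sets ?P" by measurable
  have "emeasure ?P ?E = (\<integral>\<^sup>+w. indicator ?E w \<partial>?P)" by simp
  also have "... \<le> (\<integral>\<^sup>+w. ennreal (exp (- c)) * (\<Prod>t<n. ennreal (exp (l t (w t)))) \<partial>?P)"
  proof (rule nn_integral_mono)
    fix w assume "w \<in> space ?P"
    have "ennreal (exp (- c)) * (\<Prod>t<n. ennreal (exp (l t (w t)))) = ennreal (exp ((\<Sum>t<n. l t (w t)) - c))"
      by (simp add: prod_ennreal exp_sum[symmetric] ennreal_mult[symmetric] exp_add[symmetric])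
    moreover have "1 \<le> ennreal (exp ((\<Sum>t<n. l t (w t)) - c))" if "c \<le> (\<Sum>t<n. l t (w t))"
      using that by (simp add: ennreal_1[symmetric] del: ennreal_1)
    ultimately show "indicator ?E w \<le> ennreal (exp (- c)) * (\<Prod>t<n. ennreal (exp (l t (w t))))"
      by (auto simp: indicator_def)
  qed
  also have "... = ennreal (exp (- c)) * (\<integral>\<^sup>+w. (\<Prod>t<n. ennreal (exp (l t (w t)))) \<partial>?P)"
    by (rule nn_integral_cmult) measurable
  also have "(\<integral>\<^sup>+w. (\<Prod>t<n. ennreal (exp (l t (w t)))) \<partial>?P) = (\<Prod>t<n. (\<integral>\<^sup>+x. ennreal (exp (l t x)) \<partial>L))"
    by (rule P.product_nn_integral_prod) simp_all
  also have "(\<Prod>t<n. (\<integral>\<^sup>+x. ennreal (exp (l t x)) \<partial>L)) \<le> 1"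
  proof (induction n)
    case (Suc n)
    show ?case using mult_mono[OF Suc e[of n]] by simp
  qed simp
  finally have "emeasure ?P ?E \<le> ennreal (exp (- c))" by (simp add: mult_left_mono)
  then show ?thesis by (simp add: P.emeasure_eq_measure)
qed

text \<open>A weak law for independent summands that are not identically distributed: the cross
  terms of the variance vanish, and a uniform second moment bound gives decay like 1 / n. It serves
  the test statistics at the true messages as well as the sums of codeword letters.\<close>

lemma chebyshev_sum:
  fixes l :: "nat \<Rightarrow> 'a \<Rightarrow> real" and C c d :: real
  assumes L: "prob_space L" and l: "\<And>t. integrable L (l t)" "\<And>t. integrable L (\<lambda>x. (l t x)\<^sup>2)"
    and C: "\<And>t. (\<integral>x. (l t x)\<^sup>2 \<partial>L) \<le> C" and n: "n > 0" and d: "d > 0"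
    and c: "c \<le> (\<Sum>t<n. (\<integral>x. l t x \<partial>L)) - real n * d"
  shows "measure (PiM {..<n} (\<lambda>_. L)) {w \<in> space (PiM {..<n} (\<lambda>_. L)). (\<Sum>t<n. l t (w t)) < c} \<le> C / (real n * d\<^sup>2)"
proof -
  interpret L: prob_space L by (rule L)
  interpret P: product_prob_space "\<lambda>_::nat. L" "{..<n}" ..
  let ?P = "PiM {..<n} (\<lambda>_. L)"
  define D where "D t x = l t x - (\<integral>x. l t x \<partial>L)" for t x
  have [measurable]: "\<And>t. l t \<in> borel_measurable L" using l(1) by auto
  have [measurable]: "\<And>t. D t \<in> borel_measurable L" unfolding D_def by measurable
  have Di: "integrable L (D t)" for t unfolding D_def using l by simp
  have D0: "(\<integral>x. D t x \<partial>L) = 0" for t unfolding D_def using l L.prob_space by simp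
  have Dsq: "(\<lambda>x. (D t x)\<^sup>2) = (\<lambda>x. (l t x)\<^sup>2 - 2 * (\<integral>x. l t x \<partial>L) * l t x + (\<integral>x. l t x \<partial>L)\<^sup>2)" for t
    unfolding D_def by (auto simp: power2_eq_square algebra_simps)
  have D2i: "integrable L (\<lambda>x. (D t x)\<^sup>2)" for t unfolding Dsq using l by simp
  have D2: "(\<integral>x. (D t x)\<^sup>2 \<partial>L) \<le> C" for t
  proof -
    have "(\<integral>x. (D t x)\<^sup>2 \<partial>L) = (\<integral>x. (l t x)\<^sup>2 \<partial>L) - (\<integral>x. l t x \<partial>L)\<^sup>2"
      unfolding Dsq using l L.prob_space by (simp add: power2_eq_square)
    then show ?thesis using C[of t] zero_le_power2[of "\<integral>x. l t x \<partial>L"] by linarith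
  qed
  have pair: "integrable ?P (\<lambda>w. D s (w s) * D t (w t)) \<and>
      (\<integral>w. D s (w s) * D t (w t) \<partial>?P) = (if s = t then (\<integral>x. (D t x)\<^sup>2 \<partial>L) else 0)" if st: "s < n" "t < n" for s t
  proof (cases "s = t")
    case True
    \<comment> \<open>The square is written as a product over all coordinates, with factor 1 away
      from t, so that the product formula for integrals applies. The mixed case below has two
      nontrivial factors, both of mean 0.\<close>
    let ?f = "\<lambda>i x. if i = t then (D t x)\<^sup>2 else 1"
    have i: "integrable L (?f i)" for i using D2i by (cases "i = t") auto
    have e: "(\<Prod>i<n. ?f i (w i)) = D s (w s) * D t (w t)" for w
      using st True by (simp add: prod.delta power2_eq_square)
    have "integrable ?P (\<lambda>w. \<Prod>i<n. ?f i (w i))"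
      by (rule P.product_integrable_prod) (use i in auto)
    moreover have "(\<integral>w. (\<Prod>i<n. ?f i (w i)) \<partial>?P) = (\<Prod>i<n. (\<integral>x. ?f i x \<partial>L))"
      by (rule P.product_integral_prod) (use i in auto)
    moreover have "(\<Prod>i<n. (\<integral>x. ?f i x \<partial>L)) = (\<Prod>i<n. if i = t then (\<integral>x. (D t x)\<^sup>2 \<partial>L) else 1)"
      using L.prob_space by (intro prod.cong) auto
    ultimately show ?thesis unfolding e using st True by (simp add: prod.delta)
  next
    case False
    let ?f = "\<lambda>i x. if i = s then D s x else if i = t then D t x else 1"
    have i: "integrable L (?f i)" for i using Di by (cases "i = t"; cases "i = s") auto
    have e: "(\<Prod>i<n. ?f i (w i)) = D s (w s) * D t (w t)" for w
    proof -
      have "(\<Prod>i<n. ?f i (w i)) = (\<Prod>i<n. (if i = s then D s (w s) else 1) * (if i = t then D t (w t) else 1))"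
        using False by (intro prod.cong) auto
      then show ?thesis using st by (simp add: prod.distrib prod.delta)
    qed
    have "integrable ?P (\<lambda>w. \<Prod>i<n. ?f i (w i))"
      by (rule P.product_integrable_prod) (use i in auto)
    moreover have "(\<integral>w. (\<Prod>i<n. ?f i (w i)) \<partial>?P) = (\<Prod>i<n. (\<integral>x. ?f i x \<partial>L))"
      by (rule P.product_integral_prod) (use i in auto)
    moreover have "(\<Prod>i<n. (\<integral>x. ?f i x \<partial>L)) = 0"
      using D0[of s] st by (intro prod_zero) (auto intro!: bexI[of _ s])
    ultimately show ?thesis unfolding e using False by simp
  qed
  let ?S = "\<lambda>w. \<Sum>t<n. D t (w t)"
  have Ssq: "(?S w)\<^sup>2 = (\<Sum>s<n. \<Sum>t<n. D s (w s) * D t (w t))" for w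
    by (simp add: power2_eq_square sum_product)
  have Si: "integrable ?P (\<lambda>w. (?S w)\<^sup>2)" unfolding Ssq using pair by (intro Bochner_Integration.integrable_sum) auto
  have "(\<integral>w. (?S w)\<^sup>2 \<partial>?P) = (\<Sum>s<n. \<Sum>t<n. (\<integral>w. D s (w s) * D t (w t) \<partial>?P))"
  proof -
    have i2: "integrable ?P (\<lambda>w. D s (w s) * D t (w t))" if "s \<in> {..<n}" "t \<in> {..<n}" for s t
      using pair[of s t] that by simp
    have i1: "integrable ?P (\<lambda>w. \<Sum>t<n. D s (w s) * D t (w t))" if "s \<in> {..<n}" for s
      by (rule Bochner_Integration.integrable_sum) (rule i2[OF that])
    have "(\<integral>w. (?S w)\<^sup>2 \<partial>?P) = (\<Sum>s<n. (\<integral>w. (\<Sum>t<n. D s (w s) * D t (w t)) \<partial>?P))"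
      unfolding Ssq by (rule Bochner_Integration.integral_sum) (rule i1)
    also have "... = (\<Sum>s<n. \<Sum>t<n. (\<integral>w. D s (w s) * D t (w t) \<partial>?P))"
    proof (rule sum.cong[OF refl])
      fix s assume s: "s \<in> {..<n}"
      show "(\<integral>w. (\<Sum>t<n. D s (w s) * D t (w t)) \<partial>?P) = (\<Sum>t<n. (\<integral>w. D s (w s) * D t (w t) \<partial>?P))"
        by (rule Bochner_Integration.integral_sum) (rule i2[OF s])
    qed
    finally show ?thesis .
  qed
  also have "... = (\<Sum>s<n. \<Sum>t<n. if s = t then (\<integral>x. (D t x)\<^sup>2 \<partial>L) else 0)"
    using pair by (intro sum.cong) auto
  also have "... = (\<Sum>s<n. (\<integral>x. (D s x)\<^sup>2 \<partial>L))" by (simp add: sum.delta')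
  also have "... \<le> (\<Sum>s<n. C)" by (intro sum_mono D2)
  finally have var: "(\<integral>w. (?S w)\<^sup>2 \<partial>?P) \<le> real n * C" by simp
  let ?E = "{w \<in> space ?P. (\<Sum>t<n. l t (w t)) < c}"
  have nd: "real n * d > 0" using n d by simp
  have "?E \<subseteq> {w \<in> space ?P. (real n * d)\<^sup>2 \<le> (?S w)\<^sup>2}"
  proof safe
    fix w assume "(\<Sum>t<n. l t (w t)) < c"
    then have "?S w < - (real n * d)" unfolding D_def using c by (simp add: sum_subtractf)
    then have "real n * d \<le> \<bar>?S w\<bar>" by linarith
    then have "(real n * d)\<^sup>2 \<le> \<bar>?S w\<bar>\<^sup>2" using nd by (intro power_mono) auto
    then show "(real n * d)\<^sup>2 \<le> (?S w)\<^sup>2" by simp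
  qed
  moreover have "{w \<in> space ?P. (real n * d)\<^sup>2 \<le> (?S w)\<^sup>2} \<in> sets ?P" by measurable
  ultimately have "measure ?P ?E \<le> measure ?P {w \<in> space ?P. (real n * d)\<^sup>2 \<le> (?S w)\<^sup>2}"
    by (rule P.finite_measure_mono)
  also have "... \<le> (\<integral>w. (?S w)\<^sup>2 \<partial>?P) / (real n * d)\<^sup>2"
    by (rule integral_Markov_inequality_measure[OF Si]) (use nd n d in auto)
  also have "... \<le> real n * C / (real n * d)\<^sup>2" using var by (rule divide_right_mono) simp
  also have "... = C / (real n * d\<^sup>2)" using n by (simp add: power2_eq_square)
  finally show ?thesis .
qed

section \<open>Codebooks and noise as one product over time\<close>

definition pair_letters :: "nat \<Rightarrow> (nat \<Rightarrow> 'a) \<times> (nat \<Rightarrow> 'b) \<Rightarrow> nat \<Rightarrow> 'a \<times> 'b" where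
  "pair_letters n = (\<lambda>(w, z). \<lambda>t\<in>{..<n}. (w t, z t))"

lemma pair_letters_measurable:
  "pair_letters n \<in> measurable (PiM {..<n} (\<lambda>_. L) \<Otimes>\<^sub>M PiM {..<n} (\<lambda>_. N)) (PiM {..<n} (\<lambda>_. L \<Otimes>\<^sub>M N))"
  unfolding pair_letters_def case_prod_beta by (rule measurable_restrict) measurable

text \<open>The error estimates live on independent pairs of seeds and noise over time, whereas a
  code is drawn apart from the noise. Regrouping coordinates identifies the two pictures; it
  suffices to compare boxes \<open>Pi\<^sub>E {..<n} A\<close>, over which both sides
  factorize.\<close>

lemma distr_pair_letters:
  assumes L: "prob_space L" and N: "prob_space N"
  shows "distr (PiM {..<n} (\<lambda>_. L) \<Otimes>\<^sub>M PiM {..<n} (\<lambda>_. N)) (PiM {..<n} (\<lambda>_. L \<Otimes>\<^sub>M N)) (pair_letters n) = PiM {..<n} (\<lambda>_. L \<Otimes>\<^sub>M N)"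
proof -
  interpret L: prob_space L by (rule L)
  interpret N: prob_space N by (rule N)
  interpret LN: pair_prob_space L N ..
  interpret PL: product_prob_space "\<lambda>_::nat. L" "{..<n}" ..
  interpret PN: product_prob_space "\<lambda>_::nat. N" "{..<n}" ..
  interpret PLN: product_prob_space "\<lambda>_::nat. L \<Otimes>\<^sub>M N" "{..<n}" ..
  let ?P = "PiM {..<n} (\<lambda>_. L)" and ?Q = "PiM {..<n} (\<lambda>_. N)" and ?B = "PiM {..<n} (\<lambda>_. L \<Otimes>\<^sub>M N)"
  show ?thesis
  proof (rule PLN.PiM_eqI)
    fix A assume A: "\<And>i. i \<in> {..<n} \<Longrightarrow> A i \<in> sets (L \<Otimes>\<^sub>M N)"
    have AE: "Pi\<^sub>E {..<n} A \<in> sets ?B" using A by (intro sets_PiM_I_finite) auto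
    have "emeasure (distr (?P \<Otimes>\<^sub>M ?Q) ?B (pair_letters n)) (Pi\<^sub>E {..<n} A) = (\<integral>\<^sup>+w. indicator (Pi\<^sub>E {..<n} A) w \<partial>distr (?P \<Otimes>\<^sub>M ?Q) ?B (pair_letters n))"
      using AE by simp
    also have "... = (\<integral>\<^sup>+x. indicator (Pi\<^sub>E {..<n} A) (pair_letters n x) \<partial>(?P \<Otimes>\<^sub>M ?Q))"
      by (rule nn_integral_distr[OF pair_letters_measurable]) (use AE in simp)
    also have "... = (\<integral>\<^sup>+w. \<integral>\<^sup>+z. indicator (Pi\<^sub>E {..<n} A) (pair_letters n (w, z)) \<partial>?Q \<partial>?P)"
      by (rule PN.nn_integral_fst[symmetric]) (use AE pair_letters_measurable in measurable)
    also have "... = (\<integral>\<^sup>+w. \<integral>\<^sup>+z. (\<Prod>t<n. indicator (A t) (w t, z t)) \<partial>?Q \<partial>?P)"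
    proof (intro nn_integral_cong)
      fix w z
      have "pair_letters n (w, z) \<in> Pi\<^sub>E {..<n} A \<longleftrightarrow> (\<forall>t<n. (w t, z t) \<in> A t)"
        unfolding pair_letters_def by (auto simp: PiE_iff)
      then show "indicator (Pi\<^sub>E {..<n} A) (pair_letters n (w, z)) = (\<Prod>t<n. indicator (A t) (w t, z t) :: ennreal)"
        by (cases "pair_letters n (w, z) \<in> Pi\<^sub>E {..<n} A") (auto simp: indicator_def intro!: prod_zero[symmetric])
    qed
    also have "... = (\<integral>\<^sup>+w. (\<Prod>t<n. \<integral>\<^sup>+y. indicator (A t) (w t, y) \<partial>N) \<partial>?P)"
    proof (rule nn_integral_cong)
      fix w assume "w \<in> space ?P"
      then have wt: "w t \<in> space L" if "t < n" for t using that by (auto simp: space_PiM)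
      show "(\<integral>\<^sup>+z. (\<Prod>t<n. indicator (A t) (w t, z t)) \<partial>?Q) = (\<Prod>t<n. \<integral>\<^sup>+y. indicator (A t) (w t, y) \<partial>N)"
        by (rule PN.product_nn_integral_prod) (use A wt in auto)
    qed
    also have "... = (\<Prod>t<n. \<integral>\<^sup>+x. \<integral>\<^sup>+y. indicator (A t) (x, y) \<partial>N \<partial>L)"
      by (rule PL.product_nn_integral_prod[where f="\<lambda>t x. \<integral>\<^sup>+y. indicator (A t) (x, y) \<partial>N"]) (use A in auto)
    also have "... = (\<Prod>t<n. emeasure (L \<Otimes>\<^sub>M N) (A t))"
      by (intro prod.cong refl) (use A in \<open>simp add: N.emeasure_pair_measure\<close>)
    finally show "emeasure (distr (?P \<Otimes>\<^sub>M ?Q) ?B (pair_letters n)) (Pi\<^sub>E {..<n} A) = (\<Prod>t<n. emeasure (L \<Otimes>\<^sub>M N) (A t))" .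
  qed simp_all
qed

text \<open>An integrand whose second argument ignores coordinate a treats \<open>w a\<close> as
  independent of the rest, so a fresh copy may take its place. The proof is Fubini for coordinate a
  against the others.\<close>

lemma resample:
  assumes I: "finite I" "a \<in> I" and M: "prob_space M"
    and H: "H \<in> borel_measurable (M \<Otimes>\<^sub>M PiM I (\<lambda>_. M))"
    and inv: "\<And>x w x'. H (x, w(a := x')) = H (x, w)"
  shows "(\<integral>\<^sup>+w. H (w a, w) \<partial>PiM I (\<lambda>_. M)) = (\<integral>\<^sup>+x. \<integral>\<^sup>+w. H (x, w) \<partial>PiM I (\<lambda>_. M) \<partial>M)"
proof -
  interpret M: prob_space M by (rule M)
  define J where "J = I - {a}"
  have IJ: "I = insert a J" "a \<notin> J" "finite J" using I by (auto simp: J_def)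
  interpret PJ: product_prob_space "\<lambda>_. M" J ..
  interpret PI: product_prob_space "\<lambda>_. M" I ..
  interpret MJ: pair_sigma_finite M "PiM J (\<lambda>_. M)" ..
  let ?P = "PiM J (\<lambda>_. M)"
  \<comment> \<open>Any point can fill coordinate a, since H does not see it.\<close>
  obtain c where c: "c \<in> space M" using M.not_empty by blast
  have u: "(\<lambda>w. w(a := x)) \<in> measurable ?P (PiM I (\<lambda>_. M))" if "x \<in> space M" for x
    unfolding IJ(1) by (rule measurable_fun_upd[where J=J]) (use that in auto)
  have H1[measurable]: "(\<lambda>(x, w). H (x, w(a := c))) \<in> borel_measurable (M \<Otimes>\<^sub>M ?P)"
  proof -
    have "(\<lambda>(x, w). (x, w(a := c))) \<in> measurable (M \<Otimes>\<^sub>M ?P) (M \<Otimes>\<^sub>M PiM I (\<lambda>_. M))"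
      using measurable_compose[OF measurable_snd[of M ?P] u[OF c]] unfolding case_prod_beta
      by (intro measurable_Pair) auto
    from measurable_compose[OF this H] show ?thesis by (simp add: case_prod_beta)
  qed
  have "(\<integral>\<^sup>+w. H (w a, w) \<partial>PiM I (\<lambda>_. M)) = (\<integral>\<^sup>+w. \<integral>\<^sup>+x. H ((w(a := x)) a, w(a := x)) \<partial>M \<partial>?P)"
    unfolding IJ(1)
  proof (rule PJ.product_nn_integral_insert[OF IJ(3,2)])
    have "a \<in> insert a J" by simp
    then show "(\<lambda>w. H (w a, w)) \<in> borel_measurable (PiM (insert a J) (\<lambda>_. M))"
      using H unfolding IJ(1) by measurable
  qed
  also have "... = (\<integral>\<^sup>+w. \<integral>\<^sup>+x. H (x, w(a := c)) \<partial>M \<partial>?P)" by (simp add: inv)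
  also have "... = (\<integral>\<^sup>+x. \<integral>\<^sup>+w. H (x, w(a := c)) \<partial>?P \<partial>M)"
    using MJ.Fubini'[of "\<lambda>x w. H (x, w(a := c))"] H1 by simp
  also have "... = (\<integral>\<^sup>+x. \<integral>\<^sup>+w. H (x, w) \<partial>PiM I (\<lambda>_. M) \<partial>M)"
  proof (rule nn_integral_cong)
    fix x assume x: "x \<in> space M"
    have "(\<integral>\<^sup>+w. H (x, w) \<partial>PiM I (\<lambda>_. M)) = (\<integral>\<^sup>+w. \<integral>\<^sup>+x'. H (x, w(a := x')) \<partial>M \<partial>?P)"
      unfolding IJ(1)
      by (rule PJ.product_nn_integral_insert[OF IJ(3,2)]) (use H x in \<open>simp add: IJ(1)\<close>)
    also have "... = (\<integral>\<^sup>+w. H (x, w(a := c)) \<partial>?P)"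
      using M.emeasure_space_1 by (simp add: inv)
    finally show "(\<integral>\<^sup>+w. H (x, w(a := c)) \<partial>?P) = (\<integral>\<^sup>+w. H (x, w) \<partial>PiM I (\<lambda>_. M))" ..
  qed
  finally show ?thesis .
qed

section \<open>The seeds of one time instant\<close>

definition lnsq :: "(real \<Rightarrow> real) \<Rightarrow> real" where "lnsq f = (\<integral>x. (ln (f x))\<^sup>2 \<partial>dm f)"

text \<open>I is meant to index all codewords of all codebooks. At one instant each contributes an
  independent standard normal seed, and \<open>\<L>\<close> adds one noise sample of the receiver;
  letters are functions of the seeds.\<close>

locale gauss_letter =
  fixes I :: "'i set" and \<sigma> :: real
  assumes fin: "finite I" and \<sigma>: "\<sigma> > 0"
begin

abbreviation "\<Lambda> \<equiv> PiM I (\<lambda>_. gauss)"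
abbreviation "\<N> \<equiv> dm (normal_density 0 \<sigma>)"
abbreviation "\<L> \<equiv> \<Lambda> \<Otimes>\<^sub>M \<N>"

text \<open>A pointwise substitute for independence from coordinate a, which simplification can
  check.\<close>

definition inv_coord :: "'i \<Rightarrow> (('i \<Rightarrow> real) \<times> real \<Rightarrow> 'b) \<Rightarrow> bool" where
  "inv_coord a k \<longleftrightarrow> (\<forall>w x z. k (w(a := x), z) = k (w, z))"

lemma prob_Lam: "prob_space \<Lambda>"
proof -
  interpret P: product_prob_space "\<lambda>_::'i. gauss" I
    unfolding product_prob_space_def product_prob_space_axioms_def product_sigma_finite_def
    using prob_gauss by (auto intro: prob_space_imp_sigma_finite)
  show ?thesis by (rule P.prob_space_axioms)
qed

lemma prob_N: "prob_space \<N>" by (rule gdens_prob[OF gdens_normal[OF \<sigma>]])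

lemma prob_L: "prob_space \<L>"
proof -
  interpret A: prob_space \<Lambda> by (rule prob_Lam)
  interpret B: prob_space \<N> by (rule prob_N)
  interpret AB: pair_prob_space \<Lambda> \<N> ..
  show ?thesis by (rule AB.prob_space_axioms)
qed

lemma coord_measurable[measurable]: "a \<in> I \<Longrightarrow> (\<lambda>p. fst p a) \<in> borel_measurable \<L>"
  using measurable_compose[OF measurable_fst measurable_component_singleton[of a I "\<lambda>_. gauss"]]
  by simp

lemma snd_measurable[measurable]: "snd \<in> borel_measurable \<L>"
  using measurable_snd[of \<Lambda> \<N>] by simp

lemma resample_pair:
  assumes a: "a \<in> I" and H: "H \<in> borel_measurable (gauss \<Otimes>\<^sub>M \<L>)"
    and inv: "\<And>x. inv_coord a (\<lambda>p. H (x, p))"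
  shows "(\<integral>\<^sup>+p. H (fst p a, p) \<partial>\<L>) = (\<integral>\<^sup>+x. \<integral>\<^sup>+p. H (x, p) \<partial>\<L> \<partial>gauss)"
proof -
  interpret A: prob_space \<Lambda> by (rule prob_Lam)
  interpret B: prob_space \<N> by (rule prob_N)
  interpret G: prob_space gauss by (rule prob_gauss)
  interpret AB: pair_prob_space \<Lambda> \<N> ..
  interpret GB: pair_sigma_finite gauss \<N> ..
  have [measurable]: "fst \<in> measurable \<L> \<Lambda>" by (rule measurable_fst)
  have m1: "(\<lambda>p. H (fst p a, p)) \<in> borel_measurable \<L>"
  proof -
    have "(\<lambda>p. (fst p a, p)) \<in> measurable \<L> (gauss \<Otimes>\<^sub>M \<L>)"
      using coord_measurable[OF a] by (intro measurable_Pair) auto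
    from measurable_compose[OF this H] show ?thesis .
  qed
  have m2: "(\<lambda>q. H (fst q, (snd q, z))) \<in> borel_measurable (gauss \<Otimes>\<^sub>M \<Lambda>)" for z
  proof -
    have "(\<lambda>q. (fst q, (snd q, z))) \<in> measurable (gauss \<Otimes>\<^sub>M \<Lambda>) (gauss \<Otimes>\<^sub>M \<L>)"
      by (intro measurable_Pair measurable_fst measurable_snd) simp
    from measurable_compose[OF this H] show ?thesis .
  qed
  have m3: "(\<lambda>q. H (fst (fst q), (snd q, snd (fst q)))) \<in> borel_measurable ((gauss \<Otimes>\<^sub>M \<N>) \<Otimes>\<^sub>M \<Lambda>)"
  proof -
    have "(\<lambda>q. (fst (fst q), (snd q, snd (fst q)))) \<in> measurable ((gauss \<Otimes>\<^sub>M \<N>) \<Otimes>\<^sub>M \<Lambda>) (gauss \<Otimes>\<^sub>M \<L>)"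
      by (intro measurable_Pair measurable_compose[OF measurable_fst measurable_fst] measurable_snd measurable_compose[OF measurable_fst measurable_snd])
    from measurable_compose[OF this H] show ?thesis .
  qed
  have m4: "(\<lambda>q. \<integral>\<^sup>+w. H (fst q, (w, snd q)) \<partial>\<Lambda>) \<in> borel_measurable (gauss \<Otimes>\<^sub>M \<N>)"
    using A.borel_measurable_nn_integral_fst[OF m3] by simp
  have "(\<integral>\<^sup>+p. H (fst p a, p) \<partial>\<L>) = (\<integral>\<^sup>+z. \<integral>\<^sup>+w. H (w a, (w, z)) \<partial>\<Lambda> \<partial>\<N>)"
    using AB.nn_integral_snd[OF m1] by simp
  also have "... = (\<integral>\<^sup>+z. \<integral>\<^sup>+x. \<integral>\<^sup>+w. H (x, (w, z)) \<partial>\<Lambda> \<partial>gauss \<partial>\<N>)"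
  proof (rule nn_integral_cong)
    fix z
    show "(\<integral>\<^sup>+w. H (w a, (w, z)) \<partial>\<Lambda>) = (\<integral>\<^sup>+x. \<integral>\<^sup>+w. H (x, (w, z)) \<partial>\<Lambda> \<partial>gauss)"
      using resample[OF fin a prob_gauss m2[of z]] inv by (simp add: inv_coord_def)
  qed
  also have "... = (\<integral>\<^sup>+x. \<integral>\<^sup>+z. \<integral>\<^sup>+w. H (x, (w, z)) \<partial>\<Lambda> \<partial>\<N> \<partial>gauss)"
    by (rule GB.Fubini'[of "\<lambda>x z. \<integral>\<^sup>+w. H (x, (w, z)) \<partial>\<Lambda>"]) (use m4 in \<open>simp add: case_prod_beta\<close>)
  also have "... = (\<integral>\<^sup>+x. \<integral>\<^sup>+p. H (x, p) \<partial>\<L> \<partial>gauss)"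
  proof (rule nn_integral_cong)
    fix x assume x: "x \<in> space gauss"
    have "(\<lambda>p. H (x, p)) \<in> borel_measurable \<L>" by (rule measurable_compose[OF measurable_Pair1'[OF x] H])
    from AB.nn_integral_snd[OF this] show "(\<integral>\<^sup>+z. \<integral>\<^sup>+w. H (x, (w, z)) \<partial>\<Lambda> \<partial>\<N>) = (\<integral>\<^sup>+p. H (x, p) \<partial>\<L>)" by simp
  qed
  finally show ?thesis .
qed

lemma law_add:
  assumes a: "a \<in> I" and W[measurable]: "W \<in> borel_measurable \<L>" and inv: "inv_coord a W"
    and d: "distr \<L> borel W = dm f" and f: "gdens f" and s[measurable]: "s \<in> borel_measurable borel"
  shows "distr \<L> borel (\<lambda>p. s (fst p a) + W p) = dm (smooth s f)"
  unfolding dm_smooth[OF f s, symmetric]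
proof (rule measure_eqI)
  note [measurable] = coord_measurable[OF a]
  interpret F: prob_space "dm f" by (rule gdens_prob[OF f])
  fix A assume "A \<in> sets (distr \<L> borel (\<lambda>p. s (fst p a) + W p))"
  then have A[measurable]: "A \<in> sets borel" by simp
  have sm: "s \<in> measurable gauss borel" by simp
  have mP: "(\<lambda>(x, y). s x + y) \<in> measurable (gauss \<Otimes>\<^sub>M dm f) borel"
    by (simp add: measurable_cong_sets[OF sets_pair_measure_cong[OF sets_density sets_density] refl])
  have mH: "(\<lambda>(x, p). indicator A (s x + W p) :: ennreal) \<in> borel_measurable (gauss \<Otimes>\<^sub>M \<L>)"
    unfolding case_prod_beta
    using measurable_compose[OF measurable_fst sm] measurable_compose[OF measurable_snd W]
    by measurable
  have "emeasure (distr \<L> borel (\<lambda>p. s (fst p a) + W p)) A = (\<integral>\<^sup>+y. indicator A y \<partial>distr \<L> borel (\<lambda>p. s (fst p a) + W p))"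
    by simp
  also have "... = (\<integral>\<^sup>+p. indicator A (s (fst p a) + W p) \<partial>\<L>)"
    by (rule nn_integral_distr) simp_all
  also have "... = (\<integral>\<^sup>+x. \<integral>\<^sup>+p. indicator A (s x + W p) \<partial>\<L> \<partial>gauss)"
    using resample_pair[OF a mH] inv by (simp add: inv_coord_def)
  also have "... = (\<integral>\<^sup>+x. \<integral>\<^sup>+y. indicator A (s x + y) \<partial>dm f \<partial>gauss)"
    unfolding d[symmetric] by (intro nn_integral_cong nn_integral_distr[symmetric]) simp_all
  also have "... = (\<integral>\<^sup>+z. indicator A (case z of (x, y) \<Rightarrow> s x + y) \<partial>(gauss \<Otimes>\<^sub>M dm f))"
    using F.nn_integral_fst[of "\<lambda>z. indicator A (case z of (x, y) \<Rightarrow> s x + y)" gauss] measurable_compose[OF mP borel_measurable_indicator[OF A]] by simp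
  also have "... = (\<integral>\<^sup>+y. indicator A y \<partial>distr (gauss \<Otimes>\<^sub>M dm f) borel (\<lambda>(x, y). s x + y))"
    by (rule nn_integral_distr[symmetric, OF mP]) simp
  also have "... = emeasure (distr (gauss \<Otimes>\<^sub>M dm f) borel (\<lambda>(x, y). s x + y)) A" by simp
  finally show "emeasure (distr \<L> borel (\<lambda>p. s (fst p a) + W p)) A = emeasure (distr (gauss \<Otimes>\<^sub>M dm f) borel (\<lambda>(x, y). s x + y)) A" .
qed simp

text \<open>Neither Y nor K involves seed a, which can therefore be averaged out first. This turns
  the shifted density g into the convolution \<open>smooth s g\<close>.\<close>

lemma integrate_out:
  assumes a: "a \<in> I" and g: "gdens g" and s[measurable]: "s \<in> borel_measurable borel"
    and Y[measurable]: "Y \<in> borel_measurable \<L>" and K[measurable]: "K \<in> borel_measurable \<L>"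
    and inv: "inv_coord a Y" "inv_coord a K"
  shows "(\<integral>\<^sup>+p. ennreal (g (Y p - s (fst p a))) * K p \<partial>\<L>) = (\<integral>\<^sup>+p. ennreal (smooth s g (Y p)) * K p \<partial>\<L>)"
proof -
  note [measurable] = gdens_measurable[OF g]
  interpret L: prob_space \<L> by (rule prob_L)
  interpret G: prob_space gauss by (rule prob_gauss)
  interpret GL: pair_sigma_finite gauss \<L> ..
  have sm: "s \<in> measurable gauss borel" by simp
  have mH: "(\<lambda>(x, p). ennreal (g (Y p - s x)) * K p) \<in> borel_measurable (gauss \<Otimes>\<^sub>M \<L>)"
    unfolding case_prod_beta
    using measurable_compose[OF measurable_fst sm] measurable_compose[OF measurable_snd Y] measurable_compose[OF measurable_snd K]
    by measurable
  have "(\<integral>\<^sup>+p. ennreal (g (Y p - s (fst p a))) * K p \<partial>\<L>) = (\<integral>\<^sup>+x. \<integral>\<^sup>+p. ennreal (g (Y p - s x)) * K p \<partial>\<L> \<partial>gauss)"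
    using resample_pair[OF a mH] inv by (simp add: inv_coord_def)
  also have "... = (\<integral>\<^sup>+p. \<integral>\<^sup>+x. ennreal (g (Y p - s x)) * K p \<partial>gauss \<partial>\<L>)"
    by (rule GL.Fubini'[symmetric]) (use mH in \<open>simp add: case_prod_beta\<close>)
  also have "... = (\<integral>\<^sup>+p. ennreal (smooth s g (Y p)) * K p \<partial>\<L>)"
    by (intro nn_integral_cong, subst nn_integral_multc) (simp_all add: smooth_nn[OF g s])
  finally show ?thesis .
qed

text \<open>Each term is a log-density evaluated at a variable with that very law, so its mean is
  minus an entropy. When V is U plus an independent letter, the mean of X is the mutual information
  between that letter and V.\<close>

lemma log_ratio_moments:
  assumes U: "U \<in> borel_measurable \<L>" "distr \<L> borel U = dm f" "gdens f"
    and V: "V \<in> borel_measurable \<L>" "distr \<L> borel V = dm g" "gdens g"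
  defines "X \<equiv> \<lambda>p. ln (f (U p)) - ln (g (V p))"
  shows "integrable \<L> X" "integrable \<L> (\<lambda>p. (X p)\<^sup>2)" "(\<integral>p. X p \<partial>\<L>) = dent g - dent f"
    "(\<integral>p. (X p)\<^sup>2 \<partial>\<L>) \<le> 2 * lnsq f + 2 * lnsq g"
proof -
  note [measurable] = gdens_measurable[OF U(3)] gdens_measurable[OF V(3)] U(1) V(1)
  have *: "integrable \<L> (\<lambda>p. k (W p)) \<longleftrightarrow> integrable (dm h) k" "(\<integral>p. k (W p) \<partial>\<L>) = (\<integral>x. k x \<partial>dm h)"
    if "W \<in> borel_measurable \<L>" "distr \<L> borel W = dm h" "k \<in> borel_measurable borel" for W h and k :: "real \<Rightarrow> real"
    using integrable_distr_eq[OF that(1,3)] integral_distr[OF that(1,3)] that(2) by auto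
  have m: "(\<lambda>x. ln (f x)) \<in> borel_measurable borel" "(\<lambda>x. (ln (f x))\<^sup>2) \<in> borel_measurable borel"
    "(\<lambda>x. ln (g x)) \<in> borel_measurable borel" "(\<lambda>x. (ln (g x))\<^sup>2) \<in> borel_measurable borel" by measurable
  have i: "integrable \<L> (\<lambda>p. ln (f (U p)))" "integrable \<L> (\<lambda>p. (ln (f (U p)))\<^sup>2)"
    "integrable \<L> (\<lambda>p. ln (g (V p)))" "integrable \<L> (\<lambda>p. (ln (g (V p)))\<^sup>2)"
    using *(1)[OF U(1,2) m(1)] *(1)[OF U(1,2) m(2)] *(1)[OF V(1,2) m(3)] *(1)[OF V(1,2) m(4)]
      integrable_ln_gdens[OF U(3,3)] integrable_ln_gdens[OF V(3,3)] by auto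
  have e: "(\<integral>p. ln (f (U p)) \<partial>\<L>) = - dent f" "(\<integral>p. (ln (f (U p)))\<^sup>2 \<partial>\<L>) = lnsq f"
    "(\<integral>p. ln (g (V p)) \<partial>\<L>) = - dent g" "(\<integral>p. (ln (g (V p)))\<^sup>2 \<partial>\<L>) = lnsq g"
    using *(2)[OF U(1,2) m(1)] *(2)[OF U(1,2) m(2)] *(2)[OF V(1,2) m(3)] *(2)[OF V(1,2) m(4)]
    by (auto simp: dent_def lnsq_def)
  show "integrable \<L> X" unfolding X_def using i by simp
  show "(\<integral>p. X p \<partial>\<L>) = dent g - dent f" unfolding X_def using i e by simp
  have b: "(X p)\<^sup>2 \<le> 2 * (ln (f (U p)))\<^sup>2 + 2 * (ln (g (V p)))\<^sup>2" for p
    unfolding X_def using zero_le_power2[of "ln (f (U p)) + ln (g (V p))"] by (simp add: power2_eq_square algebra_simps)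
  have ib: "integrable \<L> (\<lambda>p. 2 * (ln (f (U p)))\<^sup>2 + 2 * (ln (g (V p)))\<^sup>2)" using i by simp
  show i2: "integrable \<L> (\<lambda>p. (X p)\<^sup>2)"
    by (rule Bochner_Integration.integrable_bound[OF ib]) (use b in \<open>auto simp: X_def\<close>)
  have "(\<integral>p. (X p)\<^sup>2 \<partial>\<L>) \<le> (\<integral>p. 2 * (ln (f (U p)))\<^sup>2 + 2 * (ln (g (V p)))\<^sup>2 \<partial>\<L>)"
    by (rule integral_mono[OF i2 ib b])
  also have "... = 2 * lnsq f + 2 * lnsq g" using i e by simp
  finally show "(\<integral>p. (X p)\<^sup>2 \<partial>\<L>) \<le> 2 * lnsq f + 2 * lnsq g" .
qed

end

section \<open>Joint threshold decoding\<close>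

text \<open>One receiver sees \<open>s1 + s2 + r1 + r2 + Z\<close>: wanted and interfering common letters \<open>s1\<close>, \<open>s2\<close>, wanted and
  interfering private letters \<open>r1\<close>, \<open>r2\<close>. The densities belong to \<open>r2 + Z\<close>, then \<open>r1\<close>, then one or both
  common letters added; the log-likelihood ratios test the two common messages, separately and
  jointly, and the private one.\<close>

definition mac0 :: "real \<Rightarrow> (real \<Rightarrow> real) \<Rightarrow> real \<Rightarrow> real" where
  "mac0 \<sigma> r2 = smooth r2 (normal_density 0 \<sigma>)"
definition mac1 where "mac1 \<sigma> r1 r2 = smooth r1 (mac0 \<sigma> r2)"
definition mac2 where "mac2 \<sigma> s1 r1 r2 = smooth s1 (mac1 \<sigma> r1 r2)"
definition mac12 where "mac12 \<sigma> s1 s2 r1 r2 = smooth s1 (mac2 \<sigma> s2 r1 r2)"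

definition llr1 where
  "llr1 \<sigma> s1 s2 r1 r2 y a b = ln (mac1 \<sigma> r1 r2 (y - s1 a - s2 b)) - ln (mac2 \<sigma> s1 r1 r2 (y - s2 b))"
definition llr2 where
  "llr2 \<sigma> s1 s2 r1 r2 y a b = ln (mac1 \<sigma> r1 r2 (y - s1 a - s2 b)) - ln (mac2 \<sigma> s2 r1 r2 (y - s1 a))"
definition llr12 where
  "llr12 \<sigma> s1 s2 r1 r2 y a b = ln (mac1 \<sigma> r1 r2 (y - s1 a - s2 b)) - ln (mac12 \<sigma> s1 s2 r1 r2 y)"
definition llrp where
  "llrp \<sigma> s1 s2 r1 r2 y a b u = ln (mac0 \<sigma> r2 (y - s1 a - s2 b - r1 u)) - ln (mac1 \<sigma> r1 r2 (y - s1 a - s2 b))"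

definition passes :: "real \<Rightarrow> (nat \<Rightarrow> real \<Rightarrow> real) \<Rightarrow> (nat \<Rightarrow> real \<Rightarrow> real) \<Rightarrow> (nat \<Rightarrow> real \<Rightarrow> real) \<Rightarrow> (nat \<Rightarrow> real \<Rightarrow> real)
    \<Rightarrow> nat \<Rightarrow> real \<Rightarrow> real \<Rightarrow> real \<Rightarrow> real \<Rightarrow> (nat \<Rightarrow> real) \<Rightarrow> (nat \<Rightarrow> real) \<Rightarrow> (nat \<Rightarrow> real) \<Rightarrow> (nat \<Rightarrow> real) \<Rightarrow> bool" where
  "passes \<sigma> s1 s2 r1 r2 n \<gamma>1 \<gamma>2 \<gamma>12 \<gamma>p y a b u \<longleftrightarrow>
     \<gamma>1 \<le> (\<Sum>t<n. llr1 \<sigma> (s1 t) (s2 t) (r1 t) (r2 t) (y t) (a t) (b t)) \<and>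
     \<gamma>2 \<le> (\<Sum>t<n. llr2 \<sigma> (s1 t) (s2 t) (r1 t) (r2 t) (y t) (a t) (b t)) \<and>
     \<gamma>12 \<le> (\<Sum>t<n. llr12 \<sigma> (s1 t) (s2 t) (r1 t) (r2 t) (y t) (a t) (b t)) \<and>
     \<gamma>p \<le> (\<Sum>t<n. llrp \<sigma> (s1 t) (s2 t) (r1 t) (r2 t) (y t) (a t) (b t) (u t))"

definition wave :: "real \<Rightarrow> (real \<Rightarrow> real) \<Rightarrow> bool" where
  "wave b s \<longleftrightarrow> s \<in> borel_measurable borel \<and> (\<forall>x. \<bar>s x\<bar> \<le> b)"

lemma gdens_smooth_wave: "gdens f \<Longrightarrow> wave b s \<Longrightarrow> gdens (smooth s f)"
  using gdens_smooth unfolding wave_def by blast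

lemma gdens_mac:
  assumes "\<sigma> > 0" "wave b s1" "wave b s2" "wave b r1" "wave b r2"
  shows "gdens (mac0 \<sigma> r2)" "gdens (mac1 \<sigma> r1 r2)" "gdens (mac2 \<sigma> s1 r1 r2)" "gdens (mac2 \<sigma> s2 r1 r2)" "gdens (mac12 \<sigma> s1 s2 r1 r2)"
  unfolding mac0_def mac1_def mac2_def mac12_def
  using assms by (auto intro!: gdens_smooth_wave gdens_normal)

context gauss_letter
begin

text \<open>The seed a of a wrong codeword is not part of the output. Averaging over it turns the
  numerator of the likelihood ratio into \<open>smooth s g (Y p)\<close>, which is the denominator;
  the mean is thus 1 whatever the law of Y.\<close>

lemma wrong_single:
  assumes a: "a \<in> I" and g: "gdens g" and s: "wave b s"
    and Y[measurable]: "Y \<in> borel_measurable \<L>" and inv: "inv_coord a Y"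
  shows "(\<integral>\<^sup>+p. ennreal (exp (ln (g (Y p - s (fst p a))) - ln (smooth s g (Y p)))) \<partial>\<L>) = 1"
proof -
  interpret L: prob_space \<L> by (rule prob_L)
  have sm: "s \<in> borel_measurable borel" using s by (simp add: wave_def)
  have gs: "gdens (smooth s g)" by (rule gdens_smooth_wave[OF g s])
  note [measurable] = gdens_measurable[OF gs]
  have e: "ennreal (exp (ln (g u) - ln (smooth s g v))) = ennreal (g u) * ennreal (1 / smooth s g v)" for u v
    using gdens_pos[OF g, of u] gdens_pos[OF gs, of v] by (simp add: exp_diff ennreal_mult[symmetric] del: ennreal_mult)
  have "(\<integral>\<^sup>+p. ennreal (exp (ln (g (Y p - s (fst p a))) - ln (smooth s g (Y p)))) \<partial>\<L>)
    = (\<integral>\<^sup>+p. ennreal (smooth s g (Y p)) * ennreal (1 / smooth s g (Y p)) \<partial>\<L>)"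
    unfolding e by (rule integrate_out[OF a g sm Y _ inv(1)]) (use inv in \<open>simp_all add: inv_coord_def\<close>)
  also have "... = (\<integral>\<^sup>+p. 1 \<partial>\<L>)"
    using gdens_pos[OF gs] by (intro nn_integral_cong) (simp add: ennreal_mult[symmetric] less_imp_le less_imp_neq[symmetric] del: ennreal_mult)
  also have "... = 1" using L.emeasure_space_1 by simp
  finally show ?thesis .
qed

text \<open>For two wrong common codewords the seeds are averaged out one after the other, the first
  time with \<open>Y p - s (fst p a)\<close> in the role of the output.\<close>

lemma wrong_double:
  assumes a: "a \<in> I" "b \<in> I" "a \<noteq> b" and g: "gdens g" and s: "wave k s" "wave k s'"
    and Y[measurable]: "Y \<in> borel_measurable \<L>" and inv: "inv_coord a Y" "inv_coord b Y"
  shows "(\<integral>\<^sup>+p. ennreal (exp (ln (g (Y p - s (fst p a) - s' (fst p b))) - ln (smooth s (smooth s' g) (Y p)))) \<partial>\<L>) = 1"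
proof -
  interpret L: prob_space \<L> by (rule prob_L)
  have sm[measurable]: "s \<in> borel_measurable borel" and sm'[measurable]: "s' \<in> borel_measurable borel" using s by (auto simp: wave_def)
  have gs': "gdens (smooth s' g)" by (rule gdens_smooth_wave[OF g s(2)])
  have gs: "gdens (smooth s (smooth s' g))" by (rule gdens_smooth_wave[OF gs' s(1)])
  note [measurable] = gdens_measurable[OF gs] coord_measurable[OF a(1)]
  let ?h = "smooth s (smooth s' g)"
  have e: "ennreal (exp (ln (g u) - ln (?h v))) = ennreal (g u) * ennreal (1 / ?h v)" for u v
    using gdens_pos[OF g, of u] gdens_pos[OF gs, of v] by (simp add: exp_diff ennreal_mult[symmetric] del: ennreal_mult)
  have "(\<integral>\<^sup>+p. ennreal (exp (ln (g (Y p - s (fst p a) - s' (fst p b))) - ln (?h (Y p)))) \<partial>\<L>)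
    = (\<integral>\<^sup>+p. ennreal (smooth s' g (Y p - s (fst p a))) * ennreal (1 / ?h (Y p)) \<partial>\<L>)"
    unfolding e by (rule integrate_out[OF a(2) g sm', where Y="\<lambda>p. Y p - s (fst p a)"]) (use inv a in \<open>simp_all add: inv_coord_def\<close>)
  also have "... = (\<integral>\<^sup>+p. ennreal (?h (Y p)) * ennreal (1 / ?h (Y p)) \<partial>\<L>)"
    by (rule integrate_out[OF a(1) gs' sm Y _ inv(1)]) (use inv in \<open>simp_all add: inv_coord_def\<close>)
  also have "... = (\<integral>\<^sup>+p. 1 \<partial>\<L>)"
    using gdens_pos[OF gs] by (intro nn_integral_cong) (simp add: ennreal_mult[symmetric] less_imp_le less_imp_neq[symmetric] del: ennreal_mult)
  also have "... = 1" using L.emeasure_space_1 by simp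
  finally show ?thesis .
qed

end

text \<open>c1, c2, p1, p2 are the indices of the transmitted codewords: wanted and interfering
  common, wanted and interfering private. The waves depend on t through the phase of the time
  sharing.\<close>

locale mac = gauss_letter I \<sigma> for I :: "'i set" and \<sigma> :: real +
  fixes s1 s2 r1 r2 :: "nat \<Rightarrow> real \<Rightarrow> real" and b :: real and n :: nat and c1 c2 p1 p2 :: 'i
  assumes waves: "\<And>t. wave b (s1 t)" "\<And>t. wave b (s2 t)" "\<And>t. wave b (r1 t)" "\<And>t. wave b (r2 t)"
    and idx: "c1 \<in> I" "c2 \<in> I" "p1 \<in> I" "p2 \<in> I" and dist: "distinct [c1, c2, p1, p2]" and n: "n > 0"
begin

abbreviation "Big \<equiv> PiM {..<n} (\<lambda>_. \<L>)"
abbreviation "g0 t \<equiv> mac0 \<sigma> (r2 t)"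
abbreviation "g1 t \<equiv> mac1 \<sigma> (r1 t) (r2 t)"
abbreviation "g2 t \<equiv> mac2 \<sigma> (s1 t) (r1 t) (r2 t)"
abbreviation "g3 t \<equiv> mac2 \<sigma> (s2 t) (r1 t) (r2 t)"
abbreviation "g4 t \<equiv> mac12 \<sigma> (s1 t) (s2 t) (r1 t) (r2 t)"

definition out :: "nat \<Rightarrow> ('i \<Rightarrow> real) \<times> real \<Rightarrow> real" where
  "out t p = s1 t (fst p c1) + s2 t (fst p c2) + r1 t (fst p p1) + r2 t (fst p p2) + snd p"

lemma sm[measurable]: "s1 t \<in> borel_measurable borel" "s2 t \<in> borel_measurable borel" "r1 t \<in> borel_measurable borel" "r2 t \<in> borel_measurable borel"
  using waves by (auto simp: wave_def)

lemma gd: "gdens (g0 t)" "gdens (g1 t)" "gdens (g2 t)" "gdens (g3 t)" "gdens (g4 t)"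
  using gdens_mac[OF \<sigma> waves] by auto

lemmas gm[measurable] = gd[THEN gdens_measurable]

lemmas im[measurable] = idx[THEN coord_measurable]

lemma out_measurable[measurable]: "out t \<in> borel_measurable \<L>"
  unfolding out_def by measurable

definition "W0 t p = r2 t (fst p p2) + snd p"
definition "W1 t p = r1 t (fst p p1) + W0 t p"
definition "W2 t p = s1 t (fst p c1) + W1 t p"
definition "W3 t p = s2 t (fst p c2) + W1 t p"
definition "W4 t p = s1 t (fst p c1) + W3 t p"

lemma Wm[measurable]: "W0 t \<in> borel_measurable \<L>" "W1 t \<in> borel_measurable \<L>" "W2 t \<in> borel_measurable \<L>"
  "W3 t \<in> borel_measurable \<L>" "W4 t \<in> borel_measurable \<L>"
  unfolding W0_def[abs_def] W1_def[abs_def] W2_def[abs_def] W3_def[abs_def] W4_def[abs_def] by measurable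

lemma laws: "distr \<L> borel (W0 t) = dm (g0 t)" "distr \<L> borel (W1 t) = dm (g1 t)" "distr \<L> borel (W2 t) = dm (g2 t)"
  "distr \<L> borel (W3 t) = dm (g3 t)" "distr \<L> borel (W4 t) = dm (g4 t)"
proof -
  have z: "distr \<L> borel snd = dm (normal_density 0 \<sigma>)"
  proof (rule measure_eqI)
    interpret A: prob_space \<Lambda> by (rule prob_Lam)
    interpret B: prob_space \<N> by (rule prob_N)
    fix A assume "A \<in> sets (distr \<L> borel snd)"
    then have A: "A \<in> sets borel" by simp
    then have "snd -` A \<inter> space \<L> = space \<Lambda> \<times> A" by (auto simp: space_pair_measure)
    then show "emeasure (distr \<L> borel snd) A = emeasure \<N> A"
      using A A.emeasure_space_1 by (simp add: emeasure_distr B.emeasure_pair_measure_Times)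
  qed simp
  show 0: "distr \<L> borel (W0 t) = dm (g0 t)" unfolding W0_def[abs_def] mac0_def
    by (rule law_add[OF idx(4) _ _ z gdens_normal[OF \<sigma>] sm(4)]) (auto simp: inv_coord_def)
  show 1: "distr \<L> borel (W1 t) = dm (g1 t)" unfolding W1_def[abs_def] mac1_def
    by (rule law_add[OF idx(3) _ _ 0 gd(1) sm(3)]) (use dist in \<open>auto simp: inv_coord_def W0_def\<close>)
  show 2: "distr \<L> borel (W2 t) = dm (g2 t)" unfolding W2_def[abs_def] mac2_def
    by (rule law_add[OF idx(1) _ _ 1 gd(2) sm(1)]) (use dist in \<open>auto simp: inv_coord_def W0_def W1_def\<close>)
  show 3: "distr \<L> borel (W3 t) = dm (g3 t)" unfolding W3_def[abs_def] mac2_def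
    by (rule law_add[OF idx(2) _ _ 1 gd(2) sm(2)]) (use dist in \<open>auto simp: inv_coord_def W0_def W1_def\<close>)
  show 4: "distr \<L> borel (W4 t) = dm (g4 t)" unfolding W4_def[abs_def] mac12_def
    by (rule law_add[OF idx(1) _ _ 3 gd(4) sm(1)]) (use dist in \<open>auto simp: inv_coord_def W0_def W1_def W3_def\<close>)
qed

abbreviation "A1 t a e p \<equiv> llr1 \<sigma> (s1 t) (s2 t) (r1 t) (r2 t) (out t p) (fst p a) (fst p e)"
abbreviation "A2 t a e p \<equiv> llr2 \<sigma> (s1 t) (s2 t) (r1 t) (r2 t) (out t p) (fst p a) (fst p e)"
abbreviation "A12 t a e p \<equiv> llr12 \<sigma> (s1 t) (s2 t) (r1 t) (r2 t) (out t p) (fst p a) (fst p e)"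
abbreviation "Ap t a e u p \<equiv> llrp \<sigma> (s1 t) (s2 t) (r1 t) (r2 t) (out t p) (fst p a) (fst p e) (fst p u)"

lemma A_measurable:
  assumes "a \<in> I" "e \<in> I" "u \<in> I"
  shows "A1 t a e \<in> borel_measurable \<L>" "A2 t a e \<in> borel_measurable \<L>" "A12 t a e \<in> borel_measurable \<L>" "Ap t a e u \<in> borel_measurable \<L>"
proof -
  note [measurable] = assms[THEN coord_measurable]
  show "A1 t a e \<in> borel_measurable \<L>" "A2 t a e \<in> borel_measurable \<L>" "A12 t a e \<in> borel_measurable \<L>" "Ap t a e u \<in> borel_measurable \<L>"
    unfolding llr1_def llr2_def llr12_def llrp_def by measurable
qed

lemma truth_eq:
  "A1 t c1 c2 p = ln (g1 t (W1 t p)) - ln (g2 t (W2 t p))"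
  "A2 t c1 c2 p = ln (g1 t (W1 t p)) - ln (g3 t (W3 t p))"
  "A12 t c1 c2 p = ln (g1 t (W1 t p)) - ln (g4 t (W4 t p))"
  "Ap t c1 c2 p1 p = ln (g0 t (W0 t p)) - ln (g1 t (W1 t p))"
proof -
  have e: "out t p - s1 t (fst p c1) - s2 t (fst p c2) = W1 t p" "out t p - s2 t (fst p c2) = W2 t p"
    "out t p - s1 t (fst p c1) = W3 t p" "out t p = W4 t p" "W1 t p - r1 t (fst p p1) = W0 t p" for p
    unfolding out_def W0_def W1_def W2_def W3_def W4_def by auto
  show "A1 t c1 c2 p = ln (g1 t (W1 t p)) - ln (g2 t (W2 t p))" unfolding llr1_def e(1,2) ..
  show "A2 t c1 c2 p = ln (g1 t (W1 t p)) - ln (g3 t (W3 t p))" unfolding llr2_def unfolding e(1) unfolding e(3) ..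
  show "A12 t c1 c2 p = ln (g1 t (W1 t p)) - ln (g4 t (W4 t p))" unfolding llr12_def e(1) unfolding e(4) ..
  show "Ap t c1 c2 p1 p = ln (g0 t (W0 t p)) - ln (g1 t (W1 t p))" unfolding llrp_def e(1) e(5) ..
qed

text \<open>At the true messages the mean of each statistic is an entropy difference, and the
  thresholds lie n d below its sum. The factor 4 in the bounds on \<open>lnsq\<close> comes from the
  estimate 2 \<open>lnsq f\<close> + 2 \<open>lnsq g\<close> for the second moment of a log
  ratio.\<close>

lemma truth_error:
  assumes C: "\<And>t. 4 * lnsq (g0 t) \<le> C" "\<And>t. 4 * lnsq (g1 t) \<le> C" "\<And>t. 4 * lnsq (g2 t) \<le> C"
      "\<And>t. 4 * lnsq (g3 t) \<le> C" "\<And>t. 4 * lnsq (g4 t) \<le> C"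
    and d: "d > 0"
    and \<gamma>1: "\<gamma>1 \<le> (\<Sum>t<n. dent (g2 t) - dent (g1 t)) - real n * d"
    and \<gamma>2: "\<gamma>2 \<le> (\<Sum>t<n. dent (g3 t) - dent (g1 t)) - real n * d"
    and \<gamma>12: "\<gamma>12 \<le> (\<Sum>t<n. dent (g4 t) - dent (g1 t)) - real n * d"
    and \<gamma>p: "\<gamma>p \<le> (\<Sum>t<n. dent (g1 t) - dent (g0 t)) - real n * d"
  shows "measure Big {w \<in> space Big. (\<Sum>t<n. A1 t c1 c2 (w t)) < \<gamma>1} \<le> C / (real n * d\<^sup>2)"
    "measure Big {w \<in> space Big. (\<Sum>t<n. A2 t c1 c2 (w t)) < \<gamma>2} \<le> C / (real n * d\<^sup>2)"
    "measure Big {w \<in> space Big. (\<Sum>t<n. A12 t c1 c2 (w t)) < \<gamma>12} \<le> C / (real n * d\<^sup>2)"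
    "measure Big {w \<in> space Big. (\<Sum>t<n. Ap t c1 c2 p1 (w t)) < \<gamma>p} \<le> C / (real n * d\<^sup>2)"
proof -
  {
    fix t
    note log_ratio_moments[OF Wm(2)[of t] laws(2)[of t] gd(2)[of t] Wm(3)[of t] laws(3)[of t] gd(3)[of t], folded truth_eq]
  } note m1 = this
  have m1c: "(\<integral>p. (A1 t c1 c2 p)\<^sup>2 \<partial>\<L>) \<le> C" for t
    using m1(4)[of t] C(2)[of t] C(3)[of t] by linarith
  {
    fix t
    note log_ratio_moments[OF Wm(2)[of t] laws(2)[of t] gd(2)[of t] Wm(4)[of t] laws(4)[of t] gd(4)[of t], folded truth_eq]
  } note m2 = this
  have m2c: "(\<integral>p. (A2 t c1 c2 p)\<^sup>2 \<partial>\<L>) \<le> C" for t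
    using m2(4)[of t] C(2)[of t] C(4)[of t] by linarith
  {
    fix t
    note log_ratio_moments[OF Wm(2)[of t] laws(2)[of t] gd(2)[of t] Wm(5)[of t] laws(5)[of t] gd(5)[of t], folded truth_eq]
  } note m12 = this
  have m12c: "(\<integral>p. (A12 t c1 c2 p)\<^sup>2 \<partial>\<L>) \<le> C" for t
    using m12(4)[of t] C(2)[of t] C(5)[of t] by linarith
  {
    fix t
    note log_ratio_moments[OF Wm(1)[of t] laws(1)[of t] gd(1)[of t] Wm(2)[of t] laws(2)[of t] gd(2)[of t], folded truth_eq]
  } note mp = this
  have mpc: "(\<integral>p. (Ap t c1 c2 p1 p)\<^sup>2 \<partial>\<L>) \<le> C" for t
    using mp(4)[of t] C(1)[of t] C(2)[of t] by linarith
  show "measure Big {w \<in> space Big. (\<Sum>t<n. A1 t c1 c2 (w t)) < \<gamma>1} \<le> C / (real n * d\<^sup>2)"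
    by (rule chebyshev_sum[where l="\<lambda>t. A1 t c1 c2", OF prob_L m1(1,2) m1c n d]) (use \<gamma>1 in \<open>simp add: m1(3)\<close>)
  show "measure Big {w \<in> space Big. (\<Sum>t<n. A2 t c1 c2 (w t)) < \<gamma>2} \<le> C / (real n * d\<^sup>2)"
    by (rule chebyshev_sum[where l="\<lambda>t. A2 t c1 c2", OF prob_L m2(1,2) m2c n d]) (use \<gamma>2 in \<open>simp add: m2(3)\<close>)
  show "measure Big {w \<in> space Big. (\<Sum>t<n. A12 t c1 c2 (w t)) < \<gamma>12} \<le> C / (real n * d\<^sup>2)"
    by (rule chebyshev_sum[where l="\<lambda>t. A12 t c1 c2", OF prob_L m12(1,2) m12c n d]) (use \<gamma>12 in \<open>simp add: m12(3)\<close>)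
  show "measure Big {w \<in> space Big. (\<Sum>t<n. Ap t c1 c2 p1 (w t)) < \<gamma>p} \<le> C / (real n * d\<^sup>2)"
    by (rule chebyshev_sum[where l="\<lambda>t. Ap t c1 c2 p1", OF prob_L mp(1,2) mpc n d]) (use \<gamma>p in \<open>simp add: mp(3)\<close>)
qed

text \<open>An index different from all transmitted ones does not influence the output, so its
  likelihood ratio has mean 1 at each instant. A single common test is tried with the other common
  message correct, the private test with both correct; joint confusion has a test of its
  own.\<close>

lemma wrong_error:
  assumes a: "a \<in> I" "a \<noteq> c1" "a \<noteq> c2" "a \<noteq> p1" "a \<noteq> p2"
  shows "measure Big {w \<in> space Big. \<gamma> \<le> (\<Sum>t<n. A1 t a c2 (w t))} \<le> exp (- \<gamma>)"
    "measure Big {w \<in> space Big. \<gamma> \<le> (\<Sum>t<n. A2 t c1 a (w t))} \<le> exp (- \<gamma>)"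
    "measure Big {w \<in> space Big. \<gamma> \<le> (\<Sum>t<n. Ap t c1 c2 a (w t))} \<le> exp (- \<gamma>)"
    "e \<in> I \<Longrightarrow> a \<noteq> e \<Longrightarrow> e \<noteq> c1 \<Longrightarrow> e \<noteq> c2 \<Longrightarrow> e \<noteq> p1 \<Longrightarrow> e \<noteq> p2 \<Longrightarrow> measure Big {w \<in> space Big. \<gamma> \<le> (\<Sum>t<n. A12 t a e (w t))} \<le> exp (- \<gamma>)"
proof -
  have mA: "A1 t a c2 \<in> borel_measurable \<L>" "A2 t c1 a \<in> borel_measurable \<L>" "Ap t c1 c2 a \<in> borel_measurable \<L>" for t
    using A_measurable[OF a(1) idx(2) idx(1)] A_measurable[OF idx(1) a(1) idx(1)] A_measurable[OF idx(1,2) a(1)] by auto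
  have comm: "out t p - s1 t x - s2 t y = (out t p - s2 t y) - s1 t x" for t p x y by simp
  have 1: "(\<integral>\<^sup>+p. ennreal (exp (A1 t a c2 p)) \<partial>\<L>) \<le> 1" for t
    unfolding llr1_def comm mac2_def
    by (rule eq_refl, rule wrong_single[OF a(1) gd(2) waves(1), where Y="\<lambda>p. out t p - s2 t (fst p c2)"])
       (use a in \<open>auto simp: inv_coord_def out_def[abs_def]\<close>)
  show "measure Big {w \<in> space Big. \<gamma> \<le> (\<Sum>t<n. A1 t a c2 (w t))} \<le> exp (- \<gamma>)"
    by (rule markov_sum[where l="\<lambda>t. A1 t a c2", OF prob_L mA(1) 1])
  have 2: "(\<integral>\<^sup>+p. ennreal (exp (A2 t c1 a p)) \<partial>\<L>) \<le> 1" for t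
    unfolding llr2_def mac2_def
    by (rule eq_refl, rule wrong_single[OF a(1) gd(2) waves(2), where Y="\<lambda>p. out t p - s1 t (fst p c1)"])
       (use a in \<open>auto simp: inv_coord_def out_def[abs_def]\<close>)
  show "measure Big {w \<in> space Big. \<gamma> \<le> (\<Sum>t<n. A2 t c1 a (w t))} \<le> exp (- \<gamma>)"
    by (rule markov_sum[where l="\<lambda>t. A2 t c1 a", OF prob_L mA(2) 2])
  have 3: "(\<integral>\<^sup>+p. ennreal (exp (Ap t c1 c2 a p)) \<partial>\<L>) \<le> 1" for t
    unfolding llrp_def mac1_def
    by (rule eq_refl, rule wrong_single[OF a(1) gd(1) waves(3), where Y="\<lambda>p. out t p - s1 t (fst p c1) - s2 t (fst p c2)"])
       (use a in \<open>auto simp: inv_coord_def out_def[abs_def]\<close>)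
  show "measure Big {w \<in> space Big. \<gamma> \<le> (\<Sum>t<n. Ap t c1 c2 a (w t))} \<le> exp (- \<gamma>)"
    by (rule markov_sum[where l="\<lambda>t. Ap t c1 c2 a", OF prob_L mA(3) 3])
  assume e: "e \<in> I" "a \<noteq> e" "e \<noteq> c1" "e \<noteq> c2" "e \<noteq> p1" "e \<noteq> p2"
  have 4: "(\<integral>\<^sup>+p. ennreal (exp (A12 t a e p)) \<partial>\<L>) \<le> 1" for t
    unfolding llr12_def mac12_def mac2_def
    by (rule eq_refl, rule wrong_double[OF a(1) e(1,2) gd(2) waves(1,2), where Y="out t"])
       (use a e in \<open>auto simp: inv_coord_def out_def\<close>)
  show "measure Big {w \<in> space Big. \<gamma> \<le> (\<Sum>t<n. A12 t a e (w t))} \<le> exp (- \<gamma>)"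
    by (rule markov_sum[where l="\<lambda>t. A12 t a e", OF prob_L A_measurable(3)[OF a(1) e(1) idx(1)] 4])
qed

abbreviation "seed a w \<equiv> (\<lambda>t. fst (w t) a)"
abbreviation "recv w \<equiv> (\<lambda>t. out t (w t))"

text \<open>A candidate with the right (a, u) counts as correct even if its interfering index e is
  wrong: only the receiver's own message has to be recovered.\<close>

definition error_event where
  "error_event C1 C2 P1 \<gamma>1 \<gamma>2 \<gamma>12 \<gamma>p = {w \<in> space Big.
     \<not> passes \<sigma> s1 s2 r1 r2 n \<gamma>1 \<gamma>2 \<gamma>12 \<gamma>p (recv w) (seed c1 w) (seed c2 w) (seed p1 w) \<or>
     (\<exists>a\<in>C1. \<exists>e\<in>C2. \<exists>u\<in>P1. (a, u) \<noteq> (c1, p1) \<and>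
        passes \<sigma> s1 s2 r1 r2 n \<gamma>1 \<gamma>2 \<gamma>12 \<gamma>p (recv w) (seed a w) (seed e w) (seed u w))}"

lemma S_measurable:
  assumes "a \<in> I" "e \<in> I" "u \<in> I"
  shows "(\<lambda>w. \<Sum>t<n. A1 t a e (w t)) \<in> borel_measurable Big" "(\<lambda>w. \<Sum>t<n. A2 t a e (w t)) \<in> borel_measurable Big"
    "(\<lambda>w. \<Sum>t<n. A12 t a e (w t)) \<in> borel_measurable Big" "(\<lambda>w. \<Sum>t<n. Ap t a e u (w t)) \<in> borel_measurable Big"
proof -
  have c: "(\<lambda>w. w t) \<in> measurable Big \<L>" if "t \<in> {..<n}" for t
    by (rule measurable_component_singleton[OF that])
  show "(\<lambda>w. \<Sum>t<n. A1 t a e (w t)) \<in> borel_measurable Big"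
    by (rule borel_measurable_sum) (rule measurable_compose[OF c A_measurable(1)[OF assms]])
  show "(\<lambda>w. \<Sum>t<n. A2 t a e (w t)) \<in> borel_measurable Big"
    by (rule borel_measurable_sum) (rule measurable_compose[OF c A_measurable(2)[OF assms]])
  show "(\<lambda>w. \<Sum>t<n. A12 t a e (w t)) \<in> borel_measurable Big"
    by (rule borel_measurable_sum) (rule measurable_compose[OF c A_measurable(3)[OF assms]])
  show "(\<lambda>w. \<Sum>t<n. Ap t a e u (w t)) \<in> borel_measurable Big"
    by (rule borel_measurable_sum) (rule measurable_compose[OF c A_measurable(4)[OF assms]])
qed

lemma passes_measurable:
  assumes "a \<in> I" "e \<in> I" "u \<in> I"
  shows "Measurable.pred Big (\<lambda>w. passes \<sigma> s1 s2 r1 r2 n \<gamma>1 \<gamma>2 \<gamma>12 \<gamma>p (recv w) (seed a w) (seed e w) (seed u w))"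
  unfolding passes_def using S_measurable[OF assms] by measurable

lemma error_event_sets:
  assumes "C1 \<subseteq> I" "C2 \<subseteq> I" "P1 \<subseteq> I"
  shows "error_event C1 C2 P1 \<gamma>1 \<gamma>2 \<gamma>12 \<gamma>p \<in> sets Big"
proof -
  have f: "finite C1" "finite C2" "finite P1" using assms fin by (auto intro: finite_subset)
  note [measurable] = passes_measurable[OF idx(1,2,3)]
  have "Measurable.pred Big (\<lambda>w. \<exists>a\<in>C1. \<exists>e\<in>C2. \<exists>u\<in>P1. (a, u) \<noteq> (c1, p1) \<and>
        passes \<sigma> s1 s2 r1 r2 n \<gamma>1 \<gamma>2 \<gamma>12 \<gamma>p (recv w) (seed a w) (seed e w) (seed u w))"
    by (intro pred_intros_finite f pred_intros_logic passes_measurable) (use assms in auto)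
  note [measurable] = this
  show ?thesis unfolding error_event_def by measurable
qed

lemma receiver_error:
  assumes S: "C1 \<subseteq> I" "C2 \<subseteq> I" "P1 \<subseteq> I" "c1 \<in> C1" "c2 \<in> C2" "p1 \<in> P1"
    and disj: "C1 \<inter> C2 = {}" "C1 \<inter> P1 = {}" "C2 \<inter> P1 = {}" "p2 \<notin> C1" "p2 \<notin> C2" "p2 \<notin> P1"
    and C: "\<And>t. 4 * lnsq (g0 t) \<le> C" "\<And>t. 4 * lnsq (g1 t) \<le> C" "\<And>t. 4 * lnsq (g2 t) \<le> C"
      "\<And>t. 4 * lnsq (g3 t) \<le> C" "\<And>t. 4 * lnsq (g4 t) \<le> C"
    and d: "d > 0"
    and \<gamma>1: "\<gamma>1 \<le> (\<Sum>t<n. dent (g2 t) - dent (g1 t)) - real n * d"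
    and \<gamma>2: "\<gamma>2 \<le> (\<Sum>t<n. dent (g3 t) - dent (g1 t)) - real n * d"
    and \<gamma>12: "\<gamma>12 \<le> (\<Sum>t<n. dent (g4 t) - dent (g1 t)) - real n * d"
    and \<gamma>p: "\<gamma>p \<le> (\<Sum>t<n. dent (g1 t) - dent (g0 t)) - real n * d"
  shows "measure Big (error_event C1 C2 P1 \<gamma>1 \<gamma>2 \<gamma>12 \<gamma>p) \<le> 4 * (C / (real n * d\<^sup>2))
     + real (card C1 - 1) * exp (- \<gamma>1) + real (card C2 - 1) * exp (- \<gamma>2)
     + real (card C1 - 1) * real (card C2 - 1) * exp (- \<gamma>12) + real (card P1 - 1) * exp (- \<gamma>p)"
proof -
  interpret L: prob_space \<L> by (rule prob_L)
  interpret B: product_prob_space "\<lambda>_::nat. \<L>" "{..<n}" ..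
  have f: "finite C1" "finite C2" "finite P1" using S fin by (auto intro: finite_subset)
  note T = truth_error[OF C d \<gamma>1 \<gamma>2 \<gamma>12 \<gamma>p]
  let ?T1 = "{w \<in> space Big. (\<Sum>t<n. A1 t c1 c2 (w t)) < \<gamma>1}"
  let ?T2 = "{w \<in> space Big. (\<Sum>t<n. A2 t c1 c2 (w t)) < \<gamma>2}"
  let ?T3 = "{w \<in> space Big. (\<Sum>t<n. A12 t c1 c2 (w t)) < \<gamma>12}"
  let ?T4 = "{w \<in> space Big. (\<Sum>t<n. Ap t c1 c2 p1 (w t)) < \<gamma>p}"
  let ?E1 = "\<lambda>a. {w \<in> space Big. \<gamma>1 \<le> (\<Sum>t<n. A1 t a c2 (w t))}"
  let ?E2 = "\<lambda>e. {w \<in> space Big. \<gamma>2 \<le> (\<Sum>t<n. A2 t c1 e (w t))}"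
  let ?E3 = "\<lambda>(a, e). {w \<in> space Big. \<gamma>12 \<le> (\<Sum>t<n. A12 t a e (w t))}"
  let ?E4 = "\<lambda>u. {w \<in> space Big. \<gamma>p \<le> (\<Sum>t<n. Ap t c1 c2 u (w t))}"
  have sT: "?T1 \<in> sets Big" "?T2 \<in> sets Big" "?T3 \<in> sets Big" "?T4 \<in> sets Big"
    using S_measurable[OF idx(1,2,3)] by measurable
  have sE1: "?E1 a \<in> sets Big" if "a \<in> C1" for a using S_measurable(1)[of a c2 p1] that S idx by (auto intro!: borel_measurable_le)
  have sE2: "?E2 a \<in> sets Big" if "a \<in> C2" for a using S_measurable(2)[of c1 a p1] that S idx by (auto intro!: borel_measurable_le)
  have sE3: "?E3 z \<in> sets Big" if z: "z \<in> C1 \<times> C2" for z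
  proof -
    obtain a e where e: "z = (a, e)" by force
    then have "a \<in> I" "e \<in> I" using z S by auto
    from S_measurable(3)[OF this idx(1)] show ?thesis unfolding e prod.case by (rule borel_measurable_le[rotated]) simp
  qed
  have sE4: "?E4 a \<in> sets Big" if "a \<in> P1" for a using S_measurable(4)[of c1 c2 a] that S idx by (auto intro!: borel_measurable_le)
  let ?U1 = "\<Union>a\<in>C1 - {c1}. ?E1 a" and ?U2 = "\<Union>a\<in>C2 - {c2}. ?E2 a" and ?U3 = "\<Union>z\<in>(C1 - {c1}) \<times> (C2 - {c2}). ?E3 z"
    and ?U4 = "\<Union>a\<in>P1 - {p1}. ?E4 a"
  have sU: "?U1 \<in> sets Big" "?U2 \<in> sets Big" "?U3 \<in> sets Big" "?U4 \<in> sets Big"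
    using f sE1 sE2 sE3 sE4 by (auto intro!: sets.finite_UN)
  have sub: "error_event C1 C2 P1 \<gamma>1 \<gamma>2 \<gamma>12 \<gamma>p \<subseteq> ?T1 \<union> (?T2 \<union> (?T3 \<union> (?T4 \<union> (?U1 \<union> (?U2 \<union> (?U3 \<union> ?U4))))))"
  proof
    fix w assume w: "w \<in> error_event C1 C2 P1 \<gamma>1 \<gamma>2 \<gamma>12 \<gamma>p"
    then have ws: "w \<in> space Big" by (simp add: error_event_def)
    show "w \<in> ?T1 \<union> (?T2 \<union> (?T3 \<union> (?T4 \<union> (?U1 \<union> (?U2 \<union> (?U3 \<union> ?U4))))))"
    proof (cases "passes \<sigma> s1 s2 r1 r2 n \<gamma>1 \<gamma>2 \<gamma>12 \<gamma>p (recv w) (seed c1 w) (seed c2 w) (seed p1 w)")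
      case False
      then show ?thesis using ws unfolding passes_def by auto
    next
      case True
      then obtain a e u where aeu: "a \<in> C1" "e \<in> C2" "u \<in> P1" "(a, u) \<noteq> (c1, p1)"
        and ps: "passes \<sigma> s1 s2 r1 r2 n \<gamma>1 \<gamma>2 \<gamma>12 \<gamma>p (recv w) (seed a w) (seed e w) (seed u w)"
        using w unfolding error_event_def by blast
      \<comment> \<open>Wrong candidates, sorted by the test that rules them out. In the first three
        cases that test ignores u, so the private index costs no factor in the union bound; the
        private test is used once both common indices are right. The case of a right a with wrong e
        and u is the source of the constraint on the interfering common rate.\<close>
      consider "a \<noteq> c1" "e = c2" | "a \<noteq> c1" "e \<noteq> c2" | "a = c1" "e \<noteq> c2" | "a = c1" "e = c2" "u \<noteq> p1"
        using aeu(4) by auto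
      then show ?thesis
      proof cases
        case 1
        then have "w \<in> ?U1" using ps ws aeu unfolding passes_def by auto
        then show ?thesis by blast
      next
        case 2
        then have "w \<in> ?U3" using ps ws aeu unfolding passes_def by auto
        then show ?thesis by blast
      next
        case 3
        then have "w \<in> ?U2" using ps ws aeu unfolding passes_def by auto
        then show ?thesis by blast
      next
        case 4
        then have "w \<in> ?U4" using ps ws aeu unfolding passes_def by auto
        then show ?thesis by blast
      qed
    qed
  qed
  have m1: "measure Big ?U1 \<le> real (card C1 - 1) * exp (- \<gamma>1)"
  proof -
    have "measure Big ?U1 \<le> (\<Sum>a\<in>C1 - {c1}. measure Big (?E1 a))"
      by (rule measure_UNION_le) (use f sE1 in auto)
    also have "... \<le> (\<Sum>a\<in>C1 - {c1}. exp (- \<gamma>1))"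
      by (rule sum_mono, rule wrong_error(1)) (use S disj in auto)
    finally show ?thesis using f S by (simp add: card_Diff_singleton)
  qed
  have m2: "measure Big ?U2 \<le> real (card C2 - 1) * exp (- \<gamma>2)"
  proof -
    have "measure Big ?U2 \<le> (\<Sum>a\<in>C2 - {c2}. measure Big (?E2 a))"
      by (rule measure_UNION_le) (use f sE2 in auto)
    also have "... \<le> (\<Sum>a\<in>C2 - {c2}. exp (- \<gamma>2))"
      by (rule sum_mono, rule wrong_error(2)) (use S disj in auto)
    finally show ?thesis using f S by (simp add: card_Diff_singleton)
  qed
  have m3: "measure Big ?U3 \<le> real (card C1 - 1) * real (card C2 - 1) * exp (- \<gamma>12)"
  proof -
    have "measure Big ?U3 \<le> (\<Sum>z\<in>(C1 - {c1}) \<times> (C2 - {c2}). measure Big (?E3 z))"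
      by (rule measure_UNION_le) (use f sE3 in auto)
    also have "... \<le> (\<Sum>z\<in>(C1 - {c1}) \<times> (C2 - {c2}). exp (- \<gamma>12))"
    proof (rule sum_mono)
      fix z assume "z \<in> (C1 - {c1}) \<times> (C2 - {c2})"
      then obtain a e where z: "z = (a, e)" "a \<in> C1 - {c1}" "e \<in> C2 - {c2}" by auto
      show "measure Big (?E3 z) \<le> exp (- \<gamma>12)" unfolding z prod.case
        by (rule wrong_error(4)) (use S disj z in auto)
    qed
    finally show ?thesis using f S by (simp add: card_cartesian_product card_Diff_singleton)
  qed
  have m4: "measure Big ?U4 \<le> real (card P1 - 1) * exp (- \<gamma>p)"
  proof -
    have "measure Big ?U4 \<le> (\<Sum>a\<in>P1 - {p1}. measure Big (?E4 a))"
      by (rule measure_UNION_le) (use f sE4 in auto)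
    also have "... \<le> (\<Sum>a\<in>P1 - {p1}. exp (- \<gamma>p))"
      by (rule sum_mono, rule wrong_error(3)) (use S disj in auto)
    finally show ?thesis using f S by (simp add: card_Diff_singleton)
  qed
  have "measure Big (error_event C1 C2 P1 \<gamma>1 \<gamma>2 \<gamma>12 \<gamma>p) \<le> measure Big (?T1 \<union> (?T2 \<union> (?T3 \<union> (?T4 \<union> (?U1 \<union> (?U2 \<union> (?U3 \<union> ?U4)))))))"
    by (rule B.finite_measure_mono[OF sub]) (intro sets.Un sT sU)
  also have "... \<le> measure Big ?T1 + (measure Big ?T2 + (measure Big ?T3 + (measure Big ?T4 + (measure Big ?U1 + (measure Big ?U2 + (measure Big ?U3 + measure Big ?U4))))))"
    by (intro order_trans[OF measure_Un_le] add_left_mono sets.Un sT sU order_refl)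
  also have "... \<le> C / (real n * d\<^sup>2) + (C / (real n * d\<^sup>2) + (C / (real n * d\<^sup>2) + (C / (real n * d\<^sup>2) +
     (real (card C1 - 1) * exp (- \<gamma>1) + (real (card C2 - 1) * exp (- \<gamma>2) +
     (real (card C1 - 1) * real (card C2 - 1) * exp (- \<gamma>12) + real (card P1 - 1) * exp (- \<gamma>p)))))))"
    by (intro add_mono T m1 m2 m3 m4)
  finally show ?thesis by (simp add: algebra_simps)
qed

end

section \<open>Time sharing and derandomization\<close>

lemma card_nat_interval:
  fixes a b :: real assumes "0 \<le> a"
  shows "{t::nat. a \<le> real t \<and> real t < b} = {nat \<lceil>a\<rceil>..<nat \<lceil>b\<rceil>}"
proof -
  have 1: "a \<le> real t \<longleftrightarrow> nat \<lceil>a\<rceil> \<le> t" for t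
    by (simp only: nat_le_iff ceiling_le_iff of_int_of_nat_eq)
  have 2: "real t < b \<longleftrightarrow> t < nat \<lceil>b\<rceil>" for t
    by (simp only: zless_nat_eq_int_zless less_ceiling_iff of_int_of_nat_eq)
  show ?thesis unfolding set_eq_iff mem_Collect_eq atLeastLessThan_iff by (simp only: 1 2 simp_thms)
qed

text \<open>Deterministic time sharing: [0, 1) is cut into intervals of lengths u s, and instant t
  of a block of length n uses the interval that contains t / n. The counts deviate from n u s by at
  most 1, so the averages of every function of the phase converge.\<close>

lemma time_sharing_sequence:
  fixes u :: "nat \<Rightarrow> real" and J :: nat
  assumes u: "\<And>s. 0 \<le> u s" "(\<Sum>s<J. u s) = 1"
  obtains q :: "nat \<Rightarrow> nat \<Rightarrow> nat" where "\<And>n t. q n t < J"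
    "\<And>D :: nat \<Rightarrow> real. (\<lambda>n. (\<Sum>t<n. D (q n t)) / real n) \<longlonglongrightarrow> (\<Sum>s<J. u s * D s)"
proof -
  have J: "J > 0" using u(2) by (cases J) auto
  define L where "L j = (\<Sum>s<j. u s)" for j
  have L0: "L 0 = 0" "L J = 1" "L (Suc j) = L j + u j" for j using u by (auto simp: L_def)
  have Lm: "L i \<le> L j" if "i \<le> j" for i j unfolding L_def using u(1) that by (intro sum_mono2) auto
  have Lnn: "0 \<le> L j" for j using Lm[of 0 j] L0 by simp
  \<comment> \<open>The least j for which the cumulative weight up to and including j exceeds t / n;
    beyond the block the default 0 keeps the phase below J.\<close>
  define q where "q n t = (if t < n then LEAST j. real t < real n * L (Suc j) else 0)" for n t :: nat
  have ex: "real t < real n * L (Suc (J - 1))" if "t < n" for t n using that J L0 by simp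
  have qJ: "q n t < J" for n t
  proof (cases "t < n")
    case True
    have "q n t \<le> J - 1" unfolding q_def using True ex[OF True] by (auto intro: Least_le)
    then show ?thesis using J by simp
  qed (use J in \<open>simp add: q_def\<close>)
  have qeq: "q n t = s \<longleftrightarrow> real n * L s \<le> real t \<and> real t < real n * L (Suc s)" if t: "t < n" for n t s
  proof
    assume s: "q n t = s"
    have 1: "real t < real n * L (Suc s)" using LeastI[of "\<lambda>j. real t < real n * L (Suc j)", OF ex[OF t]] s t by (simp add: q_def)
    have 2: "real n * L s \<le> real t"
    proof (cases s)
      case (Suc s')
      then have "s' < (LEAST j. real t < real n * L (Suc j))" using s t by (simp add: q_def)
      then have "\<not> real t < real n * L (Suc s')" by (rule not_less_Least[of s' "\<lambda>j. real t < real n * L (Suc j)"])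
      then show ?thesis using Suc by simp
    qed (simp add: L0)
    from 1 2 show "real n * L s \<le> real t \<and> real t < real n * L (Suc s)" by simp
  next
    assume s: "real n * L s \<le> real t \<and> real t < real n * L (Suc s)"
    show "q n t = s"
      unfolding q_def using t
    proof (simp, intro Least_equality)
      fix j assume j: "real t < real n * L (Suc j)"
      show "s \<le> j"
      proof (rule ccontr)
        assume "\<not> s \<le> j"
        then have "real n * L (Suc j) \<le> real n * L s" by (intro mult_left_mono Lm) auto
        then show False using s j by linarith
      qed
    qed (use s in simp)
  qed
  have cnt: "\<bar>real (card {t. t < n \<and> q n t = s}) / real n - u s\<bar> \<le> 1 / real n" if s: "s < J" and n: "n > 0" for n s
  proof -
    have "{t. t < n \<and> q n t = s} = {t. real n * L s \<le> real t \<and> real t < real n * L (Suc s)}"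
    proof -
      have "t < n" if "real t < real n * L (Suc s)" for t
      proof -
        have "real n * L (Suc s) \<le> real n * 1" using Lm[of "Suc s" J] s L0 by (intro mult_left_mono) auto
        then show ?thesis using that by simp
      qed
      then show ?thesis using qeq by auto
    qed
    also have "... = {nat \<lceil>real n * L s\<rceil>..<nat \<lceil>real n * L (Suc s)\<rceil>}"
      by (rule card_nat_interval) (simp add: Lnn)
    finally have c: "card {t. t < n \<and> q n t = s} = nat \<lceil>real n * L (Suc s)\<rceil> - nat \<lceil>real n * L s\<rceil>" by simp
    have le: "real n * L s \<le> real n * L (Suc s)" by (intro mult_left_mono Lm) auto
    have nn: "0 \<le> real n * L s" "0 \<le> real n * L (Suc s)" by (auto simp: Lnn)
    have "real (card {t. t < n \<and> q n t = s}) = real_of_int \<lceil>real n * L (Suc s)\<rceil> - real_of_int \<lceil>real n * L s\<rceil>"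
    proof -
      have "\<lceil>real n * L s\<rceil> \<le> \<lceil>real n * L (Suc s)\<rceil>" by (rule ceiling_mono[OF le])
      moreover have "0 \<le> \<lceil>real n * L s\<rceil>" using nn(1) by linarith
      moreover have "real (nat j - nat i) = real_of_int j - real_of_int i" if "0 \<le> i" "i \<le> j" for i j :: int
        using that by (simp add: nat_diff_distrib[symmetric])
      ultimately show ?thesis unfolding c by blast
    qed
    moreover have "real_of_int \<lceil>x\<rceil> < x + 1" "x \<le> real_of_int \<lceil>x\<rceil>" for x :: real by linarith+
    ultimately have "\<bar>real (card {t. t < n \<and> q n t = s}) - (real n * L (Suc s) - real n * L s)\<bar> \<le> 1"
      by (smt (verit))
    moreover have "real n * L (Suc s) - real n * L s = real n * u s" by (simp add: L0 algebra_simps)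
    ultimately have "\<bar>real (card {t. t < n \<and> q n t = s}) - real n * u s\<bar> \<le> 1" by simp
    then have "\<bar>real (card {t. t < n \<and> q n t = s}) - real n * u s\<bar> / real n \<le> 1 / real n" by (rule divide_right_mono) simp
    moreover have "\<bar>real (card {t. t < n \<and> q n t = s}) - real n * u s\<bar> / real n = \<bar>real (card {t. t < n \<and> q n t = s}) / real n - u s\<bar>"
    proof -
      have "real (card {t. t < n \<and> q n t = s}) / real n - u s = (real (card {t. t < n \<and> q n t = s}) - real n * u s) / real n"
        using n by (simp add: diff_divide_distrib)
      then show ?thesis by (simp only: abs_divide abs_of_nat)
    qed
    ultimately show ?thesis by simp
  qed
  have lim: "(\<lambda>n. real (card {t. t < n \<and> q n t = s}) / real n) \<longlonglongrightarrow> u s" if "s < J" for s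
  proof -
    have "(\<lambda>n. real (card {t. t < n \<and> q n t = s}) / real n - u s) \<longlonglongrightarrow> 0"
    proof (rule Lim_null_comparison)
      show "\<forall>\<^sub>F n in sequentially. norm (real (card {t. t < n \<and> q n t = s}) / real n - u s) \<le> 1 / real n"
        using eventually_gt_at_top[of 0] by eventually_elim (use cnt[OF that] in simp)
      show "(\<lambda>n. 1 / real n) \<longlonglongrightarrow> 0" by (rule lim_1_over_n)
    qed
    then show ?thesis by (simp add: LIM_zero_iff)
  qed
  show ?thesis
  proof (rule that[of q])
    show "q n t < J" for n t by (rule qJ)
    fix D :: "nat \<Rightarrow> real"
    have "(\<Sum>t<n. D (q n t)) / real n = (\<Sum>s<J. real (card {t. t < n \<and> q n t = s}) / real n * D s)" for n
    proof -
      have "(\<Sum>t<n. D (q n t)) = (\<Sum>s<J. \<Sum>t\<in>{t \<in> {..<n}. q n t = s}. D (q n t))"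
        by (rule sum.group[symmetric]) (use qJ in auto)
      also have "... = (\<Sum>s<J. real (card {t. t < n \<and> q n t = s}) * D s)"
        by (intro sum.cong refl) simp
      finally show ?thesis by (simp add: sum_divide_distrib)
    qed
    then show "(\<lambda>n. (\<Sum>t<n. D (q n t)) / real n) \<longlonglongrightarrow> (\<Sum>s<J. u s * D s)"
      by (simp only:) (intro tendsto_sum tendsto_mult lim tendsto_const, simp)
  qed
qed

section \<open>From random codebooks to fixed codes\<close>

lemma noise_meas_eq: "noise_meas \<sigma> n = PiM {..<n} (\<lambda>_. dm (normal_density 0 \<sigma>))"
  by (simp add: noise_meas_def)

lemma prob_noise: "\<sigma> > 0 \<Longrightarrow> prob_space (noise_meas \<sigma> n)"
proof -
  assume s: "\<sigma> > 0"
  interpret N: prob_space "dm (normal_density 0 \<sigma>)" by (rule gdens_prob[OF gdens_normal[OF s]])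
  interpret P: product_prob_space "\<lambda>_::nat. dm (normal_density 0 \<sigma>)" "{..<n}" ..
  show ?thesis unfolding noise_meas_eq by (rule P.prob_space_axioms)
qed

definition good_word :: "real \<Rightarrow> real \<Rightarrow> nat \<Rightarrow> (nat \<Rightarrow> real) \<Rightarrow> bool" where
  "good_word A a n x \<longleftrightarrow> (\<forall>t<n. 0 \<le> x t \<and> x t \<le> A) \<and> (\<Sum>t<n. x t) \<le> real n * a * A"

lemma valid_encoder_iff: "valid_encoder A a n M x \<longleftrightarrow> (\<forall>m\<in>{1..M}. good_word A a n (x m))"
  unfolding valid_encoder_def good_word_def ..

lemma err_prob_le:
  assumes s: "\<sigma> > 0" and M: "M > 0" "M' > 0" and S: "\<And>m m'. m \<in> {1..M} \<Longrightarrow> m' \<in> {1..M'} \<Longrightarrow> S m m' \<in> sets (noise_meas \<sigma> n)"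
    and dec: "\<And>m m' z. m \<in> {1..M} \<Longrightarrow> m' \<in> {1..M'} \<Longrightarrow> z \<in> space (noise_meas \<sigma> n) \<Longrightarrow> z \<notin> S m m' \<Longrightarrow>
       g (\<lambda>t\<in>{..<n}. hdir * x m t + hc * x' m' t + z t) = m"
    and e: "(\<Sum>m\<in>{1..M}. \<Sum>m'\<in>{1..M'}. measure (noise_meas \<sigma> n) (S m m')) \<le> e * (real M * real M')"
  shows "err_prob \<sigma> n hdir hc M M' x x' g \<le> e"
proof -
  interpret N: prob_space "noise_meas \<sigma> n" by (rule prob_noise[OF s])
  have "(\<Sum>m\<in>{1..M}. \<Sum>m'\<in>{1..M'}.
        measure (noise_meas \<sigma> n)
          {z \<in> space (noise_meas \<sigma> n). g (\<lambda>t\<in>{..<n}. hdir * x m t + hc * x' m' t + z t) \<noteq> m})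
     \<le> (\<Sum>m\<in>{1..M}. \<Sum>m'\<in>{1..M'}. measure (noise_meas \<sigma> n) (S m m'))"
    by (intro sum_mono N.finite_measure_mono) (use dec S in blast)+
  also note e
  finally show ?thesis unfolding err_prob_def using M by (simp add: divide_le_eq)
qed

lemma nn_integral_double_sum:
  assumes "\<And>i j. i \<in> S \<Longrightarrow> j \<in> T \<Longrightarrow> f i j \<in> borel_measurable M"
  shows "(\<integral>\<^sup>+x. (\<Sum>i\<in>S. \<Sum>j\<in>T. f i j x) \<partial>M) = (\<Sum>i\<in>S. \<Sum>j\<in>T. \<integral>\<^sup>+x. f i j x \<partial>M)"
proof -
  have "(\<integral>\<^sup>+x. (\<Sum>i\<in>S. \<Sum>j\<in>T. f i j x) \<partial>M) = (\<Sum>i\<in>S. \<integral>\<^sup>+x. (\<Sum>j\<in>T. f i j x) \<partial>M)"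
    by (rule nn_integral_sum) (intro borel_measurable_sum assms)
  also have "... = (\<Sum>i\<in>S. \<Sum>j\<in>T. \<integral>\<^sup>+x. f i j x \<partial>M)"
    by (rule sum.cong[OF refl], rule nn_integral_sum) (rule assms)
  finally show ?thesis .
qed

text \<open>First moment method for both receivers at once: summed over message pairs, the two error
  masses have total mean at most 2 e M1 M2, so one codebook stays below 3 e M1 M2 for both. Outside
  the bad events the input constraints hold as well, which allows invalid codewords to be exchanged
  afterwards.\<close>

lemma derandomize:
  fixes X1 X2 :: "'w \<Rightarrow> nat \<Rightarrow> nat \<Rightarrow> real"
  assumes \<Omega>: "prob_space \<Omega>" and s: "\<sigma> > 0" and e: "e > 0" and M: "M1 > 0" "M2 > 0" and A: "A \<ge> 0" "a1 \<ge> 0" "a2 \<ge> 0"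
    and B1: "\<And>m m'. m \<in> {1..M1} \<Longrightarrow> m' \<in> {1..M2} \<Longrightarrow> B1 m m' \<in> sets (\<Omega> \<Otimes>\<^sub>M noise_meas \<sigma> n)"
      "\<And>m m'. m \<in> {1..M1} \<Longrightarrow> m' \<in> {1..M2} \<Longrightarrow> measure (\<Omega> \<Otimes>\<^sub>M noise_meas \<sigma> n) (B1 m m') \<le> e"
    and B2: "\<And>m m'. m \<in> {1..M2} \<Longrightarrow> m' \<in> {1..M1} \<Longrightarrow> B2 m m' \<in> sets (\<Omega> \<Otimes>\<^sub>M noise_meas \<sigma> n)"
      "\<And>m m'. m \<in> {1..M2} \<Longrightarrow> m' \<in> {1..M1} \<Longrightarrow> measure (\<Omega> \<Otimes>\<^sub>M noise_meas \<sigma> n) (B2 m m') \<le> e"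
    and d1: "\<And>\<omega> m m' z. \<omega> \<in> space \<Omega> \<Longrightarrow> z \<in> space (noise_meas \<sigma> n) \<Longrightarrow> m \<in> {1..M1} \<Longrightarrow> m' \<in> {1..M2} \<Longrightarrow> (\<omega>, z) \<notin> B1 m m' \<Longrightarrow>
       good_word A a1 n (X1 \<omega> m) \<and> good_word A a2 n (X2 \<omega> m') \<and> G1 \<omega> (\<lambda>t\<in>{..<n}. h11 * X1 \<omega> m t + h21 * X2 \<omega> m' t + z t) = m"
    and d2: "\<And>\<omega> m m' z. \<omega> \<in> space \<Omega> \<Longrightarrow> z \<in> space (noise_meas \<sigma> n) \<Longrightarrow> m \<in> {1..M2} \<Longrightarrow> m' \<in> {1..M1} \<Longrightarrow> (\<omega>, z) \<notin> B2 m m' \<Longrightarrow>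
       good_word A a2 n (X2 \<omega> m) \<and> good_word A a1 n (X1 \<omega> m') \<and> G2 \<omega> (\<lambda>t\<in>{..<n}. h22 * X2 \<omega> m t + h12 * X1 \<omega> m' t + z t) = m"
    and v: "\<And>\<omega>. \<omega> \<in> space \<Omega> \<Longrightarrow> valid_decoder n (G1 \<omega>)" "\<And>\<omega>. \<omega> \<in> space \<Omega> \<Longrightarrow> valid_decoder n (G2 \<omega>)"
  shows "\<exists>x1 x2 g1 g2. valid_encoder A a1 n M1 x1 \<and> valid_encoder A a2 n M2 x2 \<and> valid_decoder n g1 \<and> valid_decoder n g2 \<and>
     err_prob \<sigma> n h11 h21 M1 M2 x1 x2 g1 \<le> 3 * e \<and> err_prob \<sigma> n h22 h12 M2 M1 x2 x1 g2 \<le> 3 * e"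
proof -
  let ?N = "noise_meas \<sigma> n"
  interpret O: prob_space \<Omega> by (rule \<Omega>)
  interpret N: prob_space ?N by (rule prob_noise[OF s])
  interpret ON: pair_prob_space \<Omega> ?N ..
  let ?F1 = "\<lambda>\<omega>. \<Sum>m\<in>{1..M1}. \<Sum>m'\<in>{1..M2}. emeasure ?N (Pair \<omega> -` B1 m m')"
  let ?F2 = "\<lambda>\<omega>. \<Sum>m\<in>{1..M2}. \<Sum>m'\<in>{1..M1}. emeasure ?N (Pair \<omega> -` B2 m m')"
  have mF: "?F1 \<in> borel_measurable \<Omega>" "?F2 \<in> borel_measurable \<Omega>"
    using B1(1) B2(1) by (auto intro!: borel_measurable_sum N.measurable_emeasure_Pair)
  have i1: "(\<integral>\<^sup>+\<omega>. ?F1 \<omega> \<partial>\<Omega>) \<le> ennreal (e * (real M1 * real M2))"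
  proof -
    have "(\<integral>\<^sup>+\<omega>. ?F1 \<omega> \<partial>\<Omega>) = (\<Sum>m\<in>{1..M1}. \<Sum>m'\<in>{1..M2}. \<integral>\<^sup>+\<omega>. emeasure ?N (Pair \<omega> -` B1 m m') \<partial>\<Omega>)"
      by (rule nn_integral_double_sum[where f="\<lambda>m m' \<omega>. emeasure ?N (Pair \<omega> -` B1 m m')"]) (rule N.measurable_emeasure_Pair[OF B1(1)])
    also have "... = (\<Sum>m\<in>{1..M1}. \<Sum>m'\<in>{1..M2}. emeasure (\<Omega> \<Otimes>\<^sub>M ?N) (B1 m m'))"
      using B1(1) by (simp add: N.emeasure_pair_measure_alt)
    also have "... \<le> (\<Sum>m\<in>{1..M1}. \<Sum>m'\<in>{1..M2}. ennreal e)"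
      by (intro sum_mono) (use B1(2) e in \<open>simp add: ON.P.emeasure_eq_measure\<close>)
    also have "... = ennreal (e * (real M1 * real M2))"
      using e by (simp add: ennreal_mult ennreal_of_nat_eq_real_of_nat mult_ac)
    finally show ?thesis .
  qed
  have i2: "(\<integral>\<^sup>+\<omega>. ?F2 \<omega> \<partial>\<Omega>) \<le> ennreal (e * (real M1 * real M2))"
  proof -
    have "(\<integral>\<^sup>+\<omega>. ?F2 \<omega> \<partial>\<Omega>) = (\<Sum>m\<in>{1..M2}. \<Sum>m'\<in>{1..M1}. \<integral>\<^sup>+\<omega>. emeasure ?N (Pair \<omega> -` B2 m m') \<partial>\<Omega>)"
      by (rule nn_integral_double_sum[where f="\<lambda>m m' \<omega>. emeasure ?N (Pair \<omega> -` B2 m m')"]) (rule N.measurable_emeasure_Pair[OF B2(1)])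
    also have "... = (\<Sum>m\<in>{1..M2}. \<Sum>m'\<in>{1..M1}. emeasure (\<Omega> \<Otimes>\<^sub>M ?N) (B2 m m'))"
      using B2(1) by (simp add: N.emeasure_pair_measure_alt)
    also have "... \<le> (\<Sum>m\<in>{1..M2}. \<Sum>m'\<in>{1..M1}. ennreal e)"
      by (intro sum_mono) (use B2(2) e in \<open>simp add: ON.P.emeasure_eq_measure\<close>)
    also have "... = ennreal (e * (real M1 * real M2))"
      using e by (simp add: ennreal_mult ennreal_of_nat_eq_real_of_nat mult_ac)
    finally show ?thesis .
  qed
  have ee: "e * (real M1 * real M2) > 0" using e M by simp
  obtain \<omega> where w: "\<omega> \<in> space \<Omega>" "?F1 \<omega> + ?F2 \<omega> < ennreal (3 * e * (real M1 * real M2))"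
  proof (rule ccontr)
    assume "\<not> thesis"
    then have "\<And>\<omega>. \<omega> \<in> space \<Omega> \<Longrightarrow> ennreal (3 * e * (real M1 * real M2)) \<le> ?F1 \<omega> + ?F2 \<omega>"
      using that not_less by blast
    then have "(\<integral>\<^sup>+\<omega>. ennreal (3 * e * (real M1 * real M2)) \<partial>\<Omega>) \<le> (\<integral>\<^sup>+\<omega>. ?F1 \<omega> + ?F2 \<omega> \<partial>\<Omega>)"
      by (intro nn_integral_mono) auto
    also have "... = (\<integral>\<^sup>+\<omega>. ?F1 \<omega> \<partial>\<Omega>) + (\<integral>\<^sup>+\<omega>. ?F2 \<omega> \<partial>\<Omega>)"
      by (rule nn_integral_add[OF mF])
    also have "... \<le> ennreal (e * (real M1 * real M2)) + ennreal (e * (real M1 * real M2))"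
      by (rule add_mono[OF i1 i2])
    finally have "ennreal (3 * e * (real M1 * real M2)) \<le> ennreal (2 * e * (real M1 * real M2))"
      using O.emeasure_space_1 ee by (simp flip: ennreal_plus)
    then show False using ee by (simp add: ennreal_le_iff)
  qed
  have f1: "?F1 \<omega> = ennreal (\<Sum>m\<in>{1..M1}. \<Sum>m'\<in>{1..M2}. measure ?N (Pair \<omega> -` B1 m m'))"
    by (simp add: N.emeasure_eq_measure sum_nonneg)
  have f2: "?F2 \<omega> = ennreal (\<Sum>m\<in>{1..M2}. \<Sum>m'\<in>{1..M1}. measure ?N (Pair \<omega> -` B2 m m'))"
    by (simp add: N.emeasure_eq_measure sum_nonneg)
  have "?F1 \<omega> \<le> ennreal (3 * e * (real M1 * real M2))" by (rule less_imp_le[OF le_less_trans[OF _ w(2)]]) simp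
  then have g1: "(\<Sum>m\<in>{1..M1}. \<Sum>m'\<in>{1..M2}. measure ?N (Pair \<omega> -` B1 m m')) \<le> 3 * e * (real M1 * real M2)"
    unfolding f1 using ee by (simp add: ennreal_le_iff)
  have "?F2 \<omega> \<le> ennreal (3 * e * (real M1 * real M2))" by (rule less_imp_le[OF le_less_trans[OF _ w(2)]]) simp
  then have g2: "(\<Sum>m\<in>{1..M2}. \<Sum>m'\<in>{1..M1}. measure ?N (Pair \<omega> -` B2 m m')) \<le> 3 * e * (real M2 * real M1)"
    unfolding f2 using ee by (simp add: ennreal_le_iff mult.commute)
  \<comment> \<open>Codewords that violate a constraint become zero, which is always admissible.
    Outside the bad event both transmitted words are good, so the exchange does not alter the
    received signal there.\<close>
  define x1 where "x1 m = (if good_word A a1 n (X1 \<omega> m) then X1 \<omega> m else (\<lambda>_. 0))" for m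
  define x2 where "x2 m = (if good_word A a2 n (X2 \<omega> m) then X2 \<omega> m else (\<lambda>_. 0))" for m
  have z: "good_word A a1 n (\<lambda>_. 0)" "good_word A a2 n (\<lambda>_. 0)" using A by (auto simp: good_word_def)
  have "valid_encoder A a1 n M1 x1" "valid_encoder A a2 n M2 x2"
    unfolding valid_encoder_iff x1_def x2_def using z by auto
  moreover have "err_prob \<sigma> n h11 h21 M1 M2 x1 x2 (G1 \<omega>) \<le> 3 * e"
  proof (rule err_prob_le[OF s M, where S="\<lambda>m m'. Pair \<omega> -` B1 m m'"])
    fix m m' z assume *: "m \<in> {1..M1}" "m' \<in> {1..M2}" "z \<in> space ?N" "z \<notin> Pair \<omega> -` B1 m m'"
    then show "G1 \<omega> (\<lambda>t\<in>{..<n}. h11 * x1 m t + h21 * x2 m' t + z t) = m"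
      using d1[OF w(1) *(3) *(1,2)] by (simp add: x1_def x2_def)
  qed (use B1(1) g1 in \<open>auto intro: sets_Pair1\<close>)
  moreover have "err_prob \<sigma> n h22 h12 M2 M1 x2 x1 (G2 \<omega>) \<le> 3 * e"
  proof (rule err_prob_le[OF s M(2,1), where S="\<lambda>m m'. Pair \<omega> -` B2 m m'"])
    fix m m' z assume *: "m \<in> {1..M2}" "m' \<in> {1..M1}" "z \<in> space ?N" "z \<notin> Pair \<omega> -` B2 m m'"
    then show "G2 \<omega> (\<lambda>t\<in>{..<n}. h22 * x2 m t + h12 * x1 m' t + z t) = m"
      using d2[OF w(1) *(3) *(1,2)] by (simp add: x1_def x2_def)
  qed (use B2(1) g2 in \<open>auto intro: sets_Pair1\<close>)
  ultimately show ?thesis using v[OF w(1)] by blast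
qed

section \<open>Superposition codebooks and the decoder of one receiver\<close>

context gauss_letter
begin

lemma coord_integral:
  fixes k :: "real \<Rightarrow> real"
  assumes a: "a \<in> I" and k: "integrable gauss k"
  shows "integrable \<L> (\<lambda>p. k (fst p a))" "(\<integral>p. k (fst p a) \<partial>\<L>) = (\<integral>x. k x \<partial>gauss)"
proof -
  interpret N: prob_space \<N> by (rule prob_N)
  interpret P: product_prob_space "\<lambda>_::'i. gauss" I
    unfolding product_prob_space_def product_prob_space_axioms_def product_sigma_finite_def
    using prob_gauss by (auto intro: prob_space_imp_sigma_finite)
  have m: "(\<lambda>w. w a) \<in> measurable \<Lambda> gauss" by (rule measurable_component_singleton[OF a])
  have "distr \<L> gauss (\<lambda>p. fst p a) = distr (distr \<L> \<Lambda> fst) gauss (\<lambda>w. w a)"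
    by (subst distr_distr[OF m measurable_fst]) (simp add: o_def)
  also have "distr \<L> \<Lambda> fst = \<Lambda>" by (rule N.distr_pair_fst)
  also have "distr \<Lambda> gauss (\<lambda>w. w a) = gauss" by (rule P.PiM_component[OF a])
  finally have d: "distr \<L> gauss (\<lambda>p. fst p a) = gauss" .
  have m': "(\<lambda>p. fst p a) \<in> measurable \<L> gauss" by (rule measurable_compose[OF measurable_fst m])
  have km: "k \<in> borel_measurable gauss" using k by simp
  show "integrable \<L> (\<lambda>p. k (fst p a))" using integrable_distr_eq[OF m' km] k unfolding d by simp
  show "(\<integral>p. k (fst p a) \<partial>\<L>) = (\<integral>x. k x \<partial>gauss)" using integral_distr[OF m' km] unfolding d by simp
qed

end

text \<open>Codeword indices: the first argument is the user, the second the number within the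
  common (\<open>Cw\<close>) or private (\<open>Pw\<close>) codebook.\<close>

datatype cx = Cw nat nat | Pw nat nat

lemma passes_cong:
  assumes "\<And>t. t < n \<Longrightarrow> y t = y' t" "\<And>t. t < n \<Longrightarrow> a t = a' t" "\<And>t. t < n \<Longrightarrow> b t = b' t" "\<And>t. t < n \<Longrightarrow> u t = u' t"
  shows "passes \<sigma> s1 s2 r1 r2 n \<gamma>1 \<gamma>2 \<gamma>12 \<gamma>p y a b u = passes \<sigma> s1 s2 r1 r2 n \<gamma>1 \<gamma>2 \<gamma>12 \<gamma>p y' a' b' u'"
  unfolding passes_def using assms by simp

lemma passes_output_measurable:
  assumes "\<sigma> > 0" "\<And>t. wave k (s1 t)" "\<And>t. wave k (s2 t)" "\<And>t. wave k (r1 t)" "\<And>t. wave k (r2 t)"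
  shows "Measurable.pred (PiM {..<n} (\<lambda>_. borel)) (\<lambda>y. passes \<sigma> s1 s2 r1 r2 n \<gamma>1 \<gamma>2 \<gamma>12 \<gamma>p y a b u)"
proof -
  {
    fix t
    note gdens_mac[OF assms(1) assms(2)[of t] assms(3)[of t] assms(4)[of t] assms(5)[of t], THEN gdens_measurable]
  } note [measurable] = this
  have "(\<lambda>y. \<Sum>t<n. llr1 \<sigma> (s1 t) (s2 t) (r1 t) (r2 t) (y t) (a t) (b t)) \<in> borel_measurable (PiM {..<n} (\<lambda>_. borel))"
    "(\<lambda>y. \<Sum>t<n. llr2 \<sigma> (s1 t) (s2 t) (r1 t) (r2 t) (y t) (a t) (b t)) \<in> borel_measurable (PiM {..<n} (\<lambda>_. borel))"
    "(\<lambda>y. \<Sum>t<n. llr12 \<sigma> (s1 t) (s2 t) (r1 t) (r2 t) (y t) (a t) (b t)) \<in> borel_measurable (PiM {..<n} (\<lambda>_. borel))"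
    "(\<lambda>y. \<Sum>t<n. llrp \<sigma> (s1 t) (s2 t) (r1 t) (r2 t) (y t) (a t) (b t) (u t)) \<in> borel_measurable (PiM {..<n} (\<lambda>_. borel))"
    unfolding llr1_def llr2_def llr12_def llrp_def by measurable
  then show ?thesis unfolding passes_def by measurable
qed

text \<open>\<open>vc k t\<close> and \<open>vp k t\<close> send seeds to the common and private
  letters of user k at instant t; the dependence on t carries the time sharing. The bound A on every
  sum makes the peak constraint hold surely, so only the mean constraint can fail.\<close>

locale codebook =
  fixes \<sigma> A :: real and vc vp :: "nat \<Rightarrow> nat \<Rightarrow> real \<Rightarrow> real" and Mc Mp :: "nat \<Rightarrow> nat" and n :: nat
  assumes \<sigma>_pos: "\<sigma> > 0" and A_nonneg: "A \<ge> 0" and n_pos: "n > 0" and M_pos: "\<And>k. Mc k > 0" "\<And>k. Mp k > 0"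
    and vm: "\<And>k t. vc k t \<in> borel_measurable borel" "\<And>k t. vp k t \<in> borel_measurable borel"
    and vb: "\<And>k t x. 0 \<le> vc k t x" "\<And>k t x. 0 \<le> vp k t x" "\<And>k t x y. vc k t x + vp k t y \<le> A"
begin

definition "idx = (\<Union>k\<in>{1,2}. Cw k ` {..<Mc k} \<union> Pw k ` {..<Mp k})"

lemma finite_idx: "finite idx" unfolding idx_def by simp

sublocale gauss_letter idx \<sigma> by standard (rule finite_idx, rule \<sigma>_pos)

abbreviation "BigM \<equiv> PiM {..<n} (\<lambda>_. \<L>)"
abbreviation "books \<equiv> PiM {..<n} (\<lambda>_. \<Lambda>)"
abbreviation "noise \<equiv> PiM {..<n} (\<lambda>_. \<N>)"

text \<open>Messages start at 1, so m - 1 is divided by \<open>Mc k\<close>: the remainder is the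
  common index, the quotient the private one.\<close>

definition "ci k m = (m - 1) mod Mc k"
definition "pri k m = (m - 1) div Mc k"
definition "word k w m t = vc k t (w t (Cw k (ci k m))) + vp k t (w t (Pw k (pri k m)))"

lemma ci_less: "ci k m < Mc k" unfolding ci_def using M_pos by simp

lemma pri_less: "m \<in> {1..M} \<Longrightarrow> M \<le> Mc k * Mp k \<Longrightarrow> pri k m < Mp k"
  unfolding pri_def using M_pos by (intro less_mult_imp_div_less) (auto simp: mult.commute)

lemma ci_pri_inj: "m \<ge> 1 \<Longrightarrow> m' \<ge> 1 \<Longrightarrow> ci k m = ci k m' \<Longrightarrow> pri k m = pri k m' \<Longrightarrow> m = m'"
  unfolding ci_def pri_def by (metis div_mult_mod_eq le_add_diff_inverse)

lemma idx_mem: "k \<in> {1,2} \<Longrightarrow> c < Mc k \<Longrightarrow> Cw k c \<in> idx" "k \<in> {1,2} \<Longrightarrow> p < Mp k \<Longrightarrow> Pw k p \<in> idx"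
  unfolding idx_def by auto

lemma v_integrable: "integrable gauss (vc k t)" "integrable gauss (vp k t)"
proof -
  interpret G: prob_space gauss by (rule prob_gauss)
  have "vc k t x \<le> A" "vp k t x \<le> A" for x using vb(1,2,3)[of k t] by (smt (verit))+
  then show "integrable gauss (vc k t)" "integrable gauss (vp k t)"
    using vb vm by (auto intro!: G.integrable_const_bound[where B=A])
qed

definition "viol k a m = {w \<in> space BigM. real n * a * A < (\<Sum>t<n. vc k t (fst (w t) (Cw k (ci k m))) + vp k t (fst (w t) (Pw k (pri k m))))}"

text \<open>Chebyshev's inequality for the negated letters. The slack d between the expected and the
  permitted mean makes violations rare, with A^2 as second moment bound.\<close>

lemma violation:
  assumes k: "k \<in> {1,2}" and m: "pri k m < Mp k" and d: "d > 0"
    and mean: "(\<Sum>t<n. (\<integral>x. vc k t x \<partial>gauss) + (\<integral>x. vp k t x \<partial>gauss)) \<le> real n * a * A - real n * d"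
  shows "viol k a m \<in> sets BigM" "measure BigM (viol k a m) \<le> A\<^sup>2 / (real n * d\<^sup>2)"
proof -
  let ?l = "\<lambda>t p. - (vc k t (fst p (Cw k (ci k m))) + vp k t (fst p (Pw k (pri k m))))"
  interpret L: prob_space \<L> by (rule prob_L)
  have I: "Cw k (ci k m) \<in> idx" "Pw k (pri k m) \<in> idx" using idx_mem[OF k] ci_less m by auto
  note vm[measurable] I[THEN coord_measurable, measurable]
  have lm: "?l t \<in> borel_measurable \<L>" for t by measurable
  have lb: "(?l t p)\<^sup>2 \<le> A\<^sup>2" for t p
  proof -
    have "0 \<le> vc k t (fst p (Cw k (ci k m))) + vp k t (fst p (Pw k (pri k m)))" using vb by (simp add: add_nonneg_nonneg)
    then show ?thesis unfolding power2_minus by (intro power_mono vb(3))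
  qed
  have lb': "\<bar>?l t p\<bar> \<le> A" for t p
    using lb[of t p] A_nonneg abs_le_square_iff[of "?l t p" A] by simp
  have li: "integrable \<L> (?l t)" for t
    by (rule L.integrable_const_bound[where B=A]) (use lb' lm in auto)
  have li2: "integrable \<L> (\<lambda>p. (?l t p)\<^sup>2)" for t
    by (rule L.integrable_const_bound[where B="A\<^sup>2"]) (use lb lm in auto)
  have "(\<integral>p. (?l t p)\<^sup>2 \<partial>\<L>) \<le> (\<integral>p. A\<^sup>2 \<partial>\<L>)" for t by (rule integral_mono[OF li2 _ lb]) simp
  then have l2: "(\<integral>p. (?l t p)\<^sup>2 \<partial>\<L>) \<le> A\<^sup>2" for t using L.prob_space by simp
  have mean1: "(\<integral>p. ?l t p \<partial>\<L>) = - ((\<integral>x. vc k t x \<partial>gauss) + (\<integral>x. vp k t x \<partial>gauss))" for t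
    using coord_integral[OF I(1) v_integrable(1)[of k t]] coord_integral[OF I(2) v_integrable(2)[of k t]] by simp
  have "- (real n * a * A) \<le> (\<Sum>t<n. (\<integral>p. ?l t p \<partial>\<L>)) - real n * d"
    unfolding mean1 sum_negf using mean by simp
  from chebyshev_sum[OF prob_L li li2 l2 n_pos d this]
  have "measure BigM {w \<in> space BigM. (\<Sum>t<n. ?l t (w t)) < - (real n * a * A)} \<le> A\<^sup>2 / (real n * d\<^sup>2)" .
  moreover have "{w \<in> space BigM. (\<Sum>t<n. ?l t (w t)) < - (real n * a * A)} = viol k a m"
    unfolding viol_def sum_negf by simp
  ultimately show "measure BigM (viol k a m) \<le> A\<^sup>2 / (real n * d\<^sup>2)" by simp
  have "(\<lambda>w. \<Sum>t<n. ?l t (w t)) \<in> borel_measurable BigM"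
  proof (rule borel_measurable_sum)
    fix t assume t: "t \<in> {..<n}"
    have "(\<lambda>w. w t) \<in> measurable BigM \<L>" by (rule measurable_component_singleton[OF t])
    from measurable_compose[OF this lm] show "(\<lambda>w. ?l t (w t)) \<in> borel_measurable BigM" .
  qed
  then have "(\<lambda>w. - (\<Sum>t<n. ?l t (w t))) \<in> borel_measurable BigM" by simp
  then show "viol k a m \<in> sets BigM" unfolding viol_def sum_negf by simp
qed

text \<open>Besides decoding failures, \<open>Bad\<close> contains violations of the input
  constraint by either user: zeroing an invalid codeword would change the signal at this receiver
  even when it belongs to the interferer.\<close>

lemma receiver_code:
  fixes i j :: nat and hdir hc :: real
  assumes ij: "i \<in> {1,2}" "j \<in> {1,2}" "i \<noteq> j" and h: "0 \<le> hdir" "0 \<le> hc"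
    and M: "M \<le> Mc i * Mp i" "M' \<le> Mc j * Mp j" and d: "d > 0"
    and mean: "(\<Sum>t<n. (\<integral>x. vc i t x \<partial>gauss) + (\<integral>x. vp i t x \<partial>gauss)) \<le> real n * ai * A - real n * d"
      "(\<Sum>t<n. (\<integral>x. vc j t x \<partial>gauss) + (\<integral>x. vp j t x \<partial>gauss)) \<le> real n * aj * A - real n * d"
  defines "s1 \<equiv> \<lambda>t x. hdir * vc i t x" and "s2 \<equiv> \<lambda>t x. hc * vc j t x" and "r1 \<equiv> \<lambda>t x. hdir * vp i t x" and "r2 \<equiv> \<lambda>t x. hc * vp j t x"
  assumes C: "\<And>t. 4 * lnsq (mac0 \<sigma> (r2 t)) \<le> C" "\<And>t. 4 * lnsq (mac1 \<sigma> (r1 t) (r2 t)) \<le> C" "\<And>t. 4 * lnsq (mac2 \<sigma> (s1 t) (r1 t) (r2 t)) \<le> C"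
      "\<And>t. 4 * lnsq (mac2 \<sigma> (s2 t) (r1 t) (r2 t)) \<le> C" "\<And>t. 4 * lnsq (mac12 \<sigma> (s1 t) (s2 t) (r1 t) (r2 t)) \<le> C"
    and \<gamma>1: "\<gamma>1 \<le> (\<Sum>t<n. dent (mac2 \<sigma> (s1 t) (r1 t) (r2 t)) - dent (mac1 \<sigma> (r1 t) (r2 t))) - real n * d"
    and \<gamma>2: "\<gamma>2 \<le> (\<Sum>t<n. dent (mac2 \<sigma> (s2 t) (r1 t) (r2 t)) - dent (mac1 \<sigma> (r1 t) (r2 t))) - real n * d"
    and \<gamma>12: "\<gamma>12 \<le> (\<Sum>t<n. dent (mac12 \<sigma> (s1 t) (s2 t) (r1 t) (r2 t)) - dent (mac1 \<sigma> (r1 t) (r2 t))) - real n * d"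
    and \<gamma>p: "\<gamma>p \<le> (\<Sum>t<n. dent (mac1 \<sigma> (r1 t) (r2 t)) - dent (mac0 \<sigma> (r2 t))) - real n * d"
    and e: "2 * (A\<^sup>2 / (real n * d\<^sup>2)) + (4 * (C / (real n * d\<^sup>2))
     + real (Mc i - 1) * exp (- \<gamma>1) + real (Mc j - 1) * exp (- \<gamma>2)
     + real (Mc i - 1) * real (Mc j - 1) * exp (- \<gamma>12) + real (Mp i - 1) * exp (- \<gamma>p)) \<le> e"
  obtains Bad G where
    "\<And>m m'. m \<in> {1..M} \<Longrightarrow> m' \<in> {1..M'} \<Longrightarrow> Bad m m' \<in> sets (books \<Otimes>\<^sub>M noise)"
    "\<And>m m'. m \<in> {1..M} \<Longrightarrow> m' \<in> {1..M'} \<Longrightarrow> measure (books \<Otimes>\<^sub>M noise) (Bad m m') \<le> e"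
    "\<And>\<omega> m m' z. \<omega> \<in> space books \<Longrightarrow> z \<in> space noise \<Longrightarrow> m \<in> {1..M} \<Longrightarrow> m' \<in> {1..M'} \<Longrightarrow> (\<omega>, z) \<notin> Bad m m' \<Longrightarrow>
       good_word A ai n (word i \<omega> m) \<and> good_word A aj n (word j \<omega> m') \<and>
       G \<omega> (\<lambda>t\<in>{..<n}. hdir * word i \<omega> m t + hc * word j \<omega> m' t + z t) = m"
    "\<And>\<omega>. valid_decoder n (G \<omega>)"
proof -
  define b where "b = (hdir + hc) * A"
  have vA: "vc k t x \<le> A" "vp k t x \<le> A" for k t x using vb(1,2,3)[of k t] by (smt (verit))+
  have hv: "\<bar>hdir * vc k t x\<bar> \<le> b" "\<bar>hc * vc k t x\<bar> \<le> b" "\<bar>hdir * vp k t x\<bar> \<le> b" "\<bar>hc * vp k t x\<bar> \<le> b" for k t x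
    unfolding b_def using h vb vA by (auto simp: abs_mult intro!: mult_mono)
  have W: "wave b (s1 t)" "wave b (s2 t)" "wave b (r1 t)" "wave b (r2 t)" for t
    unfolding wave_def s1_def s2_def r1_def r2_def using hv vm by (auto intro!: borel_measurable_times)
  let ?pass = "passes \<sigma> s1 s2 r1 r2 n \<gamma>1 \<gamma>2 \<gamma>12 \<gamma>p"
  let ?C1 = "Cw i ` {..<Mc i}" and ?C2 = "Cw j ` {..<Mc j}" and ?P1 = "Pw i ` {..<Mp i}"
  \<comment> \<open>The least message that passes together with some interfering common codeword.
    Outside \<open>Bad\<close> exactly one message passes, so the least one is the right one, and
    \<open>LEAST\<close> keeps the decoder total and measurable.\<close>
  define G where "G \<omega> y = (LEAST m. m \<in> {1..M} \<and> (\<exists>c<Mc j. ?pass y (\<lambda>t. \<omega> t (Cw i (ci i m))) (\<lambda>t. \<omega> t (Cw j c)) (\<lambda>t. \<omega> t (Pw i (pri i m)))))"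
    for \<omega> :: "nat \<Rightarrow> cx \<Rightarrow> real" and y
  define Ev where "Ev m m' = mac.error_event idx \<sigma> s1 s2 r1 r2 n (Cw i (ci i m)) (Cw j (ci j m')) (Pw i (pri i m)) (Pw j (pri j m')) ?C1 ?C2 ?P1 \<gamma>1 \<gamma>2 \<gamma>12 \<gamma>p
     \<union> (viol i ai m \<union> viol j aj m')" for m m'
  define Bad where "Bad m m' = pair_letters n -` Ev m m' \<inter> space (books \<Otimes>\<^sub>M noise)" for m m'
  have mc: "mac idx \<sigma> s1 s2 r1 r2 b n (Cw i (ci i m)) (Cw j (ci j m')) (Pw i (pri i m)) (Pw j (pri j m'))"
    if "m \<in> {1..M}" "m' \<in> {1..M'}" for m m'
    unfolding mac_def mac_axioms_def
    using gauss_letter_axioms W ij n_pos idx_mem ci_less pri_less[OF that(1) M(1)] pri_less[OF that(2) M(2)] by auto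
  have sub: "?C1 \<subseteq> idx" "?C2 \<subseteq> idx" "?P1 \<subseteq> idx" using idx_mem ij by auto
  have cards: "card ?C1 = Mc i" "card ?C2 = Mc j" "card ?P1 = Mp i" by (auto simp: card_image inj_on_def)
  have Ev: "Ev m m' \<in> sets BigM" "measure BigM (Ev m m') \<le> e" if mm: "m \<in> {1..M}" "m' \<in> {1..M'}" for m m'
  proof -
    interpret X: mac idx \<sigma> s1 s2 r1 r2 b n "Cw i (ci i m)" "Cw j (ci j m')" "Pw i (pri i m)" "Pw j (pri j m')" by (rule mc[OF mm])
    note v1 = violation[OF ij(1) pri_less[OF mm(1) M(1)] d mean(1)] and v2 = violation[OF ij(2) pri_less[OF mm(2) M(2)] d mean(2)]
    have ee: "X.error_event ?C1 ?C2 ?P1 \<gamma>1 \<gamma>2 \<gamma>12 \<gamma>p \<in> sets BigM" by (rule X.error_event_sets[OF sub])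
    show "Ev m m' \<in> sets BigM" unfolding Ev_def using ee v1 v2 by auto
    have "measure BigM (X.error_event ?C1 ?C2 ?P1 \<gamma>1 \<gamma>2 \<gamma>12 \<gamma>p) \<le> 4 * (C / (real n * d\<^sup>2))
     + real (card ?C1 - 1) * exp (- \<gamma>1) + real (card ?C2 - 1) * exp (- \<gamma>2)
     + real (card ?C1 - 1) * real (card ?C2 - 1) * exp (- \<gamma>12) + real (card ?P1 - 1) * exp (- \<gamma>p)"
      by (rule X.receiver_error[OF sub _ _ _ _ _ _ _ _ _ C d \<gamma>1 \<gamma>2 \<gamma>12 \<gamma>p])
         (use ci_less pri_less[OF mm(1) M(1)] ij in auto)
    moreover have "measure BigM (Ev m m') \<le> measure BigM (X.error_event ?C1 ?C2 ?P1 \<gamma>1 \<gamma>2 \<gamma>12 \<gamma>p) + (measure BigM (viol i ai m) + measure BigM (viol j aj m'))"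
      unfolding Ev_def by (intro order_trans[OF measure_Un_le] add_left_mono order_refl sets.Un ee v1(1) v2(1))
    ultimately have "measure BigM (Ev m m') \<le> (4 * (C / (real n * d\<^sup>2))
     + real (Mc i - 1) * exp (- \<gamma>1) + real (Mc j - 1) * exp (- \<gamma>2)
     + real (Mc i - 1) * real (Mc j - 1) * exp (- \<gamma>12) + real (Mp i - 1) * exp (- \<gamma>p)) + (A\<^sup>2 / (real n * d\<^sup>2) + A\<^sup>2 / (real n * d\<^sup>2))"
      unfolding cards using v1(2) v2(2) by (meson add_mono order_trans)
    then show "measure BigM (Ev m m') \<le> e" using e by argo
  qed
  have Bm: "Bad m m' \<in> sets (books \<Otimes>\<^sub>M noise)" "measure (books \<Otimes>\<^sub>M noise) (Bad m m') \<le> e" if mm: "m \<in> {1..M}" "m' \<in> {1..M'}" for m m'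
  proof -
    show "Bad m m' \<in> sets (books \<Otimes>\<^sub>M noise)" unfolding Bad_def by (rule measurable_sets[OF pair_letters_measurable Ev(1)[OF mm]])
    have "measure (books \<Otimes>\<^sub>M noise) (Bad m m') = measure (distr (books \<Otimes>\<^sub>M noise) BigM (pair_letters n)) (Ev m m')"
      unfolding Bad_def by (rule measure_distr[OF pair_letters_measurable Ev(1)[OF mm], symmetric])
    also have "distr (books \<Otimes>\<^sub>M noise) BigM (pair_letters n) = BigM" by (rule distr_pair_letters[OF prob_Lam prob_N])
    finally show "measure (books \<Otimes>\<^sub>M noise) (Bad m m') \<le> e" using Ev(2)[OF mm] by simp
  qed
  have dec: "good_word A ai n (word i \<omega> m) \<and> good_word A aj n (word j \<omega> m') \<and>
       G \<omega> (\<lambda>t\<in>{..<n}. hdir * word i \<omega> m t + hc * word j \<omega> m' t + z t) = m"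
    if wz: "\<omega> \<in> space books" "z \<in> space noise" and mm: "m \<in> {1..M}" "m' \<in> {1..M'}" and nb: "(\<omega>, z) \<notin> Bad m m'" for \<omega> m m' z
  proof -
    interpret X: mac idx \<sigma> s1 s2 r1 r2 b n "Cw i (ci i m)" "Cw j (ci j m')" "Pw i (pri i m)" "Pw j (pri j m')" by (rule mc[OF mm])
    define w where "w = pair_letters n (\<omega>, z)"
    have "(\<omega>, z) \<in> space (books \<Otimes>\<^sub>M noise)" using wz by (simp add: space_pair_measure)
    then have ws: "w \<in> space BigM" unfolding w_def by (rule measurable_space[OF pair_letters_measurable])
    have wE: "w \<notin> Ev m m'" using nb \<open>(\<omega>, z) \<in> space (books \<Otimes>\<^sub>M noise)\<close> unfolding Bad_def w_def by auto
    have wt: "w t = (\<omega> t, z t)" if "t < n" for t using that unfolding w_def pair_letters_def by simp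
    have S: "(\<Sum>t<n. vc k t (fst (w t) (Cw k (ci k l))) + vp k t (fst (w t) (Pw k (pri k l)))) = (\<Sum>t<n. word k \<omega> l t)" for k l
      by (rule sum.cong) (auto simp: wt word_def)
    have g: "good_word A ak n (word k \<omega> l)" if "w \<notin> viol k ak l" for k l ak
    proof -
      have "(\<Sum>t<n. word k \<omega> l t) \<le> real n * ak * A" using that ws unfolding viol_def by (simp add: S not_less)
      then show ?thesis unfolding good_word_def by (auto simp: word_def vb add_nonneg_nonneg)
    qed
    have gg: "good_word A ai n (word i \<omega> m)" "good_word A aj n (word j \<omega> m')" using g wE unfolding Ev_def by auto
    let ?y = "\<lambda>t\<in>{..<n}. hdir * word i \<omega> m t + hc * word j \<omega> m' t + z t"
    have o: "X.out t (\<omega> t, z t) = hdir * word i \<omega> m t + hc * word j \<omega> m' t + z t" for t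
      unfolding X.out_def word_def by (simp add: s1_def s2_def r1_def r2_def algebra_simps)
    have pc: "?pass (\<lambda>t. X.out t (w t)) (\<lambda>t. fst (w t) a) (\<lambda>t. fst (w t) e') (\<lambda>t. fst (w t) u)
      = ?pass ?y (\<lambda>t. \<omega> t a) (\<lambda>t. \<omega> t e') (\<lambda>t. \<omega> t u)" for a e' u
      by (rule passes_cong) (simp_all add: wt o)
    have nE: "w \<notin> X.error_event ?C1 ?C2 ?P1 \<gamma>1 \<gamma>2 \<gamma>12 \<gamma>p" using wE unfolding Ev_def by blast
    have tr: "?pass ?y (\<lambda>t. \<omega> t (Cw i (ci i m))) (\<lambda>t. \<omega> t (Cw j (ci j m'))) (\<lambda>t. \<omega> t (Pw i (pri i m)))"
      using nE ws unfolding X.error_event_def mem_Collect_eq pc by blast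
    have wr: "\<not> ?pass ?y (\<lambda>t. \<omega> t a) (\<lambda>t. \<omega> t e') (\<lambda>t. \<omega> t u)"
      if "a \<in> ?C1" "e' \<in> ?C2" "u \<in> ?P1" "(a, u) \<noteq> (Cw i (ci i m), Pw i (pri i m))" for a e' u
      using nE ws that unfolding X.error_event_def mem_Collect_eq pc by blast
    have "G \<omega> ?y = m" unfolding G_def
    proof (rule Least_equality)
      show "m \<in> {1..M} \<and> (\<exists>c<Mc j. ?pass ?y (\<lambda>t. \<omega> t (Cw i (ci i m))) (\<lambda>t. \<omega> t (Cw j c)) (\<lambda>t. \<omega> t (Pw i (pri i m))))"
        using mm tr ci_less by blast
      fix l assume l: "l \<in> {1..M} \<and> (\<exists>c<Mc j. ?pass ?y (\<lambda>t. \<omega> t (Cw i (ci i l))) (\<lambda>t. \<omega> t (Cw j c)) (\<lambda>t. \<omega> t (Pw i (pri i l))))"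
      then obtain c where c: "c < Mc j" "?pass ?y (\<lambda>t. \<omega> t (Cw i (ci i l))) (\<lambda>t. \<omega> t (Cw j c)) (\<lambda>t. \<omega> t (Pw i (pri i l)))" by blast
      have "(Cw i (ci i l), Pw i (pri i l)) = (Cw i (ci i m), Pw i (pri i m))"
      proof (rule ccontr)
        assume "(Cw i (ci i l), Pw i (pri i l)) \<noteq> (Cw i (ci i m), Pw i (pri i m))"
        then have "\<not> ?pass ?y (\<lambda>t. \<omega> t (Cw i (ci i l))) (\<lambda>t. \<omega> t (Cw j c)) (\<lambda>t. \<omega> t (Pw i (pri i l)))"
          using ci_less pri_less[of l M i] l M(1) c(1) by (intro wr) auto
        then show False using c(2) by simp
      qed
      then have "l = m" using ci_pri_inj[of l m i] l mm by auto
      then show "m \<le> l" by simp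
    qed
    then show ?thesis using gg by simp
  qed
  have vd: "valid_decoder n (G \<omega>)" for \<omega>
  proof -
    note passes_output_measurable[OF \<sigma>_pos W(1) W(2) W(3) W(4), measurable]
    have "Measurable.pred (PiM {..<n} (\<lambda>_. borel)) (\<lambda>y. m \<in> {1..M} \<and> (\<exists>c<Mc j. ?pass y (\<lambda>t. \<omega> t (Cw i (ci i m))) (\<lambda>t. \<omega> t (Cw j c)) (\<lambda>t. \<omega> t (Pw i (pri i m)))))" for m
      by measurable
    then show ?thesis unfolding valid_decoder_def G_def by (rule measurable_Least)
  qed
  show ?thesis by (rule that[OF Bm dec vd])
qed

end

section \<open>Message counts and the time-shared scheme\<close>

lemma num_msgs_pos: "num_msgs n R > 0"
proof -
  have "(0::real) < 2 powr (real n * R)" by simp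
  then have "0 < \<lceil>2 powr (real n * R)\<rceil>" by linarith
  then show ?thesis unfolding num_msgs_def by simp
qed

lemma num_msgs_real: "real (num_msgs n R) = of_int \<lceil>2 powr (real n * R)\<rceil>"
proof -
  have "(0::real) < 2 powr (real n * R)" by simp
  then have "0 \<le> \<lceil>2 powr (real n * R)\<rceil>" by linarith
  then show ?thesis unfolding num_msgs_def by simp
qed

text \<open>Counting only wrong messages removes the excess of the ceiling, so no constant appears
  in front. A rate of at most 0 leaves a single message and the count 0, which lets negative rates
  pass through all estimates.\<close>

lemma num_msgs_le: "real (num_msgs n R - 1) \<le> exp (real n * (R * ln 2))"
proof -
  have "real (num_msgs n R - 1) = real (num_msgs n R) - 1" using num_msgs_pos[of n R] by (simp add: of_nat_diff)
  also have "... \<le> 2 powr (real n * R)" unfolding num_msgs_real by linarith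
  also have "... = exp (real n * (R * ln 2))" by (simp add: powr_def mult_ac)
  finally show ?thesis .
qed

text \<open>The product of the two counts is an integer not below 2^(n (R + R')). Pairs of a common
  and a private codeword thus suffice to carry all messages of the sum rate.\<close>

lemma num_msgs_mult: "num_msgs n (R + R') \<le> num_msgs n R * num_msgs n R'"
proof -
  have nn: "0 \<le> real_of_int \<lceil>2 powr (real n * r)\<rceil>" for r
    unfolding num_msgs_real[symmetric] by simp
  have "2 powr (real n * (R + R')) = 2 powr (real n * R) * 2 powr (real n * R')"
    by (simp add: distrib_left powr_add)
  also have "... \<le> of_int \<lceil>2 powr (real n * R)\<rceil> * of_int \<lceil>2 powr (real n * R')\<rceil>"
    by (intro mult_mono le_of_int_ceiling nn) simp_all
  finally have "\<lceil>2 powr (real n * (R + R'))\<rceil> \<le> \<lceil>2 powr (real n * R)\<rceil> * \<lceil>2 powr (real n * R')\<rceil>"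
    by (simp add: ceiling_le_iff)
  then have "(of_int \<lceil>2 powr (real n * (R + R'))\<rceil> :: real) \<le> of_int (\<lceil>2 powr (real n * R)\<rceil> * \<lceil>2 powr (real n * R')\<rceil>)"
    by (simp only: of_int_le_iff)
  then have "real (num_msgs n (R + R')) \<le> real (num_msgs n R * num_msgs n R')"
    by (simp add: num_msgs_real)
  then show ?thesis by (simp only: of_nat_le_iff)
qed

text \<open>For the rate conditions the slack is spent three times: on the convergence of
  time-sharing averages, on Chebyshev's inequality at the true messages, and on exponential decay
  for the wrong ones.\<close>

lemma finite_slack:
  fixes S :: "(real \<times> real) set"
  assumes "finite S" "\<And>p. p \<in> S \<Longrightarrow> fst p < snd p"
  shows "\<exists>d>0. \<forall>p\<in>S. fst p + 3 * d \<le> snd p"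
  using assms
proof (induction S)
  case empty
  show ?case by (intro exI[of _ 1]) simp
next
  case (insert p S)
  then obtain d where d: "d > 0" "\<forall>p\<in>S. fst p + 3 * d \<le> snd p" by auto
  have p: "fst p < snd p" using insert by simp
  let ?d = "min d ((snd p - fst p) / 3)"
  have "?d > 0" using d p by simp
  moreover have "fst r + 3 * ?d \<le> snd r" if "r \<in> insert p S" for r
  proof -
    have *: "fst r + 3 * m \<le> snd r" if "m \<le> d" "m \<le> (snd p - fst p) / 3" for m
    proof (cases "r = p")
      case True
      then show ?thesis using that(2) by simp
    next
      case False
      then have "fst r + 3 * d \<le> snd r" using d(2) \<open>r \<in> insert p S\<close> by blast
      then show ?thesis using that(1) by linarith
    qed
    show ?thesis by (rule *[OF min.cobounded1 min.cobounded2])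
  qed
  ultimately show ?case by blast
qed

text \<open>In all these densities i is the receiver, j its interferer and s the time-sharing phase.
  In \<open>rx2\<close>, l is the user whose common letter is present besides the private
  ones.\<close>

definition rx0 where "rx0 \<sigma> h wp i j s = mac0 \<sigma> (\<lambda>x. h j i * wp s j x)"
definition rx1 where "rx1 \<sigma> h wp i j s = mac1 \<sigma> (\<lambda>x. h i i * wp s i x) (\<lambda>x. h j i * wp s j x)"
definition rx2 where "rx2 \<sigma> h wc wp i j l s = mac2 \<sigma> (\<lambda>x. h l i * wc s l x) (\<lambda>x. h i i * wp s i x) (\<lambda>x. h j i * wp s j x)"
definition rx12 where "rx12 \<sigma> h wc wp i j s = mac12 \<sigma> (\<lambda>x. h i i * wc s i x) (\<lambda>x. h j i * wc s j x) (\<lambda>x. h i i * wp s i x) (\<lambda>x. h j i * wp s j x)"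

lemma lnsq_nonneg: "0 \<le> lnsq f"
  unfolding lnsq_def by simp

lemma trivial_code:
  assumes "A \<ge> 0" "a1 \<ge> 0" "a2 \<ge> 0"
  shows "valid_encoder A a1 n M1 (\<lambda>_ _. 0)" "valid_encoder A a2 n M2 (\<lambda>_ _. 0)" "valid_decoder n (\<lambda>_. 0)"
  using assms unfolding valid_encoder_def valid_decoder_def by auto

lemma err_prob_nonneg: "0 \<le> err_prob \<sigma> n hdir hc M M' x x' g"
  unfolding err_prob_def by (intro divide_nonneg_nonneg sum_nonneg mult_nonneg_nonneg) auto

text \<open>The mean constraint is imposed on the time-sharing average, not on each phase. The rate
  conditions, one for each kind of confusion at a receiver, are averages too, since log-likelihoods
  are added up over the block.\<close>

lemma achievable_scheme:
  fixes h :: "nat \<Rightarrow> nat \<Rightarrow> real" and wc wp :: "nat \<Rightarrow> nat \<Rightarrow> real \<Rightarrow> real" and u :: "nat \<Rightarrow> real" and rc rp :: "nat \<Rightarrow> real"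
  assumes \<sigma>: "\<sigma> > 0" and A: "A \<ge> 0" and \<alpha>: "0 \<le> \<alpha> 1" "0 \<le> \<alpha> 2" and h: "\<And>k l. k \<in> {1,2} \<Longrightarrow> l \<in> {1,2} \<Longrightarrow> 0 \<le> h k l"
    and u: "\<And>s. 0 \<le> u s" "(\<Sum>s<J. u s) = 1"
    and wm: "\<And>s k. wc s k \<in> borel_measurable borel" "\<And>s k. wp s k \<in> borel_measurable borel"
    and wb: "\<And>s k x. 0 \<le> wc s k x" "\<And>s k x. 0 \<le> wp s k x" "\<And>s k x y. wc s k x + wp s k y \<le> A"
    and mean: "\<And>i. i \<in> {1,2} \<Longrightarrow> (\<Sum>s<J. u s * ((\<integral>x. wc s i x \<partial>gauss) + (\<integral>x. wp s i x \<partial>gauss))) < \<alpha> i * A"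
    and rate: "\<And>i j. i \<in> {1,2} \<Longrightarrow> j \<in> {1,2} \<Longrightarrow> i \<noteq> j \<Longrightarrow>
        rc i * ln 2 < (\<Sum>s<J. u s * (dent (rx2 \<sigma> h wc wp i j i s) - dent (rx1 \<sigma> h wp i j s)))"
      "\<And>i j. i \<in> {1,2} \<Longrightarrow> j \<in> {1,2} \<Longrightarrow> i \<noteq> j \<Longrightarrow>
        rc j * ln 2 < (\<Sum>s<J. u s * (dent (rx2 \<sigma> h wc wp i j j s) - dent (rx1 \<sigma> h wp i j s)))"
      "\<And>i j. i \<in> {1,2} \<Longrightarrow> j \<in> {1,2} \<Longrightarrow> i \<noteq> j \<Longrightarrow>
        (rc i + rc j) * ln 2 < (\<Sum>s<J. u s * (dent (rx12 \<sigma> h wc wp i j s) - dent (rx1 \<sigma> h wp i j s)))"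
      "\<And>i j. i \<in> {1,2} \<Longrightarrow> j \<in> {1,2} \<Longrightarrow> i \<noteq> j \<Longrightarrow>
        rp i * ln 2 < (\<Sum>s<J. u s * (dent (rx1 \<sigma> h wp i j s) - dent (rx0 \<sigma> h wp i j s)))"
  shows "achievable \<sigma> A \<alpha> h (rc 1 + rp 1) (rc 2 + rp 2)"
proof -
  obtain q :: "nat \<Rightarrow> nat \<Rightarrow> nat" where q: "\<And>n t. q n t < J"
    "\<And>D :: nat \<Rightarrow> real. (\<lambda>n. (\<Sum>t<n. D (q n t)) / real n) \<longlonglongrightarrow> (\<Sum>s<J. u s * D s)"
    using time_sharing_sequence[OF u] by blast
  define av where "av D = (\<Sum>s<J. u s * D s)" for D :: "nat \<Rightarrow> real"
  define D1 where "D1 i j s = dent (rx2 \<sigma> h wc wp i j i s) - dent (rx1 \<sigma> h wp i j s)" for i j s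
  define D2 where "D2 i j s = dent (rx2 \<sigma> h wc wp i j j s) - dent (rx1 \<sigma> h wp i j s)" for i j s
  define D3 where "D3 i j s = dent (rx12 \<sigma> h wc wp i j s) - dent (rx1 \<sigma> h wp i j s)" for i j s
  define D4 where "D4 i j s = dent (rx1 \<sigma> h wp i j s) - dent (rx0 \<sigma> h wp i j s)" for i j s
  define E where "E i s = (\<integral>x. wc s i x \<partial>gauss) + (\<integral>x. wp s i x \<partial>gauss)" for i s
  define P where "P i j = {(av (E i), \<alpha> i * A), (rc i * ln 2, av (D1 i j)), (rc j * ln 2, av (D2 i j)),
     ((rc i + rc j) * ln 2, av (D3 i j)), (rp i * ln 2, av (D4 i j))}" for i j
  have m: "av (E i) < \<alpha> i * A" if "i \<in> {1,2}" for i
    unfolding av_def E_def by (rule mean[OF that])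
  have r: "rc i * ln 2 < av (D1 i j)" "rc j * ln 2 < av (D2 i j)" "(rc i + rc j) * ln 2 < av (D3 i j)" "rp i * ln 2 < av (D4 i j)"
    if "i \<in> {1,2}" "j \<in> {1,2}" "i \<noteq> j" for i j
    unfolding av_def D1_def D2_def D3_def D4_def by (rule rate[OF that])+
  have Plt: "fst p < snd p" if p: "p \<in> P i j" and ij: "i \<in> {1,2}" "j \<in> {1,2}" "i \<noteq> j" for p i j
  proof -
    note f = m[OF ij(1)] r[OF ij]
    from p consider "p = (av (E i), \<alpha> i * A)" | "p = (rc i * ln 2, av (D1 i j))" | "p = (rc j * ln 2, av (D2 i j))"
      | "p = ((rc i + rc j) * ln 2, av (D3 i j))" | "p = (rp i * ln 2, av (D4 i j))" unfolding P_def by blast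
    then show ?thesis by cases (simp_all only: fst_conv snd_conv f)
  qed
  have fP: "finite (P 1 2 \<union> P 2 1)" unfolding P_def by (intro finite_UnI finite.insertI finite.emptyI)
  have lP: "fst p < snd p" if "p \<in> P 1 2 \<union> P 2 1" for p
    using that
  proof
    assume "p \<in> P 1 2"
    then show ?thesis by (rule Plt) simp_all
  next
    assume "p \<in> P 2 1"
    then show ?thesis by (rule Plt) simp_all
  qed
  have exd: "\<exists>d>0. \<forall>p\<in>P 1 2 \<union> P 2 1. fst p + 3 * d \<le> snd p"
    by (rule finite_slack[OF fP]) (rule lP)
  obtain d where d: "d > 0" and d': "\<forall>p\<in>P 1 2 \<union> P 2 1. fst p + 3 * d \<le> snd p"
    using exd by (elim exE conjE)
  note d = d d'[rule_format]
  have sl: "av (E i) + 3 * d \<le> \<alpha> i * A" "rc i * ln 2 + 3 * d \<le> av (D1 i j)" "rc j * ln 2 + 3 * d \<le> av (D2 i j)"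
    "(rc i + rc j) * ln 2 + 3 * d \<le> av (D3 i j)" "rp i * ln 2 + 3 * d \<le> av (D4 i j)" if "(i, j) \<in> {(1::nat, 2::nat), (2, 1)}" for i j
  proof -
    have "fst p + 3 * d \<le> snd p" if "p \<in> P i j" for p
      by (rule d(2)) (use \<open>(i, j) \<in> {(1, 2), (2, 1)}\<close> that in blast)
    note this[unfolded P_def]
    from this[of "(av (E i), \<alpha> i * A)"] this[of "(rc i * ln 2, av (D1 i j))"] this[of "(rc j * ln 2, av (D2 i j))"]
      this[of "((rc i + rc j) * ln 2, av (D3 i j))"] this[of "(rp i * ln 2, av (D4 i j))"]
    show "av (E i) + 3 * d \<le> \<alpha> i * A" "rc i * ln 2 + 3 * d \<le> av (D1 i j)" "rc j * ln 2 + 3 * d \<le> av (D2 i j)"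
    "(rc i + rc j) * ln 2 + 3 * d \<le> av (D3 i j)" "rp i * ln 2 + 3 * d \<le> av (D4 i j)" by simp_all
  qed
  \<comment> \<open>There are finitely many phases, so one second moment bound serves all
    instants.\<close>
  define C where "C = (\<Sum>s<J. \<Sum>(i, j)\<in>{(1, 2), (2, 1)}. 4 * (lnsq (rx0 \<sigma> h wp i j s) + lnsq (rx1 \<sigma> h wp i j s) + lnsq (rx2 \<sigma> h wc wp i j i s)
     + lnsq (rx2 \<sigma> h wc wp i j j s) + lnsq (rx12 \<sigma> h wc wp i j s)))"
  have C: "4 * lnsq (rx0 \<sigma> h wp i j s) \<le> C" "4 * lnsq (rx1 \<sigma> h wp i j s) \<le> C" "4 * lnsq (rx2 \<sigma> h wc wp i j i s) \<le> C"
     "4 * lnsq (rx2 \<sigma> h wc wp i j j s) \<le> C" "4 * lnsq (rx12 \<sigma> h wc wp i j s) \<le> C" if ij: "(i, j) \<in> {(1, 2), (2, 1)}" and s: "s < J" for i j s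
  proof -
    let ?g = "\<lambda>s (i, j). 4 * (lnsq (rx0 \<sigma> h wp i j s) + lnsq (rx1 \<sigma> h wp i j s) + lnsq (rx2 \<sigma> h wc wp i j i s)
     + lnsq (rx2 \<sigma> h wc wp i j j s) + lnsq (rx12 \<sigma> h wc wp i j s))"
    have nn: "0 \<le> ?g s z" for s z by (cases z) (simp add: lnsq_nonneg)
    have "?g s (i, j) \<le> (\<Sum>z\<in>{(1, 2), (2, 1)}. ?g s z)" by (rule member_le_sum) (use ij nn in auto)
    also have "... \<le> C" unfolding C_def by (rule member_le_sum[where f="\<lambda>s. \<Sum>z\<in>{(1, 2), (2, 1)}. ?g s z"]) (use s nn in \<open>auto intro!: sum_nonneg\<close>)
    finally have "?g s (i, j) \<le> C" .
    moreover note lnsq_nonneg[of "rx0 \<sigma> h wp i j s"] lnsq_nonneg[of "rx1 \<sigma> h wp i j s"] lnsq_nonneg[of "rx2 \<sigma> h wc wp i j i s"]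
      lnsq_nonneg[of "rx2 \<sigma> h wc wp i j j s"] lnsq_nonneg[of "rx12 \<sigma> h wc wp i j s"]
    ultimately show "4 * lnsq (rx0 \<sigma> h wp i j s) \<le> C" "4 * lnsq (rx1 \<sigma> h wp i j s) \<le> C" "4 * lnsq (rx2 \<sigma> h wc wp i j i s) \<le> C"
     "4 * lnsq (rx2 \<sigma> h wc wp i j j s) \<le> C" "4 * lnsq (rx12 \<sigma> h wc wp i j s) \<le> C" by auto
  qed
  \<comment> \<open>Block lengths at which the time-sharing averages have nearly converged:
    thresholds may be placed 2 d below the limits and still leave d per letter for Chebyshev's
    inequality.\<close>
  define good where "good n \<longleftrightarrow> n > 0 \<and> (\<forall>(i, j)\<in>{(1, 2), (2, 1)}. (\<Sum>t<n. E i (q n t)) \<le> real n * \<alpha> i * A - real n * d \<and>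
     real n * (av (D1 i j) - 2 * d) \<le> (\<Sum>t<n. D1 i j (q n t)) - real n * d \<and>
     real n * (av (D2 i j) - 2 * d) \<le> (\<Sum>t<n. D2 i j (q n t)) - real n * d \<and>
     real n * (av (D3 i j) - 2 * d) \<le> (\<Sum>t<n. D3 i j (q n t)) - real n * d \<and>
     real n * (av (D4 i j) - 2 * d) \<le> (\<Sum>t<n. D4 i j (q n t)) - real n * d)" for n
  have ev: "\<forall>\<^sub>F n in sequentially. good n"
  proof -
    have lo: "\<forall>\<^sub>F n in sequentially. real n * (av D - 2 * d) \<le> (\<Sum>t<n. D (q n t)) - real n * d" for D
    proof -
      have "\<forall>\<^sub>F n in sequentially. av D - d < (\<Sum>t<n. D (q n t)) / real n"
        by (rule order_tendstoD(1)[OF q(2)[of D]]) (use d in \<open>simp add: av_def\<close>)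
      then show ?thesis using eventually_gt_at_top[of 0]
        by eventually_elim (simp add: field_simps)
    qed
    have hi: "\<forall>\<^sub>F n in sequentially. (\<Sum>t<n. E i (q n t)) \<le> real n * \<alpha> i * A - real n * d" if "(i, j) \<in> {(1::nat, 2::nat), (2, 1)}" for i j
    proof -
      have "\<forall>\<^sub>F n in sequentially. (\<Sum>t<n. E i (q n t)) / real n < \<alpha> i * A - d"
        by (rule order_tendstoD(2)[OF q(2)[of "E i"]]) (use d sl(1)[OF that] in \<open>simp add: av_def\<close>)
      then show ?thesis using eventually_gt_at_top[of 0]
        by eventually_elim (simp add: field_simps)
    qed
    have 1: "\<forall>\<^sub>F n in sequentially. (\<Sum>t<n. E i (q n t)) \<le> real n * \<alpha> i * A - real n * d \<and>
     real n * (av (D1 i j) - 2 * d) \<le> (\<Sum>t<n. D1 i j (q n t)) - real n * d \<and>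
     real n * (av (D2 i j) - 2 * d) \<le> (\<Sum>t<n. D2 i j (q n t)) - real n * d \<and>
     real n * (av (D3 i j) - 2 * d) \<le> (\<Sum>t<n. D3 i j (q n t)) - real n * d \<and>
     real n * (av (D4 i j) - 2 * d) \<le> (\<Sum>t<n. D4 i j (q n t)) - real n * d" if "(i, j) \<in> {(1::nat, 2::nat), (2, 1)}" for i j
      by (rule eventually_conj[OF hi[OF that] eventually_conj[OF lo eventually_conj[OF lo eventually_conj[OF lo lo]]]])
    have "(1::nat, 2::nat) \<in> {(1, 2), (2, 1)}" "(2::nat, 1::nat) \<in> {(1, 2), (2, 1)}" by simp_all
    from 1[OF this(1)] 1[OF this(2)] eventually_gt_at_top[of "0::nat"] show ?thesis
      by eventually_elim (unfold good_def, blast)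
  qed
  define e where "e n = 2 * (A\<^sup>2 / (real n * d\<^sup>2)) + (4 * (C / (real n * d\<^sup>2)) + 4 * exp (- (real n * d))) + 1 / real n" for n :: nat
  have elim: "e \<longlonglongrightarrow> 0"
  proof -
    have 1: "(\<lambda>n. c / (real n * d\<^sup>2)) \<longlonglongrightarrow> 0" for c
    proof -
      have "(\<lambda>n. (c / d\<^sup>2) * (1 / real n)) \<longlonglongrightarrow> (c / d\<^sup>2) * 0" by (intro tendsto_mult tendsto_const lim_1_over_n)
      then show ?thesis by (simp add: mult.commute)
    qed
    have 2: "(\<lambda>n. exp (- (real n * d))) \<longlonglongrightarrow> 0"
    proof -
      have "filterlim (\<lambda>n. real n * d) at_top sequentially"
        using filterlim_tendsto_pos_mult_at_top[OF tendsto_const d(1) filterlim_real_sequentially] by (simp add: mult.commute)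
      then have "filterlim (\<lambda>n. - (real n * d)) at_bot sequentially" by (simp add: filterlim_uminus_at_bot)
      from filterlim_compose[OF exp_at_bot this] show ?thesis .
    qed
    have "e \<longlonglongrightarrow> 2 * 0 + (4 * 0 + 4 * 0) + 0" unfolding e_def
      by (intro tendsto_add tendsto_mult tendsto_const 1 2 lim_1_over_n)
    then show ?thesis by simp
  qed
  let ?M = "\<lambda>n k. num_msgs n (rc k + rp k)"
  have ex: "\<exists>x1 x2 g1 g2. valid_encoder A (\<alpha> 1) n (?M n 1) x1 \<and> valid_encoder A (\<alpha> 2) n (?M n 2) x2 \<and> valid_decoder n g1 \<and> valid_decoder n g2 \<and>
     (good n \<longrightarrow> err_prob \<sigma> n (h 1 1) (h 2 1) (?M n 1) (?M n 2) x1 x2 g1 \<le> 3 * e n \<and> err_prob \<sigma> n (h 2 2) (h 1 2) (?M n 2) (?M n 1) x2 x1 g2 \<le> 3 * e n)" for n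
  \<comment> \<open>\<open>achievable\<close> demands admissible codes at every n >= 1. The zero
    code serves the finitely many n that are not \<open>good\<close> and does not affect the
    limit.\<close>
  proof (cases "good n")
    case False
    then show ?thesis using trivial_code[OF A \<alpha>] by blast
  next
    case True
    then have n: "n > 0" by (simp add: good_def)
    interpret codebook \<sigma> A "\<lambda>k t. wc (q n t) k" "\<lambda>k t. wp (q n t) k" "\<lambda>k. num_msgs n (rc k)" "\<lambda>k. num_msgs n (rp k)" n
      by standard (use \<sigma> A n num_msgs_pos wm wb in auto)
    have eb: "2 * (A\<^sup>2 / (real n * d\<^sup>2)) + (4 * (C / (real n * d\<^sup>2))
     + real (num_msgs n (rc i) - 1) * exp (- (real n * (av (D1 i j) - 2 * d))) + real (num_msgs n (rc j) - 1) * exp (- (real n * (av (D2 i j) - 2 * d)))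
     + real (num_msgs n (rc i) - 1) * real (num_msgs n (rc j) - 1) * exp (- (real n * (av (D3 i j) - 2 * d))) + real (num_msgs n (rp i) - 1) * exp (- (real n * (av (D4 i j) - 2 * d)))) \<le> e n"
      if ij: "(i, j) \<in> {(1, 2), (2, 1)}" for i j
    proof -
      \<comment> \<open>Of the slack 3 d the threshold consumes 2 d; the remaining d becomes the
        exponent.\<close>
      have b: "real (num_msgs n r - 1) * exp (- (real n * (g - 2 * d))) \<le> exp (- (real n * d))" if "r * ln 2 + 3 * d \<le> g" for r g
      proof -
        have "real (num_msgs n r - 1) * exp (- (real n * (g - 2 * d))) \<le> exp (real n * (r * ln 2)) * exp (- (real n * (g - 2 * d)))"
          by (intro mult_right_mono num_msgs_le) simp
        also have "... = exp (real n * (r * ln 2 - g + 2 * d))" by (simp add: exp_add[symmetric] algebra_simps)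
        also have "... \<le> exp (real n * (- d))" using that by (intro exp_le_cancel_iff[THEN iffD2] mult_left_mono) auto
        finally show ?thesis by simp
      qed
      have b2: "real (num_msgs n r - 1) * real (num_msgs n r' - 1) * exp (- (real n * (g - 2 * d))) \<le> exp (- (real n * d))" if "(r + r') * ln 2 + 3 * d \<le> g" for r r' g
      proof -
        have "real (num_msgs n r - 1) * real (num_msgs n r' - 1) * exp (- (real n * (g - 2 * d))) \<le> (exp (real n * (r * ln 2)) * exp (real n * (r' * ln 2))) * exp (- (real n * (g - 2 * d)))"
          by (intro mult_right_mono mult_mono num_msgs_le) simp_all
        also have "... = exp (real n * ((r + r') * ln 2 - g + 2 * d))" by (simp add: exp_add[symmetric] algebra_simps)
        also have "... \<le> exp (real n * (- d))" using that by (intro exp_le_cancel_iff[THEN iffD2] mult_left_mono) auto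
        finally show ?thesis by simp
      qed
      have "0 \<le> 1 / real n" by simp
      then show ?thesis unfolding e_def
        using b[OF sl(2)[OF ij]] b[OF sl(3)[OF ij]] b2[OF sl(4)[OF ij]] b[OF sl(5)[OF ij]] by argo
    qed
    have epos: "e n > 0"
    proof -
      have "0 \<le> C" unfolding C_def by (intro sum_nonneg) (auto simp: lnsq_nonneg)
      then show ?thesis unfolding e_def using n d by (simp add: add_nonneg_pos)
    qed
    have rc: "thesis" if ij: "(i, j) \<in> {(1, 2), (2, 1)}"
      and that: "\<And>Bad G. (\<And>m m'. m \<in> {1..?M n i} \<Longrightarrow> m' \<in> {1..?M n j} \<Longrightarrow> Bad m m' \<in> sets (books \<Otimes>\<^sub>M noise)) \<Longrightarrow>
    (\<And>m m'. m \<in> {1..?M n i} \<Longrightarrow> m' \<in> {1..?M n j} \<Longrightarrow> measure (books \<Otimes>\<^sub>M noise) (Bad m m') \<le> e n) \<Longrightarrow>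
    (\<And>\<omega> m m' z. \<omega> \<in> space books \<Longrightarrow> z \<in> space noise \<Longrightarrow> m \<in> {1..?M n i} \<Longrightarrow> m' \<in> {1..?M n j} \<Longrightarrow> (\<omega>, z) \<notin> Bad m m' \<Longrightarrow>
       good_word A (\<alpha> i) n (word i \<omega> m) \<and> good_word A (\<alpha> j) n (word j \<omega> m') \<and>
       G \<omega> (\<lambda>t\<in>{..<n}. h i i * word i \<omega> m t + h j i * word j \<omega> m' t + z t) = m) \<Longrightarrow>
    (\<And>\<omega>. valid_decoder n (G \<omega>)) \<Longrightarrow> thesis" for i j thesis
    proof -
      have ji: "(j, i) \<in> {(1, 2), (2, 1)}" and ij2: "i \<in> {1,2}" "j \<in> {1,2}" "i \<noteq> j" using ij by auto
      have g: "(\<Sum>t<n. E k (q n t)) \<le> real n * \<alpha> k * A - real n * d" if "(k, l) \<in> {(1::nat, 2::nat), (2, 1)}" for k l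
        using True that unfolding good_def by auto
      have g': "real n * (av (D1 i j) - 2 * d) \<le> (\<Sum>t<n. D1 i j (q n t)) - real n * d"
        "real n * (av (D2 i j) - 2 * d) \<le> (\<Sum>t<n. D2 i j (q n t)) - real n * d"
        "real n * (av (D3 i j) - 2 * d) \<le> (\<Sum>t<n. D3 i j (q n t)) - real n * d"
        "real n * (av (D4 i j) - 2 * d) \<le> (\<Sum>t<n. D4 i j (q n t)) - real n * d"
        using True ij unfolding good_def by auto
      show thesis
        by (rule receiver_code[OF ij2 h[OF ij2(1,1)] h[OF ij2(2,1)] num_msgs_mult num_msgs_mult d(1)
            g[OF ij, unfolded E_def] g[OF ji, unfolded E_def]
            C[OF ij q(1), unfolded rx0_def rx1_def rx2_def rx12_def]
            g'[unfolded D1_def D2_def D3_def D4_def, unfolded rx0_def rx1_def rx2_def rx12_def]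
            eb[OF ij, unfolded D1_def D2_def D3_def D4_def, unfolded rx0_def rx1_def rx2_def rx12_def]])
           (rule that)
    qed
    obtain B1 G1 where 1: "\<And>m m'. m \<in> {1..?M n 1} \<Longrightarrow> m' \<in> {1..?M n 2} \<Longrightarrow> B1 m m' \<in> sets (books \<Otimes>\<^sub>M noise)"
    "\<And>m m'. m \<in> {1..?M n 1} \<Longrightarrow> m' \<in> {1..?M n 2} \<Longrightarrow> measure (books \<Otimes>\<^sub>M noise) (B1 m m') \<le> e n"
    "\<And>\<omega> m m' z. \<omega> \<in> space books \<Longrightarrow> z \<in> space noise \<Longrightarrow> m \<in> {1..?M n 1} \<Longrightarrow> m' \<in> {1..?M n 2} \<Longrightarrow> (\<omega>, z) \<notin> B1 m m' \<Longrightarrow>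
       good_word A (\<alpha> 1) n (word 1 \<omega> m) \<and> good_word A (\<alpha> 2) n (word 2 \<omega> m') \<and>
       G1 \<omega> (\<lambda>t\<in>{..<n}. h 1 1 * word 1 \<omega> m t + h 2 1 * word 2 \<omega> m' t + z t) = m"
    "\<And>\<omega>. valid_decoder n (G1 \<omega>)"
      by (rule rc[of 1 2]) (simp, blast)
    obtain B2 G2 where 2: "\<And>m m'. m \<in> {1..?M n 2} \<Longrightarrow> m' \<in> {1..?M n 1} \<Longrightarrow> B2 m m' \<in> sets (books \<Otimes>\<^sub>M noise)"
    "\<And>m m'. m \<in> {1..?M n 2} \<Longrightarrow> m' \<in> {1..?M n 1} \<Longrightarrow> measure (books \<Otimes>\<^sub>M noise) (B2 m m') \<le> e n"
    "\<And>\<omega> m m' z. \<omega> \<in> space books \<Longrightarrow> z \<in> space noise \<Longrightarrow> m \<in> {1..?M n 2} \<Longrightarrow> m' \<in> {1..?M n 1} \<Longrightarrow> (\<omega>, z) \<notin> B2 m m' \<Longrightarrow>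
       good_word A (\<alpha> 2) n (word 2 \<omega> m) \<and> good_word A (\<alpha> 1) n (word 1 \<omega> m') \<and>
       G2 \<omega> (\<lambda>t\<in>{..<n}. h 2 2 * word 2 \<omega> m t + h 1 2 * word 1 \<omega> m' t + z t) = m"
    "\<And>\<omega>. valid_decoder n (G2 \<omega>)"
      by (rule rc[of 2 1]) (simp, blast)
    have pb: "prob_space books"
    proof -
      interpret PL: prob_space \<Lambda> by (rule prob_Lam)
      interpret PB: product_prob_space "\<lambda>_::nat. \<Lambda>" "{..<n}" ..
      show ?thesis by (rule PB.prob_space_axioms)
    qed
    have "\<exists>x1 x2 g1 g2. valid_encoder A (\<alpha> 1) n (?M n 1) x1 \<and> valid_encoder A (\<alpha> 2) n (?M n 2) x2 \<and> valid_decoder n g1 \<and> valid_decoder n g2 \<and>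
     err_prob \<sigma> n (h 1 1) (h 2 1) (?M n 1) (?M n 2) x1 x2 g1 \<le> 3 * e n \<and> err_prob \<sigma> n (h 2 2) (h 1 2) (?M n 2) (?M n 1) x2 x1 g2 \<le> 3 * e n"
      by (rule derandomize[where \<Omega>=books and ?X1.0="word 1" and ?X2.0="word 2" and ?B1.0=B1 and ?B2.0=B2 and ?G1.0=G1 and ?G2.0=G2, unfolded noise_meas_eq,
           OF pb \<sigma> epos num_msgs_pos num_msgs_pos A \<alpha> 1(1,2) 2(1,2) 1(3) 2(3) 1(4) 2(4)])
    then show ?thesis by blast
  qed
  define Q where "Q n x1 x2 g1 g2 \<longleftrightarrow> valid_encoder A (\<alpha> 1) n (?M n 1) x1 \<and> valid_encoder A (\<alpha> 2) n (?M n 2) x2 \<and> valid_decoder n g1 \<and> valid_decoder n g2 \<and>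
     (good n \<longrightarrow> err_prob \<sigma> n (h 1 1) (h 2 1) (?M n 1) (?M n 2) x1 x2 g1 \<le> 3 * e n \<and> err_prob \<sigma> n (h 2 2) (h 1 2) (?M n 2) (?M n 1) x2 x1 g2 \<le> 3 * e n)"
    for n x1 x2 g1 g2
  have "\<forall>n. \<exists>x1 x2 g1 g2. Q n x1 x2 g1 g2" using ex unfolding Q_def by blast
  then obtain x1 x2 g1 g2 where Q: "\<And>n. Q n (x1 n) (x2 n) (g1 n) (g2 n)" by metis
  note code = Q[unfolded Q_def]
  have lim3: "(\<lambda>n. 3 * e n) \<longlonglongrightarrow> 0" using tendsto_mult[OF tendsto_const[of 3] elim] by simp
  show ?thesis unfolding achievable_def
  proof (rule exI[of _ x1], rule exI[of _ x2], rule exI[of _ g1], rule exI[of _ g2], intro conjI)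
    show "\<forall>n\<ge>1. valid_encoder A (\<alpha> 1) n (?M n 1) (x1 n) \<and> valid_encoder A (\<alpha> 2) n (?M n 2) (x2 n) \<and> valid_decoder n (g1 n) \<and> valid_decoder n (g2 n)"
      using code by blast
    show "(\<lambda>n. err_prob \<sigma> n (h 1 1) (h 2 1) (?M n 1) (?M n 2) (x1 n) (x2 n) (g1 n)) \<longlonglongrightarrow> 0"
      by (rule Lim_null_comparison[OF _ lim3]) (rule eventually_mono[OF ev], use code err_prob_nonneg in auto)
    show "(\<lambda>n. err_prob \<sigma> n (h 2 2) (h 1 2) (?M n 2) (?M n 1) (x2 n) (x1 n) (g2 n)) \<longlonglongrightarrow> 0"
      by (rule Lim_null_comparison[OF _ lim3]) (rule eventually_mono[OF ev], use code err_prob_nonneg in auto)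
  qed
qed

section \<open>Rates of one configuration\<close>

text \<open>For standard normal \<open>X\<close> the differential entropy of \<open>T X\<close> is \<open>ln (2 \<pi> e) / 2 + E (ln (T' X))\<close>, so the
  condition on \<open>T'\<close> says that \<open>rho t\<close> is the entropy power of \<open>T X\<close>.\<close>

definition is_quantile :: "real \<Rightarrow> (real \<Rightarrow> real) \<Rightarrow> bool" where
  "is_quantile t T \<longleftrightarrow> (\<exists>T'. (\<forall>x. (T has_real_derivative T' x) (at x)) \<and> continuous_on UNIV T' \<and> (\<forall>x. T' x > 0) \<and>
     integrable gauss (\<lambda>x. ln (T' x)) \<and> exp (2 * (\<integral>x. ln (T' x) \<partial>gauss)) = rho t) \<and>
     (\<forall>x. 0 \<le> T x \<and> T x \<le> 1) \<and> (\<integral>x. T x \<partial>gauss) \<le> t"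

lemma quantile_exists: "0 < t \<Longrightarrow> \<exists>T. is_quantile t T"
  unfolding is_quantile_def by (erule rho_quantile) blast

lemma quantile_bounds: "is_quantile t T \<Longrightarrow> 0 \<le> T x" "is_quantile t T \<Longrightarrow> T x \<le> 1" "is_quantile t T \<Longrightarrow> (\<integral>x. T x \<partial>gauss) \<le> t"
  unfolding is_quantile_def by auto

lemma quantile_measurable: "is_quantile t T \<Longrightarrow> T \<in> borel_measurable borel"
  unfolding is_quantile_def by (metis DERIV_all_continuous_on borel_measurable_continuous_onI)

lemma quantile_integral_nonneg: "is_quantile t T \<Longrightarrow> 0 \<le> (\<integral>x. T x \<partial>gauss)"
  by (intro integral_nonneg_AE AE_I2 quantile_bounds)

lemma entropy_power_rho:
  assumes f: "gdens f" and T: "is_quantile t T" and a: "a \<ge> 0"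
  shows "2 * pi * exp 1 * (rho t * a\<^sup>2) + exp (2 * dent f) \<le> exp (2 * dent (smooth (\<lambda>x. a * T x) f))"
proof -
  obtain T' where T': "\<And>x. (T has_real_derivative T' x) (at x)" "continuous_on UNIV T'" "\<And>x. T' x > 0"
     "integrable gauss (\<lambda>x. ln (T' x))" "exp (2 * (\<integral>x. ln (T' x) \<partial>gauss)) = rho t"
    using T unfolding is_quantile_def by blast
  have "\<bar>T x\<bar> \<le> 1" for x using quantile_bounds(1,2)[OF T, of x] by simp
  from entropy_power_inequality[OF f T'(1-3) this T'(4) a] show ?thesis unfolding T'(5) .
qed

lemma rho_nonneg: "0 \<le> rho t"
  unfolding rho_def Let_def by simp

text \<open>With N for entropy power, N(V + W) >= N(V) + N(W) gives h(V + W) - h(W) >= ln (1 + N(V)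
  / N(W)) / 2. This decreases in N(W), so the upper bound \<sigma>^2 2^(2 C) may be inserted for
  N(W).\<close>

lemma rate_bound:
  assumes \<sigma>: "\<sigma> > 0" and P: "P \<ge> 0" and g: "2 * pi * exp 1 * P + exp (2 * dent f) \<le> exp (2 * dent g)"
    and f: "dent f \<le> ln (2 * pi * exp 1 * \<sigma>\<^sup>2) / 2 + ln 2 * C"
  shows "ln 2 * (1/2 * log 2 (1 + P / (\<sigma>\<^sup>2 * 2 powr (2 * C)))) \<le> dent g - dent f"
proof -
  define N where "N = exp (2 * dent f)"
  have N: "N > 0" by (simp add: N_def)
  have "N \<le> exp (ln (2 * pi * exp 1 * \<sigma>\<^sup>2) + 2 * (ln 2 * C))"
    unfolding N_def using f by simp
  also have "... = 2 * pi * exp 1 * (\<sigma>\<^sup>2 * 2 powr (2 * C))"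
    using \<sigma> by (simp add: exp_add powr_def mult_ac)
  finally have N2: "N \<le> 2 * pi * exp 1 * (\<sigma>\<^sup>2 * 2 powr (2 * C))" .
  define Q where "Q = \<sigma>\<^sup>2 * 2 powr (2 * C)"
  have Q: "Q > 0" using \<sigma> by (simp add: Q_def)
  have "P / Q = 2 * pi * exp 1 * P / (2 * pi * exp 1 * Q)" by simp
  also have "... \<le> 2 * pi * exp 1 * P / N"
    by (rule divide_left_mono) (use N2 N P Q in \<open>auto simp: Q_def\<close>)
  finally have "1 + P / Q \<le> (2 * pi * exp 1 * P + N) / N" using N by (simp add: add_divide_distrib)
  also have "... \<le> exp (2 * dent g) / N" using g N unfolding N_def by (intro divide_right_mono) auto
  also have "... = exp (2 * (dent g - dent f))" unfolding N_def by (simp add: exp_diff right_diff_distrib)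
  finally have 1: "1 + P / Q \<le> exp (2 * (dent g - dent f))" .
  have "0 < 1 + P / Q" using P Q by (simp add: add_pos_nonneg)
  then have "ln (1 + P / Q) \<le> 2 * (dent g - dent f)" using 1 by (metis exp_gt_zero ln_exp ln_le_cancel_iff)
  then show ?thesis unfolding Q_def[symmetric] log_def by simp
qed

text \<open>The factor c shrinks the letters, but peak and mean of the interference are still
  bounded by their values at c = 1, which keeps c out of the \<open>Cbar\<close> arguments of
  \<open>F\<close>. \<open>tt\<close> relates mean to peak of the combined private amplitude, the
  noise for the common messages; for the private message only the interferer's private part remains,
  with ratio \<open>tj\<close>.\<close>

lemma config_rates:
  assumes \<sigma>: "\<sigma> > 0" and h: "hdir \<ge> 0" "hc \<ge> 0" and k: "ki \<ge> 0" "kj \<ge> 0" "ei \<ge> 0" "ej \<ge> 0" and c: "0 \<le> c" "c \<le> 1"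
    and t: "ti > 0" "tj > 0"
    and q: "is_quantile ti Ti" "is_quantile tj Tj" "is_quantile fi Vi" "is_quantile fj Vj"
    and tt: "hdir * ki + hc * kj > 0 \<Longrightarrow> tt > 0" "hdir * ki * ti + hc * kj * tj \<le> tt * (hdir * ki + hc * kj)"
  defines "s1 \<equiv> \<lambda>x. hdir * (c * ei * Vi x)" and "s2 \<equiv> \<lambda>x. hc * (c * ej * Vj x)"
    and "r1 \<equiv> \<lambda>x. hdir * (c * ki * Ti x)" and "r2 \<equiv> \<lambda>x. hc * (c * kj * Tj x)"
  shows "ln 2 * F \<sigma> 0 (hdir * (c * ki)) (hc * kj) 1 ti tj \<le> dent (mac1 \<sigma> r1 r2) - dent (mac0 \<sigma> r2)"
    "ln 2 * F \<sigma> 0 (hdir * (c * ei)) (hdir * ki + hc * kj) 1 fi tt \<le> dent (mac2 \<sigma> s1 r1 r2) - dent (mac1 \<sigma> r1 r2)"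
    "ln 2 * F \<sigma> 0 (hc * (c * ej)) (hdir * ki + hc * kj) 1 fj tt \<le> dent (mac2 \<sigma> s2 r1 r2) - dent (mac1 \<sigma> r1 r2)"
    "ln 2 * F \<sigma> (hdir * (c * ei)) (hc * (c * ej)) (hdir * ki + hc * kj) fi fj tt \<le> dent (mac12 \<sigma> s1 s2 r1 r2) - dent (mac1 \<sigma> r1 r2)"
proof -
  have eq: "s1 = (\<lambda>x. (hdir * (c * ei)) * Vi x)" "s2 = (\<lambda>x. (hc * (c * ej)) * Vj x)"
    "r1 = (\<lambda>x. (hdir * (c * ki)) * Ti x)" "r2 = (\<lambda>x. (hc * (c * kj)) * Tj x)"
    unfolding s1_def s2_def r1_def r2_def by (auto simp: mult.assoc)
  have nn: "0 \<le> hdir * (c * ei)" "0 \<le> hc * (c * ej)" "0 \<le> hdir * (c * ki)" "0 \<le> hc * (c * kj)" using h k c by auto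
  have ck: "c * x \<le> x" if "x \<ge> 0" for x using mult_right_mono[OF c(2) that] by simp
  have rm: "r1 \<in> borel_measurable borel" "r2 \<in> borel_measurable borel"
    unfolding r1_def r2_def using quantile_measurable[OF q(1)] quantile_measurable[OF q(2)] by auto
  have rb: "0 \<le> r1 x" "r1 x \<le> hdir * ki" "0 \<le> r2 x" "r2 x \<le> hc * kj" for x
  proof -
    show "0 \<le> r1 x" "0 \<le> r2 x" unfolding eq using nn quantile_bounds(1)[OF q(1), of x] quantile_bounds(1)[OF q(2), of x] by auto
    have "r1 x \<le> hdir * (c * ki) * 1" unfolding eq using nn quantile_bounds(2)[OF q(1), of x] by (intro mult_left_mono) auto
    also have "... \<le> hdir * ki" using ck[OF k(1)] h by (simp add: mult_left_mono)
    finally show "r1 x \<le> hdir * ki" .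
    have "r2 x \<le> hc * (c * kj) * 1" unfolding eq using nn quantile_bounds(2)[OF q(2), of x] by (intro mult_left_mono) auto
    also have "... \<le> hc * kj" using ck[OF k(2)] h by (simp add: mult_left_mono)
    finally show "r2 x \<le> hc * kj" .
  qed
  have ri: "(\<integral>x. r1 x \<partial>gauss) \<le> hdir * ki * ti" "(\<integral>x. r2 x \<partial>gauss) \<le> hc * kj * tj"
  proof -
    have "(\<integral>x. r1 x \<partial>gauss) = hdir * (c * ki) * (\<integral>x. Ti x \<partial>gauss)" unfolding eq by simp
    also have "... \<le> hdir * ki * ti"
      by (intro mult_mono mult_left_mono ck k h quantile_bounds(3)[OF q(1)] quantile_integral_nonneg[OF q(1)]) (use h k in auto)
    finally show "(\<integral>x. r1 x \<partial>gauss) \<le> hdir * ki * ti" .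
    have "(\<integral>x. r2 x \<partial>gauss) = hc * (c * kj) * (\<integral>x. Tj x \<partial>gauss)" unfolding eq by simp
    also have "... \<le> hc * kj * tj"
      by (intro mult_mono mult_left_mono ck k h quantile_bounds(3)[OF q(2)] quantile_integral_nonneg[OF q(2)]) (use h k in auto)
    finally show "(\<integral>x. r2 x \<partial>gauss) \<le> hc * kj * tj" .
  qed
  have a0: "amp_noise \<sigma> (0 + hc * kj) (0 + (\<integral>x. r2 x \<partial>gauss)) (mac0 \<sigma> r2)"
    unfolding mac0_def by (rule amp_noise_smooth[OF amp_noise_normal[OF \<sigma>] rm(2) rb(3,4)])
  have a1: "amp_noise \<sigma> (0 + hc * kj + hdir * ki) (0 + (\<integral>x. r2 x \<partial>gauss) + (\<integral>x. r1 x \<partial>gauss)) (mac1 \<sigma> r1 r2)"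
    unfolding mac1_def by (rule amp_noise_smooth[OF a0 rm(1) rb(1,2)])
  have a1': "amp_noise \<sigma> (hdir * ki + hc * kj) (0 + (\<integral>x. r2 x \<partial>gauss) + (\<integral>x. r1 x \<partial>gauss)) (mac1 \<sigma> r1 r2)"
    using a1 by (simp add: add.commute)
  have d0: "dent (mac0 \<sigma> r2) \<le> ln (2 * pi * exp 1 * \<sigma>\<^sup>2) / 2 + ln 2 * Cbar \<sigma> (hc * kj) tj"
    by (rule dent_le_Cbar[OF a0[unfolded add_0] \<sigma>]) (use h k t ri in \<open>auto simp: mult.commute\<close>)
  have d1: "dent (mac1 \<sigma> r1 r2) \<le> ln (2 * pi * exp 1 * \<sigma>\<^sup>2) / 2 + ln 2 * Cbar \<sigma> (hdir * ki + hc * kj) tt"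
    by (rule dent_le_Cbar[OF a1' \<sigma> _ tt(1)]) (use h k ri tt(2) in auto)
  have g0: "gdens (mac0 \<sigma> r2)" by (rule amp_noise_gdens[OF a0])
  have g1: "gdens (mac1 \<sigma> r1 r2)" by (rule amp_noise_gdens[OF a1])
  have e0: "2 * pi * exp 1 * (rho ti * (hdir * (c * ki))\<^sup>2) + exp (2 * dent (mac0 \<sigma> r2)) \<le> exp (2 * dent (mac1 \<sigma> r1 r2))"
    unfolding mac1_def eq(3) by (rule entropy_power_rho[OF g0 q(1) nn(3)])
  show "ln 2 * F \<sigma> 0 (hdir * (c * ki)) (hc * kj) 1 ti tj \<le> dent (mac1 \<sigma> r1 r2) - dent (mac0 \<sigma> r2)"
    using rate_bound[OF \<sigma> _ e0 d0] unfolding F_def by (simp add: rho_nonneg)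
  have e1: "2 * pi * exp 1 * (rho fi * (hdir * (c * ei))\<^sup>2) + exp (2 * dent (mac1 \<sigma> r1 r2)) \<le> exp (2 * dent (mac2 \<sigma> s1 r1 r2))"
    unfolding mac2_def eq(1) by (rule entropy_power_rho[OF g1 q(3) nn(1)])
  show "ln 2 * F \<sigma> 0 (hdir * (c * ei)) (hdir * ki + hc * kj) 1 fi tt \<le> dent (mac2 \<sigma> s1 r1 r2) - dent (mac1 \<sigma> r1 r2)"
    using rate_bound[OF \<sigma> _ e1 d1] unfolding F_def by (simp add: rho_nonneg)
  have e2: "2 * pi * exp 1 * (rho fj * (hc * (c * ej))\<^sup>2) + exp (2 * dent (mac1 \<sigma> r1 r2)) \<le> exp (2 * dent (mac2 \<sigma> s2 r1 r2))"
    unfolding mac2_def eq(2) by (rule entropy_power_rho[OF g1 q(4) nn(2)])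
  show "ln 2 * F \<sigma> 0 (hc * (c * ej)) (hdir * ki + hc * kj) 1 fj tt \<le> dent (mac2 \<sigma> s2 r1 r2) - dent (mac1 \<sigma> r1 r2)"
    using rate_bound[OF \<sigma> _ e2 d1] unfolding F_def by (simp add: rho_nonneg)
  have g2: "gdens (mac2 \<sigma> s2 r1 r2)" unfolding mac2_def
  proof (rule gdens_smooth[OF g1])
    show "s2 \<in> borel_measurable borel" unfolding s2_def using quantile_measurable[OF q(4)] by auto
    show "\<bar>s2 x\<bar> \<le> hc * (c * ej) * 1" for x
    proof -
      have "0 \<le> s2 x" unfolding eq by (intro mult_nonneg_nonneg[OF nn(2)] quantile_bounds(1)[OF q(4)])
      moreover have "s2 x \<le> hc * (c * ej) * 1" unfolding eq by (intro mult_left_mono[OF _ nn(2)] quantile_bounds(2)[OF q(4)])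
      ultimately show ?thesis by simp
    qed
  qed
  \<comment> \<open>With both common letters the entropy power inequality is applied twice, to the
    interfering letter first, so that the two powers add up.\<close>
  have e3: "2 * pi * exp 1 * (rho fi * (hdir * (c * ei))\<^sup>2) + exp (2 * dent (mac2 \<sigma> s2 r1 r2)) \<le> exp (2 * dent (mac12 \<sigma> s1 s2 r1 r2))"
    unfolding mac12_def eq(1) by (rule entropy_power_rho[OF g2 q(3) nn(1)])
  have e4: "2 * pi * exp 1 * (rho fi * (hdir * (c * ei))\<^sup>2 + rho fj * (hc * (c * ej))\<^sup>2) + exp (2 * dent (mac1 \<sigma> r1 r2)) \<le> exp (2 * dent (mac12 \<sigma> s1 s2 r1 r2))"
    using e2 e3 unfolding distrib_left by linarith
  show "ln 2 * F \<sigma> (hdir * (c * ei)) (hc * (c * ej)) (hdir * ki + hc * kj) fi fj tt \<le> dent (mac12 \<sigma> s1 s2 r1 r2) - dent (mac1 \<sigma> r1 r2)"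
    using rate_bound[OF \<sigma> _ e4 d1] unfolding F_def by (simp add: rho_nonneg)
qed

text \<open>Only the signal amplitudes move with c; the denominator contains a fixed value of
  \<open>Cbar\<close>, so this is the continuity of a logarithm.\<close>

lemma F_tendsto:
  assumes \<sigma>: "\<sigma> > 0" and c: "c \<longlonglongrightarrow> 1"
  shows "(\<lambda>n. F \<sigma> (x * (c n * a)) (y * (c n * b)) a3 t1 t2 t3) \<longlonglongrightarrow> F \<sigma> (x * a) (y * b) a3 t1 t2 t3"
proof -
  let ?D = "\<sigma>\<^sup>2 * 2 powr (2 * Cbar \<sigma> a3 t3)"
  let ?g = "\<lambda>c. 1 + (rho t1 * (x * (c * a))\<^sup>2 + rho t2 * (y * (c * b))\<^sup>2) / ?D"
  have D: "0 < ?D" using \<sigma> by simp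
  have "0 \<le> rho t1 * (x * (1 * a))\<^sup>2 + rho t2 * (y * (1 * b))\<^sup>2" by (simp add: rho_nonneg)
  then have pos: "0 < ?g 1" using D by (intro add_pos_nonneg divide_nonneg_pos) auto
  have "(\<lambda>n. ?g (c n)) \<longlonglongrightarrow> ?g 1"
    by (intro tendsto_add tendsto_divide tendsto_mult tendsto_power tendsto_const c) (use \<sigma> in simp)
  then have "(\<lambda>n. log 2 (?g (c n))) \<longlonglongrightarrow> log 2 (?g 1)"
    by (rule tendsto_log[OF tendsto_const]) (use pos in auto)
  then have "(\<lambda>n. 1/2 * log 2 (?g (c n))) \<longlonglongrightarrow> 1/2 * log 2 (?g 1)"
    by (rule tendsto_mult[OF tendsto_const])
  then show ?thesis unfolding F_def by simp
qed

section \<open>Rate splitting, scaling and the convex hull\<close>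

lemma F_nonneg: "0 \<le> F \<sigma> a1 a2 a3 t1 t2 t3"
proof -
  have "0 \<le> (rho t1 * a1\<^sup>2 + rho t2 * a2\<^sup>2) / (\<sigma>\<^sup>2 * 2 powr (2 * Cbar \<sigma> a3 t3))"
    by (intro divide_nonneg_nonneg add_nonneg_nonneg mult_nonneg_nonneg rho_nonneg) auto
  then show ?thesis unfolding F_def by (simp add: zero_le_log_cancel_iff)
qed

text \<open>Ensures in \<open>rate_splitting\<close> that the bound for one common message does not
  exceed the bound for the sum at the same receiver.\<close>

lemma F_mono:
  assumes "\<sigma> > 0"
  shows "F \<sigma> 0 a2 a3 t t2 t3 \<le> F \<sigma> a1 a2 a3 t1 t2 t3" "F \<sigma> 0 a1 a3 t t1 t3 \<le> F \<sigma> a1 a2 a3 t1 t2 t3"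
proof -
  let ?D = "\<sigma>\<^sup>2 * 2 powr (2 * Cbar \<sigma> a3 t3)"
  have D: "0 < ?D" using assms by simp
  have *: "1/2 * log 2 (1 + p / ?D) \<le> 1/2 * log 2 (1 + r / ?D)" if "0 \<le> p" "p \<le> r" for p r
  proof -
    have "0 \<le> p / ?D" "p / ?D \<le> r / ?D" using that D by (auto intro: divide_right_mono simp del: divide_const_simps)
    then have "log 2 (1 + p / ?D) \<le> log 2 (1 + r / ?D)" by (subst log_le_cancel_iff) auto
    then show ?thesis by simp
  qed
  show "F \<sigma> 0 a2 a3 t t2 t3 \<le> F \<sigma> a1 a2 a3 t1 t2 t3" "F \<sigma> 0 a1 a3 t t1 t3 \<le> F \<sigma> a1 a2 a3 t1 t2 t3"
    unfolding F_def by (rule *; simp add: rho_nonneg)+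
qed

text \<open>\<open>theta'\<close> is the ratio of mean to peak of the private amplitude received.
  The second clause is an equality when that peak is positive, and both sides are 0
  otherwise.\<close>

lemma theta'_props:
  assumes ij: "(i, j) \<in> {(1::nat, 2::nat), (2, 1)}" and h: "\<And>k l. k \<in> {1,2} \<Longrightarrow> l \<in> {1,2} \<Longrightarrow> 0 \<le> h k l"
    and p: "\<And>k. k \<in> {1,2} \<Longrightarrow> 0 \<le> \<kappa> k \<and> 0 < \<theta> k"
  shows "h i i * \<kappa> i + h j i * \<kappa> j > 0 \<Longrightarrow> theta' h \<kappa> \<theta> i > 0"
    "h i i * \<kappa> i * \<theta> i + h j i * \<kappa> j * \<theta> j \<le> theta' h \<kappa> \<theta> i * (h i i * \<kappa> i + h j i * \<kappa> j)"
proof -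
  have ij2: "i \<in> {1,2}" "j \<in> {1,2}" using ij by auto
  define x y where "x = h i i * \<kappa> i" and "y = h j i * \<kappa> j"
  have xy: "0 \<le> x" "0 \<le> y" unfolding x_def y_def using h ij2 p by (auto intro!: mult_nonneg_nonneg)
  have th: "theta' h \<kappa> \<theta> i = (if x + y > 0 then (x * \<theta> i + y * \<theta> j) / (x + y) else 0)"
    unfolding theta'_def Let_def x_def y_def using ij by (auto simp: add.commute mult_ac)
  have pos: "x * \<theta> i + y * \<theta> j > 0" if "x + y > 0"
  proof (cases "x > 0")
    case True
    then show ?thesis using p[OF ij2(1)] p[OF ij2(2)] xy by (intro add_pos_nonneg) auto
  next
    case False
    then have "y > 0" using that xy by simp
    then show ?thesis using p[OF ij2(1)] p[OF ij2(2)] xy by (intro add_nonneg_pos) auto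
  qed
  show "theta' h \<kappa> \<theta> i > 0" if "h i i * \<kappa> i + h j i * \<kappa> j > 0"
    unfolding th using that pos unfolding x_def y_def by simp
  show "h i i * \<kappa> i * \<theta> i + h j i * \<kappa> j * \<theta> j \<le> theta' h \<kappa> \<theta> i * (h i i * \<kappa> i + h j i * \<kappa> j)"
    unfolding th x_def[symmetric] y_def[symmetric]
  proof (cases "x + y > 0")
    case False
    then have "x = 0" "y = 0" using xy by auto
    then show "x * \<theta> i + y * \<theta> j \<le> (if 0 < x + y then (x * \<theta> i + y * \<theta> j) / (x + y) else 0) * (x + y)" by simp
  qed simp
qed

text \<open>Each private rate is taken as large as its bound and the total rate allow; the rest is
  common. A common rate is then either 0 or the total minus the full private bound. If both are
  positive, the sum bound of the region applies; if one is 0, the sum is a single common rate (or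
  0), and \<open>F_mono\<close> controls it.\<close>

lemma rate_splitting:
  assumes \<sigma>: "\<sigma> > 0" and R: "(R1, R2) \<in> RHK' \<sigma> h \<kappa> \<eta> \<theta> \<phi>"
  obtains rc rp :: "nat \<Rightarrow> real" where "rc 1 + rp 1 = R1" "rc 2 + rp 2 = R2"
    "\<And>i j. (i, j) \<in> {(1::nat, 2::nat), (2, 1)} \<Longrightarrow>
      rp i \<le> F \<sigma> 0 (h i i * \<kappa> i) (h j i * \<kappa> j) 1 (\<theta> i) (\<theta> j) \<and>
      rc i \<le> F \<sigma> 0 (h i i * \<eta> i) (h i i * \<kappa> i + h j i * \<kappa> j) 1 (\<phi> i) (theta' h \<kappa> \<theta> i) \<and>
      rc j \<le> F \<sigma> 0 (h j i * \<eta> j) (h i i * \<kappa> i + h j i * \<kappa> j) 1 (\<phi> j) (theta' h \<kappa> \<theta> i) \<and>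
      rc i + rc j \<le> F \<sigma> (h i i * \<eta> i) (h j i * \<eta> j) (h i i * \<kappa> i + h j i * \<kappa> j) (\<phi> i) (\<phi> j) (theta' h \<kappa> \<theta> i)"
proof -
  define p1 p2 where "p1 = F \<sigma> 0 (h 1 1 * \<kappa> 1) (h 2 1 * \<kappa> 2) 1 (\<theta> 1) (\<theta> 2)" and "p2 = F \<sigma> 0 (h 2 2 * \<kappa> 2) (h 1 2 * \<kappa> 1) 1 (\<theta> 2) (\<theta> 1)"
  define a11 where "a11 = F \<sigma> 0 (h 1 1 * \<eta> 1) (h 1 1 * \<kappa> 1 + h 2 1 * \<kappa> 2) 1 (\<phi> 1) (theta' h \<kappa> \<theta> 1)"
  define a12 where "a12 = F \<sigma> 0 (h 1 2 * \<eta> 1) (h 2 2 * \<kappa> 2 + h 1 2 * \<kappa> 1) 1 (\<phi> 1) (theta' h \<kappa> \<theta> 2)"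
  define a21 where "a21 = F \<sigma> 0 (h 2 1 * \<eta> 2) (h 1 1 * \<kappa> 1 + h 2 1 * \<kappa> 2) 1 (\<phi> 2) (theta' h \<kappa> \<theta> 1)"
  define a22 where "a22 = F \<sigma> 0 (h 2 2 * \<eta> 2) (h 2 2 * \<kappa> 2 + h 1 2 * \<kappa> 1) 1 (\<phi> 2) (theta' h \<kappa> \<theta> 2)"
  define S1 where "S1 = F \<sigma> (h 1 1 * \<eta> 1) (h 2 1 * \<eta> 2) (h 1 1 * \<kappa> 1 + h 2 1 * \<kappa> 2) (\<phi> 1) (\<phi> 2) (theta' h \<kappa> \<theta> 1)"
  define S2 where "S2 = F \<sigma> (h 2 2 * \<eta> 2) (h 1 2 * \<eta> 1) (h 2 2 * \<kappa> 2 + h 1 2 * \<kappa> 1) (\<phi> 2) (\<phi> 1) (theta' h \<kappa> \<theta> 2)"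
  have c: "R1 \<le> p1 + min a11 a12" "R2 \<le> p2 + min a21 a22" "R1 + R2 \<le> p1 + p2 + min S1 S2"
    using R unfolding RHK'_def Let_def p1_def p2_def a11_def a12_def a21_def a22_def S1_def S2_def
    by (auto simp: add.commute)
  have nn: "0 \<le> a11" "0 \<le> a12" "0 \<le> a21" "0 \<le> a22" "a11 \<le> S1" "a21 \<le> S1" "a22 \<le> S2" "a12 \<le> S2"
    unfolding a11_def a12_def a21_def a22_def S1_def S2_def by (rule F_nonneg F_mono[OF \<sigma>])+
  define rp where "rp i = (if i = 1 then min R1 p1 else min R2 p2)" for i :: nat
  define rc where "rc i = (if i = 1 then R1 else R2) - rp i" for i :: nat
  have v: "rp 1 = min R1 p1" "rp 2 = min R2 p2" "rc 1 = R1 - min R1 p1" "rc 2 = R2 - min R2 p2"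
    unfolding rc_def rp_def by auto
  have b: "rp 1 \<le> p1" "rp 2 \<le> p2" "rc 1 \<le> a11" "rc 1 \<le> a12" "rc 2 \<le> a21" "rc 2 \<le> a22" "rc 1 + rc 2 \<le> S1" "rc 1 + rc 2 \<le> S2"
    unfolding v using c nn by linarith+
  show ?thesis
  proof (rule that[of rc rp])
    show "rc 1 + rp 1 = R1" "rc 2 + rp 2 = R2" unfolding v by auto
    fix i j assume "(i, j) \<in> {(1::nat, 2::nat), (2, 1)}"
    then consider "i = 1" "j = 2" | "i = 2" "j = 1" by auto
    then show "rp i \<le> F \<sigma> 0 (h i i * \<kappa> i) (h j i * \<kappa> j) 1 (\<theta> i) (\<theta> j) \<and>
      rc i \<le> F \<sigma> 0 (h i i * \<eta> i) (h i i * \<kappa> i + h j i * \<kappa> j) 1 (\<phi> i) (theta' h \<kappa> \<theta> i) \<and>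
      rc j \<le> F \<sigma> 0 (h j i * \<eta> j) (h i i * \<kappa> i + h j i * \<kappa> j) 1 (\<phi> j) (theta' h \<kappa> \<theta> i) \<and>
      rc i + rc j \<le> F \<sigma> (h i i * \<eta> i) (h j i * \<eta> j) (h i i * \<kappa> i + h j i * \<kappa> j) (\<phi> i) (\<phi> j) (theta' h \<kappa> \<theta> i)"
    proof cases
      case 1
      show ?thesis unfolding 1 using b unfolding p1_def a11_def a21_def S1_def by blast
    next
      case 2
      have "rc 2 + rc 1 \<le> S2" using b by linarith
      then show ?thesis unfolding 2 using b unfolding p2_def a12_def a22_def S2_def by blast
    qed
  qed
qed

lemma sum_lim_eventually:
  fixes G :: "nat \<Rightarrow> nat \<Rightarrow> real"
  assumes "\<And>s. s < J \<Longrightarrow> G s \<longlonglongrightarrow> g s" and d: "d > 0"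
  shows "\<forall>\<^sub>F n in sequentially. (\<Sum>s<J. u s * g s) - d < (\<Sum>s<J. u s * G s n)"
proof -
  have "(\<lambda>n. \<Sum>s<J. u s * G s n) \<longlonglongrightarrow> (\<Sum>s<J. u s * g s)"
    by (intro tendsto_sum tendsto_mult tendsto_const assms(1)) auto
  from order_tendstoD(1)[OF this] d show ?thesis by simp
qed

text \<open>A loss of d in every common and private rate makes the rate conditions strict, and
  scaling by c < 1 does so for the mean. Since the bounds converge as c tends to 1, one c can be
  fixed for all phases and both receivers before any coding takes place.\<close>

lemma achievable_mixture:
  fixes h :: "nat \<Rightarrow> nat \<Rightarrow> real" and \<kappa> \<eta> \<theta> \<phi> :: "nat \<Rightarrow> nat \<Rightarrow> real" and u R1 R2 :: "nat \<Rightarrow> real"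
  assumes h: "\<And>k l. k \<in> {1,2} \<Longrightarrow> l \<in> {1,2} \<Longrightarrow> 0 \<le> h k l" and \<sigma>: "\<sigma> > 0" and A: "A > 0"
    and \<alpha>: "\<And>i. i \<in> {1,2} \<Longrightarrow> 0 < \<alpha> i"
    and u: "\<And>s. 0 \<le> u s" "(\<Sum>s<J. u s) = 1"
    and cfg: "\<And>s i. s < J \<Longrightarrow> i \<in> {1,2} \<Longrightarrow> 0 < \<theta> s i \<and> 0 < \<phi> s i \<and> 0 \<le> \<kappa> s i \<and> 0 \<le> \<eta> s i \<and> \<kappa> s i + \<eta> s i \<le> A \<and>
        \<theta> s i * \<kappa> s i + \<phi> s i * \<eta> s i \<le> \<alpha> i * A"
    and R: "\<And>s. s < J \<Longrightarrow> (R1 s, R2 s) \<in> RHK' \<sigma> h (\<kappa> s) (\<eta> s) (\<theta> s) (\<phi> s)" and d: "d > 0"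
  shows "achievable \<sigma> A \<alpha> h ((\<Sum>s<J. u s * R1 s) - 2 * d) ((\<Sum>s<J. u s * R2 s) - 2 * d)"
proof -
  let ?ord = "{(1::nat, 2::nat), (2, 1)}"
  have "\<forall>s. \<exists>rc rp. s < J \<longrightarrow> rc 1 + rp 1 = R1 s \<and> rc 2 + rp 2 = R2 s \<and> (\<forall>i j. (i, j) \<in> ?ord \<longrightarrow>
      rp i \<le> F \<sigma> 0 (h i i * \<kappa> s i) (h j i * \<kappa> s j) 1 (\<theta> s i) (\<theta> s j) \<and>
      rc i \<le> F \<sigma> 0 (h i i * \<eta> s i) (h i i * \<kappa> s i + h j i * \<kappa> s j) 1 (\<phi> s i) (theta' h (\<kappa> s) (\<theta> s) i) \<and>
      rc j \<le> F \<sigma> 0 (h j i * \<eta> s j) (h i i * \<kappa> s i + h j i * \<kappa> s j) 1 (\<phi> s j) (theta' h (\<kappa> s) (\<theta> s) i) \<and>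
      rc i + rc j \<le> F \<sigma> (h i i * \<eta> s i) (h j i * \<eta> s j) (h i i * \<kappa> s i + h j i * \<kappa> s j) (\<phi> s i) (\<phi> s j) (theta' h (\<kappa> s) (\<theta> s) i))"
    (is "\<forall>s. \<exists>rc rp. ?Q s rc rp")
  proof
    fix s
    show "\<exists>rc rp. ?Q s rc rp"
    proof (cases "s < J")
      case True
      show ?thesis by (rule rate_splitting[OF \<sigma> R[OF True]]) blast
    qed blast
  qed
  then obtain rc rp where rr: "\<And>s. ?Q s (rc s) (rp s)" by metis
  have r12: "rc s 1 + rp s 1 = R1 s" "rc s 2 + rp s 2 = R2 s" if "s < J" for s using rr[of s] that by blast+
  have rF: "rp s i \<le> F \<sigma> 0 (h i i * \<kappa> s i) (h j i * \<kappa> s j) 1 (\<theta> s i) (\<theta> s j)"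
    "rc s i \<le> F \<sigma> 0 (h i i * \<eta> s i) (h i i * \<kappa> s i + h j i * \<kappa> s j) 1 (\<phi> s i) (theta' h (\<kappa> s) (\<theta> s) i)"
    "rc s j \<le> F \<sigma> 0 (h j i * \<eta> s j) (h i i * \<kappa> s i + h j i * \<kappa> s j) 1 (\<phi> s j) (theta' h (\<kappa> s) (\<theta> s) i)"
    "rc s i + rc s j \<le> F \<sigma> (h i i * \<eta> s i) (h j i * \<eta> s j) (h i i * \<kappa> s i + h j i * \<kappa> s j) (\<phi> s i) (\<phi> s j) (theta' h (\<kappa> s) (\<theta> s) i)"
    if "s < J" "(i, j) \<in> ?ord" for s i j
    using rr[of s] that by blast+
  have "\<exists>T. \<forall>t>0. is_quantile t (T t)" using quantile_exists by metis
  then obtain T where T: "\<And>t. t > 0 \<Longrightarrow> is_quantile t (T t)" by blast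
  \<comment> \<open>A sequence in [0, 1) with limit 1, from which a single c is picked.\<close>
  define cn where "cn n = 1 - 1 / (real n + 2)" for n :: nat
  have cn: "0 \<le> cn n" "cn n < 1" for n unfolding cn_def by (auto simp: field_simps)
  have cnlim: "cn \<longlonglongrightarrow> 1"
  proof -
    have "(\<lambda>n. 1 / real (n + 2)) \<longlonglongrightarrow> 0" by (rule LIMSEQ_ignore_initial_segment[OF lim_1_over_n])
    from tendsto_diff[OF tendsto_const[of 1] this] show ?thesis unfolding cn_def by (simp add: add.commute)
  qed
  define H4 where "H4 i j s c = F \<sigma> 0 (h i i * (c * \<kappa> s i)) (h j i * \<kappa> s j) 1 (\<theta> s i) (\<theta> s j)" for i j s c
  define H1 where "H1 i j s c = F \<sigma> 0 (h i i * (c * \<eta> s i)) (h i i * \<kappa> s i + h j i * \<kappa> s j) 1 (\<phi> s i) (theta' h (\<kappa> s) (\<theta> s) i)" for i j s c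
  define H2 where "H2 i j s c = F \<sigma> 0 (h j i * (c * \<eta> s j)) (h i i * \<kappa> s i + h j i * \<kappa> s j) 1 (\<phi> s j) (theta' h (\<kappa> s) (\<theta> s) i)" for i j s c
  define H3 where "H3 i j s c = F \<sigma> (h i i * (c * \<eta> s i)) (h j i * (c * \<eta> s j)) (h i i * \<kappa> s i + h j i * \<kappa> s j) (\<phi> s i) (\<phi> s j) (theta' h (\<kappa> s) (\<theta> s) i)" for i j s c
  have lims: "(\<lambda>n. H4 i j s (cn n)) \<longlonglongrightarrow> H4 i j s 1" "(\<lambda>n. H1 i j s (cn n)) \<longlonglongrightarrow> H1 i j s 1"
    "(\<lambda>n. H2 i j s (cn n)) \<longlonglongrightarrow> H2 i j s 1" "(\<lambda>n. H3 i j s (cn n)) \<longlonglongrightarrow> H3 i j s 1" for i j s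
    unfolding H4_def H1_def H2_def H3_def
    using F_tendsto[OF \<sigma> cnlim, of 0 0] F_tendsto[OF \<sigma> cnlim] by simp_all
  have eventually_all: "\<forall>\<^sub>F n in sequentially.
     (\<Sum>s<J. u s * H4 i j s 1) - d < (\<Sum>s<J. u s * H4 i j s (cn n)) \<and> (\<Sum>s<J. u s * H1 i j s 1) - d < (\<Sum>s<J. u s * H1 i j s (cn n)) \<and>
     (\<Sum>s<J. u s * H2 i j s 1) - d < (\<Sum>s<J. u s * H2 i j s (cn n)) \<and> (\<Sum>s<J. u s * H3 i j s 1) - d < (\<Sum>s<J. u s * H3 i j s (cn n))" for i j
    by (intro eventually_conj sum_lim_eventually d lims)
  have "\<forall>\<^sub>F n in sequentially. \<forall>(i, j)\<in>?ord.
     (\<Sum>s<J. u s * H4 i j s 1) - d < (\<Sum>s<J. u s * H4 i j s (cn n)) \<and> (\<Sum>s<J. u s * H1 i j s 1) - d < (\<Sum>s<J. u s * H1 i j s (cn n)) \<and>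
     (\<Sum>s<J. u s * H2 i j s 1) - d < (\<Sum>s<J. u s * H2 i j s (cn n)) \<and> (\<Sum>s<J. u s * H3 i j s 1) - d < (\<Sum>s<J. u s * H3 i j s (cn n))"
    using eventually_all[of 1 2] eventually_all[of 2 1] by eventually_elim blast
  then obtain n where n: "\<forall>(i, j)\<in>?ord.
     (\<Sum>s<J. u s * H4 i j s 1) - d < (\<Sum>s<J. u s * H4 i j s (cn n)) \<and> (\<Sum>s<J. u s * H1 i j s 1) - d < (\<Sum>s<J. u s * H1 i j s (cn n)) \<and>
     (\<Sum>s<J. u s * H2 i j s 1) - d < (\<Sum>s<J. u s * H2 i j s (cn n)) \<and> (\<Sum>s<J. u s * H3 i j s 1) - d < (\<Sum>s<J. u s * H3 i j s (cn n))"
    using eventually_happens'[OF sequentially_bot] by blast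
  define c where "c = cn n"
  have c: "0 \<le> c" "c < 1" "c \<le> 1" using cn[of n] by (auto simp: c_def)
  have cl: "(\<Sum>s<J. u s * H4 i j s 1) - d < (\<Sum>s<J. u s * H4 i j s c)" "(\<Sum>s<J. u s * H1 i j s 1) - d < (\<Sum>s<J. u s * H1 i j s c)"
     "(\<Sum>s<J. u s * H2 i j s 1) - d < (\<Sum>s<J. u s * H2 i j s c)" "(\<Sum>s<J. u s * H3 i j s 1) - d < (\<Sum>s<J. u s * H3 i j s c)"
    if "(i, j) \<in> ?ord" for i j using n that unfolding c_def by blast+
  \<comment> \<open>Zero outside the range, because the coding scheme asks for bounded measurable
    letters at every phase and user index.\<close>
  define wc where "wc s i = (if s < J \<and> i \<in> {1,2} then (\<lambda>x. c * \<eta> s i * T (\<phi> s i) x) else (\<lambda>_. 0))" for s i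
  define wp where "wp s i = (if s < J \<and> i \<in> {1,2} then (\<lambda>x. c * \<kappa> s i * T (\<theta> s i) x) else (\<lambda>_. 0))" for s i
  have we: "wc s i = (\<lambda>x. c * \<eta> s i * T (\<phi> s i) x)" "wp s i = (\<lambda>x. c * \<kappa> s i * T (\<theta> s i) x)" if "s < J" "i \<in> {1,2}" for s i
    using that by (auto simp: wc_def wp_def)
  have wm: "wc s k \<in> borel_measurable borel" "wp s k \<in> borel_measurable borel" for s k
  proof -
    have "wc s k \<in> borel_measurable borel \<and> wp s k \<in> borel_measurable borel"
    proof (cases "s < J \<and> k \<in> {1,2}")
      case True
      then have p: "0 < \<theta> s k" "0 < \<phi> s k" using cfg[of s k] by auto
      show ?thesis using True quantile_measurable[OF T[OF p(1)]] quantile_measurable[OF T[OF p(2)]] by (auto simp: we)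
    next
      case False
      then show ?thesis by (auto simp: wc_def wp_def)
    qed
    then show "wc s k \<in> borel_measurable borel" "wp s k \<in> borel_measurable borel" by auto
  qed
  have wb: "0 \<le> wc s k x" "0 \<le> wp s k x" "wc s k x + wp s k y \<le> A" for s k x y
  proof -
    have "0 \<le> wc s k x \<and> 0 \<le> wp s k x \<and> wc s k x + wp s k y \<le> A"
    proof (cases "s < J \<and> k \<in> {1,2}")
      case True
      then have cf: "0 < \<theta> s k" "0 < \<phi> s k" "0 \<le> \<kappa> s k" "0 \<le> \<eta> s k" "\<kappa> s k + \<eta> s k \<le> A" using cfg[of s k] by auto
      note q1 = quantile_bounds(1,2)[OF T[OF cf(1)]] and q2 = quantile_bounds(1,2)[OF T[OF cf(2)]]
      have "c * \<eta> s k \<le> \<eta> s k" "c * \<kappa> s k \<le> \<kappa> s k" using mult_right_mono[OF c(3) cf(4)] mult_right_mono[OF c(3) cf(3)] by auto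
      moreover have "c * \<eta> s k * T (\<phi> s k) x \<le> c * \<eta> s k * 1" "c * \<kappa> s k * T (\<theta> s k) y \<le> c * \<kappa> s k * 1"
        by (intro mult_left_mono q1 q2 mult_nonneg_nonneg c cf)+
      ultimately have "c * \<eta> s k * T (\<phi> s k) x + c * \<kappa> s k * T (\<theta> s k) y \<le> A" using cf(5) by linarith
      moreover have "0 \<le> c * \<eta> s k * T (\<phi> s k) x" "0 \<le> c * \<kappa> s k * T (\<theta> s k) x"
        by (intro mult_nonneg_nonneg c cf q1 q2)+
      ultimately show ?thesis using True by (auto simp: we)
    next
      case False
      then show ?thesis using A by (auto simp: wc_def wp_def)
    qed
    then show "0 \<le> wc s k x" "0 \<le> wp s k x" "wc s k x + wp s k y \<le> A" by auto
  qed
  have mean: "(\<Sum>s<J. u s * ((\<integral>x. wc s i x \<partial>gauss) + (\<integral>x. wp s i x \<partial>gauss))) < \<alpha> i * A" if i: "i \<in> {1,2}" for i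
  proof -
    have "(\<integral>x. wc s i x \<partial>gauss) + (\<integral>x. wp s i x \<partial>gauss) \<le> c * (\<alpha> i * A)" if s: "s < J" for s
    proof -
      have cf: "0 < \<theta> s i" "0 < \<phi> s i" "0 \<le> \<kappa> s i" "0 \<le> \<eta> s i" "\<theta> s i * \<kappa> s i + \<phi> s i * \<eta> s i \<le> \<alpha> i * A" using cfg[OF s i] by auto
      have "(\<integral>x. wc s i x \<partial>gauss) + (\<integral>x. wp s i x \<partial>gauss) = c * \<eta> s i * (\<integral>x. T (\<phi> s i) x \<partial>gauss) + c * \<kappa> s i * (\<integral>x. T (\<theta> s i) x \<partial>gauss)"
        unfolding we[OF s i] by simp
      also have "... \<le> c * \<eta> s i * \<phi> s i + c * \<kappa> s i * \<theta> s i"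
        by (intro add_mono mult_left_mono quantile_bounds(3)[OF T[OF cf(1)]] quantile_bounds(3)[OF T[OF cf(2)]] mult_nonneg_nonneg c cf)
      also have "... = c * (\<theta> s i * \<kappa> s i + \<phi> s i * \<eta> s i)" by (simp add: algebra_simps)
      also have "... \<le> c * (\<alpha> i * A)" by (rule mult_left_mono[OF cf(5) c(1)])
      finally show ?thesis .
    qed
    then have "(\<Sum>s<J. u s * ((\<integral>x. wc s i x \<partial>gauss) + (\<integral>x. wp s i x \<partial>gauss))) \<le> (\<Sum>s<J. u s * (c * (\<alpha> i * A)))"
      by (intro sum_mono mult_left_mono u(1)) auto
    also have "... = c * (\<alpha> i * A)" unfolding sum_distrib_right[symmetric] u(2) by simp
    also have "... < 1 * (\<alpha> i * A)" by (rule mult_strict_right_mono[OF c(2)]) (use \<alpha>[OF i] A in simp)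
    finally show ?thesis by simp
  qed
  have rates: "ln 2 * H4 i j s c \<le> dent (rx1 \<sigma> h wp i j s) - dent (rx0 \<sigma> h wp i j s)"
    "ln 2 * H1 i j s c \<le> dent (rx2 \<sigma> h wc wp i j i s) - dent (rx1 \<sigma> h wp i j s)"
    "ln 2 * H2 i j s c \<le> dent (rx2 \<sigma> h wc wp i j j s) - dent (rx1 \<sigma> h wp i j s)"
    "ln 2 * H3 i j s c \<le> dent (rx12 \<sigma> h wc wp i j s) - dent (rx1 \<sigma> h wp i j s)"
    if s: "s < J" and ij: "(i, j) \<in> ?ord" for s i j
  proof -
    have i: "i \<in> {1,2}" and j: "j \<in> {1,2}" using ij by auto
    note ci = cfg[OF s i] and cj = cfg[OF s j]
    have kp: "k \<in> {1,2} \<Longrightarrow> 0 \<le> \<kappa> s k \<and> 0 < \<theta> s k" for k using cfg[OF s, of k] by blast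
    note th = theta'_props[where \<kappa>="\<kappa> s" and \<theta>="\<theta> s", OF ij h kp]
    note cr = config_rates[where hdir="h i i" and hc="h j i" and ki="\<kappa> s i" and kj="\<kappa> s j" and ei="\<eta> s i" and ej="\<eta> s j" and c=c
      and ti="\<theta> s i" and tj="\<theta> s j" and fi="\<phi> s i" and fj="\<phi> s j" and Ti="T (\<theta> s i)" and Tj="T (\<theta> s j)" and Vi="T (\<phi> s i)" and Vj="T (\<phi> s j)"
      and tt="theta' h (\<kappa> s) (\<theta> s) i", OF \<sigma> h[OF i i] h[OF j i] _ _ _ _ c(1,3) _ _ _ _ _ _ th]
    show "ln 2 * H4 i j s c \<le> dent (rx1 \<sigma> h wp i j s) - dent (rx0 \<sigma> h wp i j s)"
      unfolding H4_def rx0_def rx1_def we[OF s i] we[OF s j] by (rule cr(1)) (use ci cj T in auto)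
    show "ln 2 * H1 i j s c \<le> dent (rx2 \<sigma> h wc wp i j i s) - dent (rx1 \<sigma> h wp i j s)"
      unfolding H1_def rx1_def rx2_def we[OF s i] we[OF s j] by (rule cr(2)) (use ci cj T in auto)
    show "ln 2 * H2 i j s c \<le> dent (rx2 \<sigma> h wc wp i j j s) - dent (rx1 \<sigma> h wp i j s)"
      unfolding H2_def rx1_def rx2_def we[OF s i] we[OF s j] by (rule cr(3)) (use ci cj T in auto)
    show "ln 2 * H3 i j s c \<le> dent (rx12 \<sigma> h wc wp i j s) - dent (rx1 \<sigma> h wp i j s)"
      unfolding H3_def rx1_def rx12_def we[OF s i] we[OF s j] by (rule cr(4)) (use ci cj T in auto)
  qed
  \<comment> \<open>These rates may be negative; the corresponding codebook then has a single word.\<close>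
  define RC where "RC i = (\<Sum>s<J. u s * rc s i) - d" for i
  define RP where "RP i = (\<Sum>s<J. u s * rp s i) - d" for i
  \<comment> \<open>The common chain behind all four conditions: averaged split rates less d, the
    bounds \<open>F\<close> at c = 1 less d, the same bounds at the chosen c, and finally the
    entropy differences.\<close>
  have final: "x * ln 2 < (\<Sum>s<J. u s * D s)"
    if "x \<le> (\<Sum>s<J. u s * r s) - d" "\<And>s. s < J \<Longrightarrow> r s \<le> H s 1" "(\<Sum>s<J. u s * H s 1) - d < (\<Sum>s<J. u s * H s c)" "\<And>s. s < J \<Longrightarrow> ln 2 * H s c \<le> D s"
    for x r D and H :: "nat \<Rightarrow> real \<Rightarrow> real"
  proof -
    have "(\<Sum>s<J. u s * r s) \<le> (\<Sum>s<J. u s * H s 1)" by (intro sum_mono mult_left_mono u(1) that(2)) auto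
    then have "x < (\<Sum>s<J. u s * H s c)" using that(1,3) by linarith
    then have "x * ln 2 < (\<Sum>s<J. u s * H s c) * ln 2" by simp
    also have "... = (\<Sum>s<J. u s * (ln 2 * H s c))" unfolding sum_distrib_right by (intro sum.cong refl) simp
    also have "... \<le> (\<Sum>s<J. u s * D s)" by (intro sum_mono mult_left_mono u(1) that(4)) auto
    finally show ?thesis .
  qed
  have ordI: "(i, j) \<in> ?ord" if "i \<in> {1,2}" "j \<in> {1,2}" "i \<noteq> j" for i j :: nat using that by auto
  have "achievable \<sigma> A \<alpha> h (RC 1 + RP 1) (RC 2 + RP 2)"
  proof (rule achievable_scheme[OF \<sigma> less_imp_le[OF A] _ _ h u wm wb mean])
    show "0 \<le> \<alpha> 1" "0 \<le> \<alpha> 2" using \<alpha>[of 1] \<alpha>[of 2] by auto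
    fix i j :: nat assume "i \<in> {1,2}" "j \<in> {1,2}" "i \<noteq> j"
    then have ij: "(i, j) \<in> ?ord" by (rule ordI)
    show "RC i * ln 2 < (\<Sum>s<J. u s * (dent (rx2 \<sigma> h wc wp i j i s) - dent (rx1 \<sigma> h wp i j s)))"
      by (rule final[where r="\<lambda>s. rc s i" and H="H1 i j"]) (use rF(2)[OF _ ij] cl(2)[OF ij] rates(2)[OF _ ij] in \<open>simp_all add: RC_def H1_def\<close>)
    show "RC j * ln 2 < (\<Sum>s<J. u s * (dent (rx2 \<sigma> h wc wp i j j s) - dent (rx1 \<sigma> h wp i j s)))"
      by (rule final[where r="\<lambda>s. rc s j" and H="H2 i j"]) (use rF(3)[OF _ ij] cl(3)[OF ij] rates(3)[OF _ ij] in \<open>simp_all add: RC_def H2_def\<close>)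
    \<comment> \<open>Two common rates lose 2 d together, of which the chain needs only d.\<close>
    show "(RC i + RC j) * ln 2 < (\<Sum>s<J. u s * (dent (rx12 \<sigma> h wc wp i j s) - dent (rx1 \<sigma> h wp i j s)))"
      by (rule final[where r="\<lambda>s. rc s i + rc s j" and H="H3 i j"])
         (use rF(4)[OF _ ij] cl(4)[OF ij] rates(4)[OF _ ij] d in \<open>simp_all add: RC_def H3_def distrib_left sum.distrib\<close>)
    show "RP i * ln 2 < (\<Sum>s<J. u s * (dent (rx1 \<sigma> h wp i j s) - dent (rx0 \<sigma> h wp i j s)))"
      by (rule final[where r="\<lambda>s. rp s i" and H="H4 i j"]) (use rF(1)[OF _ ij] cl(1)[OF ij] rates(1)[OF _ ij] in \<open>simp_all add: RP_def H4_def\<close>)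
  qed
  moreover have "RC 1 + RP 1 = (\<Sum>s<J. u s * R1 s) - 2 * d"
  proof -
    have "(\<Sum>s<J. u s * R1 s) = (\<Sum>s<J. u s * rc s 1 + u s * rp s 1)"
      by (intro sum.cong refl) (simp add: r12(1)[symmetric] distrib_left)
    then show ?thesis unfolding RC_def RP_def by (simp add: sum.distrib)
  qed
  moreover have "RC 2 + RP 2 = (\<Sum>s<J. u s * R2 s) - 2 * d"
  proof -
    have "(\<Sum>s<J. u s * R2 s) = (\<Sum>s<J. u s * rc s 2 + u s * rp s 2)"
      by (intro sum.cong refl) (simp add: r12(2)[symmetric] distrib_left)
    then show ?thesis unfolding RC_def RP_def by (simp add: sum.distrib)
  qed
  ultimately show ?thesis by simp
qed

theorem theorem2:
  fixes h :: "nat \<Rightarrow> nat \<Rightarrow> real" and \<sigma> A :: real and \<alpha> :: "nat \<Rightarrow> real"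
  assumes "\<forall>k\<in>{1,2}. \<forall>l\<in>{1,2}. h k l \<ge> 0"
    and "\<sigma> > 0" and "A > 0"
    and "\<forall>i\<in>{1,2}. 0 < \<alpha> i \<and> \<alpha> i \<le> 1"
  shows "GHK' \<sigma> A \<alpha> h \<subseteq> capacity_region \<sigma> A \<alpha> h"
proof
  fix z assume "z \<in> GHK' \<sigma> A \<alpha> h"
  then obtain J v x where v: "\<forall>i\<in>{1..J}. 0 \<le> v i \<and> x i \<in> \<Union> {RHK' \<sigma> h \<kappa> \<eta> \<theta> \<phi> | \<kappa> \<eta> \<theta> \<phi>.
      \<forall>i\<in>{1::nat,2}. 0 < \<theta> i \<and> \<theta> i \<le> 1 \<and> 0 < \<phi> i \<and> \<phi> i \<le> 1 \<and>
        0 \<le> \<kappa> i \<and> \<kappa> i \<le> A \<and> 0 \<le> \<eta> i \<and> \<eta> i \<le> A \<and> \<kappa> i + \<eta> i \<le> A \<and>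
        \<theta> i * \<kappa> i + \<phi> i * \<eta> i \<le> \<alpha> i * A}" "sum v {1..J::nat} = 1" "(\<Sum>i\<in>{1..J}. v i *\<^sub>R x i) = z"
    unfolding GHK'_def convex_hull_indexed by auto
  \<comment> \<open>Hull weights are numbered from 1, time-sharing phases from 0; the default 0
    makes u nonnegative everywhere.\<close>
  define u where "u s = (if s < J then v (Suc s) else 0)" for s
  have u: "0 \<le> u s" for s using v(1) by (auto simp: u_def)
  have u1: "(\<Sum>s<J. u s) = 1"
    using v(2) unfolding u_def by (simp add: sum.atLeast1_atMost_eq)
  have z: "z = (\<Sum>s<J. u s *\<^sub>R x (Suc s))"
    using v(3) unfolding u_def by (simp add: sum.atLeast1_atMost_eq)
  have "\<forall>s. \<exists>\<kappa> \<eta> \<theta> \<phi>. s < J \<longrightarrow> x (Suc s) \<in> RHK' \<sigma> h \<kappa> \<eta> \<theta> \<phi> \<and>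
      (\<forall>i\<in>{1::nat,2}. 0 < \<theta> i \<and> 0 < \<phi> i \<and> 0 \<le> \<kappa> i \<and> 0 \<le> \<eta> i \<and> \<kappa> i + \<eta> i \<le> A \<and> \<theta> i * \<kappa> i + \<phi> i * \<eta> i \<le> \<alpha> i * A)"
  proof
    fix s
    show "\<exists>\<kappa> \<eta> \<theta> \<phi>. s < J \<longrightarrow> x (Suc s) \<in> RHK' \<sigma> h \<kappa> \<eta> \<theta> \<phi> \<and>
      (\<forall>i\<in>{1::nat,2}. 0 < \<theta> i \<and> 0 < \<phi> i \<and> 0 \<le> \<kappa> i \<and> 0 \<le> \<eta> i \<and> \<kappa> i + \<eta> i \<le> A \<and> \<theta> i * \<kappa> i + \<phi> i * \<eta> i \<le> \<alpha> i * A)"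
    proof (cases "s < J")
      case True
      then have "Suc s \<in> {1..J}" by simp
      from v(1)[rule_format, OF this, THEN conjunct2]
      show ?thesis by (clarsimp simp del: insert_iff) (intro exI conjI impI, assumption, blast)
    qed blast
  qed
  then obtain \<kappa> \<eta> \<theta> \<phi> where cfg: "\<And>s. s < J \<Longrightarrow> x (Suc s) \<in> RHK' \<sigma> h (\<kappa> s) (\<eta> s) (\<theta> s) (\<phi> s) \<and>
      (\<forall>i\<in>{1::nat,2}. 0 < \<theta> s i \<and> 0 < \<phi> s i \<and> 0 \<le> \<kappa> s i \<and> 0 \<le> \<eta> s i \<and> \<kappa> s i + \<eta> s i \<le> A \<and> \<theta> s i * \<kappa> s i + \<phi> s i * \<eta> s i \<le> \<alpha> i * A)"
    by metis
  let ?R1 = "\<lambda>s. fst (x (Suc s))" and ?R2 = "\<lambda>s. snd (x (Suc s))"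
  have zz: "fst z = (\<Sum>s<J. u s * ?R1 s)" "snd z = (\<Sum>s<J. u s * ?R2 s)"
    unfolding z by (simp_all add: fst_sum snd_sum)
  have ach: "achievable \<sigma> A \<alpha> h (fst z - 2 * d) (snd z - 2 * d)" if "d > 0" for d
    unfolding zz
  proof (rule achievable_mixture[OF _ assms(2,3) _ u u1 _ _ that])
    show "0 \<le> h k l" if "k \<in> {1,2}" "l \<in> {1,2}" for k l using assms(1) that by blast
    show "0 < \<alpha> i" if "i \<in> {1,2}" for i using assms(4) that by blast
    show "0 < \<theta> s i \<and> 0 < \<phi> s i \<and> 0 \<le> \<kappa> s i \<and> 0 \<le> \<eta> s i \<and> \<kappa> s i + \<eta> s i \<le> A \<and> \<theta> s i * \<kappa> s i + \<phi> s i * \<eta> s i \<le> \<alpha> i * A"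
      if "s < J" "i \<in> {1,2}" for s i using cfg[OF that(1)] that(2) by blast
    show "(?R1 s, ?R2 s) \<in> RHK' \<sigma> h (\<kappa> s) (\<eta> s) (\<theta> s) (\<phi> s)" if "s < J" for s using cfg[OF that] by simp
  qed
  show "z \<in> capacity_region \<sigma> A \<alpha> h"
    unfolding capacity_region_def closure_approachable
  proof (intro allI impI)
    fix e :: real assume e: "e > 0"
    \<comment> \<open>Each coordinate moves by e / 4, so the distance to z is at most e / 2. A
      coordinate may become negative, which \<open>achievable\<close> permits.\<close>
    let ?y = "(fst z - 2 * (e / 8), snd z - 2 * (e / 8))"
    have "dist p z \<le> \<bar>fst p - fst z\<bar> + \<bar>snd p - snd z\<bar>" for p
      using sqrt_sum_squares_le_sum_abs[of "fst p - fst z" "snd p - snd z"] by (simp add: dist_prod_def dist_real_def)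
    from this[of ?y] have "dist ?y z \<le> \<bar>fst ?y - fst z\<bar> + \<bar>snd ?y - snd z\<bar>" .
    then have "dist ?y z < e" using e by simp
    moreover have "?y \<in> {(R1, R2). achievable \<sigma> A \<alpha> h R1 R2}" using ach[of "e / 8"] e by simp
    ultimately show "\<exists>y\<in>{(R1, R2). achievable \<sigma> A \<alpha> h R1 R2}. dist y z < e" by blast
  qed
qed

end
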